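(* Let $((X_t)_{t\ge0},\mathbf P_\mu)$ be a stationary, ergodic Feller diffusion in $E\subseteq\mathbb R^d$ with invariant probability measure $\mu$, satisfying conditions (I)--(V) listed in the context. Let $\mathcal F\subseteq L_0^2(d\mu)$ be a class of functions, all vanishing outside a common compact subset of the interior of $E$. If $$\int_0^\infty\sqrt{\log N_{[\,]}(\varepsilon,\mathcal F,L^2(d\mu))}\,d\varepsilon<\infty,$$ then $\mathcal F$ is Donsker.
   Context: Setting. $E\subseteq\mathbb R^d$ is a Borel set and $X=(X_t)_{t\ge0}$ is an $E$-valued diffusion (continuous Markov process) with invariant probability measure $\mu$, transition semigroup $(P_t)_{t\ge0}$ and transition densities $p_t(x,y)$. $\mathbf P_\mu$ is the law of $X$ with $X_0\sim\mu$; under it $X$ is stationary. $A$ is the infinitesimal generator of $(P_t)$ as a contraction semigroup on $L^2(d\mu)=L^2(E,d\mu)$, with domain $\mathbb D_A$. $L_0^2(d\mu)=\{f\in L^2(d\mu):\int f\,d\mu=0\}$. On $\mathcal C_K^\infty$ (smooth functions with compact support in the interior of $E$), $A=\frac12\sum_{i,j}a_{ij}\,\partial_i\partial_j+\sum_i b_i\,\partial_i$, where $a,b$ are Borel measurable and locally bounded and $a(x)$ is positive definite for every $x$. The carré du champ is $\Gamma(g,\tilde g)=A(g\tilde g)-gA\tilde g-\tilde gAg=\langle\nabla g,a\nabla\tilde g\rangle$ for $g,\tilde g\in\mathcal C^2_K$, and $\Gamma(f)=\Gamma(f,f)$; for general $f\in\mathbb D_A$, $\int\Gamma(f)\,d\mu$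 is understood as $-2\int fAf\,d\mu$. Assumptions. (I) Poincaré inequality: there is $c>0$ with $\operatorname{Var}_\mu(f)=\int f^2d\mu-(\int f\,d\mu)^2\le c\int\Gamma(f)\,d\mu$ for all $f\in\mathbb D_A$. (II) There is $C_0>0$ such that for all $u\ge t>0$ and all $x,y\in\mathbb R^d$ with $\|x-y\|_2^2\le u$: $p_t(x,y)\le C_0(t^{-d/2}+u^{3d/2})$. (III) There is $\alpha>0$ with $\xi^ta(y)\xi\ge\alpha\|\xi\|_2^2$ for all $\xi\in\mathbb R^d\setminus\{0\}$, $y\in E$. (IV) $(P_t)$ is symmetric with respect to $\mu$: $\int fP_tg\,d\mu=\int gP_tf\,d\mu$ for all $f,g\in L^2(d\mu)$. (V) $\mu$ has a Lebesgue density $\pi$, bounded and uniformly bounded away from zero on every compact subset of the interior of $E$. Donsker. Let $\mathbb G_t(f)=t^{-1/2}\int_0^tf(X_u)\,du$, $f\in\mathcal F$. $\mathcal F$ is Donsker if there is a tight Borel measurable random element $\mathbb G$ of $\ell^\infty(\mathcal F)$ such that $\mathbb G_t\rightsquigarrow\mathbb G$ in $\ell^\infty(\mathcal F)$ as $t\to\infty$ (convergence in law in the sense of Hoffmann-Jørgensen). Bracketing. For functions $l,u\in L^2(d\mu)$, the bracket $[l,u]$ is the set of $f$ with $l\le f\le u$; it is an $\varepsilon$-bracket in $L^2(d\mu)$ if $\|u-l\|_{L^2(d\mu)}<\varepsilon$. $N_{[\,]}(\varepsilon,\mathcal F,L^2(d\mu))$ is the smallest number of $\varepsilon$-brackets in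 $L^2(d\mu)$ required to cover $\mathcal F$. *)

theory Defs
  imports "HOL-Probability.Probability"
begin

definition partial :: "'n::finite \<Rightarrow> (real ^ 'n \<Rightarrow> real) \<Rightarrow> real ^ 'n \<Rightarrow> real" where
  "partial i f x = frechet_derivative f (at x) (axis i 1)"

primrec C_k :: "nat \<Rightarrow> (real ^ 'n::finite \<Rightarrow> real) \<Rightarrow> bool" where
  "C_k 0 f \<longleftrightarrow> continuous_on UNIV f"
| "C_k (Suc k) f \<longleftrightarrow> (\<forall>x. f differentiable (at x)) \<and> (\<forall>i. C_k k (partial i f))"

definition test_functions :: "(real ^ 'n::finite) set \<Rightarrow> (real ^ 'n \<Rightarrow> real) set" where
  "test_functions E =
     {f. (\<forall>k. C_k k f) \<and> compact (closure {x. f x \<noteq> 0}) \<and> closure {x. f x \<noteq> 0} \<subseteq> interior E}"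

definition diffusion_operator ::
  "(real ^ 'n::finite \<Rightarrow> real ^ 'n ^ 'n) \<Rightarrow> (real ^ 'n \<Rightarrow> real ^ 'n)
    \<Rightarrow> (real ^ 'n \<Rightarrow> real) \<Rightarrow> real ^ 'n \<Rightarrow> real" where
  "diffusion_operator a b f x =
     1 / 2 * (\<Sum>i\<in>UNIV. \<Sum>j\<in>UNIV. a x $ i $ j * partial i (partial j f) x)
     + (\<Sum>i\<in>UNIV. b x $ i * partial i f x)"

text \<open>Elements of \<open>L\<^sup>2\<close> are functions, not equivalence classes: the brackets below are pointwise
  and the class \<open>F\<close> indexes an empirical process.\<close>

definition L2 :: "'a measure \<Rightarrow> ('a \<Rightarrow> real) set" where
  "L2 \<mu> = {f \<in> borel_measurable \<mu>. integrable \<mu> (\<lambda>x. (f x)\<^sup>2)}"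

definition L2_norm :: "'a measure \<Rightarrow> ('a \<Rightarrow> real) \<Rightarrow> real" where
  "L2_norm \<mu> f = sqrt (\<integral>x. (f x)\<^sup>2 \<partial>\<mu>)"

definition L2_0 :: "'a measure \<Rightarrow> ('a \<Rightarrow> real) set" where
  "L2_0 \<mu> = {f \<in> L2 \<mu>. (\<integral>x. f x \<partial>\<mu>) = 0}"

definition transition_semigroup ::
  "'a::topological_space set \<Rightarrow> (real \<Rightarrow> 'a \<Rightarrow> 'a measure) \<Rightarrow> bool" where
  "transition_semigroup E \<kappa> \<longleftrightarrow>
     (\<forall>t\<ge>0. \<kappa> t \<in> restrict_space borel E \<rightarrow>\<^sub>M prob_algebra (restrict_space borel E)) \<and>
     (\<forall>x\<in>E. \<kappa> 0 x = return (restrict_space borel E) x) \<and>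
     (\<forall>s\<ge>0. \<forall>t\<ge>0. \<forall>x\<in>E. \<kappa> (s + t) x = \<kappa> s x \<bind> \<kappa> t)"

definition P_op :: "(real \<Rightarrow> 'a \<Rightarrow> 'a measure) \<Rightarrow> real \<Rightarrow> ('a \<Rightarrow> real) \<Rightarrow> 'a \<Rightarrow> real" where
  "P_op \<kappa> t f x = (\<integral>y. f y \<partial>\<kappa> t x)"

text \<open>\<open>E\<close> is only a Borel set, so the Feller property is stated on bounded continuous functions.
  For conservative semigroups on locally compact \<open>E\<close> it is implied by invariance of
  \<open>C\<^sub>0(E)\<close>.\<close>

definition feller :: "'a::topological_space set \<Rightarrow> (real \<Rightarrow> 'a \<Rightarrow> 'a measure) \<Rightarrow> bool" where
  "feller E \<kappa> \<longleftrightarrow>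
     (\<forall>t\<ge>0. \<forall>f. continuous_on E f \<longrightarrow> bounded (f ` E) \<longrightarrow> continuous_on E (P_op \<kappa> t f))"

definition transition_densities ::
  "'a::euclidean_space set \<Rightarrow> (real \<Rightarrow> 'a \<Rightarrow> 'a measure) \<Rightarrow> (real \<Rightarrow> 'a \<Rightarrow> 'a \<Rightarrow> real) \<Rightarrow> bool" where
  "transition_densities E \<kappa> p \<longleftrightarrow>
     (\<forall>t>0. \<forall>x\<in>E. p t x \<in> borel_measurable (restrict_space borel E) \<and> (\<forall>y\<in>E. 0 \<le> p t x y) \<and>
        \<kappa> t x = density (restrict_space lborel E) (\<lambda>y. ennreal (p t x y)))"

definition invariant_measure :: "(real \<Rightarrow> 'a \<Rightarrow> 'a measure) \<Rightarrow> 'a measure \<Rightarrow> bool" where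
  "invariant_measure \<kappa> \<mu> \<longleftrightarrow> (\<forall>t\<ge>0. \<mu> \<bind> \<kappa> t = \<mu>)"

text \<open>The graph of the generator on \<open>L\<^sup>2(\<mu>)\<close>: \<open>f\<close> lies in the domain and \<open>g\<close> is a version
  of its image.\<close>

definition generator ::
  "'a measure \<Rightarrow> (real \<Rightarrow> 'a \<Rightarrow> 'a measure) \<Rightarrow> ('a \<Rightarrow> real) \<Rightarrow> ('a \<Rightarrow> real) \<Rightarrow> bool" where
  "generator \<mu> \<kappa> f g \<longleftrightarrow> f \<in> L2 \<mu> \<and> g \<in> L2 \<mu> \<and>
     ((\<lambda>t. L2_norm \<mu> (\<lambda>x. (P_op \<kappa> t f x - f x) / t - g x)) \<longlongrightarrow> 0) (at_right 0)"

definition generator_coefficients ::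
  "(real ^ 'n::finite) set \<Rightarrow> (real ^ 'n) measure \<Rightarrow> (real \<Rightarrow> real ^ 'n \<Rightarrow> (real ^ 'n) measure)
    \<Rightarrow> (real ^ 'n \<Rightarrow> real ^ 'n ^ 'n) \<Rightarrow> (real ^ 'n \<Rightarrow> real ^ 'n) \<Rightarrow> bool" where
  "generator_coefficients E \<mu> \<kappa> a b \<longleftrightarrow>
     a \<in> borel_measurable (restrict_space borel E) \<and>
     b \<in> borel_measurable (restrict_space borel E) \<and>
     (\<forall>K. compact K \<longrightarrow> K \<subseteq> E \<longrightarrow> bounded (a ` K) \<and> bounded (b ` K)) \<and>
     (\<forall>x\<in>E. transpose (a x) = a x \<and> (\<forall>\<xi>. \<xi> \<noteq> 0 \<longrightarrow> \<xi> \<bullet> (a x *v \<xi>) > 0)) \<and>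
     (\<forall>f\<in>test_functions E. generator \<mu> \<kappa> f (diffusion_operator a b f))"

text \<open>The integrated carre du champ of \<open>f\<close> in the domain of the generator, where \<open>g\<close> is
  the image of \<open>f\<close>.\<close>

definition integral_carre_du_champ :: "'a measure \<Rightarrow> ('a \<Rightarrow> real) \<Rightarrow> ('a \<Rightarrow> real) \<Rightarrow> real" where
  "integral_carre_du_champ \<mu> f g = - 2 * (\<integral>x. f x * g x \<partial>\<mu>)"

definition natural_filtration ::
  "'w measure \<Rightarrow> (real \<Rightarrow> 'w \<Rightarrow> 'a::topological_space) \<Rightarrow> real \<Rightarrow> 'w measure" where
  "natural_filtration M X s =
     sigma (space M) {X u -` B \<inter> space M | u B. 0 \<le> u \<and> u \<le> s \<and> B \<in> sets borel}"

definition continuous_markov_process ::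
  "'w measure \<Rightarrow> (real \<Rightarrow> 'w \<Rightarrow> 'a::topological_space) \<Rightarrow> 'a set
    \<Rightarrow> (real \<Rightarrow> 'a \<Rightarrow> 'a measure) \<Rightarrow> bool" where
  "continuous_markov_process M X E \<kappa> \<longleftrightarrow>
     prob_space M \<and>
     (\<forall>t\<ge>0. X t \<in> M \<rightarrow>\<^sub>M restrict_space borel E) \<and>
     (\<forall>\<omega>\<in>space M. continuous_on {0..} (\<lambda>t. X t \<omega>)) \<and>
     (\<forall>s\<ge>0. \<forall>t\<ge>0. \<forall>B\<in>sets (restrict_space borel E).
        AE \<omega> in M. real_cond_exp M (natural_filtration M X s)
            (\<lambda>\<omega>. indicator B (X (s + t) \<omega>)) \<omega> = measure (\<kappa> t (X s \<omega>)) B)"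

text \<open>Ergodicity under the time shift. Invariance of \<open>A\<close> is required up to null sets only: on the
  full product space an event of the product \<open>\<sigma>\<close>-algebra depends on countably many
  coordinates, and strict invariance under all shifts would leave only trivial events.\<close>

definition ergodic_process ::
  "'w measure \<Rightarrow> (real \<Rightarrow> 'w \<Rightarrow> 'a::topological_space) \<Rightarrow> 'a set \<Rightarrow> bool" where
  "ergodic_process M X E \<longleftrightarrow>
     (\<forall>A\<in>sets (\<Pi>\<^sub>M t\<in>{0..}. restrict_space borel E).
        (\<forall>s\<ge>0. AE \<omega> in M. (\<lambda>t\<in>{0..}. X (s + t) \<omega>) \<in> A \<longleftrightarrow> (\<lambda>t\<in>{0..}. X t \<omega>) \<in> A) \<longrightarrow>
        measure M {\<omega>\<in>space M. (\<lambda>t\<in>{0..}. X t \<omega>) \<in> A} \<in> {0, 1})"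

definition stationary_ergodic_feller_diffusion ::
  "'w measure \<Rightarrow> (real \<Rightarrow> 'w \<Rightarrow> 'a::euclidean_space) \<Rightarrow> 'a set
    \<Rightarrow> (real \<Rightarrow> 'a \<Rightarrow> 'a measure) \<Rightarrow> (real \<Rightarrow> 'a \<Rightarrow> 'a \<Rightarrow> real) \<Rightarrow> 'a measure \<Rightarrow> bool" where
  "stationary_ergodic_feller_diffusion M X E \<kappa> p \<mu> \<longleftrightarrow>
     E \<in> sets borel \<and>
     transition_semigroup E \<kappa> \<and> feller E \<kappa> \<and> transition_densities E \<kappa> p \<and>
     prob_space \<mu> \<and> sets \<mu> = sets (restrict_space borel E) \<and> invariant_measure \<kappa> \<mu> \<and>
     continuous_markov_process M X E \<kappa> \<and>
     distr M (restrict_space borel E) (X 0) = \<mu> \<and>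
     ergodic_process M X E"

definition bracketing_number :: "real \<Rightarrow> ('a \<Rightarrow> real) set \<Rightarrow> 'a measure \<Rightarrow> enat" where
  "bracketing_number \<epsilon> F \<mu> = Inf {enat (card B) | B. finite B \<and>
     (\<forall>(l, u)\<in>B. l \<in> L2 \<mu> \<and> u \<in> L2 \<mu> \<and> L2_norm \<mu> (\<lambda>x. u x - l x) < \<epsilon>) \<and>
     (\<forall>f\<in>F. \<exists>(l, u)\<in>B. \<forall>x\<in>space \<mu>. l x \<le> f x \<and> f x \<le> u x)}"

definition sqrt_entropy :: "real \<Rightarrow> ('a \<Rightarrow> real) set \<Rightarrow> 'a measure \<Rightarrow> ennreal" where
  "sqrt_entropy \<epsilon> F \<mu> =
     (case bracketing_number \<epsilon> F \<mu> of enat n \<Rightarrow> ennreal (sqrt (ln (real n))) | \<infinity> \<Rightarrow> \<infinity>)"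

text \<open>The usual outer expectation minimises over measurable extended-real majorants everywhere.
  For \<open>T\<close> bounded almost everywhere, integrable real-valued majorants up to null sets give the
  same value.\<close>

definition outer_expectation :: "'w measure \<Rightarrow> ('w \<Rightarrow> real) \<Rightarrow> real" where
  "outer_expectation M T = Inf {(\<integral>\<omega>. U \<omega> \<partial>M) | U. integrable M U \<and> (AE \<omega> in M. T \<omega> \<le> U \<omega>)}"

definition borel_of_metric :: "'b metric \<Rightarrow> 'b measure" where
  "borel_of_metric m = sigma (mspace m) {U. openin (mtopology_of m) U}"

definition tight_random_element :: "'c measure \<Rightarrow> ('c \<Rightarrow> 'b) \<Rightarrow> 'b metric \<Rightarrow> bool" where
  "tight_random_element N G m \<longleftrightarrow>
     prob_space N \<and> G \<in> N \<rightarrow>\<^sub>M borel_of_metric m \<and>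
     (\<forall>e>0. \<exists>K. compactin (mtopology_of m) K \<and> measure N (G -` K \<inter> space N) \<ge> 1 - e)"

definition HJ_converges ::
  "'w measure \<Rightarrow> (real \<Rightarrow> 'w \<Rightarrow> 'b) \<Rightarrow> 'c measure \<Rightarrow> ('c \<Rightarrow> 'b) \<Rightarrow> 'b metric \<Rightarrow> bool" where
  "HJ_converges M Y N G m \<longleftrightarrow>
     (\<forall>h. continuous_map (mtopology_of m) euclideanreal h \<longrightarrow> bounded (h ` mspace m) \<longrightarrow>
        ((\<lambda>t. outer_expectation M (\<lambda>\<omega>. h (Y t \<omega>))) \<longlongrightarrow> (\<integral>\<omega>. h (G \<omega>) \<partial>N)) at_top)"

text \<open>Bounded functions on \<open>F\<close>, undefined outside \<open>F\<close>, with the supremum metric.\<close>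

abbreviation ell_infinity :: "'b set \<Rightarrow> ('b \<Rightarrow> real) metric" where
  "ell_infinity F \<equiv> funspace F euclidean_metric"

definition empirical_process ::
  "(real \<Rightarrow> 'w \<Rightarrow> 'a) \<Rightarrow> ('a \<Rightarrow> real) set \<Rightarrow> real \<Rightarrow> 'w \<Rightarrow> ('a \<Rightarrow> real) \<Rightarrow> real" where
  "empirical_process X F t \<omega> = (\<lambda>f\<in>F. t powr (- 1 / 2) * (LBINT u:{0..t}. f (X u \<omega>)))"

text \<open>The first conjunct says that the empirical process is well defined and has values in
  \<open>\<ell>\<^sup>\<infinity>(F)\<close> off a null set, so that the remaining clause is meaningful (a Lebesgue integral that
  does not exist would be read as 0). The limit may live on any probability space; one over the
  type of \<open>\<ell>\<^sup>\<infinity>(F)\<close> suffices because the identity is a random element with any given law.\<close>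

definition donsker ::
  "'w measure \<Rightarrow> (real \<Rightarrow> 'w \<Rightarrow> 'a) \<Rightarrow> ('a \<Rightarrow> real) set \<Rightarrow> bool" where
  "donsker M X F \<longleftrightarrow>
     (\<forall>t>0. AE \<omega> in M. (\<forall>f\<in>F. set_integrable lborel {0..t} (\<lambda>u. f (X u \<omega>))) \<and>
        empirical_process X F t \<omega> \<in> mspace (ell_infinity F)) \<and>
     (\<exists>(N :: (('a \<Rightarrow> real) \<Rightarrow> real) measure) G.
        tight_random_element N G (ell_infinity F) \<and>
        HJ_converges M (empirical_process X F) N G (ell_infinity F))"

definition poincare :: "'a measure \<Rightarrow> (real \<Rightarrow> 'a \<Rightarrow> 'a measure) \<Rightarrow> bool" where
  "poincare \<mu> \<kappa> \<longleftrightarrow> (\<exists>c>0. \<forall>f g. generator \<mu> \<kappa> f g \<longrightarrow>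
     (\<integral>x. (f x)\<^sup>2 \<partial>\<mu>) - (\<integral>x. f x \<partial>\<mu>)\<^sup>2 \<le> c * integral_carre_du_champ \<mu> f g)"

text \<open>The bound is required on the whole space; \<open>p\<close> is otherwise unconstrained off \<open>E \<times> E\<close>, where
  it may be taken to be 0.\<close>

definition heat_kernel_bound :: "(real \<Rightarrow> real ^ 'n::finite \<Rightarrow> real ^ 'n \<Rightarrow> real) \<Rightarrow> bool" where
  "heat_kernel_bound p \<longleftrightarrow> (\<exists>C\<^sub>0>0. \<forall>u t x y. 0 < t \<longrightarrow> t \<le> u \<longrightarrow> (norm (x - y))\<^sup>2 \<le> u \<longrightarrow>
     p t x y \<le> C\<^sub>0 * (t powr (- real CARD('n) / 2) + u powr (3 * real CARD('n) / 2)))"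

definition uniformly_elliptic ::
  "(real ^ 'n::finite) set \<Rightarrow> (real ^ 'n \<Rightarrow> real ^ 'n ^ 'n) \<Rightarrow> bool" where
  "uniformly_elliptic E a \<longleftrightarrow>
     (\<exists>\<alpha>>0. \<forall>y\<in>E. \<forall>\<xi>. \<xi> \<noteq> 0 \<longrightarrow> \<xi> \<bullet> (a y *v \<xi>) \<ge> \<alpha> * (norm \<xi>)\<^sup>2)"

definition symmetric_semigroup :: "'a measure \<Rightarrow> (real \<Rightarrow> 'a \<Rightarrow> 'a measure) \<Rightarrow> bool" where
  "symmetric_semigroup \<mu> \<kappa> \<longleftrightarrow> (\<forall>t\<ge>0. \<forall>f\<in>L2 \<mu>. \<forall>g\<in>L2 \<mu>.
     (\<integral>x. f x * P_op \<kappa> t g x \<partial>\<mu>) = (\<integral>x. g x * P_op \<kappa> t f x \<partial>\<mu>))"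

definition locally_bounded_density :: "'a::euclidean_space set \<Rightarrow> 'a measure \<Rightarrow> bool" where
  "locally_bounded_density E \<mu> \<longleftrightarrow>
     (\<exists>\<pi>. \<pi> \<in> borel_measurable (restrict_space borel E) \<and> (\<forall>x\<in>E. 0 \<le> \<pi> x) \<and>
        \<mu> = density (restrict_space lborel E) (\<lambda>x. ennreal (\<pi> x)) \<and>
        (\<forall>K. compact K \<longrightarrow> K \<subseteq> interior E \<longrightarrow>
           (\<exists>m>0. \<exists>B. \<forall>x\<in>K. m \<le> \<pi> x \<and> \<pi> x \<le> B)))"

end

theory Submission
  imports Defs
begin

text \<open>The Poincare inequality and reversibility make the semigroup contract mean-zero functions in
  \<open>L\<^sup>2(\<mu>)\<close> at an exponential rate \<open>\<gamma>\<close>. Perturbing the semigroup by a bounded potential then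
  bounds the Laplace transform of a path integral, which yields a Bernstein-type maximal inequality
  for finitely many bounded functions. Chaining along brackets of size \<open>2\<^sup>-\<^sup>q\<close>, truncated where the
  bracket width exceeds a level-dependent multiple of \<open>\<surd>t\<close>, approximates the empirical process
  uniformly on \<open>F\<close> by its values at finitely many representatives, with an error small in mean.

  At finitely many functions a central limit theorem holds: by the Markov property and the decay of
  correlations the characteristic function of the path integral of a bounded continuous function
  solves a linear differential equation up to a small error, and the variance bound
  \<open>2 \<parallel>f\<parallel>\<^sup>2 / \<gamma>\<close> extends the limit to all of \<open>L\<^sup>2\<^sub>0\<close>. The limits of the finite-dimensional
  approximations, evaluated on one Gaussian sequence, are Cauchy in mean, so they converge almost
  surely in \<open>\<ell>\<^sup>\<infinity>(F)\<close>; their limit is tight and is the weak limit of the empirical process.\<close>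

section \<open>Square-integrable functions\<close>

text \<open>The kernels act pointwise, so the semigroup is handled on the class \<open>Bd\<close> of
  functions bounded on \<open>E\<close>, where every integral exists at every point; estimates reach
  \<open>L2\<close> afterwards, by density. Three obstacles shape the rest. A bounded function need
  not lie in the domain of the generator, so the Poincare inequality is applied to its time
  averages. A supremum over an uncountable \<open>F\<close> need not be measurable, so every uniform
  bound is an integrable majorant \<open>R\<close> that dominates all of \<open>F\<close> off one
  null set; outer expectations accept exactly such majorants. Finally, members of \<open>F\<close>
  are only square integrable, while the Laplace transform bound admits exponents at most inversely
  proportional to the sup norm; the truncation level is the one for which the largest admissible
  exponent balances entropy against variance. The perturbed semigroup appears only in discrete time:
  Jensen's inequality compares a path integral with sums over shifted grids, and each grid step
  costs one \<open>L2\<close> contraction estimate.\<close>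

lemmas lint_cong = Bochner_Integration.integral_cong

lemma L2_measurable [measurable_dest]: "f \<in> L2 M \<Longrightarrow> f \<in> borel_measurable M"
  by (simp add: L2_def)

lemma L2_integrable_square: "f \<in> L2 M \<Longrightarrow> integrable M (\<lambda>x. (f x)^2)"
  by (simp add: L2_def)

lemma L2I: "f \<in> borel_measurable M \<Longrightarrow> integrable M (\<lambda>x. (f x)^2) \<Longrightarrow> f \<in> L2 M"
  by (simp add: L2_def)

lemma L2_integrable_mult:
  assumes "f \<in> L2 M" "g \<in> L2 M"
  shows "integrable M (\<lambda>x. f x * g x)"
proof (rule Bochner_Integration.integrable_bound)
  show "integrable M (\<lambda>x. (f x)^2 + (g x)^2)"
    using assms by (simp add: L2_integrable_square)
  show "(\<lambda>x. f x * g x) \<in> borel_measurable M"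
    using assms by (simp add: L2_measurable)
  have "\<bar>a * b\<bar> \<le> a\<^sup>2 + b\<^sup>2" for a b :: real
  proof -
    have "2 * \<bar>a\<bar> * \<bar>b\<bar> \<le> \<bar>a\<bar>\<^sup>2 + \<bar>b\<bar>\<^sup>2" by (rule sum_squares_bound)
    moreover have "0 \<le> \<bar>a\<bar> * \<bar>b\<bar>" by simp
    ultimately show ?thesis unfolding abs_mult power2_abs by linarith
  qed
  then show "AE x in M. norm (f x * g x) \<le> norm ((f x)^2 + (g x)^2)"
    by (auto intro!: AE_I2 simp: abs_mult[symmetric])
qed

lemma L2_add [intro]:
  assumes "f \<in> L2 M" "g \<in> L2 M"
  shows "(\<lambda>x. f x + g x) \<in> L2 M"
proof (rule L2I)
  have "integrable M (\<lambda>x. (f x)^2 + (g x)^2 + 2 * (f x * g x))"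
    using assms L2_integrable_mult[OF assms] by (simp add: L2_integrable_square)
  then show "integrable M (\<lambda>x. (f x + g x)^2)"
    by (simp add: power2_eq_square algebra_simps)
qed (use assms in \<open>simp add: L2_measurable\<close>)

lemma L2_cmult [intro]:
  assumes "f \<in> L2 M"
  shows "(\<lambda>x. c * f x) \<in> L2 M"
  using assms by (auto intro!: L2I simp: L2_measurable L2_integrable_square power_mult_distrib)

lemma L2_diff [intro]:
  assumes "f \<in> L2 M" "g \<in> L2 M"
  shows "(\<lambda>x. f x - g x) \<in> L2 M"
  using L2_add[OF assms(1) L2_cmult[OF assms(2), of "-1"]] by simp

lemma L2_zero [simp, intro]: "(\<lambda>_. 0) \<in> L2 M"
  by (rule L2I) auto

lemma L2_sum [intro]:
  assumes "\<And>i. i \<in> I \<Longrightarrow> f i \<in> L2 M"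
  shows "(\<lambda>x. \<Sum>i\<in>I. f i x) \<in> L2 M"
  using assms by (induction I rule: infinite_finite_induct) auto

lemma L2_abs [intro]: "f \<in> L2 M \<Longrightarrow> (\<lambda>x. \<bar>f x\<bar>) \<in> L2 M"
  by (auto simp: L2_def)

lemma L2_bounded_by:
  assumes "g \<in> L2 M" "f \<in> borel_measurable M" "\<And>x. x \<in> space M \<Longrightarrow> \<bar>f x\<bar> \<le> \<bar>g x\<bar>"
  shows "f \<in> L2 M"
proof (rule L2I[OF assms(2)], rule Bochner_Integration.integrable_bound)
  show "integrable M (\<lambda>x. (g x)^2)" using assms(1) by (rule L2_integrable_square)
  show "AE x in M. norm ((f x)^2) \<le> norm ((g x)^2)"
    using assms(3) by (auto intro!: AE_I2 simp: abs_le_square_iff)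
qed (use assms in simp)

lemma L2_norm_nonneg [simp]: "0 \<le> L2_norm M f"
  by (simp add: L2_norm_def)

lemma L2_norm_sq: "(L2_norm M f)^2 = (\<integral>x. (f x)^2 \<partial>M)"
  by (simp add: L2_norm_def)

lemma L2_norm_cmult: "L2_norm M (\<lambda>x. c * f x) = \<bar>c\<bar> * L2_norm M f"
  by (simp add: L2_norm_def power_mult_distrib real_sqrt_mult)

lemma L2_norm_abs [simp]: "L2_norm M (\<lambda>x. \<bar>f x\<bar>) = L2_norm M f"
  by (simp add: L2_norm_def)

lemma L2_norm_minus_commute: "L2_norm M (\<lambda>x. f x - g x) = L2_norm M (\<lambda>x. g x - f x)"
  by (simp add: L2_norm_def power2_commute)

lemma L2_norm_cong: "(\<And>x. x \<in> space M \<Longrightarrow> f x = g x) \<Longrightarrow> L2_norm M f = L2_norm M g"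
  unfolding L2_norm_def by (metis (mono_tags, lifting) lint_cong)

lemma L2_norm_mono:
  assumes "g \<in> L2 M" "f \<in> borel_measurable M" "\<And>x. x \<in> space M \<Longrightarrow> \<bar>f x\<bar> \<le> \<bar>g x\<bar>"
  shows "L2_norm M f \<le> L2_norm M g"
  unfolding L2_norm_def
  using L2_integrable_square[OF L2_bounded_by[OF assms]] L2_integrable_square[OF assms(1)] assms(3)
  by (auto intro!: integral_mono simp: abs_le_square_iff)

lemma L2_Cauchy_Schwarz:
  assumes "f \<in> L2 M" "g \<in> L2 M"
  shows "\<bar>\<integral>x. f x * g x \<partial>M\<bar> \<le> L2_norm M f * L2_norm M g"
proof -
  let ?a = "\<integral>x. (f x)^2 \<partial>M" and ?b = "\<integral>x. (g x)^2 \<partial>M" and ?c = "\<integral>x. f x * g x \<partial>M"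
  have nn: "0 \<le> ?a" "0 \<le> ?b" by auto
  note int = L2_integrable_mult[OF assms] L2_integrable_square[OF assms(1)] L2_integrable_square[OF assms(2)]
  have quad: "0 \<le> ?a * s\<^sup>2 + 2 * s * r * ?c + ?b * r\<^sup>2" for r s :: real
  proof -
    have "0 \<le> (\<integral>x. (s * f x + r * g x)^2 \<partial>M)" by simp
    also have "... = (\<integral>x. s\<^sup>2 * (f x)^2 + 2 * s * r * (f x * g x) + r\<^sup>2 * (g x)^2 \<partial>M)"
      by (rule lint_cong) (auto simp: power2_eq_square algebra_simps)
    also have "... = ?a * s\<^sup>2 + 2 * s * r * ?c + ?b * r\<^sup>2"
      using int by (simp add: mult.commute)
    finally show ?thesis .
  qed
  have "?c\<^sup>2 \<le> ?a * ?b"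
  proof (cases "?b = 0")
    case True
    have "?c = 0"
    proof (rule ccontr)
      assume c: "?c \<noteq> 0"
      \<comment> \<open>When \<open>g\<close> has norm zero, the form with \<open>s = 1\<close> is
        affine in \<open>r\<close>; this \<open>r\<close> gives it the value -1.\<close>
      define r where "r = - (?a + 1) / (2 * ?c)"
      have "2 * r * ?c = - (?a + 1)" using c by (simp add: r_def)
      then show False using quad[of 1 r] True by simp
    qed
    then show ?thesis using nn by simp
  next
    case False
    then have b: "0 < ?b" using nn by linarith
    have "0 \<le> ?a * ?b\<^sup>2 - 2 * ?b * ?c * ?c + ?b * ?c\<^sup>2"
      using quad[of ?b "- ?c"] by simp
    also have "... = ?b * (?a * ?b - ?c\<^sup>2)" by (simp add: power2_eq_square algebra_simps)
    finally show ?thesis using b by (simp add: zero_le_mult_iff)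
  qed
  then have "sqrt (?c\<^sup>2) \<le> sqrt (?a * ?b)" by (rule real_sqrt_le_mono)
  then show ?thesis by (simp add: L2_norm_def real_sqrt_mult)
qed

lemma L2_norm_triangle:
  assumes "f \<in> L2 M" "g \<in> L2 M"
  shows "L2_norm M (\<lambda>x. f x + g x) \<le> L2_norm M f + L2_norm M g"
proof (rule power2_le_imp_le)
  have "(L2_norm M (\<lambda>x. f x + g x))^2 = (\<integral>x. (f x)^2 + 2 * (f x * g x) + (g x)^2 \<partial>M)"
    unfolding L2_norm_sq by (rule lint_cong) (auto simp: power2_eq_square algebra_simps)
  also have "... = (L2_norm M f)^2 + 2 * (\<integral>x. f x * g x \<partial>M) + (L2_norm M g)^2"
    unfolding L2_norm_sq
    using assms L2_integrable_mult[OF assms] by (simp add: L2_integrable_square)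
  also have "... \<le> (L2_norm M f)^2 + 2 * (L2_norm M f * L2_norm M g) + (L2_norm M g)^2"
    using L2_Cauchy_Schwarz[OF assms] by auto
  also have "... = (L2_norm M f + L2_norm M g)^2" by (simp add: power2_sum)
  finally show "(L2_norm M (\<lambda>x. f x + g x))^2 \<le> (L2_norm M f + L2_norm M g)^2" .
qed simp

lemma L2_norm_triangle_diff:
  assumes "f \<in> L2 M" "g \<in> L2 M"
  shows "L2_norm M f \<le> L2_norm M (\<lambda>x. f x - g x) + L2_norm M g"
  using L2_norm_triangle[OF L2_diff[OF assms] assms(2)] by simp

lemma L2_norm_triangle3:
  assumes "f \<in> L2 M" "g \<in> L2 M" "h \<in> L2 M"
  shows "L2_norm M (\<lambda>x. f x - h x) \<le> L2_norm M (\<lambda>x. f x - g x) + L2_norm M (\<lambda>x. g x - h x)"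
  using L2_norm_triangle[OF L2_diff[OF assms(1,2)] L2_diff[OF assms(2,3)]] by simp

context prob_space begin

lemma L2_bounded:
  assumes "f \<in> borel_measurable M" "\<And>x. x \<in> space M \<Longrightarrow> \<bar>f x\<bar> \<le> c"
  shows "f \<in> L2 M"
proof (rule L2I[OF assms(1)], rule integrable_const_bound[where B = "c\<^sup>2"])
  show "AE x in M. norm ((f x)^2) \<le> c\<^sup>2"
    using assms(2) by (force intro!: AE_I2 simp: abs_le_square_iff[symmetric] intro: order_trans)
qed (use assms in simp)

lemma L2_norm_bounded:
  assumes "f \<in> borel_measurable M" "\<And>x. x \<in> space M \<Longrightarrow> \<bar>f x\<bar> \<le> c" "0 \<le> c"
  shows "L2_norm M f \<le> c"
proof -
  have "L2_norm M f \<le> L2_norm M (\<lambda>_. c)"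
    using assms by (intro L2_norm_mono L2_bounded[where c = c]) auto
  also have "... = c" using assms(3) by (simp add: L2_norm_def prob_space)
  finally show ?thesis .
qed

lemma L2_const [simp, intro]: "(\<lambda>_. c) \<in> L2 M"
  by (rule L2_bounded[where c = "\<bar>c\<bar>"]) auto

lemma L2_norm_const: "L2_norm M (\<lambda>_. c) = \<bar>c\<bar>"
  by (simp add: L2_norm_def prob_space)

lemma L2_integrable: "f \<in> L2 M \<Longrightarrow> integrable M f"
  using L2_integrable_mult[OF _ L2_const[of 1]] by simp

lemma L2_norm_ge_L1: "f \<in> L2 M \<Longrightarrow> (\<integral>x. \<bar>f x\<bar> \<partial>M) \<le> L2_norm M f"
  using L2_Cauchy_Schwarz[OF L2_abs L2_const, of f 1] by (simp add: L2_norm_const)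

lemma L2_norm_ge_integral: "f \<in> L2 M \<Longrightarrow> \<bar>\<integral>x. f x \<partial>M\<bar> \<le> L2_norm M f"
  using L2_Cauchy_Schwarz[OF _ L2_const, of f 1] by (simp add: L2_norm_const)

lemma L2_norm_centered:
  assumes "f \<in> L2 M"
  shows "(L2_norm M (\<lambda>x. f x - (\<integral>x. f x \<partial>M)))^2 = (L2_norm M f)^2 - (\<integral>x. f x \<partial>M)\<^sup>2"
proof -
  let ?m = "\<integral>x. f x \<partial>M"
  have "(\<integral>x. (f x - ?m)^2 \<partial>M) = (\<integral>x. (f x)^2 - 2 * ?m * f x + ?m\<^sup>2 \<partial>M)"
    by (rule lint_cong) (auto simp: power2_eq_square algebra_simps)
  also have "... = (\<integral>x. (f x)^2 \<partial>M) - ?m\<^sup>2"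
    using assms L2_integrable[OF assms] L2_integrable_square[OF assms] by (simp add: prob_space) (simp add: power2_eq_square)
  finally show ?thesis by (simp add: L2_norm_sq)
qed

end

text \<open>Dominated convergence for squares: the limit inherits the bound by \<open>g\<close>, so
  the squared differences stay below \<open>4 * (g x)^2\<close>.\<close>

lemma L2_integral_tendsto_dominated:
  assumes g: "g \<in> L2 M" and f: "f \<in> borel_measurable M" "\<And>i. s i \<in> borel_measurable M"
    and lim: "\<And>x. x \<in> space M \<Longrightarrow> (\<lambda>i. s i x) \<longlonglongrightarrow> f x"
    and dom: "\<And>i x. x \<in> space M \<Longrightarrow> \<bar>s i x\<bar> \<le> \<bar>g x\<bar>"
  shows "(\<lambda>i. L2_norm M (\<lambda>x. f x - s i x)) \<longlonglongrightarrow> 0"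
proof -
  have "(\<lambda>i. \<integral>x. (f x - s i x)^2 \<partial>M) \<longlonglongrightarrow> (\<integral>x. 0 \<partial>M)"
  proof (rule integral_dominated_convergence[where w = "\<lambda>x. 4 * (g x)^2"])
    show "integrable M (\<lambda>x. 4 * (g x)^2)" using g by (simp add: L2_integrable_square)
    show "AE x in M. (\<lambda>i. (f x - s i x)^2) \<longlonglongrightarrow> 0"
    proof (rule AE_I2)
      fix x assume "x \<in> space M"
      from tendsto_power[OF tendsto_diff[OF tendsto_const[of "f x"] lim[OF this]], of 2]
      show "(\<lambda>i. (f x - s i x)^2) \<longlonglongrightarrow> 0" by simp
    qed
    show "AE x in M. norm ((f x - s i x)^2) \<le> 4 * (g x)^2" for i
    proof (rule AE_I2)
      fix x assume x: "x \<in> space M"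
      have "\<bar>f x\<bar> \<le> \<bar>g x\<bar>"
        using tendsto_rabs[OF lim[OF x]] dom[OF x] by (intro Lim_bounded) auto
      then have "\<bar>f x - s i x\<bar> \<le> \<bar>2 * g x\<bar>" using dom[OF x, of i] by linarith
      then have "(f x - s i x)^2 \<le> (2 * g x)^2" by (simp only: abs_le_square_iff)
      then show "norm ((f x - s i x)^2) \<le> 4 * (g x)^2" by (simp add: power_mult_distrib)
    qed
  qed (use f in auto)
  then have "(\<lambda>i. sqrt (\<integral>x. (f x - s i x)^2 \<partial>M)) \<longlonglongrightarrow> sqrt 0"
    by (intro tendsto_real_sqrt) simp
  then show ?thesis by (simp add: L2_norm_def)
qed


section \<open>Density of bounded continuous functions in \<open>L2\<close>\<close>

text \<open>Inner regularity of the image measure on the whole space yields a compact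
  \<open>K\<close> inside \<open>B\<close> of almost full measure; truncated multiples of the
  distance to \<open>K\<close> then converge to the indicator of \<open>K\<close>. Passing through
  the whole space makes the approximant continuous on \<open>UNIV\<close>, so that it can be
  composed with paths.\<close>

lemma L2_indicator_approx_continuous:
  fixes B E :: "'b::euclidean_space set"
  assumes "prob_space M" and sets: "sets M = sets (restrict_space borel E)" and E: "E \<in> sets borel"
    and B: "B \<in> sets M" and e: "0 < e"
  shows "\<exists>g. continuous_on UNIV g \<and> bounded (range g) \<and> L2_norm M (\<lambda>x. indicator B x - g x) < e"
proof -
  interpret prob_space M by fact
  have meas[measurable]: "(\<lambda>x. x) \<in> M \<rightarrow>\<^sub>M borel"
    unfolding measurable_cong_sets[OF sets refl] by (rule measurable_restrict_space1) simp
  have spM: "space M = E" using sets_eq_imp_space_eq[OF sets] by (simp add: space_restrict_space)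
  define N where "N = distr M borel (\<lambda>x. x)"
  interpret N: prob_space N unfolding N_def by (rule prob_space_distr) simp
  have Bb: "B \<in> sets borel" "B \<subseteq> E" using B E unfolding sets by (auto simp: sets_restrict_space_iff)
  have NM: "emeasure N A = emeasure M (A \<inter> E)" if "A \<in> sets borel" for A
    unfolding N_def using that by (subst emeasure_distr) (auto simp: spM vimage_def Int_commute Collect_conj_eq)
  have "emeasure N B = (SUP K \<in> {K. K \<subseteq> B \<and> compact K}. emeasure N K)"
    using Bb N.emeasure_space_1 by (intro inner_regular) (auto simp: N_def)
  moreover have "{K. K \<subseteq> B \<and> compact K} \<noteq> {}" by (auto intro: exI[of _ "{}"])
  ultimately have "\<exists>K \<in> {K. K \<subseteq> B \<and> compact K}. emeasure N B < emeasure N K + ennreal ((e/2)^2)"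
    using e N.emeasure_finite[of B] by (intro SUP_approx_ennreal) auto
  then
  obtain K where K: "K \<subseteq> B" "compact K" "emeasure N B < emeasure N K + ennreal ((e/2)^2)"
    by blast
  have Kb: "K \<in> sets borel" using K(2) by (simp add: compact_imp_closed)
  have KM: "K \<in> sets M" using Kb K(1) Bb E unfolding sets by (auto simp: sets_restrict_space_iff)
  have "measure N B < measure N K + (e/2)^2"
    using K(3) by (simp add: N.emeasure_eq_measure ennreal_plus[symmetric] del: ennreal_plus)
      (metis ennreal_leI linorder_not_le)
  moreover have "measure N B = measure M B" "measure N K = measure M K"
    using NM[OF Bb(1)] NM[OF Kb] Bb(2) K(1) by (auto simp: measure_def Int_absorb2)
  ultimately have BK: "measure M (B - K) < (e/2)\<^sup>2"
    using finite_measure_Diff[OF B KM K(1)] by simp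
  have 1: "L2_norm M (\<lambda>x. indicator B x - indicator K x) < e / 2"
  proof -
    have "(L2_norm M (\<lambda>x. indicator B x - indicator K x))^2 = (\<integral>x. indicator (B - K) x \<partial>M)"
      unfolding L2_norm_sq using K(1)
      by (intro lint_cong) (auto simp: indicator_def)
    also have "... < (e/2)\<^sup>2" using BK B KM by simp
    finally show ?thesis using e by (intro power_less_imp_less_base[of _ 2 "e/2"]) auto
  qed
  have B2: "(indicator B :: 'b \<Rightarrow> real) \<in> L2 M" "(indicator K :: 'b \<Rightarrow> real) \<in> L2 M"
    using B KM by (auto intro!: L2_bounded[where c = 1] simp: indicator_def)
  show ?thesis
  \<comment> \<open>\<open>infdist x {}\<close> is 0 by convention, so for empty \<open>K\<close>
    the functions \<open>g n\<close> would be constantly 1.\<close>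
  proof (cases "K = {}")
    case True
    then show ?thesis using 1 e by (intro exI[of _ "\<lambda>_. 0"]) auto
  next
    case False
    define g where "g n x = max 0 (1 - real n * infdist x K)" for n :: nat and x
    have cont: "continuous_on UNIV (g n)" for n
      unfolding g_def by (intro continuous_intros)
    have bnd: "0 \<le> g n x" "g n x \<le> 1" for n x
      by (auto simp: g_def infdist_nonneg)
    have pm[measurable]: "g n \<in> borel_measurable M" for n
      using measurable_compose[OF meas borel_measurable_continuous_onI[OF cont]] .
    have lim: "(\<lambda>n. g n x) \<longlonglongrightarrow> indicator K x" for x
    proof (cases "x \<in> K")
      case True then show ?thesis by (simp add: g_def)
    next
      case nK: False
      have "0 < infdist x K"
        using in_closed_iff_infdist_zero[OF compact_imp_closed[OF K(2)] False] nK infdist_nonneg[of x K]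
        by (metis less_eq_real_def)
      then obtain N0 :: nat where N0: "1 < real N0 * infdist x K"
        using reals_Archimedean3 by blast
      have "g n x = 0" if "n \<ge> N0" for n
      proof -
        have "real N0 * infdist x K \<le> real n * infdist x K"
          using that by (intro mult_right_mono) (auto simp: infdist_nonneg)
        then show ?thesis using N0 by (simp add: g_def)
      qed
      then show ?thesis using nK by (intro tendsto_eventually) (auto simp: eventually_at_top_linorder)
    qed
    have "(\<lambda>n. L2_norm M (\<lambda>x. indicator K x - g n x)) \<longlonglongrightarrow> 0"
      using KM bnd lim by (intro L2_integral_tendsto_dominated[OF L2_const[of 1]]) auto
    from order_tendstoD(2)[OF this, of "e/2"] e
    obtain n where n: "L2_norm M (\<lambda>x. indicator K x - g n x) < e / 2"
      by (auto simp: eventually_sequentially)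
    have p2: "g n \<in> L2 M" using bnd by (intro L2_bounded[where c = 1]) auto
    have "L2_norm M (\<lambda>x. indicator B x - g n x) < e"
      using L2_norm_triangle3[OF B2 p2] n 1 by linarith
    moreover have "bounded (range (g n))"
      using bnd by (intro boundedI[where B = 1]) auto
    ultimately show ?thesis using cont by blast
  qed
qed

text \<open>Induction over nonnegative measurable functions. Membership in \<open>L2\<close> stays a
  premise of the induction, because each intermediate function inherits it from the final one by
  domination.\<close>

lemma L2_approx_continuous_nonneg:
  fixes f :: "'b::euclidean_space \<Rightarrow> real"
  assumes "prob_space M" and sets: "sets M = sets (restrict_space borel E)" and E: "E \<in> sets borel"
    and f: "f \<in> borel_measurable M" "\<And>x. 0 \<le> f x"
  shows "f \<in> L2 M \<Longrightarrow> 0 < e \<Longrightarrow>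
    \<exists>g. continuous_on UNIV g \<and> bounded (range g) \<and> L2_norm M (\<lambda>x. f x - g x) < e"
  using f
proof (induction arbitrary: e rule: borel_measurable_induct_real)
  case (set A)
  then show ?case by (intro L2_indicator_approx_continuous[OF assms(1-3)])
next
  case (mult u c)
  interpret prob_space M by fact
  show ?case
  \<comment> \<open>For \<open>c = 0\<close> nothing forces \<open>u\<close> itself to be square
    integrable.\<close>
  proof (cases "c = 0")
    case True
    then show ?thesis using mult by (intro exI[of _ "\<lambda>_. 0"]) (auto simp: L2_norm_const)
  next
    case False
    then have "u \<in> L2 M" using L2_cmult[OF mult.prems(1), of "1/c"] by (simp add: mult.commute)
    then obtain g where g: "continuous_on UNIV g" "bounded (range g)" "L2_norm M (\<lambda>x. u x - g x) < e / \<bar>c\<bar>"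
      using mult.IH[of "e / \<bar>c\<bar>"] mult.prems False by auto
    have "L2_norm M (\<lambda>x. c * u x - c * g x) = \<bar>c\<bar> * L2_norm M (\<lambda>x. u x - g x)"
      by (simp add: L2_norm_cmult[symmetric] right_diff_distrib)
    also have "... < e" using g(3) False by (simp add: field_simps)
    finally have "L2_norm M (\<lambda>x. c * u x - c * g x) < e" .
    moreover have "bounded (range (\<lambda>x. c * g x))"
      using bounded_scaling[OF g(2), of c] by (simp add: image_image)
    moreover have "continuous_on UNIV (\<lambda>x. c * g x)" using g(1) by (intro continuous_intros)
    ultimately show ?thesis by blast
  qed
next
  case (add u v)
  interpret prob_space M by fact
  have meas[measurable]: "(\<lambda>x. x) \<in> M \<rightarrow>\<^sub>M borel"
    unfolding measurable_cong_sets[OF sets refl] by (rule measurable_restrict_space1) simp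
  have uv: "u \<in> L2 M" "v \<in> L2 M"
    using add by (auto intro!: L2_bounded_by[OF add.prems(1)] simp: )
  obtain g where g: "continuous_on UNIV g" "bounded (range g)" "L2_norm M (\<lambda>x. u x - g x) < e / 2"
    using add.IH(1)[of "e/2"] add.prems uv by auto
  obtain h where h: "continuous_on UNIV h" "bounded (range h)" "L2_norm M (\<lambda>x. v x - h x) < e / 2"
    using add.IH(2)[of "e/2"] add.prems uv by auto
  have m[measurable]: "g \<in> borel_measurable M" "h \<in> borel_measurable M"
    using measurable_compose[OF meas borel_measurable_continuous_onI] g(1) h(1) by blast+
  have L: "g \<in> L2 M" "h \<in> L2 M"
    using g(2) h(2) by (auto simp: bounded_iff intro!: L2_bounded)
  have "L2_norm M (\<lambda>x. (u x - g x) + (v x - h x)) < e"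
    using L2_norm_triangle[OF L2_diff[OF uv(1) L(1)] L2_diff[OF uv(2) L(2)]] g(3) h(3) by linarith
  moreover have "(\<lambda>x. (u x - g x) + (v x - h x)) = (\<lambda>x. v x + u x - (g x + h x))"
      "(\<lambda>x. (u x - g x) + (v x - h x)) = (\<lambda>x. u x + v x - (g x + h x))"
    by (auto simp: algebra_simps)
  moreover have "continuous_on UNIV (\<lambda>x. g x + h x)" using g(1) h(1) by (intro continuous_intros)
  moreover have "bounded (range (\<lambda>x. g x + h x))" using g(2) h(2) by (rule bounded_plus_comp)
  ultimately show ?case by (intro exI[of _ "\<lambda>x. g x + h x"]) simp
next
  case (seq U)
  interpret prob_space M by fact
  have meas[measurable]: "(\<lambda>x. x) \<in> M \<rightarrow>\<^sub>M borel"
    unfolding measurable_cong_sets[OF sets refl] by (rule measurable_restrict_space1) simp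
  have le: "U i x \<le> f x" if "x \<in> space M" for i x
    using seq.hyps(4)[OF that] seq.hyps(3) by (intro incseq_le) (auto simp: incseq_def le_fun_def)
  have "(\<lambda>i. L2_norm M (\<lambda>x. f x - U i x)) \<longlonglongrightarrow> 0"
    using seq le by (intro L2_integral_tendsto_dominated[OF seq.prems(1)]) (auto simp: abs_of_nonneg f(2))
  from order_tendstoD(2)[OF this, of "e/2"] seq.prems
  obtain n where n: "L2_norm M (\<lambda>x. f x - U n x) < e / 2"
    by (auto simp: eventually_sequentially)
  have U: "U n \<in> L2 M"
    using seq le by (intro L2_bounded_by[OF seq.prems(1)]) (auto simp: abs_of_nonneg f(2))
  then obtain g where g: "continuous_on UNIV g" "bounded (range g)" "L2_norm M (\<lambda>x. U n x - g x) < e / 2"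
    using seq.IH[of n "e/2"] seq.prems by auto
  have m[measurable]: "g \<in> borel_measurable M"
    using measurable_compose[OF meas borel_measurable_continuous_onI] g(1) by blast
  have "g \<in> L2 M" using g(2) by (auto simp: bounded_iff intro!: L2_bounded)
  from L2_norm_triangle3[OF seq.prems(1) U this] n g show ?case
    by (intro exI[of _ g]) auto
qed

lemma L2_approx_continuous:
  fixes f :: "'b::euclidean_space \<Rightarrow> real"
  assumes "prob_space M" and sets: "sets M = sets (restrict_space borel E)" and E: "E \<in> sets borel"
    and f: "f \<in> L2 M" and e: "0 < e"
  obtains g where "continuous_on UNIV g" "bounded (range g)" "g \<in> L2 M" "L2_norm M (\<lambda>x. f x - g x) < e"
proof -
  interpret prob_space M by fact
  have meas[measurable]: "(\<lambda>x. x) \<in> M \<rightarrow>\<^sub>M borel"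
    unfolding measurable_cong_sets[OF sets refl] by (rule measurable_restrict_space1) simp
  have fm[measurable]: "f \<in> borel_measurable M" using f by (rule L2_measurable)
  let ?p = "\<lambda>x. max 0 (f x)" and ?n = "\<lambda>x. max 0 (- f x)"
  have pn: "?p \<in> L2 M" "?n \<in> L2 M" by (auto intro!: L2_bounded_by[OF f])
  obtain g where g: "continuous_on UNIV g" "bounded (range g)" "L2_norm M (\<lambda>x. ?p x - g x) < e / 2"
    using L2_approx_continuous_nonneg[OF assms(1-3), of ?p "e/2"] pn e by auto
  obtain h where h: "continuous_on UNIV h" "bounded (range h)" "L2_norm M (\<lambda>x. ?n x - h x) < e / 2"
    using L2_approx_continuous_nonneg[OF assms(1-3), of ?n "e/2"] pn e by auto
  have m[measurable]: "g \<in> borel_measurable M" "h \<in> borel_measurable M"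
    using measurable_compose[OF meas borel_measurable_continuous_onI] g(1) h(1) by blast+
  have L: "g \<in> L2 M" "h \<in> L2 M"
    using g(2) h(2) by (auto simp: bounded_iff intro!: L2_bounded)
  have "L2_norm M (\<lambda>x. f x - (g x - h x)) = L2_norm M (\<lambda>x. (?p x - g x) + (h x - ?n x))"
    by (rule L2_norm_cong) auto
  also have "... < e"
    using L2_norm_triangle[OF L2_diff[OF pn(1) L(1)] L2_diff[OF L(2) pn(2)]] g(3) h(3)
      L2_norm_minus_commute[of M h ?n] by linarith
  finally have "L2_norm M (\<lambda>x. f x - (g x - h x)) < e" .
  moreover have "continuous_on UNIV (\<lambda>x. g x - h x)" using g(1) h(1) by (intro continuous_intros)
  moreover have "bounded (range (\<lambda>x. g x - h x))" using g(2) h(2) by (rule bounded_minus_comp)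
  ultimately show ?thesis using L by (intro that[of "\<lambda>x. g x - h x"]) auto
qed

section \<open>Stationary reversible Markov processes\<close>

locale stationary_reversible_process = prob_space M + mu: prob_space \<mu>
  for M :: "'w measure" and \<mu> :: "'a::euclidean_space measure" +
  fixes X :: "real \<Rightarrow> 'w \<Rightarrow> 'a" and E :: "'a set" and \<kappa> :: "real \<Rightarrow> 'a \<Rightarrow> 'a measure"
  assumes E_borel: "E \<in> sets borel"
    and semigroup: "transition_semigroup E \<kappa>"
    and sets_mu': "sets \<mu> = sets (restrict_space borel E)"
    and markov: "continuous_markov_process M X E \<kappa>"
    and initial: "distr M (restrict_space borel E) (X 0) = \<mu>"
    and invariant: "invariant_measure \<kappa> \<mu>"
    and symmetric: "symmetric_semigroup \<mu> \<kappa>"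
begin

text \<open>The bound is asked on \<open>E\<close> only, since the kernels are uncontrolled at
  starting points off \<open>E\<close>. On this class kernel integrals exist at every point of
  \<open>E\<close>, so semigroup identities hold everywhere there and not merely almost
  everywhere.\<close>

definition Bd :: "('a \<Rightarrow> real) set" where
  "Bd = {f \<in> borel_measurable \<mu>. \<exists>c. \<forall>x\<in>E. \<bar>f x\<bar> \<le> c}"

abbreviation "mean f \<equiv> \<integral>x. f x \<partial>\<mu>"
abbreviation "nrm \<equiv> L2_norm \<mu>"
abbreviation "P \<equiv> P_op \<kappa>"
abbreviation "Filt \<equiv> natural_filtration M X"

lemma space_mu: "space \<mu> = E"
  using sets_eq_imp_space_eq[OF sets_mu'] by (simp add: space_restrict_space)

lemma X_measurable: "0 \<le> t \<Longrightarrow> X t \<in> M \<rightarrow>\<^sub>M \<mu>"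
  using markov unfolding continuous_markov_process_def measurable_cong_sets[OF refl sets_mu'] by blast

lemma X_in_E: "0 \<le> t \<Longrightarrow> w \<in> space M \<Longrightarrow> X t w \<in> E"
  using measurable_space[OF X_measurable] space_mu by auto

lemma id_measurable_mu: "(\<lambda>x. x) \<in> \<mu> \<rightarrow>\<^sub>M borel"
  unfolding measurable_cong_sets[OF sets_mu' refl] by (rule measurable_restrict_space1) simp

lemma X_borel: "0 \<le> t \<Longrightarrow> X t \<in> borel_measurable M"
  using measurable_compose[OF X_measurable id_measurable_mu] .

lemma X_continuous: "w \<in> space M \<Longrightarrow> continuous_on {0..} (\<lambda>t. X t w)"
  using markov unfolding continuous_markov_process_def by blast

lemma measurable_into_mu:
  assumes "f \<in> borel_measurable N" "\<And>x. x \<in> space N \<Longrightarrow> f x \<in> E"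
  shows "f \<in> N \<rightarrow>\<^sub>M \<mu>"
  unfolding measurable_cong_sets[OF refl sets_mu']
  using assms by (intro measurable_restrict_space2) auto

lemma kernel_measurable: "0 \<le> t \<Longrightarrow> \<kappa> t \<in> \<mu> \<rightarrow>\<^sub>M prob_algebra \<mu>"
proof -
  assume "0 \<le> t"
  moreover have "prob_algebra (restrict_space borel E) = prob_algebra \<mu>"
    unfolding prob_algebra_def using subprob_algebra_cong[OF sets_mu'[symmetric]] by simp
  ultimately show ?thesis
    using semigroup unfolding transition_semigroup_def measurable_cong_sets[OF sets_mu' refl] by auto
qed

lemma kernel_subprob: "0 \<le> t \<Longrightarrow> \<kappa> t \<in> \<mu> \<rightarrow>\<^sub>M subprob_algebra \<mu>"
  by (rule measurable_prob_algebraD[OF kernel_measurable])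

lemma kernel_prob: "0 \<le> t \<Longrightarrow> x \<in> E \<Longrightarrow> prob_space (\<kappa> t x)"
  using measurable_space[OF kernel_measurable, of t x] by (simp add: space_mu space_prob_algebra)

lemma sets_kernel: "0 \<le> t \<Longrightarrow> x \<in> E \<Longrightarrow> sets (\<kappa> t x) = sets \<mu>"
  using measurable_space[OF kernel_measurable, of t x] by (simp add: space_mu space_prob_algebra)

lemma space_kernel: "0 \<le> t \<Longrightarrow> x \<in> E \<Longrightarrow> space (\<kappa> t x) = E"
  using sets_eq_imp_space_eq[OF sets_kernel] space_mu by auto

lemma measurable_kernel_iff: "0 \<le> t \<Longrightarrow> x \<in> E \<Longrightarrow> f \<in> borel_measurable (\<kappa> t x) \<longleftrightarrow> f \<in> borel_measurable \<mu>"
  using measurable_cong_sets[OF sets_kernel refl] by blast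

lemma BdI: "f \<in> borel_measurable \<mu> \<Longrightarrow> (\<And>x. x \<in> E \<Longrightarrow> \<bar>f x\<bar> \<le> c) \<Longrightarrow> f \<in> Bd"
  unfolding Bd_def by blast

lemma BdE:
  assumes "f \<in> Bd"
  obtains c where "0 \<le> c" "\<And>x. x \<in> E \<Longrightarrow> \<bar>f x\<bar> \<le> c"
proof -
  from assms obtain c where "\<And>x. x \<in> E \<Longrightarrow> \<bar>f x\<bar> \<le> c" unfolding Bd_def by blast
  then show ?thesis using that[of "max 0 c"] by (auto simp: le_max_iff_disj)
qed

lemma Bd_measurable [measurable_dest]: "f \<in> Bd \<Longrightarrow> f \<in> borel_measurable \<mu>"
  by (simp add: Bd_def)

lemma Bd_L2: "f \<in> Bd \<Longrightarrow> f \<in> L2 \<mu>"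
  using mu.L2_bounded[of f] BdE[of f] Bd_measurable[of f] by (metis space_mu)

lemma Bd_integrable: "f \<in> Bd \<Longrightarrow> integrable \<mu> f"
  by (intro mu.L2_integrable Bd_L2)

lemma Bd_const [simp, intro]: "(\<lambda>_. c) \<in> Bd"
  by (rule BdI[of _ "\<bar>c\<bar>"]) auto

lemma Bd_mult [intro]: "f \<in> Bd \<Longrightarrow> g \<in> Bd \<Longrightarrow> (\<lambda>x. f x * g x) \<in> Bd"
proof -
  assume fg: "f \<in> Bd" "g \<in> Bd"
  obtain c d where "0 \<le> c" "\<And>x. x \<in> E \<Longrightarrow> \<bar>f x\<bar> \<le> c" "0 \<le> d" "\<And>x. x \<in> E \<Longrightarrow> \<bar>g x\<bar> \<le> d"
    using fg BdE by metis
  then have "\<bar>f x * g x\<bar> \<le> c * d" if "x \<in> E" for x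
    using that by (auto simp: abs_mult intro!: mult_mono)
  then show ?thesis using fg by (intro BdI[where c = "c * d"]) (auto simp: Bd_measurable)
qed

lemma Bd_add [intro]: "f \<in> Bd \<Longrightarrow> g \<in> Bd \<Longrightarrow> (\<lambda>x. f x + g x) \<in> Bd"
proof -
  assume fg: "f \<in> Bd" "g \<in> Bd"
  obtain c d where cd: "\<And>x. x \<in> E \<Longrightarrow> \<bar>f x\<bar> \<le> c" "\<And>x. x \<in> E \<Longrightarrow> \<bar>g x\<bar> \<le> d"
    using fg BdE by metis
  have "\<bar>f x + g x\<bar> \<le> c + d" if "x \<in> E" for x
    using cd[OF that] by linarith
  then show ?thesis using fg by (intro BdI[where c = "c + d"]) (auto simp: Bd_measurable)
qed

lemma Bd_cmult [intro]: "f \<in> Bd \<Longrightarrow> (\<lambda>x. c * f x) \<in> Bd"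
  using Bd_mult[OF Bd_const] .

lemma Bd_diff [intro]: "f \<in> Bd \<Longrightarrow> g \<in> Bd \<Longrightarrow> (\<lambda>x. f x - g x) \<in> Bd"
  using Bd_add[OF _ Bd_cmult[of g "-1"]] by simp

lemma Bd_divide [intro]: "f \<in> Bd \<Longrightarrow> (\<lambda>x. f x / c) \<in> Bd"
  using Bd_cmult[of f "1/c"] by (simp add: divide_inverse mult.commute)

lemma P_abs_le:
  assumes "0 \<le> t" "f \<in> Bd" "x \<in> E" "\<And>x. x \<in> E \<Longrightarrow> \<bar>f x\<bar> \<le> c"
  shows "\<bar>P t f x\<bar> \<le> c"
proof -
  interpret k: prob_space "\<kappa> t x" using assms by (intro kernel_prob)
  have c: "0 \<le> c" using assms(3,4) by (meson abs_ge_zero order_trans)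
  have "f \<in> L2 (\<kappa> t x)" using assms c
    by (intro k.L2_bounded) (auto simp: measurable_kernel_iff space_kernel Bd_measurable)
  from k.L2_norm_ge_integral[OF this] k.L2_norm_bounded[of f c] show ?thesis
    using assms c by (auto simp: P_op_def measurable_kernel_iff space_kernel Bd_measurable)
qed

lemma kernel_integrable: "0 \<le> t \<Longrightarrow> x \<in> E \<Longrightarrow> f \<in> Bd \<Longrightarrow> integrable (\<kappa> t x) f"
proof -
  assume a: "0 \<le> t" "x \<in> E" "f \<in> Bd"
  interpret k: prob_space "\<kappa> t x" using a by (intro kernel_prob)
  from \<open>f \<in> Bd\<close> obtain c where "\<And>x. x \<in> E \<Longrightarrow> \<bar>f x\<bar> \<le> c" using BdE by metis
  then show ?thesis using a
    by (intro k.L2_integrable k.L2_bounded[where c = c])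
      (auto simp: measurable_kernel_iff space_kernel Bd_measurable)
qed

lemma P_measurable: "0 \<le> t \<Longrightarrow> f \<in> borel_measurable \<mu> \<Longrightarrow> P t f \<in> borel_measurable \<mu>"
  unfolding P_op_def using measurable_compose[OF kernel_subprob integral_measurable_subprob_algebra, of t f] by simp

lemma P_Bd [intro]: "0 \<le> t \<Longrightarrow> f \<in> Bd \<Longrightarrow> P t f \<in> Bd"
  using BdE[of f] by (metis BdI P_measurable P_abs_le Bd_measurable)

lemma P_add: "0 \<le> t \<Longrightarrow> f \<in> Bd \<Longrightarrow> g \<in> Bd \<Longrightarrow> x \<in> E \<Longrightarrow> P t (\<lambda>x. f x + g x) x = P t f x + P t g x"
  unfolding P_op_def by (intro Bochner_Integration.integral_add kernel_integrable)

lemma P_diff: "0 \<le> t \<Longrightarrow> f \<in> Bd \<Longrightarrow> g \<in> Bd \<Longrightarrow> x \<in> E \<Longrightarrow> P t (\<lambda>x. f x - g x) x = P t f x - P t g x"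
  unfolding P_op_def by (intro Bochner_Integration.integral_diff kernel_integrable)

lemma P_divide: "P t (\<lambda>x. f x / c) x = P t f x / c"
  unfolding P_op_def by simp

lemma P_const: "0 \<le> t \<Longrightarrow> x \<in> E \<Longrightarrow> P t (\<lambda>_. c) x = c"
  unfolding P_op_def using prob_space.prob_space[OF kernel_prob] by simp

lemma P_nn:
  assumes "0 \<le> t" "f \<in> Bd" "\<And>x. x \<in> E \<Longrightarrow> 0 \<le> f x" "x \<in> E"
  shows "(\<integral>\<^sup>+y. ennreal (f y) \<partial>\<kappa> t x) = ennreal (P t f x)"
  unfolding P_op_def using assms
  by (intro nn_integral_eq_integral kernel_integrable) (auto intro!: AE_I2 simp: space_kernel)

lemma P_nonneg:
  assumes "0 \<le> t" "f \<in> Bd" "\<And>x. x \<in> E \<Longrightarrow> 0 \<le> f x" "x \<in> E"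
  shows "0 \<le> P t f x"
  unfolding P_op_def using assms
  by (intro integral_nonneg_AE) (auto intro!: AE_I2 simp: space_kernel)

text \<open>For nonnegative functions this is integration against a \<open>bind\<close>; a bounded
  function becomes nonnegative after adding a constant, which the semigroup preserves.\<close>

lemma P_semigroup:
  assumes "0 \<le> s" "0 \<le> t" "f \<in> Bd" "x \<in> E"
  shows "P (s + t) f x = P s (P t f) x"
proof -
  have *: "P (s + t) f x = P s (P t f) x" if f: "f \<in> Bd" "\<And>x. x \<in> E \<Longrightarrow> 0 \<le> f x" for f
  proof -
    have "ennreal (P (s + t) f x) = (\<integral>\<^sup>+y. ennreal (f y) \<partial>\<kappa> (s + t) x)"
      using P_nn[of "s + t" f x] f assms by simp
    also have "\<kappa> (s + t) x = \<kappa> s x \<bind> \<kappa> t"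
      using semigroup assms unfolding transition_semigroup_def by auto
    also have "(\<integral>\<^sup>+y. ennreal (f y) \<partial>(\<kappa> s x \<bind> \<kappa> t)) = (\<integral>\<^sup>+y. \<integral>\<^sup>+z. ennreal (f z) \<partial>\<kappa> t y \<partial>\<kappa> s x)"
      using f assms Bd_measurable[OF f(1)] kernel_subprob[of t]
      by (intro nn_integral_bind[where B = \<mu>])
        (auto simp: measurable_cong_sets[OF sets_kernel[OF assms(1,4)] refl])
    also have "... = (\<integral>\<^sup>+y. ennreal (P t f y) \<partial>\<kappa> s x)"
      using assms f by (intro nn_integral_cong) (simp add: P_nn space_kernel)
    also have "... = ennreal (P s (P t f) x)"
      using assms f by (intro P_nn P_Bd P_nonneg) auto
    finally have "ennreal (P (s + t) f x) = ennreal (P s (P t f) x)" .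
    then show ?thesis using assms f P_nonneg[of "s+t" f x] P_nonneg[of s "P t f" x]
      by (subst (asm) ennreal_inj) (auto intro!: P_nonneg)
  qed
  from \<open>f \<in> Bd\<close> obtain c where c: "\<And>x. x \<in> E \<Longrightarrow> \<bar>f x\<bar> \<le> c" using BdE by metis
  have nn: "0 \<le> f x + c" if "x \<in> E" for x using c[OF that] by linarith
  have "P (s + t) (\<lambda>x. f x + c) x = P s (P t (\<lambda>x. f x + c)) x"
    using nn assms by (intro *) auto
  also have "... = P s (\<lambda>x. P t f x + c) x"
    unfolding P_op_def[of \<kappa> s] using assms
    by (intro lint_cong refl) (simp add: space_kernel P_add P_const)
  also have "... = P s (P t f) x + c"
    using assms by (simp add: P_add P_const P_Bd)
  also have "P (s + t) (\<lambda>x. f x + c) x = P (s + t) f x + c"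
    using assms by (simp add: P_add P_const)
  finally show ?thesis by simp
qed

section \<open>The Markov property for functions, and stationarity\<close>

lemma subalgebra_Filt: "subalgebra M (Filt s)"
proof -
  have "X u -` B \<inter> space M \<in> sets M" if "0 \<le> u" "B \<in> sets borel" for u B
    using measurable_sets[OF X_borel[OF that(1)] that(2)] .
  then have sub: "{X u -` B \<inter> space M | u B. 0 \<le> u \<and> u \<le> s \<and> B \<in> sets borel} \<subseteq> sets M" by blast
  have "{X u -` B \<inter> space M | u B. 0 \<le> u \<and> u \<le> s \<and> B \<in> sets borel} \<subseteq> Pow (space M)" by blast
  then show ?thesis
    unfolding subalgebra_def natural_filtration_def using sets.sigma_sets_subset[OF sub] by simp
qed

lemma space_Filt: "space (Filt s) = space M"
  using subalgebra_Filt by (simp add: subalgebra_def)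

lemma Filt_measurable: "f \<in> Filt s \<rightarrow>\<^sub>M N \<Longrightarrow> f \<in> M \<rightarrow>\<^sub>M N"
  using measurable_from_subalg[OF subalgebra_Filt] .

lemma X_Filt: "0 \<le> u \<Longrightarrow> u \<le> s \<Longrightarrow> X u \<in> Filt s \<rightarrow>\<^sub>M \<mu>"
proof (rule measurable_into_mu)
  assume u: "0 \<le> u" "u \<le> s"
  show "X u \<in> borel_measurable (Filt s)"
  proof (rule measurableI)
    fix B :: "'a set" assume "B \<in> sets borel"
    then have "X u -` B \<inter> space M \<in> {X u -` B \<inter> space M | u B. 0 \<le> u \<and> u \<le> s \<and> B \<in> sets borel}"
      using u by blast
    then show "X u -` B \<inter> space (Filt s) \<in> sets (Filt s)"
      unfolding space_Filt unfolding natural_filtration_def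
      by (subst sets_measure_of) (auto intro: sigma_sets.Basic)
  qed simp
qed (auto simp: space_Filt X_in_E)

text \<open>Induction over \<open>g\<close>; for an indicator the claim is the assumed formula for
  the conditional probability, integrated against the weight \<open>Z\<close>, which is measurable
  with respect to the past.\<close>

lemma markov_nn:
  assumes s: "0 \<le> s" and t: "0 \<le> t" and Z[measurable]: "Z \<in> borel_measurable (Filt s)"
    and g: "g \<in> borel_measurable \<mu>"
  shows "(\<integral>\<^sup>+w. Z w * g (X (s + t) w) \<partial>M) = (\<integral>\<^sup>+w. Z w * (\<integral>\<^sup>+y. g y \<partial>\<kappa> t (X s w)) \<partial>M)"
proof -
  interpret F: finite_measure_subalgebra M "Filt s"
    by unfold_locales (use subalgebra_Filt in auto)
  have Zm[measurable]: "Z \<in> borel_measurable M" using Z by (rule Filt_measurable)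
  have Xm[measurable]: "X s \<in> M \<rightarrow>\<^sub>M \<mu>" "X (s + t) \<in> M \<rightarrow>\<^sub>M \<mu>" using s t by (auto intro: X_measurable)
  have km[measurable]: "\<kappa> t \<in> \<mu> \<rightarrow>\<^sub>M subprob_algebra \<mu>" using t by (rule kernel_subprob)
  show ?thesis
    using g
  proof (induction rule: borel_measurable_induct)
    case (cong f g)
    have "(\<integral>\<^sup>+w. Z w * f (X (s + t) w) \<partial>M) = (\<integral>\<^sup>+w. Z w * g (X (s + t) w) \<partial>M)"
      using cong s t by (intro nn_integral_cong) (auto simp: X_in_E space_mu)
    moreover have "(\<integral>\<^sup>+y. f y \<partial>\<kappa> t (X s w)) = (\<integral>\<^sup>+y. g y \<partial>\<kappa> t (X s w))" if "w \<in> space M" for w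
      using cong s t that by (intro nn_integral_cong) (auto simp: X_in_E space_mu space_kernel)
    ultimately show ?case using cong by (simp cong: nn_integral_cong_simp)
  next
    case (set B)
    have cexp: "AE w in M. real_cond_exp M (Filt s) (\<lambda>w. indicator B (X (s + t) w)) w = measure (\<kappa> t (X s w)) B"
      using markov set s t unfolding continuous_markov_process_def sets_mu' by blast
    have "AE w in M. nn_cond_exp M (Filt s) (\<lambda>w. indicator B (X (s + t) w)) w = emeasure (\<kappa> t (X s w)) B"
    proof -
      \<comment> \<open>\<open>real_cond_exp\<close> is a difference of \<open>enn2real\<close>
        values. The bound by 1 excludes \<open>top\<close>, which \<open>enn2real\<close> would send
        to 0, and the negative part vanishes; so the real formula can be read back in
        \<open>ennreal\<close>.\<close>
      have nn1: "AE w in M. nn_cond_exp M (Filt s) (\<lambda>w. indicator B (X (s + t) w)) w \<le> 1"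
      proof -
        have "AE w in M. nn_cond_exp M (Filt s) (\<lambda>w. indicator B (X (s + t) w)) w \<le> nn_cond_exp M (Filt s) (\<lambda>_. 1) w"
          using set by (intro F.nn_cond_exp_mono) (auto simp: indicator_def)
        moreover have "AE w in M. 1 = nn_cond_exp M (Filt s) (\<lambda>_. 1) w"
          by (intro F.nn_cond_exp_F_meas) auto
        ultimately show ?thesis by eventually_elim auto
      qed
      have z: "AE w in M. 0 = nn_cond_exp M (Filt s) (\<lambda>_. 0) w"
        by (intro F.nn_cond_exp_F_meas) auto
      have eq1: "(\<lambda>w. ennreal (indicator B (X (s + t) w))) = (\<lambda>w. indicator B (X (s + t) w))"
        by (auto simp: indicator_def)
      have eq2: "(\<lambda>w. ennreal (- indicator B (X (s + t) w))) = (\<lambda>_. 0)"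
        by (auto simp: indicator_def ennreal_neg)
      show ?thesis
        using nn1 z cexp AE_space
      proof (eventually_elim)
        fix w assume h: "nn_cond_exp M (Filt s) (\<lambda>w. indicator B (X (s + t) w)) w \<le> 1"
          "0 = nn_cond_exp M (Filt s) (\<lambda>_. 0) w"
          "real_cond_exp M (Filt s) (\<lambda>w. indicator B (X (s + t) w)) w = measure (\<kappa> t (X s w)) B"
        assume "w \<in> space M"
        then interpret k: prob_space "\<kappa> t (X s w)" using s t by (intro kernel_prob X_in_E)
        have "enn2real (nn_cond_exp M (Filt s) (\<lambda>w. indicator B (X (s + t) w)) w) = measure (\<kappa> t (X s w)) B"
          using h(3) h(2) unfolding real_cond_exp_def eq1 eq2 by simp
        moreover have "emeasure (\<kappa> t (X s w)) B \<noteq> top" by simp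
        moreover have "nn_cond_exp M (Filt s) (\<lambda>w. indicator B (X (s + t) w)) w < top"
          using h(1) by (rule le_less_trans) simp
        ultimately show "nn_cond_exp M (Filt s) (\<lambda>w. indicator B (X (s + t) w)) w = emeasure (\<kappa> t (X s w)) B"
          unfolding measure_def by (metis ennreal_enn2real less_top)
      qed
    qed
    then have "(\<integral>\<^sup>+w. Z w * emeasure (\<kappa> t (X s w)) B \<partial>M) =
        (\<integral>\<^sup>+w. Z w * nn_cond_exp M (Filt s) (\<lambda>w. indicator B (X (s + t) w)) w \<partial>M)"
      by (intro nn_integral_cong_AE) auto
    also have "... = (\<integral>\<^sup>+w. Z w * indicator B (X (s + t) w) \<partial>M)"
      using set by (intro F.nn_cond_exp_intg) auto
    moreover have "(\<integral>\<^sup>+w. Z w * (\<integral>\<^sup>+y. indicator B y \<partial>\<kappa> t (X s w)) \<partial>M) = (\<integral>\<^sup>+w. Z w * emeasure (\<kappa> t (X s w)) B \<partial>M)"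
      using set s t by (intro nn_integral_cong) (auto simp: X_in_E sets_kernel)
    ultimately show ?case by simp
  next
    case (mult u c)
    have "(\<integral>\<^sup>+y. c * u y \<partial>\<kappa> t (X s w)) = c * (\<integral>\<^sup>+y. u y \<partial>\<kappa> t (X s w))" if "w \<in> space M" for w
      using mult s t that by (intro nn_integral_cmult) (auto simp: measurable_cong_sets[OF sets_kernel refl] X_in_E)
    then have "(\<integral>\<^sup>+w. Z w * (\<integral>\<^sup>+y. c * u y \<partial>\<kappa> t (X s w)) \<partial>M) = (\<integral>\<^sup>+w. c * (Z w * (\<integral>\<^sup>+y. u y \<partial>\<kappa> t (X s w))) \<partial>M)"
      by (intro nn_integral_cong) (simp add: ac_simps)
    also have "... = c * (\<integral>\<^sup>+w. Z w * (\<integral>\<^sup>+y. u y \<partial>\<kappa> t (X s w)) \<partial>M)"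
      using mult by (intro nn_integral_cmult) (auto intro!: borel_measurable_times_ennreal
        measurable_compose[OF Xm(1)] nn_integral_measurable_subprob_algebra2[OF _ km] measurable_compose[OF measurable_snd])
    also have "... = c * (\<integral>\<^sup>+w. Z w * u (X (s + t) w) \<partial>M)" using mult by simp
    also have "... = (\<integral>\<^sup>+w. c * (Z w * u (X (s + t) w)) \<partial>M)"
      using mult by (intro nn_integral_cmult[symmetric]) auto
    finally show ?case by (simp add: ac_simps)
  next
    case (add u v)
    have "(\<integral>\<^sup>+y. u y + v y \<partial>\<kappa> t (X s w)) = (\<integral>\<^sup>+y. u y \<partial>\<kappa> t (X s w)) + (\<integral>\<^sup>+y. v y \<partial>\<kappa> t (X s w))"
      if "w \<in> space M" for w
      using add s t that by (intro nn_integral_add) (auto simp: measurable_cong_sets[OF sets_kernel refl] X_in_E)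
    then have "(\<integral>\<^sup>+w. Z w * (\<integral>\<^sup>+y. u y + v y \<partial>\<kappa> t (X s w)) \<partial>M) =
        (\<integral>\<^sup>+w. Z w * (\<integral>\<^sup>+y. u y \<partial>\<kappa> t (X s w)) + Z w * (\<integral>\<^sup>+y. v y \<partial>\<kappa> t (X s w)) \<partial>M)"
      by (intro nn_integral_cong) (simp add: distrib_left)
    also have "... = (\<integral>\<^sup>+w. Z w * (\<integral>\<^sup>+y. u y \<partial>\<kappa> t (X s w)) \<partial>M) + (\<integral>\<^sup>+w. Z w * (\<integral>\<^sup>+y. v y \<partial>\<kappa> t (X s w)) \<partial>M)"
      using add by (intro nn_integral_add) (auto intro!: borel_measurable_times_ennreal
        measurable_compose[OF Xm(1)] nn_integral_measurable_subprob_algebra2[OF _ km] measurable_compose[OF measurable_snd])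
    also have "... = (\<integral>\<^sup>+w. Z w * u (X (s + t) w) \<partial>M) + (\<integral>\<^sup>+w. Z w * v (X (s + t) w) \<partial>M)"
      using add by simp
    also have "... = (\<integral>\<^sup>+w. Z w * u (X (s + t) w) + Z w * v (X (s + t) w) \<partial>M)"
      using add by (intro nn_integral_add[symmetric]) auto
    finally show ?case by (simp add: distrib_left add.commute)
  next
    case (seq U)
    have mU: "(\<lambda>w. \<integral>\<^sup>+y. U i y \<partial>\<kappa> t (X s w)) \<in> borel_measurable M" for i
      using seq by (auto intro!: measurable_compose[OF Xm(1)] nn_integral_measurable_subprob_algebra2[OF _ km]
          measurable_compose[OF measurable_snd])
    have "(\<integral>\<^sup>+y. (SUP i. U i) y \<partial>\<kappa> t (X s w)) = (SUP i. \<integral>\<^sup>+y. U i y \<partial>\<kappa> t (X s w))" if "w \<in> space M" for w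
      using seq s t that unfolding SUP_apply
      by (intro nn_integral_monotone_convergence_SUP) (auto simp: measurable_cong_sets[OF sets_kernel refl] X_in_E)
    then have "(\<integral>\<^sup>+w. Z w * (\<integral>\<^sup>+y. (SUP i. U i) y \<partial>\<kappa> t (X s w)) \<partial>M) =
        (\<integral>\<^sup>+w. (SUP i. Z w * (\<integral>\<^sup>+y. U i y \<partial>\<kappa> t (X s w))) \<partial>M)"
      by (intro nn_integral_cong) (simp add: SUP_mult_left_ennreal)
    also have "... = (SUP i. \<integral>\<^sup>+w. Z w * (\<integral>\<^sup>+y. U i y \<partial>\<kappa> t (X s w)) \<partial>M)"
      using mU seq by (intro nn_integral_monotone_convergence_SUP)
        (auto simp: incseq_def le_fun_def intro!: mult_left_mono nn_integral_mono)
    also have "... = (SUP i. \<integral>\<^sup>+w. Z w * U i (X (s + t) w) \<partial>M)" using seq by simp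
    also have "... = (\<integral>\<^sup>+w. (SUP i. Z w * U i (X (s + t) w)) \<partial>M)"
      using seq by (intro nn_integral_monotone_convergence_SUP[symmetric])
        (auto simp: incseq_def le_fun_def intro!: mult_left_mono)
    finally show ?case by (simp only: SUP_mult_left_ennreal SUP_apply)
  qed
qed


lemma markov_nonneg:
  assumes s: "0 \<le> s" and t: "0 \<le> t" and Z: "Z \<in> borel_measurable (Filt s)"
    and Zb: "\<And>w. w \<in> space M \<Longrightarrow> 0 \<le> Z w \<and> Z w \<le> c"
    and g: "g \<in> Bd" "\<And>x. x \<in> E \<Longrightarrow> 0 \<le> g x"
  shows "(\<integral>w. Z w * g (X (s + t) w) \<partial>M) = (\<integral>w. Z w * P t g (X s w) \<partial>M)"
proof -
  have Zm[measurable]: "Z \<in> borel_measurable M" using Z by (rule Filt_measurable)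
  have Xm[measurable]: "X s \<in> M \<rightarrow>\<^sub>M \<mu>" "X (s + t) \<in> M \<rightarrow>\<^sub>M \<mu>" using s t by (auto intro: X_measurable)
  have gm[measurable]: "g \<in> borel_measurable \<mu>" "P t g \<in> borel_measurable \<mu>"
    using g t P_Bd by (auto intro: Bd_measurable)
  have "(\<integral>w. Z w * g (X (s + t) w) \<partial>M) = enn2real (\<integral>\<^sup>+w. ennreal (Z w) * ennreal (g (X (s + t) w)) \<partial>M)"
    using Zb g s t by (subst integral_eq_nn_integral)
      (auto intro!: AE_I2 arg_cong[where f = enn2real] nn_integral_cong simp: X_in_E ennreal_mult)
  also have "(\<integral>\<^sup>+w. ennreal (Z w) * ennreal (g (X (s + t) w)) \<partial>M) =
      (\<integral>\<^sup>+w. ennreal (Z w) * (\<integral>\<^sup>+y. ennreal (g y) \<partial>\<kappa> t (X s w)) \<partial>M)"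
    using s t Z by (intro markov_nn) auto
  also have "... = (\<integral>\<^sup>+w. ennreal (Z w) * ennreal (P t g (X s w)) \<partial>M)"
    using s t g by (intro nn_integral_cong) (simp add: P_nn X_in_E)
  also have "enn2real ... = (\<integral>w. Z w * P t g (X s w) \<partial>M)"
    using Zb g s t by (subst integral_eq_nn_integral)
      (auto intro!: AE_I2 arg_cong[where f = enn2real] nn_integral_cong simp: X_in_E ennreal_mult P_nonneg)
  finally show ?thesis .
qed

lemma Bd_X_bounded:
  assumes "0 \<le> t" "g \<in> Bd"
  obtains c where "\<And>w. w \<in> space M \<Longrightarrow> \<bar>g (X t w)\<bar> \<le> c"
  using BdE[OF assms(2)] X_in_E[OF assms(1)] by metis

lemma integrable_bounded_mult_Bd:
  assumes t: "0 \<le> t" and Z[measurable]: "Z \<in> borel_measurable M"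
    and Zb: "\<And>w. w \<in> space M \<Longrightarrow> \<bar>Z w\<bar> \<le> c" and g: "g \<in> Bd"
  shows "integrable M (\<lambda>w. Z w * g (X t w))"
proof -
  have [measurable]: "X t \<in> M \<rightarrow>\<^sub>M \<mu>" "g \<in> borel_measurable \<mu>" using t g by (auto intro: X_measurable Bd_measurable)
  obtain d where d: "\<And>w. w \<in> space M \<Longrightarrow> \<bar>g (X t w)\<bar> \<le> d" using Bd_X_bounded[OF t g] by blast
  show ?thesis
    using Zb d by (intro L2_integrable_mult L2_bounded[where c = c] L2_bounded[where c = d]) auto
qed

lemma integrable_Bd_X: "0 \<le> t \<Longrightarrow> g \<in> Bd \<Longrightarrow> integrable M (\<lambda>w. g (X t w))"
  using integrable_bounded_mult_Bd[of t "\<lambda>_. 1" 1 g] by simp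

lemma markov_shift:
  assumes s: "0 \<le> s" and t: "0 \<le> t" and Z: "Z \<in> borel_measurable (Filt s)"
    and Zb: "\<And>w. w \<in> space M \<Longrightarrow> 0 \<le> Z w \<and> Z w \<le> c" and g: "g \<in> Bd"
  shows "(\<integral>w. Z w * g (X (s + t) w) \<partial>M) = (\<integral>w. Z w * P t g (X s w) \<partial>M)"
proof -
  have Zm: "Z \<in> borel_measurable M" using Z by (rule Filt_measurable)
  have Zb': "\<And>w. w \<in> space M \<Longrightarrow> \<bar>Z w\<bar> \<le> c" using Zb by (simp add: abs_of_nonneg)
  note int = integrable_bounded_mult_Bd[OF _ Zm Zb']
  obtain d where d: "\<And>x. x \<in> E \<Longrightarrow> \<bar>g x\<bar> \<le> d" using BdE[OF g] by metis
  have nn: "0 \<le> g x + d" if "x \<in> E" for x using d[OF that] by linarith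
  have "(\<integral>w. Z w * (g (X (s + t) w) + d) \<partial>M) = (\<integral>w. Z w * P t (\<lambda>x. g x + d) (X s w) \<partial>M)"
    using nn g by (intro markov_nonneg[OF s t Z Zb]) auto
  also have "... = (\<integral>w. Z w * (P t g (X s w) + d) \<partial>M)"
    using s t g by (intro lint_cong refl) (simp add: P_add P_const X_in_E)
  also have "... = (\<integral>w. Z w * P t g (X s w) \<partial>M) + (\<integral>w. Z w * d \<partial>M)"
    unfolding distrib_left using s t g int[of s "P t g"] int[of s "\<lambda>_. d"] by (intro Bochner_Integration.integral_add) auto
  also have "(\<integral>w. Z w * (g (X (s + t) w) + d) \<partial>M) = (\<integral>w. Z w * g (X (s + t) w) \<partial>M) + (\<integral>w. Z w * d \<partial>M)"
    unfolding distrib_left using s t g int[of "s + t" g] int[of s "\<lambda>_. d"] by (intro Bochner_Integration.integral_add) auto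
  finally show ?thesis by simp
qed

text \<open>Constants are added to make both factors nonnegative: \<open>markov_shift\<close> treats
  \<open>g\<close>, the present step treats \<open>Z\<close>.\<close>

lemma markov_property:
  assumes s: "0 \<le> s" and t: "0 \<le> t" and Z: "Z \<in> borel_measurable (Filt s)"
    and Zb: "\<And>w. w \<in> space M \<Longrightarrow> \<bar>Z w\<bar> \<le> c" and g: "g \<in> Bd"
  shows "(\<integral>w. Z w * g (X (s + t) w) \<partial>M) = (\<integral>w. Z w * P t g (X s w) \<partial>M)"
proof -
  have Zm: "Z \<in> borel_measurable M" using Z by (rule Filt_measurable)
  note int = integrable_bounded_mult_Bd[OF _ Zm Zb]
  note intc = integrable_bounded_mult_Bd[of _ "\<lambda>_. c" "\<bar>c\<bar>", simplified]
  have "(\<integral>w. (Z w + c) * g (X (s + t) w) \<partial>M) = (\<integral>w. (Z w + c) * P t g (X s w) \<partial>M)"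
  proof (rule markov_shift[OF s t _ _ g])
    show "0 \<le> Z w + c \<and> Z w + c \<le> 2 * c" if "w \<in> space M" for w
      using Zb[OF that] by linarith
  qed (use Z in simp)
  moreover have "(\<integral>w. c * g (X (s + t) w) \<partial>M) = (\<integral>w. c * P t g (X s w) \<partial>M)"
    using markov_shift[OF s t, of "\<lambda>_. 1" 1 g] g by simp
  moreover have "(\<integral>w. (Z w + c) * g (X (s + t) w) \<partial>M) = (\<integral>w. Z w * g (X (s + t) w) \<partial>M) + (\<integral>w. c * g (X (s + t) w) \<partial>M)"
    unfolding distrib_right using s t g int[of "s + t" g] integrable_bounded_mult_Bd[of "s + t" "\<lambda>_. c" "\<bar>c\<bar>" g]
    by (intro Bochner_Integration.integral_add) auto
  moreover have "(\<integral>w. (Z w + c) * P t g (X s w) \<partial>M) = (\<integral>w. Z w * P t g (X s w) \<partial>M) + (\<integral>w. c * P t g (X s w) \<partial>M)"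
    unfolding distrib_right using s t g int[of s "P t g"] integrable_bounded_mult_Bd[of s "\<lambda>_. c" "\<bar>c\<bar>" "P t g"]
    by (intro Bochner_Integration.integral_add) auto
  ultimately show ?thesis by auto
qed

text \<open>The Markov property at time 0 writes the law of \<open>X t\<close> as the bind of the
  initial law with \<open>\<kappa> t\<close>, and \<mu> is both initial and invariant.\<close>

lemma distr_X:
  assumes t: "0 \<le> t"
  shows "distr M \<mu> (X t) = \<mu>"
proof -
  have *: "distr M (restrict_space borel E) (X 0) = distr M \<mu> (X 0)"
    by (rule distr_cong) (auto simp: sets_mu')
  show ?thesis
  proof (rule measure_eqI)
    fix B assume "B \<in> sets (distr M \<mu> (X t))"
    then have B: "B \<in> sets \<mu>" by simp
    have "emeasure (distr M \<mu> (X t)) B = (\<integral>\<^sup>+y. indicator B y \<partial>distr M \<mu> (X t))" using B by simp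
    also have "... = (\<integral>\<^sup>+w. 1 * indicator B (X (0 + t) w) \<partial>M)"
      using B t by (subst nn_integral_distr) (auto intro: X_measurable)
    also have "... = (\<integral>\<^sup>+w. 1 * (\<integral>\<^sup>+y. indicator B y \<partial>\<kappa> t (X 0 w)) \<partial>M)"
      using B t by (intro markov_nn) auto
    also have "... = (\<integral>\<^sup>+w. emeasure (\<kappa> t (X 0 w)) B \<partial>M)"
      using B t by (intro nn_integral_cong) (simp add: sets_kernel X_in_E)
    also have "... = (\<integral>\<^sup>+x. emeasure (\<kappa> t x) B \<partial>distr M \<mu> (X 0))"
      using B t by (subst nn_integral_distr)
        (auto intro!: X_measurable measurable_compose[OF kernel_subprob measurable_emeasure_subprob_algebra])
    also have "... = (\<integral>\<^sup>+x. emeasure (\<kappa> t x) B \<partial>\<mu>)"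
      using initial * by simp
    also have "... = emeasure (\<mu> \<bind> \<kappa> t) B"
      using B t mu.not_empty by (subst emeasure_bind[OF _ kernel_subprob]) auto
    finally show "emeasure (distr M \<mu> (X t)) B = emeasure \<mu> B"
      using invariant t by (simp add: invariant_measure_def)
  qed simp
qed

lemma integral_X:
  fixes f :: "'a \<Rightarrow> real"
  assumes "0 \<le> t" "f \<in> borel_measurable \<mu>"
  shows "(\<integral>w. f (X t w) \<partial>M) = mean f"
  using integral_distr[OF X_measurable[OF assms(1)] assms(2)] distr_X[OF assms(1)] by simp

lemma nn_integral_X:
  assumes "0 \<le> t" "f \<in> borel_measurable \<mu>"
  shows "(\<integral>\<^sup>+w. f (X t w) \<partial>M) = (\<integral>\<^sup>+x. f x \<partial>\<mu>)"
  using nn_integral_distr[OF X_measurable[OF assms(1)], of f] distr_X[OF assms(1)] assms by simp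

lemma integrable_X:
  fixes f :: "'a \<Rightarrow> real"
  assumes "0 \<le> t" "integrable \<mu> f"
  shows "integrable M (\<lambda>w. f (X t w))"
  using integrable_distr[OF X_measurable[OF assms(1)], of f] distr_X[OF assms(1)] assms by simp

lemma L2_X: "0 \<le> t \<Longrightarrow> f \<in> L2 \<mu> \<Longrightarrow> (\<lambda>w. f (X t w)) \<in> L2 M"
  using integrable_X[of t "\<lambda>x. (f x)^2"] measurable_compose[OF X_measurable, of t f]
  by (auto simp: L2_def)

lemma L2_norm_X: "0 \<le> t \<Longrightarrow> f \<in> borel_measurable \<mu> \<Longrightarrow> L2_norm M (\<lambda>w. f (X t w)) = nrm f"
  unfolding L2_norm_def by (subst integral_X[of t "\<lambda>x. (f x)^2"]) auto

lemma correlation: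
  assumes "0 \<le> s" "0 \<le> t" "f \<in> Bd" "g \<in> Bd"
  shows "(\<integral>w. g (X s w) * f (X (s + t) w) \<partial>M) = mean (\<lambda>x. g x * P t f x)"
proof -
  obtain c where c: "\<And>w. w \<in> space M \<Longrightarrow> \<bar>g (X s w)\<bar> \<le> c" using Bd_X_bounded[OF assms(1,4)] by blast
  have "(\<integral>w. g (X s w) * f (X (s + t) w) \<partial>M) = (\<integral>w. g (X s w) * P t f (X s w) \<partial>M)"
    using assms by (intro markov_property[OF _ _ _ c] measurable_compose[OF X_Filt Bd_measurable]) auto
  also have "... = mean (\<lambda>x. g x * P t f x)"
    using assms P_Bd[of t f] by (intro integral_X borel_measurable_times Bd_measurable) auto
  finally show ?thesis .
qed

lemma P_symmetric:
  assumes "0 \<le> t" "f \<in> Bd" "g \<in> Bd"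
  shows "mean (\<lambda>x. f x * P t g x) = mean (\<lambda>x. g x * P t f x)"
  using symmetric assms Bd_L2 unfolding symmetric_semigroup_def by blast

text \<open>Symmetry tested against the constant 1, which the semigroup fixes.\<close>

lemma P_integral:
  assumes "0 \<le> t" "f \<in> Bd"
  shows "mean (P t f) = mean f"
proof -
  have "mean (P t f) = mean (\<lambda>x. f x * P t (\<lambda>_. 1) x)"
    using P_symmetric[OF assms(1,2), of "\<lambda>_. 1"] by simp
  also have "... = mean f"
    using assms by (intro lint_cong) (auto simp: P_const space_mu)
  finally show ?thesis .
qed

text \<open>The squared norm of \<open>P t f\<close> is the correlation of
  \<open>P t f (X 0)\<close> with \<open>f (X t)\<close>. Cauchy-Schwarz on the path space and
  stationarity bound it by \<open>nrm (P t f) * nrm f\<close>, and one factor cancels.\<close>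

lemma P_norm_le:
  assumes t: "0 \<le> t" and f: "f \<in> Bd"
  shows "nrm (P t f) \<le> nrm f"
proof (cases "nrm (P t f) = 0")
  case False
  note [simp] = X_measurable
  have Pf: "P t f \<in> Bd" using t f by (rule P_Bd)
  have "nrm (P t f) * nrm (P t f) = mean (\<lambda>x. P t f x * P t f x)"
    using L2_norm_sq[of \<mu> "P t f"] by (simp add: power2_eq_square)
  also have "... = (\<integral>w. P t f (X 0 w) * f (X (0 + t) w) \<partial>M)"
    using t f Pf by (intro correlation[symmetric]) auto
  also have "... \<le> L2_norm M (\<lambda>w. P t f (X 0 w)) * L2_norm M (\<lambda>w. f (X (0 + t) w))"
    using L2_Cauchy_Schwarz[of "\<lambda>w. P t f (X 0 w)" M "\<lambda>w. f (X (0 + t) w)"]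
      L2_X[of 0 "P t f"] L2_X[of "0 + t" f] t f Pf by (simp add: Bd_L2)
  also have "... = nrm (P t f) * nrm f"
    using t f Pf by (simp add: L2_norm_X Bd_measurable)
  finally show ?thesis using False by (simp add: less_le)
qed simp

end

section \<open>Joint measurability in time and path, path integrals\<close>

text \<open>Rounding time down to the grid of mesh \<open>1 / Suc n\<close> leaves countably many
  time values, hence a jointly measurable function; path continuity gives pointwise
  convergence.\<close>

lemma jointly_measurable_continuous:
  fixes Y :: "real \<Rightarrow> 'w \<Rightarrow> 'a::metric_space"
  assumes Y: "\<And>u. Y u \<in> borel_measurable N"
    and cont: "\<And>w. w \<in> space N \<Longrightarrow> continuous_on UNIV (\<lambda>u. Y u w)"
  shows "(\<lambda>p. Y (fst p) (snd p)) \<in> borel_measurable (borel \<Otimes>\<^sub>M N)"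
proof (rule borel_measurable_LIMSEQ_metric)
  define r :: "nat \<Rightarrow> real \<Rightarrow> real" where "r n u = real_of_int \<lfloor>u * real (Suc n)\<rfloor> / real (Suc n)" for n u
  show "(\<lambda>p. Y (r n (fst p)) (snd p)) \<in> borel_measurable (borel \<Otimes>\<^sub>M N)" for n
    unfolding r_def
  proof (rule measurable_compose_countable[where f = "\<lambda>i p. Y (real_of_int i / real (Suc n)) (snd p)"
        and g = "\<lambda>p. \<lfloor>fst p * real (Suc n)\<rfloor>"])
    show "(\<lambda>p. Y (real_of_int i / real (Suc n)) (snd p)) \<in> borel_measurable (borel \<Otimes>\<^sub>M N)" for i
      using Y by simp
  qed measurable
  fix p :: "real \<times> 'w" assume p: "p \<in> space (borel \<Otimes>\<^sub>M N)"
  have "(\<lambda>n. r n u) \<longlonglongrightarrow> u" for u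
  proof (rule tendsto_sandwich)
    show "(\<lambda>n. u - 1 / real (Suc n)) \<longlonglongrightarrow> u"
      using tendsto_diff[OF tendsto_const LIMSEQ_inverse_real_of_nat, of u] by (simp add: inverse_eq_divide)
    show "\<forall>\<^sub>F n in sequentially. u - 1 / real (Suc n) \<le> r n u"
    proof (rule always_eventually, rule allI)
      fix n
      have "u * real (Suc n) - 1 \<le> real_of_int \<lfloor>u * real (Suc n)\<rfloor>" by linarith
      from divide_right_mono[OF this, of "real (Suc n)"] show "u - 1 / real (Suc n) \<le> r n u"
        by (simp add: r_def diff_divide_distrib)
    qed
    show "\<forall>\<^sub>F n in sequentially. r n u \<le> u"
      by (rule always_eventually) (auto simp: r_def divide_le_eq)
  qed simp
  moreover have "isCont (\<lambda>u. Y u (snd p)) (fst p)"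
    using cont[of "snd p"] p by (auto simp: space_pair_measure continuous_on_eq_continuous_at)
  ultimately show "(\<lambda>n. Y (r n (fst p)) (snd p)) \<longlonglongrightarrow> Y (fst p) (snd p)"
    using isCont_tendsto_compose by fastforce
qed

context stationary_reversible_process
begin

text \<open>Fubini runs over the whole real line, but \<open>X\<close> is unspecified at negative
  times; time is therefore clamped at 0, and an indicator removes the negative part later.\<close>

lemma X_max_measurable [measurable]: "(\<lambda>p. X (max 0 (fst p)) (snd p)) \<in> borel \<Otimes>\<^sub>M M \<rightarrow>\<^sub>M \<mu>"
proof (rule measurable_into_mu)
  have "continuous_on UNIV (\<lambda>u. X (max 0 u) w)" if "w \<in> space M" for w
    by (rule continuous_on_compose2[OF X_continuous[OF that]]) (auto intro!: continuous_intros)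
  then show "(\<lambda>p. X (max 0 (fst p)) (snd p)) \<in> borel_measurable (borel \<Otimes>\<^sub>M M)"
    by (intro jointly_measurable_continuous[of "\<lambda>u. X (max 0 u)"]) (auto intro: X_borel)
qed (auto simp: space_pair_measure X_in_E)

text \<open>Clamping time to \<open>{0..s}\<close> on both sides keeps the map measurable for the
  past up to \<open>s\<close>; this makes path integrals adapted.\<close>

lemma X_clamp_measurable:
  assumes "0 \<le> s"
  shows "(\<lambda>p. X (min s (max 0 (fst p))) (snd p)) \<in> borel \<Otimes>\<^sub>M Filt s \<rightarrow>\<^sub>M \<mu>"
proof (rule measurable_into_mu)
  have "continuous_on UNIV (\<lambda>u. X (min s (max 0 u)) w)" if "w \<in> space M" for w
    by (rule continuous_on_compose2[OF X_continuous[OF that]]) (use assms in \<open>auto intro!: continuous_intros\<close>)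
  then show "(\<lambda>p. X (min s (max 0 (fst p))) (snd p)) \<in> borel_measurable (borel \<Otimes>\<^sub>M Filt s)"
    using assms by (intro jointly_measurable_continuous[of "\<lambda>u. X (min s (max 0 u))"])
      (auto simp: space_Filt intro!: measurable_compose[OF X_Filt id_measurable_mu])
qed (use assms in \<open>auto simp: space_pair_measure X_in_E space_Filt\<close>)

text \<open>The value is 0 on paths along which \<open>g\<close> is not integrable, so additivity
  below carries integrability premises for the path.\<close>

definition path_integral :: "real \<Rightarrow> ('a \<Rightarrow> real) \<Rightarrow> 'w \<Rightarrow> real" where
  "path_integral T g w = (LBINT u:{0..T}. g (X u w))"

lemma path_integral_Filt:
  assumes "0 \<le> T" and g[measurable]: "g \<in> borel_measurable \<mu>"
  shows "path_integral T g \<in> borel_measurable (Filt T)"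
proof -
  have [measurable]: "(\<lambda>p. X (min T (max 0 (fst p))) (snd p)) \<in> lborel \<Otimes>\<^sub>M Filt T \<rightarrow>\<^sub>M \<mu>"
    using X_clamp_measurable[OF assms(1)] by simp
  have "(\<lambda>w. \<integral>u. indicator {0..T} u * g (X (min T (max 0 u)) w) \<partial>lborel) \<in> borel_measurable (Filt T)"
    by (rule lborel.borel_measurable_lebesgue_integral)
      (use measurable_compose[OF measurable_pair_swap' \<open>(\<lambda>p. X (min T (max 0 (fst p))) (snd p)) \<in> _\<close>]
        in \<open>simp add: split_beta' case_prod_beta'\<close>)
  also have "(\<lambda>w. \<integral>u. indicator {0..T} u * g (X (min T (max 0 u)) w) \<partial>lborel) = path_integral T g"
    unfolding path_integral_def set_lebesgue_integral_def
    by (intro ext lint_cong) (auto simp: indicator_def)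
  finally show ?thesis .
qed

lemma path_integral_measurable [measurable]:
  assumes g[measurable]: "g \<in> borel_measurable \<mu>"
  shows "path_integral T g \<in> borel_measurable M"
proof (cases "0 \<le> T")
  case True
  then show ?thesis using path_integral_Filt Filt_measurable g by blast
next
  case False
  then have "path_integral T g = (\<lambda>_. 0)" by (intro ext) (simp add: path_integral_def set_lebesgue_integral_def)
  then show ?thesis by simp
qed

lemma path_measurable:
  assumes "w \<in> space M" and g[measurable]: "g \<in> borel_measurable \<mu>"
  shows "(\<lambda>u. g (X (max 0 u) w)) \<in> borel_measurable borel"
proof -
  have "(\<lambda>u. X (max 0 u) w) \<in> borel \<rightarrow>\<^sub>M \<mu>"
    using measurable_compose[OF measurable_Pair2'[OF assms(1)] X_max_measurable] by simp
  then show ?thesis by measurable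
qed

end

section \<open>Strong continuity, time averages and exponential decay\<close>

context stationary_reversible_process
begin

lemma nrm_mult_self: "nrm f * nrm f = mean (\<lambda>x. f x * f x)"
  using L2_norm_sq[of \<mu> f] by (simp add: power2_eq_square)

text \<open>Duality, by testing with \<open>g = f\<close>. It serves for functions known only
  through their inner products.\<close>

lemma nrm_le_from_inner:
  assumes "\<And>g. g \<in> Bd \<Longrightarrow> (mean (\<lambda>x. f x * g x)) \<le> K * nrm g" "f \<in> Bd" "0 \<le> K"
  shows "nrm f \<le> K"
proof (cases "nrm f = 0")
  case False
  then have "0 < nrm f" using L2_norm_nonneg[of \<mu> f] by linarith
  then show ?thesis using assms(1)[OF assms(2)] unfolding nrm_mult_self[symmetric] by simp
qed (use assms in simp)

text \<open>Expanding the square and using contraction leaves \<open>2 * (nrm f)^2\<close> minus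
  twice the correlation, which is the expected squared increment of \<open>f\<close> along the
  stationary path.\<close>

lemma P_diff_norm_le:
  assumes "0 \<le> t" "f \<in> Bd"
  shows "nrm (\<lambda>x. P t f x - f x) \<le> L2_norm M (\<lambda>w. f (X 0 w) - f (X t w))"
proof (rule power2_le_imp_le)
  note Pf = P_Bd[OF assms]
  have L: "f \<in> L2 \<mu>" "P t f \<in> L2 \<mu>" using assms Pf by (auto intro: Bd_L2)
  note int = L2_integrable_mult[OF L(1,2)] L2_integrable_square[OF L(1)] L2_integrable_square[OF L(2)]
  have LX: "(\<lambda>w. f (X 0 w)) \<in> L2 M" "(\<lambda>w. f (X t w)) \<in> L2 M" using assms L by (auto intro: L2_X)
  note intX = L2_integrable_mult[OF LX] L2_integrable_square[OF LX(1)] L2_integrable_square[OF LX(2)]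
  have "(nrm (\<lambda>x. P t f x - f x))^2 = mean (\<lambda>x. (P t f x)^2 - 2 * (f x * P t f x) + (f x)^2)"
    unfolding L2_norm_sq by (intro lint_cong) (auto simp: power2_eq_square algebra_simps)
  also have "... = (nrm (P t f))^2 - 2 * mean (\<lambda>x. f x * P t f x) + (nrm f)^2"
    unfolding L2_norm_sq using int by simp
  also have "... \<le> 2 * (nrm f)^2 - 2 * mean (\<lambda>x. f x * P t f x)"
    using power_mono[OF P_norm_le[OF assms] L2_norm_nonneg, of 2] by simp
  also have "... = (L2_norm M (\<lambda>w. f (X 0 w)))^2 - 2 * (\<integral>w. f (X 0 w) * f (X t w) \<partial>M) + (L2_norm M (\<lambda>w. f (X t w)))^2"
    using correlation[of 0 t f f] assms by (simp add: L2_norm_X Bd_measurable)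
  also have "... = (\<integral>w. (f (X 0 w))^2 - 2 * (f (X 0 w) * f (X t w)) + (f (X t w))^2 \<partial>M)"
    unfolding L2_norm_sq using intX by simp
  also have "... = (L2_norm M (\<lambda>w. f (X 0 w) - f (X t w)))^2"
    unfolding L2_norm_sq by (intro lint_cong) (auto simp: power2_eq_square algebra_simps)
  finally show "(nrm (\<lambda>x. P t f x - f x))^2 \<le> (L2_norm M (\<lambda>w. f (X 0 w) - f (X t w)))^2" .
qed simp

lemma increment_tendsto_0:
  assumes h: "continuous_on UNIV h" "bounded (range h)" and t: "\<And>n. 0 \<le> t n" "t \<longlonglongrightarrow> 0"
  shows "(\<lambda>n. L2_norm M (\<lambda>w. h (X 0 w) - h (X (t n) w))) \<longlonglongrightarrow> 0"
proof -
  obtain c where c: "\<And>x. \<bar>h x\<bar> \<le> c" using h(2) by (auto simp: bounded_iff)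
  have m: "(\<lambda>w. h (X s w)) \<in> borel_measurable M" if "0 \<le> s" for s
    using measurable_compose[OF X_borel[OF that] borel_measurable_continuous_onI[OF h(1)]] .
  show ?thesis
  proof (rule L2_integral_tendsto_dominated[where g = "\<lambda>_. c"])
    fix w assume w: "w \<in> space M"
    have "continuous_on {0..} (\<lambda>u. h (X u w))"
      using continuous_on_compose2[OF h(1) X_continuous[OF w]] by simp
    then show "(\<lambda>i. h (X (t i) w)) \<longlonglongrightarrow> h (X 0 w)"
      using t by (auto simp: continuous_on_sequentially o_def)
  qed (use m t order_trans[OF c abs_ge_self] in auto)
qed

text \<open>Path continuity settles bounded continuous functions. For general \<open>f\<close> a
  continuous approximant \<open>g\<close> is inserted at times 0 and \<open>t\<close>; by
  stationarity its error is the same at both times.\<close>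

lemma strong_continuity:
  assumes f: "f \<in> Bd" and e: "0 < e"
  shows "\<exists>d>0. \<forall>t. 0 \<le> t \<and> t \<le> d \<longrightarrow> nrm (\<lambda>x. P t f x - f x) \<le> e"
proof (rule ccontr)
  assume "\<not> ?thesis"
  then have "\<forall>n. \<exists>t. 0 \<le> t \<and> t \<le> 1 / real (Suc n) \<and> e < nrm (\<lambda>x. P t f x - f x)"
    by (auto simp: not_le)
  then obtain t where t: "\<And>n. 0 \<le> t n" "\<And>n. t n \<le> 1 / real (Suc n)" "\<And>n. e < nrm (\<lambda>x. P (t n) f x - f x)"
    by metis
  obtain g where g: "continuous_on UNIV g" "bounded (range g)" "g \<in> L2 \<mu>" "nrm (\<lambda>x. f x - g x) < e / 4"
    using L2_approx_continuous[OF mu.prob_space_axioms sets_mu' E_borel Bd_L2[OF f], of "e/4"] e by auto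
  have "t \<longlonglongrightarrow> 0"
  proof (rule tendsto_sandwich[of "\<lambda>_. 0" _ _ "\<lambda>n. 1 / real (Suc n)"])
    show "(\<lambda>n. 1 / real (Suc n)) \<longlonglongrightarrow> 0" using LIMSEQ_inverse_real_of_nat by (simp add: inverse_eq_divide)
  qed (use t in auto)
  from increment_tendsto_0[OF g(1,2) t(1) this] have "(\<lambda>n. L2_norm M (\<lambda>w. g (X 0 w) - g (X (t n) w))) \<longlonglongrightarrow> 0" .
  from order_tendstoD(2)[OF this, of "e/4"] e obtain n
    where n: "L2_norm M (\<lambda>w. g (X 0 w) - g (X (t n) w)) < e / 4" by (auto simp: eventually_sequentially)
  have L: "(\<lambda>w. f (X s w)) \<in> L2 M" "(\<lambda>w. g (X s w)) \<in> L2 M" if "0 \<le> s" for s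
    using that f g by (auto intro!: L2_X Bd_L2)
  have N: "L2_norm M (\<lambda>w. f (X s w) - g (X s w)) = nrm (\<lambda>x. f x - g x)" if "0 \<le> s" for s
    using L2_norm_X[OF that, of "\<lambda>x. f x - g x"] f g by (auto simp: Bd_measurable L2_measurable)
  have "nrm (\<lambda>x. P (t n) f x - f x) \<le> L2_norm M (\<lambda>w. f (X 0 w) - f (X (t n) w))"
    using t f by (intro P_diff_norm_le)
  also have "... \<le> L2_norm M (\<lambda>w. f (X 0 w) - g (X 0 w)) + L2_norm M (\<lambda>w. g (X 0 w) - f (X (t n) w))"
    using L t by (intro L2_norm_triangle3) auto
  also have "L2_norm M (\<lambda>w. g (X 0 w) - f (X (t n) w)) \<le>
      L2_norm M (\<lambda>w. g (X 0 w) - g (X (t n) w)) + L2_norm M (\<lambda>w. g (X (t n) w) - f (X (t n) w))"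
    using L t by (intro L2_norm_triangle3) auto
  finally have "nrm (\<lambda>x. P (t n) f x - f x) < e"
    using N[of 0] N[OF t(1)[of n]] n g(4) L2_norm_minus_commute[of M "\<lambda>w. f (X (t n) w)" "\<lambda>w. g (X (t n) w)"] e
    by linarith
  then show False using t(3)[of n] by simp
qed

text \<open>Contraction by \<open>P s\<close> makes the modulus of continuity at time 0 valid at
  every time.\<close>

lemma inner_P_increment:
  assumes "0 \<le> s" "0 \<le> h" "f \<in> Bd" "g \<in> Bd"
  shows "\<bar>mean (\<lambda>x. g x * P (s + h) f x) - mean (\<lambda>x. g x * P s f x)\<bar> \<le> nrm g * nrm (\<lambda>x. P h f x - f x)"
proof -
  have D: "(\<lambda>x. P h f x - f x) \<in> Bd" using assms by auto
  have B: "P (s + h) f \<in> Bd" "P s f \<in> Bd" using assms by auto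
  have "mean (\<lambda>x. g x * P (s + h) f x) - mean (\<lambda>x. g x * P s f x) = mean (\<lambda>x. g x * P (s + h) f x - g x * P s f x)"
    using assms B by (intro Bochner_Integration.integral_diff[symmetric] Bd_integrable Bd_mult)
  also have "... = mean (\<lambda>x. g x * P s (\<lambda>x. P h f x - f x) x)"
    using assms by (intro lint_cong)
      (auto simp: P_diff P_Bd P_semigroup space_mu right_diff_distrib)
  also have "\<bar>...\<bar> \<le> nrm g * nrm (P s (\<lambda>x. P h f x - f x))"
    using assms D by (intro L2_Cauchy_Schwarz Bd_L2 P_Bd)
  also have "... \<le> nrm g * nrm (\<lambda>x. P h f x - f x)"
    using assms D by (intro mult_left_mono P_norm_le) auto
  finally show ?thesis .
qed

lemma inner_P_continuous:
  assumes "f \<in> Bd" "g \<in> Bd"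
  shows "continuous_on {0..} (\<lambda>s. \<integral>x. g x * P s f x \<partial>\<mu>)"
proof -
  have "\<exists>d>0. \<forall>s\<in>{0..}. dist s t < d \<longrightarrow>
      dist (mean (\<lambda>x. g x * P s f x)) (mean (\<lambda>x. g x * P t f x)) < e" if "0 < e" for e t :: real
  proof -
    have "0 < e / (2 * (nrm g + 1))" using that by (simp add: add_nonneg_pos)
    from strong_continuity[OF assms(1) this] obtain d where d: "0 < d"
      "\<And>h. 0 \<le> h \<Longrightarrow> h \<le> d \<Longrightarrow> nrm (\<lambda>x. P h f x - f x) \<le> e / (2 * (nrm g + 1))" by blast
    have *: "nrm g * nrm (\<lambda>x. P h f x - f x) < e" if "0 \<le> h" "h \<le> d" for h
    proof -
      have "nrm g * nrm (\<lambda>x. P h f x - f x) \<le> (nrm g + 1) * (e / (2 * (nrm g + 1)))"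
        using d(2)[OF that] by (intro mult_mono) auto
      also have "... = e / 2" using add_nonneg_pos[OF L2_norm_nonneg[of \<mu> g] zero_less_one] by (simp add: divide_simps)
      finally show ?thesis using \<open>0 < e\<close> by simp
    qed
    show ?thesis
    proof (cases "0 \<le> t")
      case True
      have "dist (mean (\<lambda>x. g x * P s f x)) (mean (\<lambda>x. g x * P t f x)) < e" if "0 \<le> s" "dist s t < d" for s
      proof (cases "s \<le> t")
        case True
        then show ?thesis using inner_P_increment[of s "t - s" f g] *[of "t - s"] that assms
          by (auto simp: dist_real_def abs_minus_commute)
      next
        case False
        then show ?thesis using inner_P_increment[of t "s - t" f g] *[of "s - t"] that assms \<open>0 \<le> t\<close>
          by (auto simp: dist_real_def)
      qed
      then show ?thesis using d(1) by auto
    next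
      case False
      then show ?thesis by (intro exI[of _ "-t"]) (auto simp: dist_real_def)
    qed
  qed
  then show ?thesis unfolding continuous_on_iff by blast
qed

text \<open>The function \<open>h\<close> is the conditional expectation of \<open>Z\<close> given
  \<open>X 0\<close>, obtained as a Radon-Nikodym density: the measure with density
  \<open>Z + c\<close> is pushed forward by \<open>X 0\<close>, and its total weight on any set is
  at most \<open>2 * c\<close> times that of \<mu>.\<close>

lemma conditional_expectation_Bd:
  assumes Z[measurable]: "Z \<in> borel_measurable M" and Zb: "\<And>w. w \<in> space M \<Longrightarrow> \<bar>Z w\<bar> \<le> c"
  shows "\<exists>h\<in>Bd. \<forall>g\<in>Bd. mean (\<lambda>x. h x * g x) = (\<integral>w. Z w * g (X 0 w) \<partial>M)"
proof -
  have [measurable]: "X 0 \<in> M \<rightarrow>\<^sub>M \<mu>" by (rule X_measurable) simp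
  have Zc: "0 \<le> Z w + c" "Z w + c \<le> 2 * c" if "w \<in> space M" for w using Zb[OF that] by auto
  have c: "0 \<le> c" using Zb not_empty by (meson abs_ge_zero ex_in_conv order_trans)
  define N where "N = distr (density M (\<lambda>w. ennreal (Z w + c))) \<mu> (X 0)"
  have Nle: "emeasure N A \<le> ennreal (2 * c) * emeasure \<mu> A" if A[measurable]: "A \<in> sets \<mu>" for A
  proof -
    have "emeasure N A = (\<integral>\<^sup>+w. ennreal (Z w + c) * indicator (X 0 -` A \<inter> space M) w \<partial>M)"
      unfolding N_def by (simp add: emeasure_distr emeasure_density)
    also have "... \<le> (\<integral>\<^sup>+w. ennreal (2 * c) * indicator A (X 0 w) \<partial>M)"
      using Zc by (intro nn_integral_mono) (auto simp: indicator_def ennreal_leI)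
    also have "... = ennreal (2 * c) * (\<integral>\<^sup>+w. indicator A (X 0 w) \<partial>M)"
      by (intro nn_integral_cmult) auto
    also have "(\<integral>\<^sup>+w. indicator A (X 0 w) \<partial>M) = emeasure \<mu> A"
      by (subst nn_integral_X) auto
    finally show ?thesis .
  qed
  have "absolutely_continuous \<mu> N"
    unfolding absolutely_continuous_def
  proof
    fix A assume A: "A \<in> null_sets \<mu>"
    then have "emeasure N A = 0" using Nle[of A] by (auto simp: null_sets_def)
    then show "A \<in> null_sets N" using A by (auto simp: null_sets_def N_def)
  qed
  then obtain h where h[measurable]: "h \<in> borel_measurable \<mu>" and dens: "density \<mu> h = N"
    using mu.Radon_Nikodym[of N] by (auto simp: N_def)
  \<comment> \<open>On this set the density exceeds its permitted bound; comparing masses shows that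
    the excess integrates to 0, so the set is null.\<close>
  define A where "A = {x \<in> space \<mu>. ennreal (2 * c) < h x}"
  have [measurable]: "A \<in> sets \<mu>" unfolding A_def by measurable
  have "(\<integral>\<^sup>+x. (h x - ennreal (2 * c)) * indicator A x \<partial>\<mu>) + (\<integral>\<^sup>+x. ennreal (2 * c) * indicator A x \<partial>\<mu>)
      = (\<integral>\<^sup>+x. h x * indicator A x \<partial>\<mu>)"
    by (subst nn_integral_add[symmetric]) (auto intro!: nn_integral_cong simp: A_def indicator_def diff_add_cancel_ennreal less_imp_le)
  also have "... = emeasure N A" unfolding dens[symmetric] by (simp add: emeasure_density)
  also have "... \<le> (\<integral>\<^sup>+x. ennreal (2 * c) * indicator A x \<partial>\<mu>)"
    using Nle[of A] by (simp add: nn_integral_cmult)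
  finally have "(\<integral>\<^sup>+x. (h x - ennreal (2 * c)) * indicator A x \<partial>\<mu>) + ennreal (2 * c) * emeasure \<mu> A \<le> 0 + ennreal (2 * c) * emeasure \<mu> A"
    by (simp add: nn_integral_cmult)
  then have "(\<integral>\<^sup>+x. (h x - ennreal (2 * c)) * indicator A x \<partial>\<mu>) = 0"
    using ennreal_add_left_cancel[of "ennreal (2 * c) * emeasure \<mu> A"
        "(\<integral>\<^sup>+x. (h x - ennreal (2 * c)) * indicator A x \<partial>\<mu>)" 0]
    by (auto simp: ennreal_mult_eq_top_iff add.commute intro: antisym)
  then have "AE x in \<mu>. (h x - ennreal (2 * c)) * indicator A x = 0"
    by (subst (asm) nn_integral_0_iff_AE) auto
  then have h_le: "AE x in \<mu>. h x \<le> ennreal (2 * c)"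
    using AE_space by eventually_elim (auto simp: A_def indicator_def not_less[symmetric] diff_eq_0_iff_ennreal split: if_splits)
  \<comment> \<open>Truncation changes the density on a null set only and makes it bounded at every
    point, as membership in \<open>Bd\<close> demands.\<close>
  define k where "k x = enn2real (min (h x) (ennreal (2 * c)))" for x
  have k[measurable]: "k \<in> borel_measurable \<mu>" unfolding k_def by measurable
  have kb: "0 \<le> k x" "k x \<le> 2 * c" for x
    using c enn2real_mono[of "min (h x) (ennreal (2 * c))" "ennreal (2 * c)"] by (auto simp: k_def)
  have "N = density \<mu> (\<lambda>x. ennreal (k x))"
    unfolding dens[symmetric]
  proof (rule density_cong)
    show "AE x in \<mu>. h x = ennreal (k x)"
      using h_le by eventually_elim (auto simp: k_def min_def ennreal_enn2real_if top_unique)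
  qed auto
  then have Nk: "(\<integral>x. g x \<partial>N) = mean (\<lambda>x. k x * g x)" if "g \<in> borel_measurable \<mu>" for g :: "'a \<Rightarrow> real"
    using that kb by (simp add: integral_density)
  have NZ: "(\<integral>x. g x \<partial>N) = (\<integral>w. (Z w + c) * g (X 0 w) \<partial>M)" if [measurable]: "g \<in> borel_measurable \<mu>" for g :: "'a \<Rightarrow> real"
    unfolding N_def using Zc by (subst integral_distr) (auto simp: integral_density intro!: AE_I2)
  have kBd: "k \<in> Bd" using kb k by (intro BdI[where c = "2 * c"]) auto
  show ?thesis
  proof (intro bexI ballI)
    show "(\<lambda>x. k x - c) \<in> Bd" using kBd by auto
    fix g assume g: "g \<in> Bd"
    have "(\<integral>w. (Z w + c) * g (X 0 w) \<partial>M) = (\<integral>w. Z w * g (X 0 w) \<partial>M) + (\<integral>w. c * g (X 0 w) \<partial>M)"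
      unfolding distrib_right using integrable_bounded_mult_Bd[OF _ Z Zb g, of 0] integrable_Bd_X[OF _ g, of 0]
      by (intro Bochner_Integration.integral_add) auto
    moreover have "(\<integral>w. c * g (X 0 w) \<partial>M) = mean (\<lambda>x. c * g x)"
      using integral_X[of 0 "\<lambda>x. c * g x"] g by (simp add: Bd_measurable)
    moreover have "mean (\<lambda>x. (k x - c) * g x) = mean (\<lambda>x. k x * g x) - mean (\<lambda>x. c * g x)"
      unfolding left_diff_distrib using g kBd by (intro Bochner_Integration.integral_diff Bd_integrable) auto
    ultimately show "mean (\<lambda>x. (k x - c) * g x) = (\<integral>w. Z w * g (X 0 w) \<partial>M)"
      using Nk[of g] NZ[of g] g by (auto simp: Bd_measurable)
  qed
qed

lemma path_integral_bound:
  assumes "0 \<le> T" "w \<in> space M" "f \<in> borel_measurable \<mu>" "\<And>x. x \<in> E \<Longrightarrow> \<bar>f x\<bar> \<le> c"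
  shows "\<bar>path_integral T f w\<bar> \<le> c * T"
proof -
  have "\<bar>path_integral T f w\<bar> = \<bar>\<integral>u. indicator {0..T} u * f (X (max 0 u) w) \<partial>lborel\<bar>"
    unfolding path_integral_def set_lebesgue_integral_def
    by (intro arg_cong[where f = abs] lint_cong) (auto simp: indicator_def)
  also have "... \<le> (\<integral>u. c * indicator {0..T} u \<partial>lborel)"
  proof (rule integral_abs_bound[THEN order_trans], rule integral_mono')
    show "integrable lborel (\<lambda>u. c * indicator {0..T} u :: real)" using assms by simp
    have "0 \<le> c" using assms(4)[OF X_in_E[OF order_refl assms(2)]] by linarith
    then show "\<bar>indicator {0..T} u * f (X (max 0 u) w)\<bar> \<le> c * indicator {0..T} u" "0 \<le> c * (indicator {0..T} u :: real)" for u
      using assms(2,4) by (auto simp: indicator_def X_in_E)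
  qed
  also have "... = c * T" using assms(1) by simp
  finally show ?thesis .
qed

lemma expectation_path_integral:
  assumes T: "0 \<le> T" and Z[measurable]: "Z \<in> borel_measurable M"
    and Zb: "\<And>w. w \<in> space M \<Longrightarrow> \<bar>Z w\<bar> \<le> c" and f: "f \<in> Bd"
  shows "(\<integral>w. Z w * path_integral T f w \<partial>M) = (LBINT u:{0..T}. \<integral>w. Z w * f (X u w) \<partial>M)"
proof -
  interpret pair_sigma_finite lborel M by unfold_locales
  have fm[measurable]: "f \<in> borel_measurable \<mu>" using f by (rule Bd_measurable)
  have Xm[measurable]: "(\<lambda>p. X (max 0 (fst p)) (snd p)) \<in> lborel \<Otimes>\<^sub>M M \<rightarrow>\<^sub>M \<mu>" using X_max_measurable by simp
  obtain d where d: "\<And>x. x \<in> E \<Longrightarrow> \<bar>f x\<bar> \<le> d" using BdE[OF f] by metis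
  have c: "0 \<le> c" using Zb not_empty by (meson abs_ge_zero ex_in_conv order_trans)
  let ?k = "\<lambda>u w. indicator {0..T} u * (Z w * f (X (max 0 u) w))"
  have int: "integrable (lborel \<Otimes>\<^sub>M M) (case_prod ?k)"
  proof (rule integrableI_bounded_set[where A = "{0..T} \<times> space M" and B = "c * d"])
    show "{0..T} \<times> space M \<in> sets (lborel \<Otimes>\<^sub>M M)" by auto
    show "emeasure (lborel \<Otimes>\<^sub>M M) ({0..T} \<times> space M) < \<infinity>"
      using T by (subst sigma_finite_measure.emeasure_pair_measure_Times[OF prob_space_imp_sigma_finite[OF prob_space_axioms]]) (auto simp: emeasure_space_1)
    show "case_prod ?k \<in> borel_measurable (lborel \<Otimes>\<^sub>M M)"
      unfolding split_beta' by measurable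
    show "AE p in lborel \<Otimes>\<^sub>M M. p \<in> {0..T} \<times> space M \<longrightarrow> norm (case_prod ?k p) \<le> c * d"
      using Zb d c by (intro AE_I2) (auto simp: abs_mult X_in_E intro!: mult_mono)
    show "AE p in lborel \<Otimes>\<^sub>M M. p \<notin> {0..T} \<times> space M \<longrightarrow> case_prod ?k p = 0"
      by (intro AE_I2) (auto simp: space_pair_measure indicator_def)
  qed
  have "(\<integral>w. Z w * path_integral T f w \<partial>M) = (\<integral>w. (\<integral>u. ?k u w \<partial>lborel) \<partial>M)"
    unfolding path_integral_def set_lebesgue_integral_def integral_mult_right_zero[symmetric]
    by (intro lint_cong refl) (auto simp: indicator_def)
  also have "... = (\<integral>u. (\<integral>w. ?k u w \<partial>M) \<partial>lborel)"
    using Fubini_integral[OF int] .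
  also have "... = (LBINT u:{0..T}. \<integral>w. Z w * f (X u w) \<partial>M)"
    unfolding set_lebesgue_integral_def by (intro lint_cong refl) (auto simp: indicator_def)
  finally show ?thesis .
qed

text \<open>\<open>F\<close> stands for the time average of \<open>P s f\<close> over
  \<open>{0..e}\<close>. It is realised as the conditional expectation, given \<open>X 0\<close>, of
  the average of \<open>f\<close> along the path, so the integrand \<open>P s f x\<close> never has
  to be integrated in \<open>s\<close> at a fixed \<open>x\<close>; only inner products of
  \<open>F\<close> are computed.\<close>

lemma averaged_semigroup_exists:
  assumes f: "f \<in> Bd" and e: "0 < e"
  obtains F where "F \<in> Bd"
    "\<And>g. g \<in> Bd \<Longrightarrow> (mean (\<lambda>x. F x * g x)) = integral {0..e} (\<lambda>s. \<integral>x. g x * P s f x \<partial>\<mu>) / e"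
proof -
  obtain d where d: "0 \<le> d" "\<And>x. x \<in> E \<Longrightarrow> \<bar>f x\<bar> \<le> d" using BdE[OF f] by metis
  have "\<bar>path_integral e f w / e\<bar> \<le> d" if "w \<in> space M" for w
    using path_integral_bound[OF _ that Bd_measurable[OF f] d(2), of e] e by (simp add: field_simps)
  moreover have "(\<lambda>w. path_integral e f w / e) \<in> borel_measurable M"
    using path_integral_measurable[OF Bd_measurable[OF f]] by simp
  ultimately obtain F where F: "F \<in> Bd"
    "\<And>g. g \<in> Bd \<Longrightarrow> (mean (\<lambda>x. F x * g x)) = (\<integral>w. path_integral e f w / e * g (X 0 w) \<partial>M)"
    using conditional_expectation_Bd[of "\<lambda>w. path_integral e f w / e" d] by metis
  have "mean (\<lambda>x. F x * g x) = integral {0..e} (\<lambda>s. \<integral>x. g x * P s f x \<partial>\<mu>) / e" if g: "g \<in> Bd" for g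
  proof -
    obtain c where c: "\<And>w. w \<in> space M \<Longrightarrow> \<bar>g (X 0 w)\<bar> \<le> c" using Bd_X_bounded[OF order_refl g] by blast
    have "mean (\<lambda>x. F x * g x) = (\<integral>w. g (X 0 w) * path_integral e f w \<partial>M) / e"
      using F(2)[OF g] by (simp add: mult.commute)
    also have "(\<integral>w. g (X 0 w) * path_integral e f w \<partial>M) = (LBINT u:{0..e}. \<integral>w. g (X 0 w) * f (X u w) \<partial>M)"
      using e g f by (intro expectation_path_integral[OF _ _ c] measurable_compose[OF X_measurable Bd_measurable]) auto
    also have "... = (LBINT u:{0..e}. \<integral>x. g x * P u f x \<partial>\<mu>)"
      using correlation[of 0 _ f g] f g by (intro set_lebesgue_integral_cong) auto
    also have "... = integral {0..e} (\<lambda>s. \<integral>x. g x * P s f x \<partial>\<mu>)"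
      using continuous_on_subset[OF inner_P_continuous[OF f g]]
      by (intro set_borel_integral_eq_integral borel_integrable_atLeastAtMost') auto
    finally show ?thesis .
  qed
  with F(1) show ?thesis by (rule that)
qed


text \<open>Time averages lie in the domain of the generator. By symmetry \<open>P h\<close> moves
  to the test function and shifts the window of integration from \<open>{0..e}\<close> to
  \<open>{h..e + h}\<close>; the two end pieces that remain are governed by strong continuity at
  0.\<close>

lemma averaged_semigroup_generator:
  assumes f: "f \<in> Bd" and e: "0 < e" and F: "F \<in> Bd"
    and FI: "\<And>g. g \<in> Bd \<Longrightarrow> (mean (\<lambda>x. F x * g x)) = integral {0..e} (\<lambda>s. \<integral>x. g x * P s f x \<partial>\<mu>) / e"
  shows "generator \<mu> \<kappa> F (\<lambda>x. (P e f x - f x) / e)"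
proof -
  define G where "G x = (P e f x - f x) / e" for x
  have G: "G \<in> Bd" unfolding G_def using f e by (intro Bd_divide Bd_diff P_Bd) auto
  \<comment> \<open>Here \<open>z\<close> bounds the modulus of strong continuity on
    \<open>{0..h}\<close>; each end of the window contributes one \<open>z\<close>, and the average
    divides by \<open>e\<close>.\<close>
  have key: "nrm (\<lambda>x. (P h F x - F x) / h - G x) \<le> 2 * z / e"
    if h: "0 < h" and z: "\<And>s. 0 \<le> s \<Longrightarrow> s \<le> h \<Longrightarrow> nrm (\<lambda>x. P s f x - f x) \<le> z" for h z
  proof (rule nrm_le_from_inner)
    have "0 \<le> nrm (\<lambda>x. P 0 f x - f x)" by simp
    also have "... \<le> z" using z[of 0] h by simp
    finally have z0: "0 \<le> z" .
    then show "0 \<le> 2 * z / e" using e by simp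
    have PF: "P h F \<in> Bd" using h F by auto
    show D: "(\<lambda>x. (P h F x - F x) / h - G x) \<in> Bd" using PF F G by (intro Bd_diff Bd_divide)
    fix g assume g: "g \<in> Bd"
    define C where "C s = mean (\<lambda>x. g x * P s f x)" for s
    have Cc: "continuous_on {0..} C" unfolding C_def using f g by (rule inner_P_continuous)
    have Ci: "C integrable_on {a..b}" if "0 \<le> a" for a b
      using continuous_on_subset[OF Cc] that by (intro integrable_continuous_interval) auto
    have "mean (\<lambda>x. P h F x * g x) = mean (\<lambda>x. F x * P h g x)"
      using P_symmetric[of h F g] h F g by (simp add: mult.commute)
    also have "... = integral {0..e} (\<lambda>s. \<integral>x. P h g x * P s f x \<partial>\<mu>) / e"
      using h g by (intro FI P_Bd) auto
    also have "integral {0..e} (\<lambda>s. \<integral>x. P h g x * P s f x \<partial>\<mu>) = integral {0..e} (C \<circ> (\<lambda>s. s + h))"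
    proof (rule integral_cong)
      fix s assume s: "s \<in> {0..e}"
      have "mean (\<lambda>x. P h g x * P s f x) = mean (\<lambda>x. P s f x * P h g x)" by (simp add: mult.commute)
      also have "... = mean (\<lambda>x. g x * P h (P s f) x)" using s h f g by (intro P_symmetric) auto
      also have "... = C (h + s)" unfolding C_def
        using s h f by (intro lint_cong) (auto simp: P_semigroup space_mu)
      finally show "mean (\<lambda>x. P h g x * P s f x) = (C \<circ> (\<lambda>s. s + h)) s" by (simp add: add.commute)
    qed
    also have "... = integral {0 + h..e + h} C"
      using h by (intro integral_shift continuous_on_subset[OF Cc]) auto
    finally have 1: "mean (\<lambda>x. P h F x * g x) = integral {h..e + h} C / e" by simp
    have 2: "mean (\<lambda>x. F x * g x) = integral {0..e} C / e" using FI[OF g] by (simp add: C_def[abs_def])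
    have 3: "mean (\<lambda>x. G x * g x) = (C e - C 0) / e"
    proof -
      have "mean (\<lambda>x. G x * g x) = mean (\<lambda>x. (g x * P e f x - g x * f x) / e)"
        unfolding G_def by (intro lint_cong) (auto simp: algebra_simps)
      also have "... = (mean (\<lambda>x. g x * P e f x) - mean (\<lambda>x. g x * f x)) / e"
        using f g e by (simp add: Bochner_Integration.integral_diff Bd_integrable Bd_mult P_Bd)
      also have "mean (\<lambda>x. g x * f x) = C 0" unfolding C_def using semigroup
        by (intro lint_cong refl)
          (use f in \<open>auto simp: P_op_def space_mu transition_semigroup_def integral_return Bd_measurable
            measurable_cong_sets[OF sets_mu'[symmetric] refl] space_restrict_space\<close>)
      finally show ?thesis by (simp add: C_def)
    qed
    \<comment> \<open>Both windows are completed to \<open>{0..e + h}\<close>, which also covers the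
      case that \<open>h\<close> exceeds \<open>e\<close>.\<close>
    have split: "integral {h..e + h} C - integral {0..e} C = integral {e..e + h} C - integral {0..h} C"
    proof -
      have "integral {0..h} C + integral {h..e + h} C = integral {0..e + h} C"
        using h e by (intro Henstock_Kurzweil_Integration.integral_combine Ci) auto
      moreover have "integral {0..e} C + integral {e..e + h} C = integral {0..e + h} C"
        using h e by (intro Henstock_Kurzweil_Integration.integral_combine Ci) auto
      ultimately show ?thesis by linarith
    qed
    have up: "integral {e..e + h} C \<le> h * (C e + nrm g * z)"
    proof -
      have "C u \<le> C e + nrm g * z" if "u \<in> {e..e+h}" for u
        using inner_P_increment[of e "u - e" f g] that e f g
          mult_left_mono[OF z[of "u - e"] L2_norm_nonneg[of \<mu> g]] by (auto simp: C_def)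
      then have "integral {e..e + h} C \<le> integral {e..e + h} (\<lambda>_. C e + nrm g * z)"
        using e by (intro integral_le Ci) auto
      then show ?thesis using h by simp
    qed
    have lo: "h * (C 0 - nrm g * z) \<le> integral {0..h} C"
    proof -
      have "C 0 - nrm g * z \<le> C u" if "u \<in> {0..h}" for u
        using inner_P_increment[of 0 u f g] that f g
          mult_left_mono[OF z[of u] L2_norm_nonneg[of \<mu> g]] by (auto simp: C_def)
      then have "integral {0..h} (\<lambda>_. C 0 - nrm g * z) \<le> integral {0..h} C"
        by (intro integral_le Ci) auto
      then show ?thesis using h by simp
    qed
    have "mean (\<lambda>x. ((P h F x - F x) / h - G x) * g x) = mean (\<lambda>x. P h F x * g x / h - F x * g x / h - G x * g x)"
      by (intro lint_cong) (auto simp: algebra_simps diff_divide_distrib)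
    also have "... = mean (\<lambda>x. P h F x * g x) / h - mean (\<lambda>x. F x * g x) / h - mean (\<lambda>x. G x * g x)"
      using PF F G g by (simp add: Bochner_Integration.integral_diff Bd_integrable Bd_mult Bd_divide Bd_diff)
    also have "... = ((integral {e..e + h} C - integral {0..h} C) / h - (C e - C 0)) / e"
      unfolding 1 2 3 split[symmetric] using h e by (simp add: field_simps)
    also have "... \<le> ((h * (C e + nrm g * z) - h * (C 0 - nrm g * z)) / h - (C e - C 0)) / e"
      using up lo h e by (intro divide_right_mono diff_right_mono) auto
    also have "... = 2 * z / e * nrm g" using h e by (simp add: field_simps)
    finally show "mean (\<lambda>x. ((P h F x - F x) / h - G x) * g x) \<le> 2 * z / e * nrm g" .
  qed
  have "((\<lambda>h. nrm (\<lambda>x. (P h F x - F x) / h - G x)) \<longlongrightarrow> 0) (at_right 0)"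
  proof (rule tendstoI)
    fix r :: real assume r: "0 < r"
    have "0 < r * e / 4" using r e by simp
    from strong_continuity[OF f this] obtain d where d: "0 < d"
      "\<And>t. 0 \<le> t \<Longrightarrow> t \<le> d \<Longrightarrow> nrm (\<lambda>x. P t f x - f x) \<le> r * e / 4" by blast
    have "dist (nrm (\<lambda>x. (P h F x - F x) / h - G x)) 0 < r" if "0 < h" "h < d" for h
    proof -
      have "nrm (\<lambda>x. (P h F x - F x) / h - G x) \<le> 2 * (r * e / 4) / e"
        using that d by (intro key) auto
      also have "... < r" using r e by simp
      finally show ?thesis by simp
    qed
    then show "\<forall>\<^sub>F h in at_right 0. dist (nrm (\<lambda>x. (P h F x - F x) / h - G x)) 0 < r"
      using d(1) by (auto simp: eventually_at_right)
  qed
  then show ?thesis unfolding generator_def using F Bd_L2[OF G] by (simp add: Bd_L2 G_def[abs_def])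
qed

text \<open>An average of functions within \<open>z\<close> of \<open>f\<close> is within
  \<open>z\<close> of \<open>f\<close>; the comparison is made through inner products because
  \<open>F\<close> is known only in that form.\<close>

lemma averaged_semigroup_approx:
  assumes f: "f \<in> Bd" and e: "0 < e" and F: "F \<in> Bd"
    and FI: "\<And>g. g \<in> Bd \<Longrightarrow> (mean (\<lambda>x. F x * g x)) = integral {0..e} (\<lambda>s. \<integral>x. g x * P s f x \<partial>\<mu>) / e"
    and z: "\<And>s. 0 \<le> s \<Longrightarrow> s \<le> e \<Longrightarrow> nrm (\<lambda>x. P s f x - f x) \<le> z"
  shows "nrm (\<lambda>x. F x - f x) \<le> z"
proof (rule nrm_le_from_inner)
  have "0 \<le> nrm (\<lambda>x. P 0 f x - f x)" by simp
  also have "... \<le> z" using z[of 0] e by simp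
  finally show "0 \<le> z" .
  show "(\<lambda>x. F x - f x) \<in> Bd" using F f by auto
  fix g assume g: "g \<in> Bd"
  define C where "C s = mean (\<lambda>x. g x * P s f x)" for s
  have Cc: "continuous_on {0..} C" unfolding C_def using f g by (rule inner_P_continuous)
  have C0: "mean (\<lambda>x. g x * f x) = C 0" unfolding C_def using semigroup
    by (intro lint_cong refl)
      (use f in \<open>auto simp: P_op_def space_mu transition_semigroup_def integral_return Bd_measurable
        measurable_cong_sets[OF sets_mu'[symmetric] refl] space_restrict_space\<close>)
  have "C u \<le> C 0 + nrm g * z" if "u \<in> {0..e}" for u
    using inner_P_increment[of 0 u f g] that f g
      mult_left_mono[OF z[of u] L2_norm_nonneg[of \<mu> g]] by (auto simp: C_def)
  then have "integral {0..e} C \<le> integral {0..e} (\<lambda>_. C 0 + nrm g * z)"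
    by (intro integral_le integrable_continuous_interval continuous_on_subset[OF Cc]) auto
  then have "integral {0..e} C \<le> e * (C 0 + nrm g * z)" using e by simp
  then have "integral {0..e} C / e \<le> C 0 + nrm g * z" using e by (simp add: divide_le_eq mult.commute)
  moreover have "mean (\<lambda>x. (F x - f x) * g x) = mean (\<lambda>x. F x * g x) - mean (\<lambda>x. g x * f x)"
    using F f g by (subst Bochner_Integration.integral_diff[symmetric]) (auto simp: Bd_integrable Bd_mult algebra_simps)
  ultimately show "mean (\<lambda>x. (F x - f x) * g x) \<le> z * nrm g"
    using FI[OF g] C0 unfolding C_def[abs_def] mult.commute[of z] by linarith
qed

text \<open>A discrete Gronwall argument for the squared norm \<open>u s\<close> of
  \<open>P s F\<close>: one step of length \<open>h\<close> multiplies it by at most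
  \<open>1 - h / c\<close>, up to an error \<open>h * w h\<close> with \<open>w h\<close> tending to
  0. Iterating over \<open>t / h\<close> steps and refining the mesh produces
  \<open>exp (- t / c)\<close>.\<close>

lemma generator_decay:
  assumes c: "0 < c" and PI: "\<And>f g. generator \<mu> \<kappa> f g \<Longrightarrow>
      (mean (\<lambda>x. (f x)^2)) - (mean f)\<^sup>2 \<le> c * integral_carre_du_champ \<mu> f g"
    and F: "F \<in> Bd" and G: "G \<in> Bd" and gen: "generator \<mu> \<kappa> F G" and mean: "mean F = 0" and t: "0 \<le> t"
  shows "(nrm (P t F))^2 \<le> exp (- t / c) * (nrm F)^2"
proof -
  define R where "R h x = (P h F x - F x) / h - G x" for h x
  have R: "R h \<in> Bd" if "0 \<le> h" for h unfolding R_def using that F G by (intro Bd_diff Bd_divide P_Bd)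
  have R0: "((\<lambda>h. nrm (R h)) \<longlongrightarrow> 0) (at_right 0)"
    using gen unfolding generator_def R_def by blast
  have Psub: "P s (R h) x = (P h (P s F) x - P s F x) / h - P s G x" if "0 \<le> s" "0 < h" "x \<in> E" for s h x
  proof -
    have "P s (R h) x = P s (\<lambda>x. (P h F x - F x) / h) x - P s G x"
      unfolding R_def using that F G by (intro P_diff Bd_divide Bd_diff P_Bd) auto
    also have "P s (\<lambda>x. (P h F x - F x) / h) x = P s (\<lambda>x. P h F x - F x) x / h" by (rule P_divide)
    also have "P s (\<lambda>x. P h F x - F x) x = P s (P h F) x - P s F x" using that F by (intro P_diff) auto
    also have "P s (P h F) x = P h (P s F) x"
      using that F by (simp add: P_semigroup[symmetric] add.commute)
    finally show ?thesis .
  qed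
  have genP: "generator \<mu> \<kappa> (P s F) (P s G)" if s: "0 \<le> s" for s
  proof -
    have "((\<lambda>h. nrm (\<lambda>x. (P h (P s F) x - P s F x) / h - P s G x)) \<longlongrightarrow> 0) (at_right 0)"
    proof (rule Lim_null_comparison[OF _ R0])
      show "\<forall>\<^sub>F h in at_right 0. norm (nrm (\<lambda>x. (P h (P s F) x - P s F x) / h - P s G x)) \<le> nrm (R h)"
      proof (rule eventually_mono[OF eventually_at_right_less])
        fix h :: real assume h: "0 < h"
        have "nrm (\<lambda>x. (P h (P s F) x - P s F x) / h - P s G x) = nrm (P s (R h))"
          using Psub s h by (intro L2_norm_cong) (simp add: space_mu)
        also have "... \<le> nrm (R h)" using s h R by (intro P_norm_le) auto
        finally show "norm (nrm (\<lambda>x. (P h (P s F) x - P s F x) / h - P s G x)) \<le> nrm (R h)" by simp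
      qed
    qed
    then show ?thesis unfolding generator_def using s F G by (simp add: Bd_L2 P_Bd)
  qed
  define u where "u s = (nrm (P s F))^2" for s
  \<comment> \<open>The per-step error divided by \<open>h\<close>: the cross term from replacing
    the difference quotient by \<open>G\<close>, and the square of the increment.\<close>
  define w where "w h = 2 * nrm (R h) * nrm F + h * (nrm G + nrm (R h))^2" for h
  have step: "u (s + h) \<le> (1 - h / c) * u s + h * w h" if s: "0 \<le> s" and h: "0 < h" for s h
  proof -
    define A where "A x = P s G x + P s (R h) x" for x
    have B: "P s F \<in> Bd" "P s G \<in> Bd" "P s (R h) \<in> Bd" using s h F G R by auto
    then have A: "A \<in> Bd" unfolding A_def by auto
    have eq: "P (s + h) F x = P s F x + h * A x" if "x \<in> E" for x
      using Psub[OF s h that] that s h F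
      by (simp add: A_def P_semigroup[symmetric] add.commute field_simps)
    have "u (s + h) = mean (\<lambda>x. (P s F x)^2 + 2 * h * (P s F x * P s G x) + 2 * h * (P s F x * P s (R h) x) + h\<^sup>2 * (A x)^2)"
      unfolding u_def L2_norm_sq
      unfolding space_mu by (intro lint_cong refl, subst eq)
        (auto simp: space_mu A_def power2_eq_square algebra_simps)
    also have "... = u s + 2 * h * mean (\<lambda>x. P s F x * P s G x) + 2 * h * mean (\<lambda>x. P s F x * P s (R h) x) + h\<^sup>2 * (nrm A)^2"
      unfolding u_def L2_norm_sq using B A
      by (simp add: Bd_integrable Bd_mult Bd_L2 L2_integrable_square)
    finally have expand: "u (s + h) = u s + h * (2 * mean (\<lambda>x. P s F x * P s G x)) + 2 * h * mean (\<lambda>x. P s F x * P s (R h) x) + h\<^sup>2 * (nrm A)^2"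
      by simp
    \<comment> \<open>The Poincare inequality for \<open>P s F\<close>, which stays in the domain
      with image \<open>P s G\<close> and keeps mean 0.\<close>
    have "u s \<le> c * (- 2 * mean (\<lambda>x. P s F x * P s G x))"
      using PI[OF genP[OF s]] P_integral[OF s F] mean
      by (simp add: u_def L2_norm_sq integral_carre_du_champ_def)
    then have 1: "2 * mean (\<lambda>x. P s F x * P s G x) \<le> - (u s / c)"
      using c by (simp add: field_simps)
    have 2: "mean (\<lambda>x. P s F x * P s (R h) x) \<le> nrm (R h) * nrm F"
    proof -
      have "mean (\<lambda>x. P s F x * P s (R h) x) \<le> nrm (P s F) * nrm (P s (R h))"
        using L2_Cauchy_Schwarz[of "P s F" \<mu> "P s (R h)"] B by (simp add: Bd_L2)
      also have "... \<le> nrm F * nrm (R h)"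
        using s h F R by (intro mult_mono P_norm_le) auto
      finally show ?thesis by (simp add: mult.commute)
    qed
    have 3: "nrm A \<le> nrm G + nrm (R h)"
    proof -
      have "nrm A \<le> nrm (P s G) + nrm (P s (R h))"
        unfolding A_def using B by (intro L2_norm_triangle Bd_L2)
      also have "... \<le> nrm G + nrm (R h)" using s h G R by (intro add_mono P_norm_le) auto
      finally show ?thesis .
    qed
    have "u (s + h) \<le> u s + h * (- (u s / c)) + 2 * h * (nrm (R h) * nrm F) + h\<^sup>2 * (nrm G + nrm (R h))^2"
      unfolding expand using 1 2 3 h by (intro add_mono mult_left_mono power_mono order_refl) auto
    also have "... = (1 - h / c) * u s + h * w h"
      by (simp add: w_def algebra_simps power2_eq_square)
    finally show ?thesis .
  qed
  have w0: "(w \<longlongrightarrow> 0) (at_right 0)"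
    unfolding w_def by (rule tendsto_eq_intros R0 tendsto_ident_at refl | simp)+
  have u0: "0 \<le> u s" for s by (simp add: u_def)
  have u_init: "u 0 \<le> (nrm F)^2" unfolding u_def using F by (intro power_mono P_norm_le) auto
  have wn: "0 \<le> w h" if "0 \<le> h" for h using that by (simp add: w_def)
  \<comment> \<open>With \<open>h\<close> at most \<open>c\<close> the factor
    \<open>1 - h / c\<close> is nonnegative, so the induction hypothesis may be multiplied by
    it.\<close>
  have iter: "u (real n * h) \<le> exp (- (real n * h) / c) * u 0 + real n * h * w h" if h: "0 < h" "h \<le> c" for n h
  proof (induction n)
    case 0 then show ?case by simp
  next
    case (Suc n)
    have e: "0 \<le> 1 - h / c" "1 - h / c \<le> exp (- h / c)" "1 - h / c \<le> 1"
      using h c exp_ge_add_one_self[of "- h / c"] by auto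
    have "u (real (Suc n) * h) = u (real n * h + h)" by (simp add: algebra_simps)
    also have "... \<le> (1 - h / c) * u (real n * h) + h * w h" using h by (intro step) auto
    also have "(1 - h / c) * u (real n * h) \<le> (1 - h / c) * (exp (- (real n * h) / c) * u 0 + real n * h * w h)"
      using Suc.IH e by (intro mult_left_mono)
    also have "... = (1 - h / c) * (exp (- (real n * h) / c) * u 0) + (1 - h / c) * (real n * h * w h)"
      by (rule distrib_left)
    also have "... \<le> exp (- h / c) * (exp (- (real n * h) / c) * u 0) + 1 * (real n * h * w h)"
      using e u0 h wn[of h] by (intro add_mono mult_right_mono) auto
    also have "exp (- h / c) * (exp (- (real n * h) / c) * u 0) = exp (- (real (Suc n) * h) / c) * u 0"
      by (simp add: mult_exp_exp[symmetric] exp_add[symmetric] algebra_simps add_divide_distrib diff_divide_distrib)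
    finally show ?case by (simp add: algebra_simps)
  qed
  show ?thesis
  proof (cases "t = 0")
    case True then show ?thesis using u_init by (simp add: u_def)
  next
    case False
    then have tp: "0 < t" using t by simp
    have lim: "(\<lambda>n. exp (- t / c) * u 0 + t * w (t / real (Suc n))) \<longlonglongrightarrow> exp (- t / c) * u 0 + t * 0"
    proof (intro tendsto_intros filterlim_compose[OF w0])
      have "(\<lambda>n. t * inverse (real (Suc n))) \<longlonglongrightarrow> t * 0"
        by (intro tendsto_mult tendsto_const LIMSEQ_inverse_real_of_nat)
      then show "filterlim (\<lambda>n. t / real (Suc n)) (at_right 0) sequentially"
        using tp by (auto simp: filterlim_at divide_inverse)
    qed
    have "\<forall>\<^sub>F n in sequentially. u t \<le> exp (- t / c) * u 0 + t * w (t / real (Suc n))"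
    proof -
      obtain N :: nat where N: "t / c < real N" using reals_Archimedean2 by blast
      show ?thesis unfolding eventually_sequentially
      proof (intro exI allI impI)
        fix n assume n: "N \<le> n"
        have "t / c \<le> real (Suc n)" using N n by linarith
        then have "t / real (Suc n) \<le> c" using c by (simp add: field_simps)
        from iter[OF _ this, of "Suc n"] tp
        show "u t \<le> exp (- t / c) * u 0 + t * w (t / real (Suc n))" by simp
      qed
    qed
    from tendsto_lowerbound[OF lim this] have "u t \<le> exp (- t / c) * u 0" by simp
    also have "... \<le> exp (- t / c) * (nrm F)^2" using u_init by simp
    finally show ?thesis by (simp add: u_def)
  qed
qed

text \<open>The decay is proved for time averages \<open>F\<close> close to \<open>f\<close>, and
  contraction carries the approximation error along. The rate is half of \<open>1 / c\<close>
  because \<open>generator_decay\<close> concerns squared norms.\<close>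

theorem exponential_decay:
  assumes "poincare \<mu> \<kappa>"
  obtains \<gamma> where "0 < \<gamma>"
    "\<And>f t. f \<in> Bd \<Longrightarrow> mean f = 0 \<Longrightarrow> 0 \<le> t \<Longrightarrow> nrm (P t f) \<le> exp (- \<gamma> * t) * nrm f"
proof -
  obtain c where c: "0 < c" and PI: "\<And>f g. generator \<mu> \<kappa> f g \<Longrightarrow>
      (mean (\<lambda>x. (f x)^2)) - (mean f)\<^sup>2 \<le> c * integral_carre_du_champ \<mu> f g"
    using assms unfolding poincare_def by blast
  define \<gamma> where "\<gamma> = 1 / (2 * c)"
  have "nrm (P t f) \<le> exp (- \<gamma> * t) * nrm f" if f: "f \<in> Bd" and mean: "mean f = 0" and t: "0 \<le> t" for f t
  proof (rule field_le_epsilon)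
    fix z :: real assume "0 < z"
    then have z: "0 < z / 2" by simp
    from strong_continuity[OF f z] obtain e where e: "0 < e"
      "\<And>t. 0 \<le> t \<Longrightarrow> t \<le> e \<Longrightarrow> nrm (\<lambda>x. P t f x - f x) \<le> z / 2" by blast
    obtain F where F: "F \<in> Bd"
      "\<And>g. g \<in> Bd \<Longrightarrow> (mean (\<lambda>x. F x * g x)) = integral {0..e} (\<lambda>s. \<integral>x. g x * P s f x \<partial>\<mu>) / e"
      using averaged_semigroup_exists[OF f e(1)] by blast
    note near = averaged_semigroup_approx[OF f e(1) F e(2)]
    have G: "(\<lambda>x. (P e f x - f x) / e) \<in> Bd" using f e by (intro Bd_divide Bd_diff P_Bd) auto
    \<comment> \<open>Testing against 1 shows that averaging preserves the mean, so the decay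
      estimate applies to \<open>F\<close>.\<close>
    have "mean (\<lambda>x. F x * 1) = integral {0..e} (\<lambda>s. \<integral>x. 1 * P s f x \<partial>\<mu>) / e"
      by (rule F(2)) simp
    also have "integral {0..e} (\<lambda>s. \<integral>x. 1 * P s f x \<partial>\<mu>) = integral {0..e} (\<lambda>s. 0)"
      using P_integral[OF _ f] mean by (intro integral_cong) simp
    finally have meanF: "mean F = 0" by simp
    have "(nrm (P t F))^2 \<le> exp (- t / c) * (nrm F)^2"
      by (rule generator_decay[OF c PI F(1) G averaged_semigroup_generator[OF f e(1) F] meanF t])
    also have "... = (exp (- \<gamma> * t) * nrm F)^2"
      using c by (simp add: power_mult_distrib exp_double[symmetric] \<gamma>_def)
    finally have decF: "nrm (P t F) \<le> exp (- \<gamma> * t) * nrm F"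
      by (rule power2_le_imp_le) simp
    have PF: "P t F \<in> Bd" "P t f \<in> Bd" using t F f by auto
    have "nrm (P t f) \<le> nrm (\<lambda>x. P t f x - P t F x) + nrm (P t F)"
      using PF by (intro L2_norm_triangle_diff Bd_L2)
    also have "nrm (\<lambda>x. P t f x - P t F x) = nrm (P t (\<lambda>x. f x - F x))"
      using t f F by (intro L2_norm_cong) (simp add: P_diff space_mu)
    also have "... \<le> nrm (\<lambda>x. f x - F x)" using t f F by (intro P_norm_le) auto
    also have "... \<le> z / 2" using near L2_norm_minus_commute[of \<mu> f F] by simp
    also have "nrm (P t F) \<le> exp (- \<gamma> * t) * nrm F" by (rule decF)
    also have "nrm F \<le> nrm (\<lambda>x. F x - f x) + nrm f"
      using F f by (intro L2_norm_triangle_diff Bd_L2)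
    finally have "nrm (P t f) \<le> z / 2 + exp (- \<gamma> * t) * (z / 2 + nrm f)"
      using near by (smt (verit) exp_ge_zero mult_left_mono)
    also have "... = exp (- \<gamma> * t) * nrm f + (z / 2 + exp (- \<gamma> * t) * (z / 2))" by (simp add: algebra_simps)
    also have "exp (- \<gamma> * t) * (z / 2) \<le> 1 * (z / 2)"
      using z t c by (intro mult_right_mono) (auto simp: \<gamma>_def)
    finally show "nrm (P t f) \<le> exp (- \<gamma> * t) * nrm f + z" by simp
  qed
  moreover have "0 < \<gamma>" using c by (simp add: \<gamma>_def)
  ultimately show ?thesis using that by blast
qed

end

section \<open>Elementary inequalities for exponentials and grid averages\<close>

lemma exp_le_quadratic:
  assumes "\<bar>x\<bar> \<le> 1 / 2"
  shows "exp x \<le> 1 + x + (x::real)^2"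
proof -
  obtain t where t: "\<bar>t\<bar> \<le> \<bar>x\<bar>" "exp x = (\<Sum>m<2. x ^ m / fact m) + exp t / fact 2 * x ^ 2"
    using Maclaurin_exp_le[of x 2] by auto
  have "exp t \<le> exp (1 / 2)" using t(1) assms by simp
  also have "... \<le> 2" by (rule exp_half_le2)
  finally have "exp t / 2 * x\<^sup>2 \<le> 1 * x\<^sup>2" by (intro mult_right_mono) auto
  then show ?thesis using t(2) by (simp add: numeral_2_eq_2)
qed

text \<open>Jensen's inequality: the tangent line of \<open>exp\<close> at the mean value lies below
  \<open>exp\<close> and is integrated.\<close>

lemma average_exp_ge:
  fixes R :: "real \<Rightarrow> real"
  assumes d: "0 < d" and R[measurable]: "R \<in> borel_measurable borel" and Rb: "\<And>v. \<bar>R v\<bar> \<le> B"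
  shows "exp ((LBINT v:{0..<d}. R v) / d) \<le> (LBINT v:{0..<d}. exp (R v)) / d"
proof -
  define x where "x = (LBINT v:{0..<d}. R v) / d"
  have int: "set_integrable lborel {0..<d} g" if [measurable]: "g \<in> borel_measurable borel" and "\<And>v. \<bar>g v\<bar> \<le> B'" for g :: "real \<Rightarrow> real" and B'
    unfolding set_integrable_def
    by (rule integrableI_bounded_set_indicator[where B = B']) (use that d in auto)
  have iR: "set_integrable lborel {0..<d} R" using Rb by (intro int) auto
  have eb: "\<bar>exp (R v)\<bar> \<le> exp B" for v using Rb[of v] by auto
  have iE: "set_integrable lborel {0..<d} (\<lambda>v. exp (R v))" by (rule int[OF _ eb]) auto
  have iC: "set_integrable lborel {0..<d} (\<lambda>v. c :: real)" for c by (rule int[of _ "\<bar>c\<bar>"]) auto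
  have "exp x * d = exp x * d + exp x * ((LBINT v:{0..<d}. R v) - x * d)"
    using d by (simp add: x_def)
  also have "... = (LBINT v:{0..<d}. exp x * (1 - x) + exp x * R v)"
  proof -
    have "(LBINT v:{0..<d}. exp x * (1 - x) + exp x * R v) = (LBINT v:{0..<d}. exp x * (1 - x)) + (LBINT v:{0..<d}. exp x * R v)"
      by (intro set_integral_add iC set_integrable_mult_right iR)
    also have "(LBINT v:{0..<d}. exp x * (1 - x)) = d * (exp x * (1 - x))"
      using d by (simp add: set_lebesgue_integral_def mult.commute)
    finally show ?thesis by (simp add: algebra_simps)
  qed
  also have "... \<le> (LBINT v:{0..<d}. exp (R v))"
  proof (rule set_integral_mono)
    fix v
    have "exp x * (1 + (R v - x)) \<le> exp x * exp (R v - x)"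
      by (intro mult_left_mono exp_ge_add_one_self) auto
    also have "... = exp (R v)" by (simp add: exp_diff)
    finally show "exp x * (1 - x) + exp x * R v \<le> exp (R v)" by (simp add: algebra_simps)
  qed (intro set_integral_add iC set_integrable_mult_right iR iE)+
  finally show ?thesis using d by (simp add: x_def pos_le_divide_eq)
qed

text \<open>Folds \<open>n\<close> consecutive cells of length \<open>d\<close> onto the first one:
  the integral over time becomes an integral over the offset of sums along a shifted grid.\<close>

lemma set_integral_split_cells:
  fixes g :: "real \<Rightarrow> real"
  assumes d: "0 < d" and g[measurable]: "g \<in> borel_measurable borel" and gb: "\<And>v. \<bar>g v\<bar> \<le> B"
  shows "(LBINT u:{0..<real n * d}. g u) = (LBINT v:{0..<d}. \<Sum>i<n. g (real i * d + v))"
proof -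
  have fin: "emeasure lborel {a..<b} < \<infinity>" for a b :: real
    by (rule emeasure_bounded_finite, rule bounded_subset[OF bounded_closed_interval[of a b]]) auto
  have int: "set_integrable lborel {a..<b} h" if [measurable]: "h \<in> borel_measurable borel" and "\<And>v. \<bar>h v\<bar> \<le> B'" for h :: "real \<Rightarrow> real" and B' a b
    unfolding set_integrable_def
    by (rule integrableI_bounded_set_indicator[where B = B']) (use that fin in auto)
  show ?thesis
  proof (induction n)
    case 0 then show ?case by (simp add: set_lebesgue_integral_def)
  next
    case (Suc n)
    have dn: "0 \<le> d * real n" using d by simp
    have "{0..<real (Suc n) * d} = {0..<real n * d} \<union> {real n * d..<real (Suc n) * d}"
      using d dn by (auto simp: algebra_simps not_less intro: order_trans[OF dn])
    moreover have "{0..<real n * d} \<inter> {real n * d..<real (Suc n) * d} = {}" by auto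
    ultimately have "(LBINT u:{0..<real (Suc n) * d}. g u) = (LBINT u:{0..<real n * d}. g u) + (LBINT u:{real n * d..<real (Suc n) * d}. g u)"
      by (simp add: set_integral_Un int[OF g gb])
    also have "(LBINT u:{real n * d..<real (Suc n) * d}. g u) = (LBINT v:{0..<d}. g (real n * d + v))"
      unfolding set_lebesgue_integral_def
      by (subst lborel_integral_real_affine[where c = 1 and t = "real n * d"])
        (auto intro!: lint_cong simp: indicator_def algebra_simps)
    also have "(LBINT u:{0..<real n * d}. g u) = (LBINT v:{0..<d}. \<Sum>i<n. g (real i * d + v))" by (rule Suc.IH)
    also have "(LBINT v:{0..<d}. \<Sum>i<n. g (real i * d + v)) + (LBINT v:{0..<d}. g (real n * d + v)) =
        (LBINT v:{0..<d}. \<Sum>i<Suc n. g (real i * d + v))"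
    proof -
      have b: "\<bar>\<Sum>i<n. g (real i * d + v)\<bar> \<le> real n * B" for v
        using sum_mono[of "{..<n}" "\<lambda>i. \<bar>g (real i * d + v)\<bar>" "\<lambda>_. B"] gb
        by (intro order_trans[OF sum_abs]) simp
      have "set_integrable lborel {0..<d} (\<lambda>v. \<Sum>i<n. g (real i * d + v))"
        by (rule int[OF _ b]) measurable
      moreover have "set_integrable lborel {0..<d} (\<lambda>v. g (real n * d + v))"
        by (rule int[OF _ gb]) measurable
      ultimately show ?thesis by (simp add: set_integral_add)
    qed
    finally show ?case .
  qed
qed

section \<open>Exponential moments\<close>

locale spectral_gap_process = stationary_reversible_process M \<mu> X E \<kappa>
  for M :: "'w measure" and \<mu> :: "'a::euclidean_space measure" and X E \<kappa> +
  fixes \<gamma> :: real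
  assumes gap_pos: "0 < \<gamma>"
    and decay: "\<And>f t. f \<in> Bd \<Longrightarrow> mean f = 0 \<Longrightarrow> 0 \<le> t \<Longrightarrow> nrm (P t f) \<le> exp (- \<gamma> * t) * nrm f"
begin

lemma Bd_exp [intro]: "f \<in> Bd \<Longrightarrow> (\<lambda>x. exp (f x)) \<in> Bd"
proof -
  assume f: "f \<in> Bd"
  obtain c where c: "\<And>x. x \<in> E \<Longrightarrow> \<bar>f x\<bar> \<le> c" using BdE[OF f] by metis
  have "\<bar>exp (f x)\<bar> \<le> exp c" if "x \<in> E" for x using c[OF that] by auto
  then show ?thesis using Bd_measurable[OF f] by (intro BdI[where c = "exp c"]) auto
qed

text \<open>One grid step of a discrete Feynman-Kac semigroup. The function \<open>h\<close> splits
  into its mean \<alpha> and a centred part, which \<open>P d\<close> shrinks by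
  \<open>exp (- \<gamma> * d)\<close>. As \<open>f\<close> has mean 0, it contributes nothing at
  first order to the square of \<alpha>; its cross term and its action on the centred part are paid
  for by that shrinking.\<close>

lemma weighted_contraction:
  assumes f: "f \<in> Bd" "mean f = 0" "\<And>x. x \<in> E \<Longrightarrow> \<bar>f x\<bar> \<le> b"
    and L: "0 \<le> L" "L * b \<le> \<gamma>" and d: "0 < d" "d * \<gamma> \<le> 1 / 2" and h: "h \<in> Bd"
  shows "(nrm (\<lambda>x. exp (L / 2 * d * f x) * P d h x))^2 \<le> exp (d * L\<^sup>2 * (nrm f)^2 / \<gamma> + d\<^sup>2 * \<gamma>\<^sup>2) * (nrm h)^2"
proof -
  define \<alpha> where "\<alpha> = mean h"
  define k where "k = P d (\<lambda>x. h x - \<alpha>)"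
  define s where "s = nrm f"
  \<comment> \<open>Inside this proof the name denotes a norm; the kernel remains present only
    through \<open>P\<close>.\<close>
  define \<kappa> where "\<kappa> = nrm k"
  define S where "S = L * s"
  have nn: "0 \<le> \<kappa>" "0 \<le> s" "0 \<le> S" using L by (auto simp: \<kappa>_def s_def S_def)
  have b0: "0 \<le> b" using f(3) mu.not_empty space_mu by (metis abs_ge_zero all_not_in_conv order_trans)
  have h0: "(\<lambda>x. h x - \<alpha>) \<in> Bd" using h by auto
  have k: "k \<in> Bd" unfolding k_def using d h0 by (intro P_Bd) auto
  have keq: "P d h x = \<alpha> + k x" if "x \<in> E" for x
    using P_diff[of d h "\<lambda>_. \<alpha>" x] P_const[of d x \<alpha>] d h that by (simp add: k_def)
  have h0m: "mean (\<lambda>x. h x - \<alpha>) = 0"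
    using h by (simp add: Bochner_Integration.integral_diff Bd_integrable mu.prob_space \<alpha>_def)
  have km: "mean k = 0" unfolding k_def using P_integral[OF _ h0, of d] d h0m by simp
  have e: "(nrm (\<lambda>x. h x - \<alpha>))^2 = (nrm h)^2 - \<alpha>\<^sup>2"
    unfolding \<alpha>_def using h by (intro mu.L2_norm_centered Bd_L2)
  have kdec: "exp (2 * (d * \<gamma>)) * \<kappa>\<^sup>2 \<le> (nrm h)^2 - \<alpha>\<^sup>2"
  proof -
    have "\<kappa> \<le> exp (- \<gamma> * d) * nrm (\<lambda>x. h x - \<alpha>)"
      unfolding \<kappa>_def k_def using d h0 h0m by (intro decay) auto
    then have "\<kappa>\<^sup>2 \<le> (exp (- \<gamma> * d) * nrm (\<lambda>x. h x - \<alpha>))^2" using nn by (intro power_mono)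
    also have "... = exp (- (2 * (d * \<gamma>))) * ((nrm h)^2 - \<alpha>\<^sup>2)"
      by (simp add: power_mult_distrib e exp_double[symmetric] mult.commute)
    finally show ?thesis by (simp add: exp_minus field_simps)
  qed
  have kk: "(\<lambda>x. \<alpha> + k x) \<in> Bd" using k by (intro Bd_add Bd_const)
  have Bf: "(\<lambda>x. f x * (\<alpha> + k x)^2) \<in> Bd" "(\<lambda>x. (\<alpha> + k x)^2) \<in> Bd" "(\<lambda>x. f x * k x) \<in> Bd" "(\<lambda>x. f x * (k x)^2) \<in> Bd" "(\<lambda>x. (k x)^2) \<in> Bd"
    using Bd_mult[OF kk kk] Bd_mult[OF f(1) Bd_mult[OF kk kk]] Bd_mult[OF f(1) k] Bd_mult[OF f(1) Bd_mult[OF k k]] Bd_mult[OF k k]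
    by (simp_all add: power2_eq_square)
  have Q: "mean (\<lambda>x. (\<alpha> + k x)^2) = \<alpha>\<^sup>2 + \<kappa>\<^sup>2"
  proof -
    have "mean (\<lambda>x. (\<alpha> + k x)^2) = mean (\<lambda>x. \<alpha>\<^sup>2 + 2 * \<alpha> * k x + (k x)^2)"
      by (intro lint_cong) (auto simp: power2_eq_square algebra_simps)
    also have "... = \<alpha>\<^sup>2 + \<kappa>\<^sup>2"
      using k Bf km by (simp add: Bd_integrable mu.prob_space \<kappa>_def L2_norm_sq)
    finally show ?thesis .
  qed
  have fQ: "mean (\<lambda>x. f x * (\<alpha> + k x)^2) \<le> 2 * \<bar>\<alpha>\<bar> * (s * \<kappa>) + b * \<kappa>\<^sup>2"
  proof -
    have "mean (\<lambda>x. f x * (\<alpha> + k x)^2) = mean (\<lambda>x. \<alpha>\<^sup>2 * f x + 2 * \<alpha> * (f x * k x) + f x * (k x)^2)"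
      by (intro lint_cong) (auto simp: power2_eq_square algebra_simps)
    also have "... = 2 * \<alpha> * mean (\<lambda>x. f x * k x) + mean (\<lambda>x. f x * (k x)^2)"
      using f Bf by (simp add: Bd_integrable)
    also have "2 * \<alpha> * mean (\<lambda>x. f x * k x) \<le> 2 * \<bar>\<alpha>\<bar> * (s * \<kappa>)"
    proof -
      have "2 * \<alpha> * mean (\<lambda>x. f x * k x) \<le> \<bar>2 * \<alpha> * mean (\<lambda>x. f x * k x)\<bar>" by (rule abs_ge_self)
      also have "... = 2 * \<bar>\<alpha>\<bar> * \<bar>\<integral>x. f x * k x \<partial>\<mu>\<bar>" by (simp add: abs_mult)
      also have "... \<le> 2 * \<bar>\<alpha>\<bar> * (s * \<kappa>)"
        unfolding s_def \<kappa>_def using f k by (intro mult_left_mono L2_Cauchy_Schwarz Bd_L2) auto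
      finally show ?thesis .
    qed
    also have "mean (\<lambda>x. f x * (k x)^2) \<le> mean (\<lambda>x. b * (k x)^2)"
      using f(3) Bf by (intro integral_mono Bd_integrable Bd_cmult) (auto simp: space_mu abs_le_iff intro!: mult_right_mono)
    also have "... = b * \<kappa>\<^sup>2" by (simp add: \<kappa>_def L2_norm_sq)
    finally show ?thesis by simp
  qed
  have "(nrm (\<lambda>x. exp (L / 2 * d * f x) * P d h x))^2 = mean (\<lambda>x. exp (L * d * f x) * (\<alpha> + k x)^2)"
    unfolding L2_norm_sq by (intro lint_cong refl)
      (simp add: keq space_mu power_mult_distrib exp_double[symmetric])
  also have "... \<le> mean (\<lambda>x. (1 + (d * \<gamma>)^2) * (\<alpha> + k x)^2 + L * d * (f x * (\<alpha> + k x)^2))"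
  proof (rule integral_mono)
    show "integrable \<mu> (\<lambda>x. exp (L * d * f x) * (\<alpha> + k x)^2)"
      using f Bf by (intro Bd_integrable Bd_mult Bd_exp Bd_cmult)
    show "integrable \<mu> (\<lambda>x. (1 + (d * \<gamma>)^2) * (\<alpha> + k x)^2 + L * d * (f x * (\<alpha> + k x)^2))"
      using f Bf by (intro Bd_integrable Bd_add Bd_cmult)
    fix x assume "x \<in> space \<mu>"
    then have "\<bar>L * d * f x\<bar> \<le> L * d * b"
      using f(3) L d by (auto simp: abs_mult space_mu intro!: mult_left_mono)
    also have "... \<le> d * \<gamma>" using mult_left_mono[OF L(2), of d] d by (simp add: ac_simps)
    finally have small: "\<bar>L * d * f x\<bar> \<le> d * \<gamma>" .
    then have "exp (L * d * f x) \<le> 1 + L * d * f x + (L * d * f x)^2"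
      using d by (intro exp_le_quadratic) linarith
    also have "(L * d * f x)^2 \<le> (d * \<gamma>)^2" using power_mono[OF small abs_ge_zero, of 2] by simp
    finally have "exp (L * d * f x) \<le> 1 + L * d * f x + (d * \<gamma>)^2" by simp
    from mult_right_mono[OF this zero_le_power2[of "\<alpha> + k x"]]
    show "exp (L * d * f x) * (\<alpha> + k x)^2 \<le> (1 + (d * \<gamma>)^2) * (\<alpha> + k x)^2 + L * d * (f x * (\<alpha> + k x)^2)"
      by (simp add: algebra_simps)
  qed
  also have "... = (1 + (d * \<gamma>)^2) * (\<alpha>\<^sup>2 + \<kappa>\<^sup>2) + L * d * mean (\<lambda>x. f x * (\<alpha> + k x)^2)"
    using Bf by (simp add: Bd_integrable Q)
  also have "... \<le> (1 + (d * \<gamma>)^2) * (\<alpha>\<^sup>2 + \<kappa>\<^sup>2) + L * d * (2 * \<bar>\<alpha>\<bar> * (s * \<kappa>) + b * \<kappa>\<^sup>2)"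
    using fQ L d by (intro add_left_mono mult_left_mono) auto
  also have "... = (1 + (d * \<gamma>)^2) * (\<alpha>\<^sup>2 + \<kappa>\<^sup>2) + d * (2 * (\<bar>\<alpha>\<bar> * S) * \<kappa>) + d * (L * b) * \<kappa>\<^sup>2"
    by (simp add: S_def algebra_simps)
  \<comment> \<open>Young's inequality with weight \<gamma>. Together with
    \<open>L * b \<le> \<gamma>\<close> it makes the coefficient of the centred part exactly
    \<open>(1 + d * \<gamma>)^2\<close>, which the decay factor
    \<open>exp (2 * (d * \<gamma>))\<close> absorbs.\<close>
  also have "... \<le> (1 + (d * \<gamma>)^2) * (\<alpha>\<^sup>2 + \<kappa>\<^sup>2) + d * (S\<^sup>2 / \<gamma> * \<alpha>\<^sup>2 + \<gamma> * \<kappa>\<^sup>2) + d * \<gamma> * \<kappa>\<^sup>2"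
  proof (intro add_mono mult_left_mono mult_right_mono order_refl)
    have "0 \<le> (\<bar>\<alpha>\<bar> * S - \<gamma> * \<kappa>)^2" by simp
    also have "... = (\<bar>\<alpha>\<bar> * S)^2 + (\<gamma> * \<kappa>)^2 - 2 * (\<bar>\<alpha>\<bar> * S) * (\<gamma> * \<kappa>)" by (rule power2_diff)
    finally have "\<gamma> * (2 * (\<bar>\<alpha>\<bar> * S) * \<kappa>) \<le> \<gamma> * (S\<^sup>2 / \<gamma> * \<alpha>\<^sup>2 + \<gamma> * \<kappa>\<^sup>2)"
      using gap_pos by (simp add: power_mult_distrib power2_eq_square algebra_simps)
    then show "2 * (\<bar>\<alpha>\<bar> * S) * \<kappa> \<le> S\<^sup>2 / \<gamma> * \<alpha>\<^sup>2 + \<gamma> * \<kappa>\<^sup>2"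
      using gap_pos by simp
  qed (use d L in auto)
  also have "... = (1 + (d * \<gamma>)^2 + d * S\<^sup>2 / \<gamma>) * \<alpha>\<^sup>2 + (1 + d * \<gamma>)^2 * \<kappa>\<^sup>2"
    by (simp add: power2_eq_square algebra_simps)
  also have "(1 + d * \<gamma>)^2 * \<kappa>\<^sup>2 \<le> (exp (d * \<gamma>))^2 * \<kappa>\<^sup>2"
    using d gap_pos exp_ge_add_one_self[of "d * \<gamma>"] by (intro mult_right_mono power_mono) auto
  also have "(exp (d * \<gamma>))^2 * \<kappa>\<^sup>2 \<le> (nrm h)^2 - \<alpha>\<^sup>2" using kdec by (simp add: exp_double)
  also have "(nrm h)^2 - \<alpha>\<^sup>2 \<le> (1 + (d * \<gamma>)^2 + d * S\<^sup>2 / \<gamma>) * ((nrm h)^2 - \<alpha>\<^sup>2)"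
  proof -
    have "0 \<le> (nrm h)^2 - \<alpha>\<^sup>2" unfolding e[symmetric] by simp
    moreover have "0 \<le> (d * \<gamma>)^2 + d * S\<^sup>2 / \<gamma>" using d gap_pos by (intro add_nonneg_nonneg) auto
    ultimately have "0 \<le> ((d * \<gamma>)^2 + d * S\<^sup>2 / \<gamma>) * ((nrm h)^2 - \<alpha>\<^sup>2)" by (rule mult_nonneg_nonneg[OF _ _, rotated])
    then show ?thesis by (simp add: algebra_simps)
  qed
  finally have "(nrm (\<lambda>x. exp (L / 2 * d * f x) * P d h x))^2 \<le> (1 + (d * S\<^sup>2 / \<gamma> + (d * \<gamma>)^2)) * (nrm h)^2"
    by (simp add: algebra_simps)
  also have "... \<le> exp (d * S\<^sup>2 / \<gamma> + (d * \<gamma>)^2) * (nrm h)^2"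
    by (intro mult_right_mono exp_ge_add_one_self) auto
  finally show ?thesis by (simp add: S_def s_def power_mult_distrib mult.assoc)
qed

text \<open>Peels off the last grid time: the Markov property replaces \<open>g\<close> there by
  \<open>P d g\<close> one step earlier, and the last weight is merged into it, giving a new
  terminal function whose norm \<open>weighted_contraction\<close> controls. Hence \<open>g\<close>
  is arbitrary in the induction.\<close>

lemma skeleton_product_bound:
  assumes f: "f \<in> Bd" "mean f = 0" "\<And>x. x \<in> E \<Longrightarrow> \<bar>f x\<bar> \<le> b"
    and L: "0 \<le> L" "L * b \<le> \<gamma>" and d: "0 < d" "d * \<gamma> \<le> 1 / 2" and v: "0 \<le> v" and g: "g \<in> Bd"
  shows "(\<integral>w. exp (\<Sum>i<n. L / 2 * d * f (X (real i * d + v) w)) * g (X (real n * d + v) w) \<partial>M)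
    \<le> exp (real n * ((d * L\<^sup>2 * (nrm f)^2 / \<gamma> + d\<^sup>2 * \<gamma>\<^sup>2) / 2)) * nrm g"
  using g
proof (induction n arbitrary: g)
  case 0
  have "(\<integral>w. g (X v w) \<partial>M) = mean g" using 0 v by (intro integral_X) (auto simp: Bd_measurable)
  also have "... \<le> nrm g" using mu.L2_norm_ge_integral[OF Bd_L2[OF 0]] by linarith
  finally show ?case by simp
next
  case (Suc n)
  let ?r = "(d * L\<^sup>2 * (nrm f)^2 / \<gamma> + d\<^sup>2 * \<gamma>\<^sup>2) / 2"
  let ?S = "\<lambda>n w. \<Sum>i<n. L / 2 * d * f (X (real i * d + v) w)"
  let ?s = "real n * d + v"
  define h where "h x = exp (L / 2 * d * f x) * P d g x" for x
  have h: "h \<in> Bd" unfolding h_def using f Suc.prems d by (intro Bd_mult Bd_exp Bd_cmult P_Bd) auto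
  have s: "0 \<le> ?s" using d v by simp
  have "(\<integral>w. exp (?S (Suc n) w) * g (X (real (Suc n) * d + v) w) \<partial>M) = (\<integral>w. exp (?S (Suc n) w) * g (X (?s + d) w) \<partial>M)"
    by (simp add: algebra_simps)
  also have "... = (\<integral>w. exp (?S (Suc n) w) * P d g (X ?s w) \<partial>M)"
  proof (rule markov_property[OF s _ _ _ Suc.prems])
    show "(\<lambda>w. exp (?S (Suc n) w)) \<in> borel_measurable (Filt ?s)"
      using d v by (intro borel_measurable_exp borel_measurable_sum borel_measurable_times borel_measurable_const
          measurable_compose[OF X_Filt Bd_measurable[OF f(1)]] borel_measurable_exp[THEN measurable_compose_rev]
          measurable_compose[OF _ borel_measurable_exp]) (auto intro!: mult_right_mono)
    fix w assume w: "w \<in> space M"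
    have "?S (Suc n) w \<le> (\<Sum>i<Suc n. L / 2 * d * b)"
      using L d v w abs_le_D1[OF f(3)] by (intro sum_mono mult_left_mono) (auto simp: X_in_E)
    then show "\<bar>exp (?S (Suc n) w)\<bar> \<le> exp (\<Sum>i<Suc n. L / 2 * d * b)" by simp
  qed (use d in auto)
  also have "... = (\<integral>w. exp (?S n w) * h (X ?s w) \<partial>M)"
    by (simp add: h_def exp_add mult.assoc)
  also have "... \<le> exp (real n * ?r) * nrm h" by (rule Suc.IH[OF h])
  also have "nrm h \<le> exp ?r * nrm g"
  proof (rule power2_le_imp_le)
    have "(nrm h)^2 \<le> exp (d * L\<^sup>2 * (nrm f)^2 / \<gamma> + d\<^sup>2 * \<gamma>\<^sup>2) * (nrm g)^2"
      unfolding h_def by (rule weighted_contraction[OF f L d Suc.prems])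
    also have "... = (exp ?r * nrm g)^2" by (simp add: power_mult_distrib exp_double[symmetric])
    finally show "(nrm h)^2 \<le> (exp ?r * nrm g)^2" .
  qed simp
  finally have "(\<integral>w. exp (?S (Suc n) w) * g (X (real (Suc n) * d + v) w) \<partial>M) \<le> exp (real n * ?r) * (exp ?r * nrm g)"
    by simp
  moreover have "exp (real (Suc n) * r) = exp (real n * r) * exp r" for r
    by (simp add: exp_add[symmetric] distrib_right add.commute)
  ultimately show ?case by (simp only: mult.assoc)
qed

text \<open>The path integral is the average over offsets \<open>v\<close> of grid sums of mesh
  \<open>d = T / n\<close>, so Jensen's inequality bounds its exponential by the average of
  exponentials of grid sums. Each is covered by \<open>skeleton_product_bound\<close> with
  \<open>L = 2 * l\<close> and terminal function 1; the term with \<open>n\<close> in the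
  denominator is the discretisation error.\<close>

lemma mgf_skeleton_bound:
  assumes f: "f \<in> Bd" "mean f = 0" "\<And>x. x \<in> E \<Longrightarrow> \<bar>f x\<bar> \<le> b"
    and l: "0 \<le> l" "2 * l * b \<le> \<gamma>" and T: "0 < T" and n: "2 * T * \<gamma> \<le> real n" "0 < n"
  shows "(\<integral>w. exp (l * path_integral T f w) \<partial>M) \<le> exp (2 * l\<^sup>2 * T * (nrm f)^2 / \<gamma> + T\<^sup>2 * \<gamma>\<^sup>2 / (2 * real n))"
proof -
  define d where "d = T / real n"
  have d: "0 < d" "d * \<gamma> \<le> 1 / 2" "real n * d = T" using T n by (auto simp: d_def field_simps)
  have fm[measurable]: "f \<in> borel_measurable \<mu>" using f(1) by (rule Bd_measurable)
  have b0: "0 \<le> b" using f(3) mu.not_empty space_mu by (metis abs_ge_zero all_not_in_conv order_trans)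
  have Xm[measurable]: "(\<lambda>p. X (max 0 (fst p)) (snd p)) \<in> borel \<Otimes>\<^sub>M M \<rightarrow>\<^sub>M \<mu>" by (rule X_max_measurable)
  define R where "R v w = (\<Sum>i<n. l * d * f (X (max 0 (real i * d + v)) w))" for v w
  have Rpair: "(\<lambda>p. R (fst p) (snd p)) \<in> borel_measurable (borel \<Otimes>\<^sub>M M)"
  proof -
    have "(\<lambda>p. f (X (max 0 (real i * d + fst p)) (snd p))) \<in> borel_measurable (borel \<Otimes>\<^sub>M M)" for i
      using measurable_compose[OF _ measurable_compose[OF Xm fm], of "\<lambda>p. (real i * d + fst p, snd p)" "borel \<Otimes>\<^sub>M M"] by simp
    then show ?thesis unfolding R_def by (intro borel_measurable_sum borel_measurable_times) auto
  qed
  have Rb: "\<bar>R v w\<bar> \<le> real n * (l * d * b)" if "w \<in> space M" for v w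
  proof -
    have "\<bar>R v w\<bar> \<le> (\<Sum>i<n. \<bar>l * d * f (X (max 0 (real i * d + v)) w)\<bar>)" unfolding R_def by (rule sum_abs)
    also have "... \<le> (\<Sum>i<n. l * d * b)"
      using l d f(3) that by (intro sum_mono) (auto simp: abs_mult X_in_E intro!: mult_left_mono)
    finally show ?thesis by simp
  qed
  note Rb' = abs_le_D1[OF Rb]
  have Rv: "R v \<in> borel_measurable M" for v
    using measurable_compose[OF measurable_Pair1' Rpair, of v] by simp
  have Rw: "(\<lambda>v. R v w) \<in> borel_measurable borel" if "w \<in> space M" for w
    using measurable_compose[OF measurable_Pair2'[OF that] Rpair] by simp
  have jensen: "exp (l * path_integral T f w) \<le> (LBINT v:{0..<d}. exp (R v w)) / d" if w: "w \<in> space M" for w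
  proof -
    have fX: "(\<lambda>u. f (X (max 0 u) w)) \<in> borel_measurable borel" by (rule path_measurable[OF w fm])
    \<comment> \<open>The endpoint \<open>T\<close>, a null set, is dropped so that half-open cells
      tile the interval.\<close>
    have "path_integral T f w = (LBINT u:{0..<T}. f (X (max 0 u) w))"
      unfolding path_integral_def set_lebesgue_integral_def
    proof (rule integral_cong_AE)
      have "AE u in lborel. u \<noteq> T" by (rule AE_lborel_singleton)
      then show "AE u in lborel. indicator {0..T} u *\<^sub>R f (X u w) = indicator {0..<T} u *\<^sub>R f (X (max 0 u) w)"
        by eventually_elim (auto simp: indicator_def)
      have "(\<lambda>u. indicator {0..T} u *\<^sub>R f (X u w)) = (\<lambda>u. indicator {0..T} u *\<^sub>R f (X (max 0 u) w))"
        by (auto simp: indicator_def)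
      then show "(\<lambda>u. indicator {0..T} u *\<^sub>R f (X u w)) \<in> borel_measurable lborel" using fX by simp
    qed (use fX in simp)
    also have "... = (LBINT v:{0..<d}. \<Sum>i<n. f (X (max 0 (real i * d + v)) w))"
      unfolding d(3)[symmetric] using fX f(3) w d by (intro set_integral_split_cells[where B = b]) (auto simp: X_in_E)
    finally have "l * path_integral T f w = (LBINT v:{0..<d}. R v w) / d"
      using d(1) by (simp add: R_def sum_distrib_left[symmetric] mult.assoc)
    then show ?thesis using average_exp_ge[OF d(1) Rw[OF w] Rb[OF w]] by simp
  qed
  have Rexp: "(\<integral>w. exp (R v w) \<partial>M) \<le> exp (2 * l\<^sup>2 * T * (nrm f)^2 / \<gamma> + T\<^sup>2 * \<gamma>\<^sup>2 / (2 * real n))" (is "_ \<le> ?B") if v: "0 \<le> v" for v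
  proof -
    have "(\<integral>w. exp (R v w) \<partial>M) = (\<integral>w. exp (\<Sum>i<n. (2 * l) / 2 * d * f (X (real i * d + v) w)) * 1 \<partial>M)"
      unfolding R_def using v d by simp
    also have "... \<le> exp (real n * ((d * (2 * l)^2 * (nrm f)^2 / \<gamma> + d\<^sup>2 * \<gamma>\<^sup>2) / 2)) * nrm (\<lambda>_. 1)"
      using l d v f by (intro skeleton_product_bound[where g = "\<lambda>_. 1"]) auto
    also have "real n * ((d * (2 * l)^2 * (nrm f)^2 / \<gamma> + d\<^sup>2 * \<gamma>\<^sup>2) / 2) = 2 * l\<^sup>2 * T * (nrm f)^2 / \<gamma> + T\<^sup>2 * \<gamma>\<^sup>2 / (2 * real n)"
      using n gap_pos by (simp add: d_def power2_eq_square field_simps)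
    finally show ?thesis by (simp add: mu.L2_norm_const)
  qed
  have expint: "integrable M (\<lambda>w. exp (R v w))" for v
    using Rb' Rv[of v] by (intro integrable_const_bound[where B = "exp (real n * (l * d * b))"]) (auto intro!: AE_I2)
  interpret pair_sigma_finite lborel M by unfold_locales
  let ?k = "\<lambda>v w. indicator {0..<d} v * exp (R v w)"
  have int: "integrable (lborel \<Otimes>\<^sub>M M) (case_prod ?k)"
  proof (rule integrableI_bounded_set[where A = "{0..<d} \<times> space M" and B = "exp (real n * (l * d * b))"])
    show "{0..<d} \<times> space M \<in> sets (lborel \<Otimes>\<^sub>M M)" by auto
    show "emeasure (lborel \<Otimes>\<^sub>M M) ({0..<d} \<times> space M) < \<infinity>"
      using d by (subst sigma_finite_measure.emeasure_pair_measure_Times[OF prob_space_imp_sigma_finite[OF prob_space_axioms]]) (auto simp: emeasure_space_1)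
    show "case_prod ?k \<in> borel_measurable (lborel \<Otimes>\<^sub>M M)"
      unfolding split_beta' using Rpair by simp
    show "AE p in lborel \<Otimes>\<^sub>M M. p \<in> {0..<d} \<times> space M \<longrightarrow> norm (case_prod ?k p) \<le> exp (real n * (l * d * b))"
      using Rb' by (intro AE_I2) (auto simp: abs_mult)
    show "AE p in lborel \<Otimes>\<^sub>M M. p \<notin> {0..<d} \<times> space M \<longrightarrow> case_prod ?k p = 0"
      by (intro AE_I2) (auto simp: space_pair_measure indicator_def)
  qed
  have "(\<integral>w. exp (l * path_integral T f w) \<partial>M) \<le> (\<integral>w. (\<integral>v. ?k v w \<partial>lborel) / d \<partial>M)"
  proof (rule integral_mono)
    have "l * path_integral T f w \<le> l * (b * T)" if "w \<in> space M" for w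
      using path_integral_bound[OF _ that fm f(3), of T] T l by (intro mult_left_mono) auto
    then show "integrable M (\<lambda>w. exp (l * path_integral T f w))"
      by (intro integrable_const_bound[where B = "exp (l * (b * T))"]) (auto intro!: AE_I2)
    show "integrable M (\<lambda>w. (\<integral>v. ?k v w \<partial>lborel) / d)"
      using integrable_snd[OF int] by simp
    show "exp (l * path_integral T f w) \<le> (\<integral>v. ?k v w \<partial>lborel) / d" if "w \<in> space M" for w
      using jensen[OF that] by (simp add: set_lebesgue_integral_def)
  qed
  also have "... = (\<integral>v. (\<integral>w. ?k v w \<partial>M) \<partial>lborel) / d"
    using Fubini_integral[OF int] by simp
  also have "(\<integral>v. (\<integral>w. ?k v w \<partial>M) \<partial>lborel) \<le> (\<integral>v. ?B * indicator {0..<d} v \<partial>lborel)"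
  proof (rule integral_mono)
    show "integrable lborel (\<lambda>v. \<integral>w. ?k v w \<partial>M)" using integrable_fst[OF int] by simp
    show "integrable lborel (\<lambda>v. ?B * indicator {0..<d} v)" using d by simp
    show "(\<integral>w. ?k v w \<partial>M) \<le> ?B * indicator {0..<d} v" for v
      using Rexp[of v] by (simp add: indicator_def)
  qed
  also have "(\<integral>v. ?B * indicator {0..<d} v \<partial>lborel) / d = ?B" using d by simp
  finally show ?thesis using d by (simp add: divide_right_mono)
qed

lemma mgf_bound:
  assumes f: "f \<in> Bd" "mean f = 0" "\<And>x. x \<in> E \<Longrightarrow> \<bar>f x\<bar> \<le> b"
    and l: "0 \<le> l" "2 * l * b \<le> \<gamma>" and T: "0 < T"
  shows "(\<integral>w. exp (l * path_integral T f w) \<partial>M) \<le> exp (2 * l\<^sup>2 * T * (nrm f)^2 / \<gamma>)"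
proof -
  let ?a = "2 * l\<^sup>2 * T * (nrm f)^2 / \<gamma>"
  have "(\<lambda>n. exp (?a + T\<^sup>2 * \<gamma>\<^sup>2 / 2 * inverse (real (Suc n)))) \<longlonglongrightarrow> exp (?a + T\<^sup>2 * \<gamma>\<^sup>2 / 2 * 0)"
    by (intro tendsto_intros LIMSEQ_inverse_real_of_nat)
  then have lim: "(\<lambda>n. exp (?a + T\<^sup>2 * \<gamma>\<^sup>2 / 2 * inverse (real (Suc n)))) \<longlonglongrightarrow> exp ?a" by simp
  obtain N :: nat where N: "2 * T * \<gamma> < real N" using reals_Archimedean2 by blast
  have "(\<integral>w. exp (l * path_integral T f w) \<partial>M) \<le> exp (?a + T\<^sup>2 * \<gamma>\<^sup>2 / 2 * inverse (real (Suc n)))" if "N \<le> n" for n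
    using mgf_skeleton_bound[OF f l T, of "Suc n"] N that by (simp add: inverse_eq_divide)
  then show ?thesis by (intro tendsto_lowerbound[OF lim]) (auto simp: eventually_sequentially)
qed

end

section \<open>Path integrals of unbounded functions and their deviations\<close>

context stationary_reversible_process
begin

abbreviation path_integrable :: "real \<Rightarrow> 'w \<Rightarrow> ('a \<Rightarrow> real) \<Rightarrow> bool" where
  "path_integrable T w g \<equiv> set_integrable lborel {0..T} (\<lambda>u. g (X u w))"

lemma path_set_measurable:
  fixes g :: "'a \<Rightarrow> real"
  assumes "w \<in> space M" "g \<in> borel_measurable \<mu>"
  shows "(\<lambda>u. indicator {0..T} u *\<^sub>R g (X u w)) \<in> borel_measurable lborel"
proof -
  have "(\<lambda>u. indicator {0..T} u *\<^sub>R g (X u w)) = (\<lambda>u. indicator {0..T} u *\<^sub>R g (X (max 0 u) w))"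
    by (intro ext) (simp add: indicator_def)
  then show ?thesis using path_measurable[OF assms] by simp
qed

lemma path_integrable_bound:
  assumes w: "w \<in> space M" and g: "g \<in> borel_measurable \<mu>" and h: "path_integrable T w h"
    and le: "\<And>x. x \<in> E \<Longrightarrow> \<bar>g x\<bar> \<le> \<bar>h x\<bar>"
  shows "path_integrable T w g"
  unfolding set_integrable_def
proof (rule Bochner_Integration.integrable_bound[OF h[unfolded set_integrable_def]])
  show "(\<lambda>u. indicator {0..T} u *\<^sub>R g (X u w)) \<in> borel_measurable lborel" by (rule path_set_measurable[OF w g])
  show "AE u in lborel. norm (indicator {0..T} u *\<^sub>R g (X u w)) \<le> norm (indicator {0..T} u *\<^sub>R h (X u w))"
    using le X_in_E[OF _ w] by (intro AE_I2) (auto simp: indicator_def)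
qed

lemma path_integrable_bounded:
  assumes w: "w \<in> space M" and g: "g \<in> Bd"
  shows "path_integrable T w g"
proof -
  obtain c where c: "0 \<le> c" "\<And>x. x \<in> E \<Longrightarrow> \<bar>g x\<bar> \<le> c" using BdE[OF g] by blast
  have "emeasure lborel {0..T} < \<infinity>" by (rule emeasure_bounded_finite) simp
  then have "path_integrable T w (\<lambda>_. c)" by (simp add: set_integrable_def)
  then show ?thesis using c Bd_measurable[OF g] by (rule_tac path_integrable_bound[OF w]) auto
qed

lemma path_integral_add:
  "path_integrable T w f \<Longrightarrow> path_integrable T w g \<Longrightarrow>
    path_integral T (\<lambda>x. f x + g x) w = path_integral T f w + path_integral T g w"
  unfolding path_integral_def by (rule set_integral_add)

lemma path_integral_diff:
  "path_integrable T w f \<Longrightarrow> path_integrable T w g \<Longrightarrow>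
    path_integral T (\<lambda>x. f x - g x) w = path_integral T f w - path_integral T g w"
  unfolding path_integral_def by (rule set_integral_diff)

lemma path_integral_cmult: "path_integral T (\<lambda>x. c * f x) w = c * path_integral T f w"
  unfolding path_integral_def by simp

lemma path_integral_sum:
  assumes "finite I" "\<And>i. i \<in> I \<Longrightarrow> path_integrable T w (f i)"
  shows "path_integrable T w (\<lambda>x. \<Sum>i\<in>I. f i x) \<and>
    path_integral T (\<lambda>x. \<Sum>i\<in>I. f i x) w = (\<Sum>i\<in>I. path_integral T (f i) w)"
  using assms
proof (induction I)
  case empty
  then show ?case by (simp add: path_integral_def set_integrable_def set_lebesgue_integral_def)
next
  case (insert i I)
  then show ?case by (simp add: path_integral_add set_integral_add)
qed

lemma path_integral_const: "0 \<le> T \<Longrightarrow> path_integral T (\<lambda>_. c) w = T * c"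
  unfolding path_integral_def set_lebesgue_integral_def by simp

lemma path_integral_abs_le:
  assumes w: "w \<in> space M" and g: "g \<in> borel_measurable \<mu>" and h: "path_integrable T w h"
    and le: "\<And>x. x \<in> E \<Longrightarrow> \<bar>g x\<bar> \<le> h x"
  shows "\<bar>path_integral T g w\<bar> \<le> path_integral T h w"
proof -
  have le': "\<bar>g x\<bar> \<le> \<bar>h x\<bar>" if "x \<in> E" for x using le[OF that] by linarith
  note gi = path_integrable_bound[OF w g h le']
  have "\<bar>path_integral T g w\<bar> \<le> (LBINT u:{0..T}. \<bar>g (X u w)\<bar>)"
    unfolding path_integral_def using set_integral_norm_bound[OF gi] by simp
  also have "... \<le> path_integral T h w"
    unfolding path_integral_def using set_integrable_abs[OF gi] h le X_in_E[OF _ w] by (intro set_integral_mono) auto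
  finally show ?thesis .
qed

text \<open>By stationarity the inner integral of \<open>\<bar>g\<bar>\<close> is the same at every
  time, so the double integral is \<open>T\<close> times the \<mu>-integral of
  \<open>\<bar>g\<bar>\<close>.\<close>

lemma path_product_integrable:
  fixes g :: "'a \<Rightarrow> real"
  assumes T: "0 \<le> T" and g: "integrable \<mu> g"
  shows "integrable (lborel \<Otimes>\<^sub>M M) (\<lambda>(u, w). indicator {0..T} u * g (X (max 0 u) w))"
proof (rule integrableI_bounded)
  have gm[measurable]: "g \<in> borel_measurable \<mu>" using g by auto
  have Xm[measurable]: "(\<lambda>p. X (max 0 (fst p)) (snd p)) \<in> lborel \<Otimes>\<^sub>M M \<rightarrow>\<^sub>M \<mu>" using X_max_measurable by simp
  show m: "(\<lambda>(u, w). indicator {0..T} u * g (X (max 0 u) w)) \<in> borel_measurable (lborel \<Otimes>\<^sub>M M)"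
    unfolding split_beta' by measurable
  have "(\<integral>\<^sup>+p. ennreal (norm (case p of (u, w) \<Rightarrow> indicator {0..T} u * g (X (max 0 u) w))) \<partial>(lborel \<Otimes>\<^sub>M M)) =
      (\<integral>\<^sup>+u. \<integral>\<^sup>+w. ennreal (norm (indicator {0..T} u * g (X (max 0 u) w))) \<partial>M \<partial>lborel)"
    using m by (subst nn_integral_fst[symmetric]) auto
  also have "... = (\<integral>\<^sup>+u. indicator {0..T} u * (\<integral>\<^sup>+x. ennreal (norm (g x)) \<partial>\<mu>) \<partial>lborel)"
  proof (rule nn_integral_cong)
    fix u :: real
    have "(\<integral>\<^sup>+w. ennreal (norm (g (X (max 0 u) w))) \<partial>M) = (\<integral>\<^sup>+x. ennreal (norm (g x)) \<partial>\<mu>)"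
      by (intro nn_integral_X) auto
    then show "(\<integral>\<^sup>+w. ennreal (norm (indicator {0..T} u * g (X (max 0 u) w))) \<partial>M) =
      indicator {0..T} u * (\<integral>\<^sup>+x. ennreal (norm (g x)) \<partial>\<mu>)"
      by (auto simp: indicator_def)
  qed
  also have "... = ennreal T * (\<integral>\<^sup>+x. ennreal (norm (g x)) \<partial>\<mu>)"
    using T by (subst nn_integral_multc) auto
  also have "... < \<infinity>"
    using g by (simp add: integrable_iff_bounded ennreal_mult_less_top)
  finally show "(\<integral>\<^sup>+p. ennreal (norm (case p of (u, w) \<Rightarrow> indicator {0..T} u * g (X (max 0 u) w))) \<partial>(lborel \<Otimes>\<^sub>M M)) < \<infinity>" .
qed

lemma indicator_X_max:
  "indicator {0..T} u *\<^sub>R g (X u w) = indicator {0..T} u * g (X (max 0 u) w)" for g :: "'a \<Rightarrow> real"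
  by (simp add: indicator_def)

lemma path_integrable_AE:
  assumes "0 \<le> T" "integrable \<mu> g"
  shows "AE w in M. path_integrable T w g"
proof -
  interpret pair_sigma_finite lborel M by unfold_locales
  show ?thesis
    using AE_integrable_snd[OF path_product_integrable[OF assms]] unfolding set_integrable_def indicator_X_max .
qed

lemma path_integral_integrable:
  assumes "0 \<le> T" "integrable \<mu> g"
  shows "integrable M (path_integral T g)" "(\<integral>w. path_integral T g w \<partial>M) = T * mean g"
proof -
  interpret pair_sigma_finite lborel M by unfold_locales
  have eq: "path_integral T g = (\<lambda>w. \<integral>u. indicator {0..T} u * g (X (max 0 u) w) \<partial>lborel)"
    unfolding path_integral_def set_lebesgue_integral_def indicator_X_max ..
  show "integrable M (path_integral T g)"
    using integrable_snd[OF path_product_integrable[OF assms]] unfolding eq .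
  have "(\<integral>w. path_integral T g w \<partial>M) = (\<integral>u. (\<integral>w. indicator {0..T} u * g (X (max 0 u) w) \<partial>M) \<partial>lborel)"
    unfolding eq by (rule Fubini_integral[OF path_product_integrable[OF assms]])
  also have "... = (\<integral>u. indicator {0..T} u * mean g \<partial>lborel)"
    using assms(2) by (intro lint_cong refl) (simp add: integral_X)
  also have "... = T * mean g" using assms(1) by simp
  finally show "(\<integral>w. path_integral T g w \<partial>M) = T * mean g" .
qed

text \<open>The truncated pieces into which chaining cuts a mean-zero function no longer have mean
  zero; hence the centring.\<close>

definition dev :: "real \<Rightarrow> ('a \<Rightarrow> real) \<Rightarrow> 'w \<Rightarrow> real" where
  "dev T g w = (path_integral T g w - T * mean g) / sqrt T"

lemma dev_measurable [measurable]:
  "g \<in> borel_measurable \<mu> \<Longrightarrow> dev T g \<in> borel_measurable M"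
  unfolding dev_def by simp

lemma dev_add:
  assumes "path_integrable T w f" "path_integrable T w g" "integrable \<mu> f" "integrable \<mu> g"
  shows "dev T (\<lambda>x. f x + g x) w = dev T f w + dev T g w"
  using assms by (simp add: dev_def path_integral_add add_divide_distrib[symmetric] algebra_simps)

lemma dev_sum:
  assumes "finite I" "\<And>i. i \<in> I \<Longrightarrow> path_integrable T w (f i)" "\<And>i. i \<in> I \<Longrightarrow> integrable \<mu> (f i)"
  shows "dev T (\<lambda>x. \<Sum>i\<in>I. f i x) w = (\<Sum>i\<in>I. dev T (f i) w)"
  using assms by (simp add: dev_def path_integral_sum sum_divide_distrib[symmetric] sum_subtractf sum_distrib_left)

text \<open>Centring destroys domination; the price is two means of \<open>h\<close>, scaled by
  \<open>sqrt T\<close>. Chaining uses this to replace pieces that depend on the individual function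
  by majorants that depend on its brackets only.\<close>

lemma dev_dominated:
  assumes w: "w \<in> space M" and T: "0 < T" and g: "g \<in> borel_measurable \<mu>"
    and h: "path_integrable T w h" "integrable \<mu> h"
    and le: "\<And>x. x \<in> E \<Longrightarrow> \<bar>g x\<bar> \<le> h x"
  shows "\<bar>dev T g w\<bar> \<le> dev T h w + 2 * sqrt T * mean h"
proof -
  have 1: "\<bar>path_integral T g w\<bar> \<le> path_integral T h w" by (rule path_integral_abs_le[OF w g h(1) le])
  have gi: "integrable \<mu> g"
    by (rule Bochner_Integration.integrable_bound[OF h(2) g])
      (use le in \<open>force intro!: AE_I2 simp: space_mu\<close>)
  have "\<bar>\<integral>x. g x \<partial>\<mu>\<bar> \<le> mean (\<lambda>x. \<bar>g x\<bar>)" by (rule integral_abs_bound)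
  also have "... \<le> mean h" using gi h(2) le by (intro integral_mono) (auto simp: space_mu)
  finally have 2: "T * \<bar>\<integral>x. g x \<partial>\<mu>\<bar> \<le> T * mean h" using T by (intro mult_left_mono) auto
  have "\<bar>path_integral T g w - T * mean g\<bar> \<le> \<bar>path_integral T g w\<bar> + \<bar>T * mean g\<bar>" by (rule abs_triangle_ineq4)
  also have "\<bar>T * mean g\<bar> = T * \<bar>\<integral>x. g x \<partial>\<mu>\<bar>" using T by (simp add: abs_mult)
  also have "\<bar>path_integral T g w\<bar> + T * \<bar>\<integral>x. g x \<partial>\<mu>\<bar> \<le> (path_integral T h w - T * mean h) + 2 * T * mean h"
    using 1 2 by simp
  finally have "\<bar>dev T g w\<bar> \<le> ((path_integral T h w - T * mean h) + 2 * T * mean h) / sqrt T"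
    using T by (simp add: dev_def divide_right_mono)
  also have "... = dev T h w + 2 * sqrt T * mean h"
  proof -
    have "T / sqrt T = sqrt T" using T by (intro real_div_sqrt) simp
    moreover have "2 * T * mean h / sqrt T = 2 * (T / sqrt T) * mean h" by simp
    ultimately show ?thesis unfolding dev_def by (simp only: add_divide_distrib)
  qed
  finally show ?thesis .
qed

end

context spectral_gap_process
begin

text \<open>Centring at most doubles the bound on \<open>f\<close>, which turns the condition
  \<open>2 * l * b \<le> \<gamma>\<close> of \<open>mgf_bound\<close>, at
  \<open>l = z / sqrt T\<close>, into \<open>4 * z * a \<le> \<gamma>\<close>.\<close>

lemma mgf_deviation:
  assumes f: "f \<in> Bd" "\<And>x. x \<in> E \<Longrightarrow> \<bar>f x\<bar> \<le> sqrt T * a" and T: "0 < T"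
    and z: "0 \<le> z" "4 * z * a \<le> \<gamma>" and s: "nrm f \<le> s"
  shows "integrable M (\<lambda>w. exp (z * dev T f w))"
    "(\<integral>w. exp (z * dev T f w) \<partial>M) \<le> exp (2 * z\<^sup>2 * s\<^sup>2 / \<gamma>)"
proof -
  define m where "m = mean f"
  define h where "h x = f x - m" for x
  have h: "h \<in> Bd" unfolding h_def using f by auto
  have hm: "mean h = 0"
    unfolding h_def using f by (simp add: Bd_integrable mu.prob_space m_def)
  have mb: "\<bar>m\<bar> \<le> sqrt T * a"
  proof -
    have "\<bar>m\<bar> \<le> mean (\<lambda>x. \<bar>f x\<bar>)" unfolding m_def by (rule integral_abs_bound)
    also have "... \<le> mean (\<lambda>x. sqrt T * a)" using f by (intro integral_mono) (auto simp: space_mu Bd_integrable)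
    finally show ?thesis by (simp add: mu.prob_space)
  qed
  have hb: "\<bar>h x\<bar> \<le> 2 * (sqrt T * a)" if "x \<in> E" for x
    using f(2)[OF that] mb by (simp add: h_def)
  have hn: "(nrm h)^2 \<le> s\<^sup>2"
  proof -
    have "(nrm h)^2 \<le> (nrm f)^2" unfolding h_def m_def using mu.L2_norm_centered[OF Bd_L2[OF f(1)]] by simp
    also have "... \<le> s\<^sup>2" using s by (intro power_mono) auto
    finally show ?thesis .
  qed
  have eq: "z * dev T f w = z / sqrt T * path_integral T h w" if "w \<in> space M" for w
    using T path_integrable_bounded[OF that f(1)] path_integrable_bounded[OF that Bd_const]
    by (simp add: dev_def h_def[abs_def] path_integral_diff path_integral_const m_def)
  have "z / sqrt T * path_integral T h w \<le> z / sqrt T * (2 * (sqrt T * a) * T)" if "w \<in> space M" for w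
    using path_integral_bound[OF _ that Bd_measurable[OF h] hb, of T] T z by (intro mult_left_mono) auto
  then have "integrable M (\<lambda>w. exp (z / sqrt T * path_integral T h w))"
    using path_integral_measurable[OF Bd_measurable[OF h], of T]
    by (intro integrable_const_bound[where B = "exp (z / sqrt T * (2 * (sqrt T * a) * T))"]) (auto intro!: AE_I2)
  then show "integrable M (\<lambda>w. exp (z * dev T f w))"
    by (subst Bochner_Integration.integrable_cong[OF refl, of _ _ "\<lambda>w. exp (z / sqrt T * path_integral T h w)"]) (auto simp: eq)
  have "(\<integral>w. exp (z * dev T f w) \<partial>M) = (\<integral>w. exp (z / sqrt T * path_integral T h w) \<partial>M)"
    by (intro lint_cong) (auto simp: eq)
  also have "... \<le> exp (2 * (z / sqrt T)^2 * T * (nrm h)^2 / \<gamma>)"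
  proof (rule mgf_bound[OF h hm hb])
    show "2 * (z / sqrt T) * (2 * (sqrt T * a)) \<le> \<gamma>" using z T by simp
  qed (use z T in auto)
  also have "... \<le> exp (2 * z\<^sup>2 * s\<^sup>2 / \<gamma>)"
    using T gap_pos hn by (auto simp: power_divide intro!: divide_right_mono mult_left_mono)
  finally show "(\<integral>w. exp (z * dev T f w) \<partial>M) \<le> exp (2 * z\<^sup>2 * s\<^sup>2 / \<gamma>)" .
qed

text \<open>The maximum is controlled by the logarithm of a sum of exponentials of both signs. That
  logarithm is replaced by a tangent line, so the majorant \<open>R\<close> is affine in the sum and
  its mean follows directly from the Laplace transform bounds.\<close>

lemma maximal_inequality:
  assumes \<Psi>: "finite \<Psi>" "card \<Psi> \<le> N" and \<Psi>_Bd: "\<And>h. h \<in> \<Psi> \<Longrightarrow> h \<in> Bd"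
    and \<Psi>_le: "\<And>h x. h \<in> \<Psi> \<Longrightarrow> x \<in> E \<Longrightarrow> \<bar>h x\<bar> \<le> sqrt T * a" and \<Psi>_nrm: "\<And>h. h \<in> \<Psi> \<Longrightarrow> nrm h \<le> s"
    and T: "0 < T" and v: "0 < v" "4 * v * a \<le> \<gamma>"
  shows "\<exists>R. integrable M R \<and> (\<forall>w\<in>space M. 0 \<le> R w) \<and> (\<forall>h\<in>\<Psi>. \<forall>w\<in>space M. \<bar>dev T h w\<bar> \<le> R w) \<and>
    (\<integral>w. R w \<partial>M) \<le> (ln (2 * (real N + 1)) + 2 * v\<^sup>2 * s\<^sup>2 / \<gamma>) / v"
proof -
  define e where "e = exp (2 * v\<^sup>2 * s\<^sup>2 / \<gamma>)"
  define m where "m = 2 * (real N + 1) * e"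
  \<comment> \<open>The summand 2 makes \<open>R\<close> nonnegative even for empty \<Psi>, and is
    the reason for \<open>N + 1\<close> in place of \<open>N\<close> in the bound \<open>m\<close>
    on the mean of \<open>S\<close>.\<close>
  define S where "S w = 2 + (\<Sum>h\<in>\<Psi>. exp (v * dev T h w) + exp (v * dev T (\<lambda>x. - h x) w))" for w
  define R where "R w = (S w / m + ln m - 1) / v" for w
  have e1: "1 \<le> e" using v gap_pos by (simp add: e_def)
  have m0: "0 < m" using e1 by (simp add: m_def add_nonneg_pos)
  have neg: "(\<lambda>x. - h x) \<in> Bd" "nrm (\<lambda>x. - h x) \<le> s" if "h \<in> \<Psi>" for h
    using Bd_cmult[OF \<Psi>_Bd[OF that], of "-1"] \<Psi>_nrm[OF that] L2_norm_cmult[of \<mu> "-1" h] by auto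
  have 1: "integrable M (\<lambda>w. exp (v * dev T h w))"
    "(\<integral>w. exp (v * dev T h w) \<partial>M) \<le> e" if "h \<in> \<Psi>" for h
    unfolding e_def by (intro mgf_deviation[OF \<Psi>_Bd _ T _ v(2) \<Psi>_nrm]; use that v \<Psi>_le in simp)+
  have 2: "integrable M (\<lambda>w. exp (v * dev T (\<lambda>x. - h x) w))"
    "(\<integral>w. exp (v * dev T (\<lambda>x. - h x) w) \<partial>M) \<le> e" if "h \<in> \<Psi>" for h
    unfolding e_def by (intro mgf_deviation[OF neg(1) _ T _ v(2) neg(2)]; use that v \<Psi>_le in simp)+
  have Sint: "integrable M S"
    unfolding S_def using 1 2 by (intro Bochner_Integration.integrable_add integrable_sum) auto
  have "(\<integral>w. S w \<partial>M) = 2 + (\<Sum>h\<in>\<Psi>. (\<integral>w. exp (v * dev T h w) \<partial>M) + (\<integral>w. exp (v * dev T (\<lambda>x. - h x) w) \<partial>M))"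
    unfolding S_def using 1 2 by (simp add: prob_space)
  also have "... \<le> 2 + (\<Sum>h\<in>\<Psi>. e + e)"
    using 1(2) 2(2) by (intro add_left_mono sum_mono add_mono) (auto simp: e_def)
  also have "... = 2 + real (card \<Psi>) * (2 * e)" by simp
  also have "... \<le> 2 * e + real N * (2 * e)" using e1 \<Psi>(2) by (intro add_mono mult_right_mono) auto
  also have "... = m" by (simp add: m_def algebra_simps)
  finally have ES: "(\<integral>w. S w \<partial>M) \<le> m" .
  \<comment> \<open>The tangent of the logarithm at \<open>m\<close>; since the mean of
    \<open>S\<close> is at most \<open>m\<close>, the terms \<open>S / m\<close> and -1 cancel in
    mean.\<close>
  have lnle: "ln y \<le> y / m + ln m - 1" if "0 < y" for y
  proof -
    have "ln (y / m) \<le> y / m - 1" using that m0 by (intro ln_le_minus_one) auto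
    then show ?thesis using that m0 by (simp add: ln_div)
  qed
  have S2: "2 \<le> S w" for w unfolding S_def by (simp add: sum_nonneg)
  have key: "z \<le> R w" if "exp (v * z) \<le> S w" for z w
  proof -
    have "v * z \<le> ln (S w)" using that S2[of w] by (simp add: ln_ge_iff)
    also have "... \<le> v * R w" using lnle[of "S w"] S2[of w] v by (simp add: R_def)
    finally show ?thesis using v by simp
  qed
  show ?thesis
  proof (intro exI[of _ R] conjI ballI)
    show "integrable M R" unfolding R_def using Sint by simp
    show "0 \<le> R w" for w using S2[of w] by (intro key) simp
    show "\<bar>dev T h w\<bar> \<le> R w" if h: "h \<in> \<Psi>" for h w
    proof -
      have "exp (v * dev T h w) + exp (v * dev T (\<lambda>x. - h x) w) \<le>
          (\<Sum>h\<in>\<Psi>. exp (v * dev T h w) + exp (v * dev T (\<lambda>x. - h x) w))"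
        using \<Psi>(1) h by (intro member_le_sum) (auto intro: add_nonneg_nonneg)
      then have "exp (v * dev T h w) \<le> S w" "exp (v * dev T (\<lambda>x. - h x) w) \<le> S w"
        unfolding S_def using exp_gt_zero[of "v * dev T h w"] exp_gt_zero[of "v * dev T (\<lambda>x. - h x) w"] by linarith+
      moreover have "dev T (\<lambda>x. - h x) w = - dev T h w"
        using path_integral_cmult[of T "-1" h w] by (simp add: dev_def minus_divide_left)
      ultimately have "dev T h w \<le> R w" "- dev T h w \<le> R w" by (auto intro!: key)
      then show ?thesis by linarith
    qed
    have "(\<integral>w. R w \<partial>M) = ((\<integral>w. S w \<partial>M) / m + ln m - 1) / v"
      unfolding R_def using Sint by (simp add: prob_space)
    also have "... \<le> (1 + ln m - 1) / v"
      using ES m0 v by (intro divide_right_mono diff_right_mono add_right_mono) auto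
    also have "ln m = ln (2 * (real N + 1)) + 2 * v\<^sup>2 * s\<^sup>2 / \<gamma>"
      unfolding m_def by (subst ln_mult) (auto simp: e_def)
    finally show "(\<integral>w. R w \<partial>M) \<le> (ln (2 * (real N + 1)) + 2 * v\<^sup>2 * s\<^sup>2 / \<gamma>) / v" by simp
  qed
qed

end

lemma (in stationary_reversible_process) Bd_sum [intro]:
  "(\<And>i. i \<in> I \<Longrightarrow> f i \<in> Bd) \<Longrightarrow> (\<lambda>x. \<Sum>i\<in>I. f i x) \<in> Bd"
  by (induction I rule: infinite_finite_induct) (auto intro!: Bd_add)

section \<open>Chaining along brackets\<close>

locale bracket_chain = spectral_gap_process M \<mu> X E \<kappa> \<gamma>
  for M :: "'w measure" and \<mu> :: "'a::euclidean_space measure" and X E \<kappa> \<gamma> +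
  fixes F :: "('a \<Rightarrow> real) set" and br :: "nat \<Rightarrow> ('a \<Rightarrow> real) \<Rightarrow> ('a \<Rightarrow> real) \<times> ('a \<Rightarrow> real)"
  assumes F_L2_0: "F \<subseteq> L2_0 \<mu>"
    and br_L2: "f \<in> F \<Longrightarrow> fst (br q f) \<in> L2 \<mu>" "f \<in> F \<Longrightarrow> snd (br q f) \<in> L2 \<mu>"
    and br_le: "f \<in> F \<Longrightarrow> x \<in> E \<Longrightarrow> fst (br q f) x \<le> f x" "f \<in> F \<Longrightarrow> x \<in> E \<Longrightarrow> f x \<le> snd (br q f) x"
    and br_size: "f \<in> F \<Longrightarrow> nrm (\<lambda>x. snd (br q f) x - fst (br q f) x) \<le> (1 / 2) ^ q"
    and br_finite: "finite (br q ` F)"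
begin

text \<open>Recording the brackets of all levels up to \<open>q\<close> makes the induced partitions
  of \<open>F\<close> nested, which the brackets of the single levels need not be.\<close>

definition lab :: "nat \<Rightarrow> ('a \<Rightarrow> real) \<Rightarrow> (('a \<Rightarrow> real) \<times> ('a \<Rightarrow> real)) list" where
  "lab q f = map (\<lambda>r. br r f) [0..<Suc q]"

text \<open>The choice depends on \<open>f\<close> through its label only, so each class of the
  partition has one representative.\<close>

definition rep :: "nat \<Rightarrow> ('a \<Rightarrow> real) \<Rightarrow> 'a \<Rightarrow> real" where
  "rep q f = (SOME g. g \<in> F \<and> lab q g = lab q f)"

text \<open>The minimum over all coarser levels makes the widths decrease in the level.\<close>

primrec Del :: "nat \<Rightarrow> ('a \<Rightarrow> real) \<Rightarrow> 'a \<Rightarrow> real" where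
  "Del 0 f x = snd (br 0 f) x - fst (br 0 f) x"
| "Del (Suc q) f x = min (Del q f x) (snd (br (Suc q) f) x - fst (br (Suc q) f) x)"

text \<open>Root of the logarithmic factor in \<open>maximal_inequality\<close>;
  \<open>2 * (_ + 1)\<close> keeps it positive even for empty \<open>F\<close>.\<close>

definition Len :: "nat \<Rightarrow> real" where
  "Len q = sqrt (ln (2 * (real (card (lab q ` F)) + 1)))"

text \<open>Chosen so that \<open>4 * z * thr q = \<gamma>\<close> for the exponent
  \<open>z = 2 ^ q * Len (Suc q)\<close>, which balances the entropy against the variance of
  functions of norm at most \<open>(1 / 2) ^ q\<close>. The shifted index appears because a link
  from level \<open>q\<close> to the next one is determined by the label at
  \<open>Suc q\<close>.\<close>

definition thr :: "nat \<Rightarrow> real" where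
  "thr q = \<gamma> / 4 * (1 / 2) ^ q / Len (Suc q)"

definition below :: "real \<Rightarrow> nat \<Rightarrow> ('a \<Rightarrow> real) \<Rightarrow> 'a \<Rightarrow> real" where
  "below T q f x = (if Del q f x \<le> sqrt T * thr q then 1 else 0)"

text \<open>Marks the points not yet truncated on arrival at level \<open>q\<close>. Level
  \<open>q\<close> itself is excluded, and at \<open>q = p\<close> the empty product is 1.\<close>

definition bel :: "real \<Rightarrow> nat \<Rightarrow> nat \<Rightarrow> ('a \<Rightarrow> real) \<Rightarrow> 'a \<Rightarrow> real" where
  "bel T p q f x = (\<Prod>r\<in>{p..<q}. below T r f x)"

lemma F_L2: "f \<in> F \<Longrightarrow> f \<in> L2 \<mu>"
  using F_L2_0 by (auto simp: L2_0_def)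

lemma lab_Suc: "lab (Suc q) f = lab q f @ [br (Suc q) f]"
  by (simp add: lab_def)

lemma lab_finite: "finite (lab q ` F)"
proof (induction q)
  case 0
  have "lab 0 ` F = (\<lambda>b. [b]) ` (br 0 ` F)" by (auto simp: lab_def)
  then show ?case using br_finite[of 0] by simp
next
  case (Suc q)
  have "lab (Suc q) ` F \<subseteq> (\<lambda>(a, b). a @ [b]) ` (lab q ` F \<times> br (Suc q) ` F)" by (auto simp: lab_Suc)
  then show ?case by (rule finite_subset) (use Suc br_finite[of "Suc q"] in simp)
qed

lemma lab_br: "lab q f = lab q g \<Longrightarrow> r \<le> q \<Longrightarrow> br r f = br r g"
  by (auto simp: lab_def)

lemma lab_le: "lab q f = lab q g \<Longrightarrow> r \<le> q \<Longrightarrow> lab r f = lab r g"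
  by (auto simp: lab_def)

lemma Del_cong: "lab q f = lab q g \<Longrightarrow> Del q f = Del q g"
proof (induction q)
  case 0 then show ?case by (auto simp: lab_def)
next
  case (Suc q)
  from Suc.IH lab_le[OF Suc.prems, of q] lab_br[OF Suc.prems, of "Suc q"] show ?case by (intro ext) simp
qed

lemma below_cong: "lab q f = lab q g \<Longrightarrow> r \<le> q \<Longrightarrow> below T r f = below T r g"
  using Del_cong[OF lab_le, of q f g r] by (intro ext) (simp add: below_def)

lemma bel_cong: "lab q f = lab q g \<Longrightarrow> n \<le> Suc q \<Longrightarrow> bel T p n f = bel T p n g"
  unfolding bel_def using below_cong[of q f g] by (intro ext prod.cong refl) simp

lemma rep_properties:
  assumes "f \<in> F"
  shows "rep q f \<in> F \<and> lab q (rep q f) = lab q f"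
  unfolding rep_def by (rule someI[of "\<lambda>g. g \<in> F \<and> lab q g = lab q f" f]) (simp add: assms)

lemmas rep_in = rep_properties[THEN conjunct1]
  and lab_rep = rep_properties[THEN conjunct2]

lemma rep_cong: "lab q f = lab q g \<Longrightarrow> rep q f = rep q g"
  by (simp add: rep_def)

text \<open>A quantity determined by the label factors through the finite set of labels; this is how
  a supremum over \<open>F\<close> becomes a maximum over finitely many functions.\<close>

lemma label_image:
  assumes "\<And>f g. f \<in> F \<Longrightarrow> g \<in> F \<Longrightarrow> lab q f = lab q g \<Longrightarrow> h f = h g"
  shows "finite (h ` F) \<and> card (h ` F) \<le> card (lab q ` F)"
proof -
  have "h ` F = (\<lambda>l. h (SOME f. f \<in> F \<and> lab q f = l)) ` (lab q ` F)"
    unfolding image_image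
  proof (rule image_cong[OF refl])
    fix f assume f: "f \<in> F"
    show "h f = h (SOME g. g \<in> F \<and> lab q g = lab q f)"
      using assms[OF f rep_in[OF f] lab_rep[OF f, symmetric]] by (simp only: rep_def)
  qed
  then show ?thesis using card_image_le[OF lab_finite] lab_finite by simp
qed

lemma Del_le: "r \<le> q \<Longrightarrow> Del q f x \<le> Del r f x"
  by (induction q) (auto simp: le_Suc_eq min_le_iff_disj)

lemma Del_le_width: "Del q f x \<le> snd (br q f) x - fst (br q f) x"
  by (cases q) auto

lemma Del_nonneg: "f \<in> F \<Longrightarrow> x \<in> E \<Longrightarrow> 0 \<le> Del q f x"
proof (induction q)
  case 0 then show ?case using br_le[of f x 0] by simp
next
  case (Suc q) then show ?case using br_le[of f x "Suc q"] by simp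
qed

lemma Del_measurable: "f \<in> F \<Longrightarrow> Del q f \<in> borel_measurable \<mu>"
proof (induction q)
  case 0
  then show ?case using br_L2[THEN L2_measurable, of f 0] by simp
next
  case (Suc q)
  then show ?case using br_L2[THEN L2_measurable, of f "Suc q"] by simp
qed

lemma Del_L2: "f \<in> F \<Longrightarrow> Del q f \<in> L2 \<mu>"
  and Del_nrm: "f \<in> F \<Longrightarrow> nrm (Del q f) \<le> (1 / 2) ^ q"
proof -
  assume f: "f \<in> F"
  have w: "(\<lambda>x. snd (br q f) x - fst (br q f) x) \<in> L2 \<mu>" using f br_L2 by auto
  have le: "\<bar>Del q f x\<bar> \<le> \<bar>snd (br q f) x - fst (br q f) x\<bar>" if "x \<in> space \<mu>" for x
    using Del_nonneg[OF f, of x q] Del_le_width[of q f x] that by (simp add: space_mu)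
  show "Del q f \<in> L2 \<mu>" by (rule L2_bounded_by[OF w Del_measurable[OF f] le])
  show "nrm (Del q f) \<le> (1 / 2) ^ q"
    using L2_norm_mono[OF w Del_measurable[OF f] le] br_size[OF f, of q] by linarith
qed

text \<open>Functions with a common label share one bracket on every level up to \<open>q\<close>,
  hence differ by at most each width and so by at most their minimum.\<close>

lemma same_label_diff:
  assumes "f \<in> F" "g \<in> F" "lab q f = lab q g" "x \<in> E"
  shows "\<bar>f x - g x\<bar> \<le> Del q f x"
  using assms(3)
proof (induction q)
  case 0
  have "br 0 f = br 0 g" using lab_br[OF 0] by simp
  then show ?case using br_le[OF assms(1,4), of 0] br_le[OF assms(2,4), of 0] by (simp add: abs_le_iff)
next
  case (Suc q)
  have "br (Suc q) f = br (Suc q) g" using lab_br[OF Suc.prems] by simp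
  then have "\<bar>f x - g x\<bar> \<le> snd (br (Suc q) f) x - fst (br (Suc q) f) x"
    using br_le[OF assms(1,4), of "Suc q"] br_le[OF assms(2,4), of "Suc q"] by (simp add: abs_le_iff)
  then show ?case using Suc.IH lab_le[OF Suc.prems, of q] by simp
qed

lemma Len_sq: "(Len q)^2 = ln (2 * (real (card (lab q ` F)) + 1))"
  unfolding Len_def by (rule real_sqrt_pow2) (simp add: ln_ge_zero)

lemma Len_pos: "0 < Len q"
  unfolding Len_def by (simp add: ln_gt_zero)

lemma thr_pos: "0 < thr q"
  using gap_pos Len_pos by (simp add: thr_def)

lemma below_range: "below T q f x \<in> {0, 1}" and bel_range: "bel T p q f x \<in> {0, 1}"
proof -
  show "below T q f x \<in> {0, 1}" for q by (simp add: below_def)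
  then have b: "below T r f x = 0 \<or> below T r f x = 1" for r by simp
  have "(\<Prod>r\<in>{p..<q}. below T r f x) \<in> {0, 1}"
  proof (induction q)
    case (Suc q)
    then show ?case using b[of q] by (cases "p \<le> q") auto
  qed simp
  then show "bel T p q f x \<in> {0, 1}" by (simp add: bel_def)
qed

lemma below_measurable: "f \<in> F \<Longrightarrow> below T q f \<in> borel_measurable \<mu>"
  using Del_measurable[of f q] unfolding below_def by simp

lemma bel_measurable: "f \<in> F \<Longrightarrow> bel T p q f \<in> borel_measurable \<mu>"
  unfolding bel_def using below_measurable by (intro borel_measurable_prod) auto

lemma bel_Suc: "p \<le> q \<Longrightarrow> bel T p (Suc q) f x = bel T p q f x * below T q f x"
  by (simp add: bel_def)

text \<open>A point that survived the truncation at level \<open>r\<close> has width below the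
  threshold there, and widths decrease; at all other points the product vanishes.\<close>

lemma Del_bel_le:
  assumes "p \<le> r" "r < q" "0 < T" "f \<in> F" "x \<in> E" "r \<le> s"
  shows "Del s f x * bel T p q f x \<le> sqrt T * thr r"
proof (cases "below T r f x = 0")
  case True
  then have "bel T p q f x = 0" using assms unfolding bel_def by (intro prod_zero) auto
  then show ?thesis using assms thr_pos[of r] by simp
next
  case False
  then have "Del r f x \<le> sqrt T * thr r" by (auto simp: below_def split: if_splits)
  moreover have "0 \<le> sqrt T * thr r" using assms thr_pos[of r] by simp
  ultimately show ?thesis using Del_le[OF assms(6), of f x] bel_range[of T p q f x] by auto
qed

text \<open>Each point follows the chain of representatives until its width first exceeds the
  threshold. The first sum collects the remainder at that level, the second the links passed before
  it, and the last term belongs to points never stopped before \<open>Q\<close>. The induction step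
  splits \<open>bel T p Q\<close> according to \<open>below T Q\<close>.\<close>

lemma telescope:
  assumes "p \<le> Q"
  shows "f x - rep p f x = (\<Sum>q\<in>{p..<Q}. (f x - rep q f x) * (bel T p q f x * (1 - below T q f x))) +
    (\<Sum>q\<in>{p..<Q}. (rep (Suc q) f x - rep q f x) * bel T p (Suc q) f x) + (f x - rep Q f x) * bel T p Q f x"
  using assms
proof (induction Q rule: dec_induct)
  case base then show ?case by (simp add: bel_def)
next
  case (step Q)
  then show ?case by (simp add: bel_Suc algebra_simps)
qed

text \<open>\<open>maximal_inequality\<close> at the exponent for which \<open>thr\<close> was
  designed: entropy over exponent gives \<open>(1 / 2) ^ q * Len (Suc q)\<close>, and the variance
  term gives \<open>2 / \<gamma>\<close> times the same.\<close>

lemma maximal_step: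
  assumes h: "\<And>f. f \<in> F \<Longrightarrow> h f \<in> borel_measurable \<mu>"
    and cong: "\<And>f g. f \<in> F \<Longrightarrow> g \<in> F \<Longrightarrow> lab (Suc q) f = lab (Suc q) g \<Longrightarrow> h f = h g"
    and le: "\<And>f x. f \<in> F \<Longrightarrow> x \<in> E \<Longrightarrow> \<bar>h f x\<bar> \<le> sqrt T * thr q"
    and le': "\<And>f x. f \<in> F \<Longrightarrow> x \<in> E \<Longrightarrow> \<bar>h f x\<bar> \<le> Del q f x" and T: "0 < T"
  shows "\<exists>R. integrable M R \<and> (\<forall>f\<in>F. \<forall>w\<in>space M. \<bar>dev T (h f) w\<bar> \<le> R w) \<and>
    (\<integral>w. R w \<partial>M) \<le> (1 + 2 / \<gamma>) * ((1 / 2) ^ q * Len (Suc q))"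
proof -
  define z where "z = Len (Suc q) * 2 ^ q"
  have z: "0 < z" "4 * z * thr q \<le> \<gamma>"
    using Len_pos[of "Suc q"] by (auto simp: z_def thr_def power_one_over)
  have "\<exists>R. integrable M R \<and> (\<forall>w\<in>space M. 0 \<le> R w) \<and> (\<forall>k\<in>h ` F. \<forall>w\<in>space M. \<bar>dev T k w\<bar> \<le> R w) \<and>
    (\<integral>w. R w \<partial>M) \<le> (ln (2 * (real (card (lab (Suc q) ` F)) + 1)) + 2 * z\<^sup>2 * ((1 / 2) ^ q)^2 / \<gamma>) / z"
  proof (rule maximal_inequality[OF _ _ _ _ _ T z])
    show "finite (h ` F)" "card (h ` F) \<le> card (lab (Suc q) ` F)" using label_image[OF cong] by auto
    show "k \<in> Bd" if "k \<in> h ` F" for k using that h le by (auto intro: BdI)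
    show "\<bar>k x\<bar> \<le> sqrt T * thr q" if "k \<in> h ` F" "x \<in> E" for k x using that le by auto
    show "nrm k \<le> (1 / 2) ^ q" if "k \<in> h ` F" for k
    proof -
      from that obtain f where f: "f \<in> F" "k = h f" by blast
      have "nrm (h f) \<le> nrm (Del q f)"
        using f le' by (intro L2_norm_mono Del_L2 h) (force simp: space_mu)+
      then show ?thesis using Del_nrm[OF f(1), of q] f(2) by simp
    qed
  qed
  moreover have "(ln (2 * (real (card (lab (Suc q) ` F)) + 1)) + 2 * z\<^sup>2 * ((1 / 2) ^ q)^2 / \<gamma>) / z
      = (1 + 2 / \<gamma>) * ((1 / 2) ^ q * Len (Suc q))"
  proof -
    have "z\<^sup>2 * ((1 / 2) ^ q)^2 = (Len (Suc q))^2 * (2 ^ q * (1 / 2) ^ q)^2"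
      by (simp add: z_def power_mult_distrib)
    also have "(2::real) ^ q * (1 / 2) ^ q = 1" by (simp add: power_mult_distrib[symmetric])
    finally have "2 * z\<^sup>2 * ((1 / 2) ^ q)^2 = 2 * (Len (Suc q))^2" by simp
    then have "(ln (2 * (real (card (lab (Suc q) ` F)) + 1)) + 2 * z\<^sup>2 * ((1 / 2) ^ q)^2 / \<gamma>) / z =
        ((1 + 2 / \<gamma>) * (Len (Suc q))^2) / z"
      unfolding Len_sq[symmetric] by (simp add: algebra_simps)
    also have "... = (1 + 2 / \<gamma>) * ((1 / 2) ^ q * Len (Suc q))"
      using Len_pos[of "Suc q"] by (simp add: z_def power2_eq_square power_one_over field_simps)
    finally show ?thesis .
  qed
  ultimately show ?thesis by auto
qed

text \<open>Up to a factor depending on \<gamma>, the mean cost of one link of the chain; the sum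
  over \<open>q\<close> is a discrete entropy integral.\<close>

definition cst :: "nat \<Rightarrow> real" where
  "cst q = (1 / 2) ^ q * Len (Suc q)"

lemma cst_nonneg: "0 \<le> cst q"
  using Len_pos[of "Suc q"] by (simp add: cst_def)

definition tail :: "nat \<Rightarrow> real" where
  "tail p = (\<Sum>n. cst (n + p))"

lemma tail_ge:
  assumes "summable cst" "finite I" "I \<subseteq> {p..}"
  shows "sum cst I \<le> tail p"
proof -
  have "sum cst I = sum (\<lambda>n. cst (n + p)) ((\<lambda>n. n - p) ` I)"
    using assms(3) by (subst sum.reindex) (auto simp: subset_iff intro!: sum.cong inj_on_diff_nat)
  also have "... \<le> tail p"
    unfolding tail_def using assms cst_nonneg by (intro sum_le_suminf summable_ignore_initial_segment) auto
  finally show ?thesis .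
qed

lemma tail_tendsto: "summable cst \<Longrightarrow> tail \<longlonglongrightarrow> 0"
  unfolding tail_def by (rule suminf_exist_split2)

definition excess :: "real \<Rightarrow> nat \<Rightarrow> ('a \<Rightarrow> real) \<Rightarrow> 'a \<Rightarrow> real" where
  "excess T q f x = Del q f x * (1 - below T q f x)"

lemma excess_measurable: "f \<in> F \<Longrightarrow> excess T q f \<in> borel_measurable \<mu>"
  unfolding excess_def using Del_measurable below_measurable by simp

lemma excess_range: "f \<in> F \<Longrightarrow> x \<in> E \<Longrightarrow> 0 \<le> excess T q f x \<and> excess T q f x \<le> Del q f x"
  using Del_nonneg[of f x q] by (auto simp: excess_def below_def)

lemma excess_le: "0 < T \<Longrightarrow> f \<in> F \<Longrightarrow> x \<in> E \<Longrightarrow> sqrt T * thr q * excess T q f x \<le> Del q f x * excess T q f x"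
  using Del_nonneg[of f x q] by (auto simp: excess_def below_def intro!: mult_right_mono)

lemma excess_L2: "f \<in> F \<Longrightarrow> excess T q f \<in> L2 \<mu>"
  using excess_range[of f _ T q] Del_nonneg[of f _ q]
  by (intro L2_bounded_by[OF Del_L2[of f q] excess_measurable]) (force simp: space_mu)+

text \<open>Chebyshev: the excess lives where the width is above \<open>sqrt T * thr q\<close>, so
  that multiple of its mean is below the squared norm of the width. Dividing by \<open>thr q\<close>
  brings in the factor \<open>4 / \<gamma>\<close>.\<close>

lemma excess_integral:
  assumes "0 < T" "f \<in> F"
  shows "sqrt T * mean (excess T q f) \<le> 4 / \<gamma> * cst q"
proof -
  have "sqrt T * thr q * mean (excess T q f) = mean (\<lambda>x. sqrt T * thr q * excess T q f x)" by simp
  also have "... \<le> mean (\<lambda>x. (Del q f x)^2)"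
  proof (rule integral_mono)
    show "integrable \<mu> (\<lambda>x. sqrt T * thr q * excess T q f x)"
      using mu.L2_integrable[OF excess_L2[OF assms(2)]] by simp
    show "integrable \<mu> (\<lambda>x. (Del q f x)^2)" using Del_L2[OF assms(2)] by (rule L2_integrable_square)
    fix x assume "x \<in> space \<mu>"
    then have x: "x \<in> E" by (simp add: space_mu)
    have "sqrt T * thr q * excess T q f x \<le> Del q f x * excess T q f x" by (rule excess_le[OF assms x])
    also have "... \<le> Del q f x * Del q f x"
      using excess_range[OF assms(2) x] Del_nonneg[OF assms(2) x] by (intro mult_left_mono) auto
    finally show "sqrt T * thr q * excess T q f x \<le> (Del q f x)^2" by (simp add: power2_eq_square)
  qed
  also have "... = (nrm (Del q f))^2" by (simp add: L2_norm_sq)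
  also have "... \<le> ((1 / 2) ^ q)^2" using Del_nrm[OF assms(2)] by (intro power_mono) auto
  also have "... = thr q * (4 / \<gamma> * cst q)"
    using gap_pos Len_pos[of "Suc q"] by (simp add: thr_def cst_def power2_eq_square)
  finally have "thr q * (sqrt T * mean (excess T q f)) \<le> thr q * (4 / \<gamma> * cst q)" by (simp only: ac_simps)
  then show ?thesis using thr_pos[of q] by (rule mult_left_le_imp_le)
qed

text \<open>At the starting level the excesses of all representatives are added rather than
  maximised, so the bound for a single function does not make their sum small. For a fixed level,
  dominated convergence as \<open>T\<close> grows does.\<close>

lemma excess_integral_tendsto:
  assumes "f \<in> F"
  shows "((\<lambda>T. sqrt T * mean (excess T q f)) \<longlongrightarrow> 0) at_top"
proof -
  have "((\<lambda>T. \<integral>x. (Del q f x)^2 * (1 - below T q f x) \<partial>\<mu>) \<longlongrightarrow> (mean (\<lambda>x. 0))) at_top"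
  proof (rule integral_dominated_convergence_at_top[where w = "\<lambda>x. (Del q f x)^2"])
    show "integrable \<mu> (\<lambda>x. (Del q f x)^2)" using Del_L2[OF assms] by (rule L2_integrable_square)
    show "\<forall>\<^sub>F T in at_top. AE x in \<mu>. norm ((Del q f x)^2 * (1 - below T q f x)) \<le> (Del q f x)^2"
      by (intro always_eventually allI AE_I2) (auto simp: below_def)
    show "AE x in \<mu>. ((\<lambda>T. (Del q f x)^2 * (1 - below T q f x)) \<longlongrightarrow> 0) at_top"
    proof (rule AE_I2, rule tendsto_eventually)
      fix x
      have "\<forall>\<^sub>F T in at_top. Del q f x / thr q \<le> sqrt T"
        using sqrt_at_top by (simp add: filterlim_at_top)
      then show "\<forall>\<^sub>F T in at_top. (Del q f x)^2 * (1 - below T q f x) = 0"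
        by eventually_elim (use thr_pos[of q] in \<open>simp add: below_def divide_le_eq\<close>)
    qed
  qed (use Del_measurable[OF assms] below_measurable[OF assms] in auto)
  then have lim: "((\<lambda>T. mean (\<lambda>x. (Del q f x)^2 * (1 - below T q f x)) / thr q) \<longlongrightarrow> 0 / thr q) at_top"
    using thr_pos[of q] by (intro tendsto_divide) auto
  show ?thesis
  proof (rule tendsto_sandwich[OF _ _ tendsto_const])
    show "((\<lambda>T. mean (\<lambda>x. (Del q f x)^2 * (1 - below T q f x)) / thr q) \<longlongrightarrow> 0) at_top" using lim by simp
    show "\<forall>\<^sub>F T in at_top. 0 \<le> sqrt T * mean (excess T q f)"
      using eventually_gt_at_top[of 0]
      by eventually_elim (use excess_range[OF assms] in \<open>auto intro!: mult_nonneg_nonneg integral_nonneg_AE AE_I2 simp: space_mu\<close>)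
    show "\<forall>\<^sub>F T in at_top. sqrt T * mean (excess T q f) \<le> mean (\<lambda>x. (Del q f x)^2 * (1 - below T q f x)) / thr q"
      using eventually_gt_at_top[of 0]
    proof eventually_elim
      fix T :: real assume T: "0 < T"
      have "sqrt T * thr q * mean (excess T q f) = mean (\<lambda>x. sqrt T * thr q * excess T q f x)" by simp
      also have "... \<le> mean (\<lambda>x. Del q f x * excess T q f x)"
        using excess_le[OF T assms] mu.L2_integrable[OF excess_L2[OF assms]] L2_integrable_mult[OF Del_L2[OF assms] excess_L2[OF assms]]
        by (intro integral_mono) (auto simp: space_mu)
      also have "... = mean (\<lambda>x. (Del q f x)^2 * (1 - below T q f x))"
        by (simp add: excess_def power2_eq_square mult.assoc)
      finally show "sqrt T * mean (excess T q f) \<le> mean (\<lambda>x. (Del q f x)^2 * (1 - below T q f x)) / thr q"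
        using thr_pos[of q] by (simp add: field_simps)
    qed
  qed
qed

lemma reps_finite: "finite (rep q ` F)"
  using label_image[of q "rep q"] rep_cong by blast

text \<open>The finitely many brackets of level 0 provide envelopes for all of \<open>F\<close> and
  for all excesses, so one null set serves the whole class.\<close>

lemma F_path_integrable_AE:
  assumes "0 < T"
  shows "AE w in M. \<forall>f\<in>F. path_integrable T w f \<and> path_integrable T w (excess T p f)"
proof -
  define env where "env g x = \<bar>fst (br 0 g) x\<bar> + \<bar>snd (br 0 g) x\<bar>" for g x
  have "AE w in M. \<forall>g\<in>rep 0 ` F. path_integrable T w (env g)"
  proof (rule AE_finite_allI[OF reps_finite])
    fix g assume "g \<in> rep 0 ` F"
    then have "g \<in> F" using rep_in by auto
    then have "env g \<in> L2 \<mu>" unfolding env_def by (intro L2_add L2_abs br_L2)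
    then show "AE w in M. path_integrable T w (env g)" using assms by (intro path_integrable_AE mu.L2_integrable) auto
  qed
  then show ?thesis using AE_space
  proof eventually_elim
    fix w assume h: "\<forall>g\<in>rep 0 ` F. path_integrable T w (env g)" and w: "w \<in> space M"
    show "\<forall>f\<in>F. path_integrable T w f \<and> path_integrable T w (excess T p f)"
    proof (intro ballI conjI)
      fix f assume f: "f \<in> F"
      have eq: "br 0 (rep 0 f) = br 0 f" using lab_br[OF lab_rep[OF f, of 0]] by simp
      have e: "path_integrable T w (env (rep 0 f))" using h f by blast
      show "path_integrable T w f"
      proof (rule path_integrable_bound[OF w L2_measurable[OF F_L2[OF f]] e])
        fix x assume "x \<in> E"
        then show "\<bar>f x\<bar> \<le> \<bar>env (rep 0 f) x\<bar>" using br_le[OF f, of x 0] by (simp add: env_def eq)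
      qed
      show "path_integrable T w (excess T p f)"
      proof (rule path_integrable_bound[OF w excess_measurable[OF f] e])
        fix x assume x: "x \<in> E"
        have "0 \<le> excess T p f x" "excess T p f x \<le> Del p f x" using excess_range[OF f x] by auto
        moreover have "Del p f x \<le> Del 0 f x" by (rule Del_le) simp
        ultimately show "\<bar>excess T p f x\<bar> \<le> \<bar>env (rep 0 f) x\<bar>" by (simp add: env_def eq)
      qed
    qed
  qed
qed

abbreviation "chain_start T p \<equiv> \<Sum>g\<in>rep p ` F. 2 * (sqrt T * mean (excess T p g))"
abbreviation "chain_total T p Q \<equiv> chain_start T p + (3 + 14 / \<gamma>) * tail p + 2 * sqrt T * (1 / 2) ^ Q"

text \<open>Applies \<open>telescope\<close> pointwise. Three families (later remainders, links,
  last term) each cost \<open>1 + 2 / \<gamma>\<close> times the tail, and the means of the later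
  excesses cost \<open>8 / \<gamma>\<close>; this gives \<open>3 + 14 / \<gamma>\<close>. The
  remaining summands stem from level \<open>p\<close> and from the width at level
  \<open>Q\<close>.\<close>

theorem chaining_bound:
  assumes T: "0 < T" and pQ: "p < Q" and sm: "summable cst"
  shows "\<exists>R. integrable M R \<and>
    (\<integral>w. R w \<partial>M) \<le> chain_total T p Q \<and>
    (AE w in M. \<forall>f\<in>F. \<bar>dev T (\<lambda>x. f x - rep p f x) w\<bar> \<le> R w)"
proof -
  \<comment> \<open>\<open>A\<close> and \<open>C\<close> involve \<open>f\<close> itself, so they
    form infinitely many functions; their majorants \<open>k\<close> and \<open>v\<close> depend on
    the label only.\<close>
  define A where "A q f x = (f x - rep q f x) * (bel T p q f x * (1 - below T q f x))" for q f x
  define k where "k q f x = Del q f x * (bel T p q f x * (1 - below T q f x))" for q f x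
  define B where "B q f x = (rep (Suc q) f x - rep q f x) * bel T p (Suc q) f x" for q f x
  define C where "C f x = (f x - rep Q f x) * bel T p Q f x" for f x
  define v where "v f x = Del Q f x * bel T p Q f x" for f x
  have meas: "f \<in> borel_measurable \<mu>" "rep q f \<in> borel_measurable \<mu>" "below T q f \<in> borel_measurable \<mu>"
      "bel T p q f \<in> borel_measurable \<mu>" "Del q f \<in> borel_measurable \<mu>" if "f \<in> F" for f q
    using that rep_in[OF that] by (auto intro: L2_measurable F_L2 below_measurable bel_measurable Del_measurable)
  have m: "A q f \<in> borel_measurable \<mu>" "k q f \<in> borel_measurable \<mu>" "B q f \<in> borel_measurable \<mu>" "C f \<in> borel_measurable \<mu>" "v f \<in> borel_measurable \<mu>"
    if "f \<in> F" for f q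
    unfolding A_def k_def B_def C_def v_def using meas[OF that] by auto
  have repd: "\<bar>f x - rep q f x\<bar> \<le> Del q f x" if "f \<in> F" "x \<in> E" for f x q
    using that by (intro same_label_diff) (auto simp: rep_in lab_rep)
  have z01: "0 \<le> bel T p q f x" "bel T p q f x \<le> 1" "0 \<le> 1 - below T q f x" "1 - below T q f x \<le> 1" for q f x
    using bel_range[of T p q f x] below_range[of T q f x] by auto
  have A_le: "\<bar>A q f x\<bar> \<le> k q f x" if "f \<in> F" "x \<in> E" for q f x
    using repd[OF that] Del_nonneg[OF that] z01 by (auto simp: A_def k_def abs_mult intro!: mult_mono)
  have C_le: "\<bar>C f x\<bar> \<le> v f x" if "f \<in> F" "x \<in> E" for f x
    using repd[OF that] Del_nonneg[OF that] z01 by (auto simp: C_def v_def abs_mult intro!: mult_mono)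
  have B_le: "\<bar>B q f x\<bar> \<le> Del q f x * bel T p (Suc q) f x" if "f \<in> F" "x \<in> E" for q f x
  proof -
    have "lab q (rep (Suc q) f) = lab q (rep q f)"
      using lab_le[OF lab_rep[OF that(1), of "Suc q"], of q] lab_rep[OF that(1), of q] by simp
    then have "\<bar>rep (Suc q) f x - rep q f x\<bar> \<le> Del q (rep (Suc q) f) x"
      using that by (intro same_label_diff rep_in) auto
    also have "Del q (rep (Suc q) f) = Del q f"
      using lab_le[OF lab_rep[OF that(1), of "Suc q"], of q] by (intro Del_cong) simp
    finally show ?thesis using z01 by (auto simp: B_def abs_mult intro!: mult_mono)
  qed
  have k_nn: "0 \<le> k q f x" "k q f x \<le> excess T q f x" "k q f x \<le> Del q f x * bel T p q f x" if "f \<in> F" "x \<in> E" for q f x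
  proof -
    note D = Del_nonneg[OF that, of q]
    show "0 \<le> k q f x" using D z01 by (simp add: k_def)
    show "k q f x \<le> excess T q f x" unfolding k_def excess_def using D z01
      by (intro mult_left_mono mult_left_le_one_le) auto
    show "k q f x \<le> Del q f x * bel T p q f x" unfolding k_def using D z01
      by (intro mult_left_mono mult_right_le_one_le) auto
  qed
  have v_nn: "0 \<le> v f x" if "f \<in> F" "x \<in> E" for f x
    using Del_nonneg[OF that] z01 by (simp add: v_def)
  have le_Del: "Del q f x * bel T p n f x \<le> Del q f x" if "f \<in> F" "x \<in> E" for q n f x
    using Del_nonneg[OF that] z01 by (intro mult_right_le_one_le) auto
  have k_bd: "\<bar>k (Suc q) f x\<bar> \<le> sqrt T * thr q" if "p \<le> q" "f \<in> F" "x \<in> E" for q f x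
    using k_nn[OF that(2,3), of "Suc q"] Del_bel_le[of p q "Suc q" T f x "Suc q"] that T by simp
  have B_bd: "\<bar>B q f x\<bar> \<le> sqrt T * thr q" if "p \<le> q" "f \<in> F" "x \<in> E" for q f x
    using B_le[OF that(2,3), of q] Del_bel_le[of p q "Suc q" T f x q] that T by simp
  \<comment> \<open>Because \<open>p < Q\<close>, the last term carries at least one truncation,
    which bounds \<open>v\<close> at level \<open>Q'\<close>.\<close>
  obtain Q' where Q': "Q = Suc Q'" "p \<le> Q'" using pQ by (cases Q) auto
  have v_bd: "\<bar>v f x\<bar> \<le> sqrt T * thr Q'" if "f \<in> F" "x \<in> E" for f x
    using v_nn[OF that] Del_bel_le[of p Q' Q T f x Q] that T Q' by (simp add: v_def)
  have kstep: "\<exists>R. integrable M R \<and> (\<forall>f\<in>F. \<forall>w\<in>space M. \<bar>dev T (k (Suc q) f) w\<bar> \<le> R w) \<and>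
      (\<integral>w. R w \<partial>M) \<le> (1 + 2 / \<gamma>) * cst q" if "p \<le> q" for q
    unfolding cst_def
  proof (rule maximal_step[OF m(2) _ _ _ T])
    fix f g assume "lab (Suc q) f = lab (Suc q) g"
    then show "k (Suc q) f = k (Suc q) g"
      using Del_cong[of "Suc q" f g] bel_cong[of "Suc q" f g "Suc q" T p] below_cong[of "Suc q" f g "Suc q" T]
      by (intro ext) (simp add: k_def)
  next
    fix f x assume fx: "f \<in> F" "x \<in> E"
    show "\<bar>k (Suc q) f x\<bar> \<le> sqrt T * thr q"
      by (rule k_bd[OF that fx])
    show "\<bar>k (Suc q) f x\<bar> \<le> Del q f x"
      using k_nn[OF fx, of "Suc q"] le_Del[OF fx, of "Suc q" "Suc q"] Del_le[of q "Suc q" f x] by simp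
  qed
  have Bstep: "\<exists>R. integrable M R \<and> (\<forall>f\<in>F. \<forall>w\<in>space M. \<bar>dev T (B q f) w\<bar> \<le> R w) \<and>
      (\<integral>w. R w \<partial>M) \<le> (1 + 2 / \<gamma>) * cst q" if "p \<le> q" for q
    unfolding cst_def
  proof (rule maximal_step[OF m(3) _ _ _ T])
    fix f g assume "lab (Suc q) f = lab (Suc q) g"
    then show "B q f = B q g"
      using rep_cong[of "Suc q" f g] rep_cong[OF lab_le, of "Suc q" f g q] bel_cong[of "Suc q" f g "Suc (Suc q)" T p]
        bel_cong[of "Suc q" f g "Suc q" T p]
      by (intro ext) (simp add: B_def)
  next
    fix f x assume fx: "f \<in> F" "x \<in> E"
    show "\<bar>B q f x\<bar> \<le> sqrt T * thr q"
      by (rule B_bd[OF that fx])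
    show "\<bar>B q f x\<bar> \<le> Del q f x"
      using B_le[OF fx, of q] le_Del[OF fx, of q "Suc q"] by simp
  qed
  have vstep: "\<exists>R. integrable M R \<and> (\<forall>f\<in>F. \<forall>w\<in>space M. \<bar>dev T (v f) w\<bar> \<le> R w) \<and>
      (\<integral>w. R w \<partial>M) \<le> (1 + 2 / \<gamma>) * cst Q'"
    unfolding cst_def
  proof (rule maximal_step[OF m(5) _ _ _ T])
    fix f g assume "lab (Suc Q') f = lab (Suc Q') g"
    then show "v f = v g"
      using Del_cong[of "Suc Q'" f g] bel_cong[of "Suc Q'" f g "Suc Q'" T p]
      by (intro ext) (simp add: v_def Q')
  next
    fix f x assume fx: "f \<in> F" "x \<in> E"
    show "\<bar>v f x\<bar> \<le> sqrt T * thr Q'"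
      by (rule v_bd[OF fx])
    show "\<bar>v f x\<bar> \<le> Del Q' f x"
      using v_nn[OF fx] le_Del[OF fx, of Q Q] Del_le[of Q' Q f x] Q' by (simp add: v_def)
  qed
  obtain Rk where Rk: "\<And>q. p \<le> q \<Longrightarrow> integrable M (Rk q)"
      "\<And>q f w. p \<le> q \<Longrightarrow> f \<in> F \<Longrightarrow> w \<in> space M \<Longrightarrow> \<bar>dev T (k (Suc q) f) w\<bar> \<le> Rk q w"
      "\<And>q. p \<le> q \<Longrightarrow> (\<integral>w. Rk q w \<partial>M) \<le> (1 + 2 / \<gamma>) * cst q"
    using kstep by metis
  obtain RB where RB: "\<And>q. p \<le> q \<Longrightarrow> integrable M (RB q)"
      "\<And>q f w. p \<le> q \<Longrightarrow> f \<in> F \<Longrightarrow> w \<in> space M \<Longrightarrow> \<bar>dev T (B q f) w\<bar> \<le> RB q w"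
      "\<And>q. p \<le> q \<Longrightarrow> (\<integral>w. RB q w \<partial>M) \<le> (1 + 2 / \<gamma>) * cst q"
    using Bstep by metis
  obtain Rv where Rv: "integrable M Rv" "\<And>f w. f \<in> F \<Longrightarrow> w \<in> space M \<Longrightarrow> \<bar>dev T (v f) w\<bar> \<le> Rv w"
      "(\<integral>w. Rv w \<partial>M) \<le> (1 + 2 / \<gamma>) * cst Q'"
    using vstep by metis
  define R0 where "R0 w = (\<Sum>g\<in>rep p ` F. path_integral T (excess T p g) w / sqrt T + sqrt T * mean (excess T p g))" for w
  \<comment> \<open>The constant is twice the \<open>4 / \<gamma>\<close> of
    \<open>excess_integral\<close>, the two coming from \<open>dev_dominated\<close>.\<close>
  define RA where "RA q w = Rk q w + 8 / \<gamma> * cst (Suc q)" for q w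
  define R where "R w = R0 w + (\<Sum>q\<in>{p..<Q'}. RA q w) + (\<Sum>q\<in>{p..<Q}. RB q w) + (Rv w + 2 * sqrt T * (1 / 2) ^ Q)" for w
  have exi: "integrable \<mu> (excess T p g)" if "g \<in> F" for g using that by (intro mu.L2_integrable excess_L2)
  have R0: "integrable M R0" "(\<integral>w. R0 w \<partial>M) = chain_start T p"
  proof -
    have i: "integrable M (path_integral T (excess T p g))" "(\<integral>w. path_integral T (excess T p g) w \<partial>M) = T * mean (excess T p g)"
      if "g \<in> rep p ` F" for g
      using that T rep_in exi by (auto intro!: path_integral_integrable)
    show "integrable M R0" unfolding R0_def using i by (intro Bochner_Integration.integrable_sum) auto
    have "(\<integral>w. R0 w \<partial>M) = (\<Sum>g\<in>rep p ` F. T * mean (excess T p g) / sqrt T + sqrt T * mean (excess T p g))"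
      unfolding R0_def using i by (simp add: prob_space)
    also have "... = chain_start T p"
    proof (rule sum.cong[OF refl])
      fix g
      have "T * mean (excess T p g) / sqrt T = (T / sqrt T) * mean (excess T p g)" by simp
      also have "T / sqrt T = sqrt T" using T by (intro real_div_sqrt) simp
      finally show "T * mean (excess T p g) / sqrt T + sqrt T * mean (excess T p g) = 2 * (sqrt T * mean (excess T p g))" by simp
    qed
    finally show "(\<integral>w. R0 w \<partial>M) = chain_start T p" .
  qed
  have Rint: "integrable M R"
    unfolding R_def RA_def using R0(1) Rk(1) RB(1) Rv(1)
    by (intro Bochner_Integration.integrable_add Bochner_Integration.integrable_sum integrable_const) auto
  have ER: "(\<integral>w. R w \<partial>M) \<le> chain_total T p Q"
  proof -
    have "(\<integral>w. R w \<partial>M) = (\<integral>w. R0 w \<partial>M) + (\<Sum>q\<in>{p..<Q'}. (\<integral>w. Rk q w \<partial>M) + 8 / \<gamma> * cst (Suc q)) + (\<Sum>q\<in>{p..<Q}. (\<integral>w. RB q w \<partial>M)) +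
        ((\<integral>w. Rv w \<partial>M) + 2 * sqrt T * (1 / 2) ^ Q)"
    proof -
      have iA: "integrable M (\<lambda>w. \<Sum>q\<in>{p..<Q'}. RA q w)" "integrable M (\<lambda>w. \<Sum>q\<in>{p..<Q}. RB q w)"
        using Rk(1) RB(1) by (auto simp: RA_def intro!: Bochner_Integration.integrable_sum)
      have "(\<integral>w. (\<Sum>q\<in>{p..<Q'}. RA q w) \<partial>M) = (\<Sum>q\<in>{p..<Q'}. (\<integral>w. RA q w \<partial>M))"
        using Rk(1) by (intro Bochner_Integration.integral_sum) (auto simp: RA_def)
      also have "... = (\<Sum>q\<in>{p..<Q'}. (\<integral>w. Rk q w \<partial>M) + 8 / \<gamma> * cst (Suc q))"
        using Rk(1) by (intro sum.cong refl) (simp add: RA_def prob_space)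
      finally have eA: "(\<integral>w. (\<Sum>q\<in>{p..<Q'}. RA q w) \<partial>M) = (\<Sum>q\<in>{p..<Q'}. (\<integral>w. Rk q w \<partial>M) + 8 / \<gamma> * cst (Suc q))" .
      have eB: "(\<integral>w. (\<Sum>q\<in>{p..<Q}. RB q w) \<partial>M) = (\<Sum>q\<in>{p..<Q}. (\<integral>w. RB q w \<partial>M))"
        using RB(1) by (intro Bochner_Integration.integral_sum) auto
      show ?thesis
        unfolding R_def eA[symmetric] eB[symmetric] using R0(1) Rv(1) iA by (simp add: prob_space)
    qed
    also have "... \<le> (\<integral>w. R0 w \<partial>M) + (\<Sum>q\<in>{p..<Q'}. (1 + 2 / \<gamma>) * cst q + 8 / \<gamma> * cst (Suc q)) + (\<Sum>q\<in>{p..<Q}. (1 + 2 / \<gamma>) * cst q) +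
        ((1 + 2 / \<gamma>) * cst Q' + 2 * sqrt T * (1 / 2) ^ Q)"
      using Rk(3) RB(3) Rv(3) by (intro add_mono sum_mono order_refl) auto
    also have "... = (\<integral>w. R0 w \<partial>M) + ((1 + 2 / \<gamma>) * sum cst {p..<Q'} + 8 / \<gamma> * sum cst (Suc ` {p..<Q'})) + (1 + 2 / \<gamma>) * sum cst {p..<Q} +
        ((1 + 2 / \<gamma>) * sum cst {Q'} + 2 * sqrt T * (1 / 2) ^ Q)"
    proof -
      have "sum cst (Suc ` {p..<Q'}) = (\<Sum>q\<in>{p..<Q'}. cst (Suc q))" by (subst sum.reindex) auto
      then show ?thesis by (simp only: sum.distrib sum_distrib_left[symmetric]) simp
    qed
    also have "... \<le> (\<integral>w. R0 w \<partial>M) + ((1 + 2 / \<gamma>) * tail p + 8 / \<gamma> * tail p) + (1 + 2 / \<gamma>) * tail p +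
        ((1 + 2 / \<gamma>) * tail p + 2 * sqrt T * (1 / 2) ^ Q)"
      using gap_pos Q' by (intro add_mono mult_left_mono order_refl tail_ge[OF sm]) auto
    finally show ?thesis using R0(2) by (simp add: algebra_simps)
  qed
  have "AE w in M. \<forall>f\<in>F. \<bar>dev T (\<lambda>x. f x - rep p f x) w\<bar> \<le> R w"
    using F_path_integrable_AE[OF T, of p] AE_space
  proof eventually_elim
    fix w assume good: "\<forall>f\<in>F. path_integrable T w f \<and> path_integrable T w (excess T p f)" and w: "w \<in> space M"
    show "\<forall>f\<in>F. \<bar>dev T (\<lambda>x. f x - rep p f x) w\<bar> \<le> R w"
    proof
      fix f assume f: "f \<in> F"
      have kBd: "k (Suc q) f \<in> Bd" if "p \<le> q" for q
        by (rule BdI[OF m(2)[OF f] k_bd[OF that f]])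
      have BBd: "B q f \<in> Bd" if "p \<le> q" for q
        by (rule BdI[OF m(3)[OF f] B_bd[OF that f]])
      have vBd: "v f \<in> Bd" by (rule BdI[OF m(5)[OF f] v_bd[OF f]])
      have CBd: "C f \<in> Bd"
      proof (rule BdI[OF m(4)[OF f]])
        fix x assume x: "x \<in> E"
        show "\<bar>C f x\<bar> \<le> sqrt T * thr Q'" using C_le[OF f x] v_bd[OF f x] by linarith
      qed
      have kp: "path_integrable T w (k p f)" "integrable \<mu> (k p f)"
      proof -
        have "\<bar>k p f x\<bar> \<le> \<bar>excess T p f x\<bar>" if "x \<in> E" for x using k_nn[OF f that, of p] by simp
        moreover have "path_integrable T w (excess T p f)" using good f by blast
        ultimately show "path_integrable T w (k p f)"
          by (intro path_integrable_bound[OF w m(2)[OF f]])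
        have "k p f \<in> L2 \<mu>"
          using k_nn[OF f, of _ p] by (intro L2_bounded_by[OF excess_L2[OF f, of T p] m(2)[OF f]])
            (simp add: space_mu order_trans[OF _ abs_ge_self])
        then show "integrable \<mu> (k p f)" by (rule mu.L2_integrable)
      qed
      have kall: "path_integrable T w (k q f) \<and> integrable \<mu> (k q f)" if "p \<le> q" for q
      proof (cases "q = p")
        case False
        then obtain r where "q = Suc r" "p \<le> r" using \<open>p \<le> q\<close> by (cases q) auto
        then show ?thesis using kBd[of r] path_integrable_bounded[OF w] Bd_integrable by auto
      qed (use kp in auto)
      have Aall: "path_integrable T w (A q f) \<and> integrable \<mu> (A q f)" if q: "p \<le> q" for q
      proof
        have le: "\<bar>A q f x\<bar> \<le> \<bar>k q f x\<bar>" if "x \<in> E" for x using A_le[OF f that, of q] k_nn[OF f that, of q] by simp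
        show "path_integrable T w (A q f)"
          using kall[OF q] le by (intro path_integrable_bound[OF w m(1)[OF f]]) auto
        show "integrable \<mu> (A q f)"
          using le conjunct2[OF kall[OF q]]
          by (intro Bochner_Integration.integrable_bound[OF _ m(1)[OF f]]) (auto intro!: AE_I2 simp: space_mu)
      qed
      have "dev T (\<lambda>x. f x - rep p f x) w =
          dev T (\<lambda>x. (\<Sum>q\<in>{p..<Q}. A q f x) + (\<Sum>q\<in>{p..<Q}. B q f x) + C f x) w"
        unfolding A_def B_def C_def telescope[OF less_imp_le[OF pQ], of f _ T, symmetric] ..
      also have "... = (\<Sum>q\<in>{p..<Q}. dev T (A q f) w) + (\<Sum>q\<in>{p..<Q}. dev T (B q f) w) + dev T (C f) w"
      proof -
        have sA: "path_integrable T w (\<lambda>x. \<Sum>q\<in>{p..<Q}. A q f x)" "integrable \<mu> (\<lambda>x. \<Sum>q\<in>{p..<Q}. A q f x)"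
          using Aall by (auto intro!: path_integral_sum[THEN conjunct1])
        have sB: "path_integrable T w (\<lambda>x. \<Sum>q\<in>{p..<Q}. B q f x)" "integrable \<mu> (\<lambda>x. \<Sum>q\<in>{p..<Q}. B q f x)"
          using BBd by (auto intro!: path_integrable_bounded[OF w] Bd_integrable Bd_sum)
        have "dev T (\<lambda>x. (\<Sum>q\<in>{p..<Q}. A q f x) + (\<Sum>q\<in>{p..<Q}. B q f x) + C f x) w =
            dev T (\<lambda>x. (\<Sum>q\<in>{p..<Q}. A q f x)) w + dev T (\<lambda>x. (\<Sum>q\<in>{p..<Q}. B q f x)) w + dev T (C f) w"
        proof -
          have "path_integrable T w (\<lambda>x. (\<Sum>q\<in>{p..<Q}. A q f x) + (\<Sum>q\<in>{p..<Q}. B q f x))"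
            using sA(1) sB(1) by (rule set_integral_add(1))
          then show ?thesis
            using sA sB path_integrable_bounded[OF w CBd] Bd_integrable[OF CBd]
            by (simp add: dev_add)
        qed
        also have "dev T (\<lambda>x. (\<Sum>q\<in>{p..<Q}. A q f x)) w = (\<Sum>q\<in>{p..<Q}. dev T (A q f) w)"
          using Aall by (intro dev_sum) auto
        also have "dev T (\<lambda>x. (\<Sum>q\<in>{p..<Q}. B q f x)) w = (\<Sum>q\<in>{p..<Q}. dev T (B q f) w)"
          using BBd by (intro dev_sum) (auto intro: path_integrable_bounded[OF w] Bd_integrable)
        finally show ?thesis .
      qed
      finally have "\<bar>dev T (\<lambda>x. f x - rep p f x) w\<bar> \<le> \<bar>\<Sum>q\<in>{p..<Q}. dev T (A q f) w\<bar> + \<bar>\<Sum>q\<in>{p..<Q}. dev T (B q f) w\<bar> + \<bar>dev T (C f) w\<bar>"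
        by linarith
      also have "\<bar>\<Sum>q\<in>{p..<Q}. dev T (A q f) w\<bar> \<le> R0 w + (\<Sum>q\<in>{p..<Q'}. RA q w)"
      proof -
        have "\<bar>\<Sum>q\<in>{p..<Q}. dev T (A q f) w\<bar> \<le> (\<Sum>q\<in>{p..<Q}. \<bar>dev T (A q f) w\<bar>)" by (rule sum_abs)
        \<comment> \<open>Level \<open>p\<close> is singled out: no earlier truncation bounds
          \<open>k p f\<close>, so no exponential moment is available there.\<close>
        also have "(\<Sum>q\<in>{p..<Q}. \<bar>dev T (A q f) w\<bar>) = (\<Sum>q\<in>insert p (Suc ` {p..<Q'}). \<bar>dev T (A q f) w\<bar>)"
          using Q' pQ by (intro sum.cong) (auto simp: image_Suc_atLeastLessThan)
        also have "... =
            \<bar>dev T (A p f) w\<bar> + (\<Sum>q\<in>{p..<Q'}. \<bar>dev T (A (Suc q) f) w\<bar>)"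
          by (subst sum.insert) (auto simp: sum.reindex simp del: image_Suc_atLeastLessThan)
        also have "... \<le> R0 w + (\<Sum>q\<in>{p..<Q'}. RA q w)"
        proof (intro add_mono sum_mono)
          fix q assume "q \<in> {p..<Q'}"
          then have q: "p \<le> q" by simp
          have "\<bar>dev T (A (Suc q) f) w\<bar> \<le> dev T (k (Suc q) f) w + 2 * sqrt T * mean (k (Suc q) f)"
            using kall[of "Suc q"] q A_le[OF f] by (intro dev_dominated[OF w T m(1)[OF f]]) auto
          also have "dev T (k (Suc q) f) w \<le> Rk q w" using Rk(2)[OF q f w] by simp
          also have "mean (k (Suc q) f) \<le> mean (excess T (Suc q) f)"
            using kall[of "Suc q"] q k_nn(2)[OF f] mu.L2_integrable[OF excess_L2[OF f]]
            by (intro integral_mono) (auto simp: space_mu)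
          also have "2 * sqrt T * mean (excess T (Suc q) f) \<le> 8 / \<gamma> * cst (Suc q)"
            using excess_integral[OF T f, of "Suc q"] by simp
          finally show "\<bar>dev T (A (Suc q) f) w\<bar> \<le> RA q w" using T by (simp add: RA_def)
        next
          have ex: "path_integrable T w (excess T p f)" using good f by blast
          have "\<bar>dev T (A p f) w\<bar> \<le> dev T (excess T p f) w + 2 * sqrt T * mean (excess T p f)"
            using order_trans[OF A_le[OF f] k_nn(2)[OF f]] by (intro dev_dominated[OF w T m(1)[OF f] ex exi[OF f]])
          also have "... = path_integral T (excess T p f) w / sqrt T + sqrt T * mean (excess T p f)"
          proof -
            have "T * mean (excess T p f) / sqrt T = (T / sqrt T) * mean (excess T p f)" by simp
            also have "T / sqrt T = sqrt T" using T by (intro real_div_sqrt) simp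
            finally show ?thesis by (simp add: dev_def diff_divide_distrib)
          qed
          \<comment> \<open>The excess is determined by the label, so it is one of the finitely many
            summands of \<open>R0\<close>.\<close>
          also have "excess T p f = excess T p (rep p f)"
            using lab_rep[OF f, of p] by (auto simp: excess_def fun_eq_iff Del_cong[of p f "rep p f"] below_cong[of p f "rep p f" p])
          also have "path_integral T (excess T p (rep p f)) w / sqrt T + sqrt T * mean (excess T p (rep p f)) \<le> R0 w"
            unfolding R0_def
          proof (rule member_le_sum[where f = "\<lambda>g. path_integral T (excess T p g) w / sqrt T + sqrt T * mean (excess T p g)"])
            fix g assume "g \<in> rep p ` F - {rep p f}"
            then have g: "g \<in> F" using rep_in by auto
            have "0 \<le> path_integral T (excess T p g) w"
              using path_integral_abs_le[OF w excess_measurable[OF g, of T p], where h = "excess T p g" and T = T] good g excess_range[OF g]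
              by (auto simp: abs_of_nonneg intro: order_trans[OF abs_ge_zero])
            moreover have "0 \<le> mean (excess T p g)"
              using excess_range[OF g] by (intro integral_nonneg_AE AE_I2) (auto simp: space_mu)
            ultimately show "0 \<le> path_integral T (excess T p g) w / sqrt T + sqrt T * mean (excess T p g)" using T by simp
          qed (use f reps_finite in auto)
          finally show "\<bar>dev T (A p f) w\<bar> \<le> R0 w" .
        qed
        finally show ?thesis .
      qed
      also have "\<bar>\<Sum>q\<in>{p..<Q}. dev T (B q f) w\<bar> \<le> (\<Sum>q\<in>{p..<Q}. RB q w)"
        using RB(2)[OF _ f w] by (intro order_trans[OF sum_abs] sum_mono) auto
      also have "\<bar>dev T (C f) w\<bar> \<le> Rv w + 2 * sqrt T * (1 / 2) ^ Q"
      proof -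
        have "\<bar>dev T (C f) w\<bar> \<le> dev T (v f) w + 2 * sqrt T * mean (v f)"
          using C_le[OF f] by (intro dev_dominated[OF w T m(4)[OF f] path_integrable_bounded[OF w vBd] Bd_integrable[OF vBd]])
        also have "dev T (v f) w \<le> Rv w" using Rv(2)[OF f w] by simp
        also have "mean (v f) \<le> (1 / 2) ^ Q"
        proof -
          have "mean (v f) \<le> mean (Del Q f)"
          proof (rule integral_mono[OF Bd_integrable[OF vBd] mu.L2_integrable[OF Del_L2[OF f]]])
            show "v f x \<le> Del Q f x" if "x \<in> space \<mu>" for x
              using le_Del[OF f] that by (simp add: v_def space_mu)
          qed
          also have "... \<le> nrm (Del Q f)" by (rule abs_le_D1[OF mu.L2_norm_ge_integral[OF Del_L2[OF f]]])
          also have "... \<le> (1 / 2) ^ Q" by (rule Del_nrm[OF f])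
          finally show ?thesis .
        qed
        finally show ?thesis using T by simp
      qed
      finally show "\<bar>dev T (\<lambda>x. f x - rep p f x) w\<bar> \<le> R w" by (simp add: R_def)
    qed
  qed
  with Rint ER show ?thesis by blast
qed

end

section \<open>Weak limits from finite-dimensional approximations\<close>

text \<open>The inequality forces \<open>h\<close> to depend on the coordinates in \<open>I\<close>
  alone; bounded functions of this kind are the test functions for finite-dimensional
  convergence.\<close>

definition fin_lipschitz :: "nat set \<Rightarrow> real \<Rightarrow> ((nat \<Rightarrow> real) \<Rightarrow> real) \<Rightarrow> bool" where
  "fin_lipschitz I L h \<longleftrightarrow> finite I \<and> 0 \<le> L \<and> (\<forall>y y'. \<bar>h y - h y'\<bar> \<le> L * (\<Sum>i\<in>I. \<bar>y i - y' i\<bar>))"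

lemma coordinate_sum_small:
  fixes y :: "nat \<Rightarrow> real"
  assumes "finite I" "0 < e"
  shows "\<exists>U. open U \<and> y \<in> U \<and> (\<forall>y'\<in>U. (\<Sum>i\<in>I. \<bar>y i - y' i\<bar>) < e)"
proof -
  have "continuous_on UNIV (\<lambda>y'. \<Sum>i\<in>I. \<bar>y i - y' i\<bar>)" by (intro continuous_intros continuous_on_product_coordinates)
  then have "open {y'. (\<Sum>i\<in>I. \<bar>y i - y' i\<bar>) < e}" by (intro open_Collect_less) auto
  then show ?thesis using assms by (intro exI[of _ "{y'. (\<Sum>i\<in>I. \<bar>y i - y' i\<bar>) < e}"]) auto
qed

lemma fin_lipschitz_continuous:
  assumes "fin_lipschitz I L h"
  shows "continuous_on UNIV h"
proof -
  have "continuous_map euclidean (Met_TC.mtopology :: real topology) h"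
    unfolding Met_TC.continuous_map_to_metric
  proof (intro ballI allI impI)
    fix y :: "nat \<Rightarrow> real" and e :: real assume e: "0 < e"
    have L: "finite I" "0 \<le> L" "\<And>y y'. \<bar>h y - h y'\<bar> \<le> L * (\<Sum>i\<in>I. \<bar>y i - y' i\<bar>)"
      using assms by (auto simp: fin_lipschitz_def)
    obtain U where U: "open U" "y \<in> U" "\<And>y'. y' \<in> U \<Longrightarrow> (\<Sum>i\<in>I. \<bar>y i - y' i\<bar>) < e / (L + 1)"
      using coordinate_sum_small[OF L(1), of "e / (L + 1)" y] e L(2) by auto
    have "dist (h y) (h y') < e" if "y' \<in> U" for y'
    proof -
      have nn: "0 \<le> (\<Sum>i\<in>I. \<bar>y i - y' i\<bar>)" by (simp add: sum_nonneg)
      have "\<bar>h y - h y'\<bar> \<le> (L + 1) * (\<Sum>i\<in>I. \<bar>y i - y' i\<bar>)"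
        using L(3)[of y y'] nn unfolding distrib_right by linarith
      also have "... < e" using U(3)[OF that] L(2) by (simp add: field_simps)
      finally show ?thesis by (simp add: dist_real_def)
    qed
    then show "\<exists>U. openin euclidean U \<and> y \<in> U \<and> (\<forall>y'\<in>U. h y' \<in> Met_TC.mball (h y) e)"
      using U by (intro exI[of _ U]) auto
  qed
  then show ?thesis by simp
qed

lemma fin_lipschitz_measurable:
  assumes h: "fin_lipschitz I L h" and V: "\<And>i. (\<lambda>w. V w i) \<in> borel_measurable M"
  shows "(\<lambda>w. h (V w)) \<in> borel_measurable M"
proof -
  have "V \<in> borel_measurable M" using V by (rule measurable_coordinatewise_then_product)
  then show ?thesis
    using measurable_compose[OF _ borel_measurable_continuous_onI[OF fin_lipschitz_continuous[OF h]]] by blast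
qed

lemma (in prob_space) bounded_integrable:
  fixes f :: "'a \<Rightarrow> real"
  assumes "f \<in> borel_measurable M" "\<And>w. w \<in> space M \<Longrightarrow> \<bar>f w\<bar> \<le> B"
  shows "integrable M f"
  using assms by (intro integrable_const_bound[where B = B]) auto

text \<open>An abstract scheme: \<open>Y\<close> is approximated by Lipschitz images \<Phi> of
  random sequences \<open>V\<close> whose finite-dimensional laws converge to those of one sequence
  \<open>W\<close>. No measurability is asked of \<open>Y\<close>; its distance to the approximation
  is controlled by the integrable \<open>R\<close>.\<close>

locale weak_approximation = M: prob_space M + N: prob_space N
  for M :: "'w measure" and N :: "'n measure" +
  fixes m :: "'b metric" and Y :: "real \<Rightarrow> 'w \<Rightarrow> 'b"
    and V :: "real \<Rightarrow> 'w \<Rightarrow> nat \<Rightarrow> real" and W :: "'n \<Rightarrow> nat \<Rightarrow> real"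
    and \<Phi> :: "nat \<Rightarrow> (nat \<Rightarrow> real) \<Rightarrow> 'b" and I :: "nat \<Rightarrow> nat set" and r :: "nat \<Rightarrow> real"
  assumes complete: "mcomplete_of m"
    and \<Phi>_space: "\<Phi> k y \<in> mspace m"
    and I_finite: "finite (I k)"
    and \<Phi>_lipschitz: "mdist m (\<Phi> k y) (\<Phi> k y') \<le> (\<Sum>i\<in>I k. \<bar>y i - y' i\<bar>)"
    and V_measurable: "(\<lambda>w. V t w i) \<in> borel_measurable M"
    and W_measurable: "(\<lambda>w. W w i) \<in> borel_measurable N"
    and fidi: "fin_lipschitz J L h \<Longrightarrow> (\<And>y. \<bar>h y\<bar> \<le> B) \<Longrightarrow>
      ((\<lambda>t. \<integral>w. h (V t w) \<partial>M) \<longlongrightarrow> (\<integral>w. h (W w) \<partial>N)) at_top"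
    and approx: "\<forall>\<^sub>F t in at_top. \<exists>R. integrable M R \<and> (\<integral>w. R w \<partial>M) \<le> r k \<and>
      (AE w in M. Y t w \<in> mspace m \<and> mdist m (Y t w) (\<Phi> k (V t w)) \<le> R w)"
    and r_le: "r k \<le> (1 / 2) ^ k"
begin

sublocale Metric_space "mspace m" "mdist m"
  by (rule Metric_space_mspace_mdist)

lemma topology_eq: "mtopology_of m = mtopology"
  by (simp add: mtopology_of_def)

abbreviation "d \<equiv> mdist m"

lemma d_quadrilateral:
  assumes "a \<in> mspace m" "b \<in> mspace m" "a' \<in> mspace m" "b' \<in> mspace m"
  shows "\<bar>d a b - d a' b'\<bar> \<le> d a a' + d b b'"
  using triangle[of a a' b] triangle[of a' b' b] triangle[of a' a b'] triangle[of a b b']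
    commute[of a' a] commute[of b' b] assms by linarith

lemma \<Phi>_continuous: "continuous_map euclidean mtopology (\<Phi> k)"
  unfolding continuous_map_to_metric
proof (intro ballI allI impI)
  fix y :: "nat \<Rightarrow> real" and e :: real assume e: "0 < e"
  obtain U where U: "open U" "y \<in> U" "\<And>y'. y' \<in> U \<Longrightarrow> (\<Sum>i\<in>I k. \<bar>y i - y' i\<bar>) < e"
    using coordinate_sum_small[OF I_finite[of k] e, of y] by auto
  then show "\<exists>U. openin euclidean U \<and> y \<in> U \<and> (\<forall>y'\<in>U. \<Phi> k y' \<in> mball (\<Phi> k y) e)"
    using \<Phi>_space le_less_trans[OF \<Phi>_lipschitz[of k y] U(3)] by (intro exI[of _ U]) auto
qed

lemma W_borel: "W \<in> borel_measurable N"
  using W_measurable by (rule measurable_coordinatewise_then_product)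

lemma \<Phi>W_preimage:
  assumes "openin mtopology U"
  shows "{w \<in> space N. \<Phi> k (W w) \<in> U} \<in> sets N"
proof -
  have "openin euclidean {y \<in> topspace euclidean. \<Phi> k y \<in> U}"
    by (rule openin_continuous_map_preimage[OF \<Phi>_continuous assms])
  then have "open {y. \<Phi> k y \<in> U}" by simp
  then have "{y. \<Phi> k y \<in> U} \<in> sets borel" by simp
  from measurable_sets[OF W_borel this] show ?thesis by (simp add: vimage_def Int_def conj_commute)
qed

text \<open>Cutting the distance off at 1 makes it a bounded test function.\<close>

definition gap :: "nat \<Rightarrow> nat \<Rightarrow> (nat \<Rightarrow> real) \<Rightarrow> real" where
  "gap j k y = min 1 (d (\<Phi> j y) (\<Phi> k y))"

lemma gap_lipschitz: "fin_lipschitz (I j \<union> I k) 2 (gap j k)"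
  unfolding fin_lipschitz_def
proof (intro conjI allI)
  show "finite (I j \<union> I k)" using I_finite by simp
  fix y y' :: "nat \<Rightarrow> real"
  have "\<bar>gap j k y - gap j k y'\<bar> \<le> \<bar>d (\<Phi> j y) (\<Phi> k y) - d (\<Phi> j y') (\<Phi> k y')\<bar>"
    by (simp add: gap_def min_def)
  also have "... \<le> d (\<Phi> j y) (\<Phi> j y') + d (\<Phi> k y) (\<Phi> k y')" by (intro d_quadrilateral \<Phi>_space)
  also have "... \<le> (\<Sum>i\<in>I j. \<bar>y i - y' i\<bar>) + (\<Sum>i\<in>I k. \<bar>y i - y' i\<bar>)" by (intro add_mono \<Phi>_lipschitz)
  also have "... \<le> (\<Sum>i\<in>I j \<union> I k. \<bar>y i - y' i\<bar>) + (\<Sum>i\<in>I j \<union> I k. \<bar>y i - y' i\<bar>)"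
    using I_finite by (intro add_mono sum_mono2) auto
  finally show "\<bar>gap j k y - gap j k y'\<bar> \<le> 2 * (\<Sum>i\<in>I j \<union> I k. \<bar>y i - y' i\<bar>)" by simp
qed simp

lemma gap_range: "0 \<le> gap j k y" "gap j k y \<le> 1"
  by (auto simp: gap_def)

lemma gap_measurable: "(\<lambda>w. gap j k (W w)) \<in> borel_measurable N"
  by (rule fin_lipschitz_measurable[OF gap_lipschitz W_measurable])

text \<open>For each large \<open>t\<close> both approximations are close to the same
  \<open>Y t\<close>, so the triangle inequality bounds the gap under \<open>V\<close>;
  finite-dimensional convergence transports the bound to \<open>W\<close>.\<close>

lemma gap_expectation: "(\<integral>w. gap j k (W w) \<partial>N) \<le> r j + r k"
proof (rule tendsto_upperbound)
  show "((\<lambda>t. \<integral>w. gap j k (V t w) \<partial>M) \<longlongrightarrow> (\<integral>w. gap j k (W w) \<partial>N)) at_top"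
    using gap_range by (intro fidi[OF gap_lipschitz, of j k 1]) simp
  show "\<forall>\<^sub>F t in at_top. (\<integral>w. gap j k (V t w) \<partial>M) \<le> r j + r k"
    using approx[of j] approx[of k]
  proof eventually_elim
    case (elim t)
    obtain R where R: "integrable M R" "(\<integral>w. R w \<partial>M) \<le> r j" "AE w in M. Y t w \<in> mspace m \<and> d (Y t w) (\<Phi> j (V t w)) \<le> R w"
      using elim(1) by blast
    obtain R' where R': "integrable M R'" "(\<integral>w. R' w \<partial>M) \<le> r k" "AE w in M. Y t w \<in> mspace m \<and> d (Y t w) (\<Phi> k (V t w)) \<le> R' w"
      using elim(2) by blast
    have "(\<integral>w. gap j k (V t w) \<partial>M) \<le> (\<integral>w. R w + R' w \<partial>M)"
    proof (rule integral_mono_AE)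
      show "integrable M (\<lambda>w. gap j k (V t w))"
        using gap_range by (intro M.bounded_integrable[where B = 1] fin_lipschitz_measurable[OF gap_lipschitz V_measurable]) auto
      show "AE w in M. gap j k (V t w) \<le> R w + R' w"
        using R(3) R'(3)
      proof eventually_elim
        case (elim w)
        have "d (\<Phi> j (V t w)) (\<Phi> k (V t w)) \<le> d (\<Phi> j (V t w)) (Y t w) + d (Y t w) (\<Phi> k (V t w))"
          using elim \<Phi>_space by (intro triangle) auto
        then have "d (\<Phi> j (V t w)) (\<Phi> k (V t w)) \<le> R w + R' w"
          using elim commute[of "Y t w" "\<Phi> j (V t w)"] by linarith
        then show ?case by (simp add: gap_def min.coboundedI2)
      qed
    qed (use R R' in auto)
    also have "... \<le> r j + r k" using R R' by simp
    finally show ?case .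
  qed
qed simp

definition good :: "'n \<Rightarrow> bool" where
  "good w \<longleftrightarrow> summable (\<lambda>k. gap k (Suc k) (W w))"

lemma good_measurable: "{w \<in> space N. good w} \<in> sets N"
proof -
  have "(\<lambda>w. gap k (Suc k) (W w)) \<in> borel_measurable N" for k by (rule gap_measurable)
  then have "Measurable.pred N (\<lambda>w. Cauchy (\<lambda>n. \<Sum>k<n. gap k (Suc k) (W w)))"
    by measurable
  then show ?thesis by (simp add: good_def summable_iff_convergent Cauchy_convergent_iff pred_def)
qed

text \<open>Consecutive gaps have means at most \<open>2 * (1 / 2) ^ k\<close>, so their sum has
  finite mean and is finite almost surely.\<close>

lemma good_AE: "AE w in N. good w"
proof -
  have "(\<integral>\<^sup>+w. (\<Sum>k. ennreal (gap k (Suc k) (W w))) \<partial>N) = (\<Sum>k. \<integral>\<^sup>+w. ennreal (gap k (Suc k) (W w)) \<partial>N)"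
    using gap_measurable by (intro nn_integral_suminf) auto
  also have "... \<le> (\<Sum>k. ennreal (2 * (1 / 2) ^ k))"
  proof (rule suminf_le)
    fix k
    have "(\<integral>\<^sup>+w. ennreal (gap k (Suc k) (W w)) \<partial>N) = ennreal (\<integral>w. gap k (Suc k) (W w) \<partial>N)"
      using gap_range gap_measurable by (intro nn_integral_eq_integral N.bounded_integrable[where B = 1]) auto
    also have "(\<integral>w. gap k (Suc k) (W w) \<partial>N) \<le> 2 * (1 / 2) ^ k"
      using gap_expectation[of k "Suc k"] r_le[of k] r_le[of "Suc k"] zero_le_power[of "1 / 2 :: real" k]
      by (simp only: power_Suc) linarith
    finally show "(\<integral>\<^sup>+w. ennreal (gap k (Suc k) (W w)) \<partial>N) \<le> ennreal (2 * (1 / 2) ^ k)" by (simp add: ennreal_leI)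
  qed auto
  also have "... = ennreal (\<Sum>k. 2 * (1 / 2) ^ k)"
    by (intro suminf_ennreal2 summable_mult summable_geometric) auto
  finally have "(\<integral>\<^sup>+w. (\<Sum>k. ennreal (gap k (Suc k) (W w))) \<partial>N) \<noteq> \<infinity>"
    by (auto simp: top_unique)
  then have "AE w in N. (\<Sum>k. ennreal (gap k (Suc k) (W w))) \<noteq> \<infinity>"
    using gap_measurable by (intro nn_integral_PInf_AE) auto
  then show ?thesis
  proof eventually_elim
    case (elim w)
    then show ?case unfolding good_def using gap_range by (intro summable_suminf_not_top) auto
  qed
qed

text \<open>Summable gaps are eventually below 1, where the cut-off is inactive, so the distances
  themselves are summable from there on.\<close>

lemma good_Cauchy:
  assumes "good w"
  shows "MCauchy (\<lambda>k. \<Phi> k (W w))"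
proof -
  let ?x = "\<lambda>k. \<Phi> k (W w)"
  have sm: "summable (\<lambda>k. gap k (Suc k) (W w))" using assms by (simp add: good_def)
  from order_tendstoD(2)[OF summable_LIMSEQ_zero[OF sm], of 1]
  obtain N0 where "\<forall>k\<ge>N0. gap k (Suc k) (W w) < 1" by (auto simp: eventually_sequentially)
  then have deq: "d (?x k) (?x (Suc k)) = gap k (Suc k) (W w)" if "N0 \<le> k" for k
    using that by (auto simp: gap_def min_def split: if_splits)
  have chain: "d (?x j) (?x (j + n)) \<le> (\<Sum>k\<in>{j..<j + n}. d (?x k) (?x (Suc k)))" for j n
  proof (induction n)
    case 0 then show ?case using \<Phi>_space by simp
  next
    case (Suc n)
    have "d (?x j) (?x (j + Suc n)) \<le> d (?x j) (?x (j + n)) + d (?x (j + n)) (?x (j + Suc n))"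
      by (intro triangle \<Phi>_space)
    then show ?case using Suc by simp
  qed
  show ?thesis unfolding MCauchy_def
  proof (intro conjI allI impI)
    show "range ?x \<subseteq> mspace m" using \<Phi>_space by auto
    fix e :: real assume e: "0 < e"
    obtain N1 where N1: "\<And>j n. N1 \<le> j \<Longrightarrow> norm (\<Sum>k\<in>{j..<n}. gap k (Suc k) (W w)) < e"
      using sm[unfolded summable_Cauchy] e by blast
    have small: "d (?x j) (?x n) < e" if "max N0 N1 \<le> j" "j \<le> n" for j n
    proof -
      have "d (?x j) (?x n) \<le> (\<Sum>k\<in>{j..<n}. d (?x k) (?x (Suc k)))" using chain[of j "n - j"] that by simp
      also have "... = (\<Sum>k\<in>{j..<n}. gap k (Suc k) (W w))" using that by (intro sum.cong refl deq) auto
      also have "... < e" using N1[of j n] that by simp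
      finally show ?thesis .
    qed
    show "\<exists>N. \<forall>n n'. N \<le> n \<longrightarrow> N \<le> n' \<longrightarrow> d (?x n) (?x n') < e"
    proof (intro exI[of _ "max N0 N1"] allI impI)
      fix n n' assume "max N0 N1 \<le> n" "max N0 N1 \<le> n'"
      then show "d (?x n) (?x n') < e" using small[of n n'] small[of n' n] commute by (cases "n \<le> n'") auto
    qed
  qed
qed

text \<open>The default value off the good event is shared with \<open>Gk\<close>, so that all
  values lie in the space and \<open>Gk\<close> converges to \<open>G\<close> everywhere.\<close>

definition G :: "'n \<Rightarrow> 'b" where
  "G w = (if good w then (SOME x. limitin mtopology (\<lambda>k. \<Phi> k (W w)) x sequentially) else \<Phi> 0 (\<lambda>_. 0))"

definition Gk :: "nat \<Rightarrow> 'n \<Rightarrow> 'b" where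
  "Gk k w = (if good w then \<Phi> k (W w) else \<Phi> 0 (\<lambda>_. 0))"

lemma Gk_space: "Gk k w \<in> mspace m"
  by (simp add: Gk_def \<Phi>_space)

lemma Gk_limit: "limitin mtopology (\<lambda>k. Gk k w) (G w) sequentially"
proof (cases "good w")
  case True
  have "\<exists>x. limitin mtopology (\<lambda>k. \<Phi> k (W w)) x sequentially"
    using good_Cauchy[OF True] complete by (simp add: mcomplete_of_def mcomplete_def)
  from someI_ex[OF this] True show ?thesis by (simp add: G_def Gk_def)
next
  case False
  then show ?thesis by (simp add: G_def Gk_def \<Phi>_space)
qed

lemma G_space: "G w \<in> mspace m"
  using Gk_limit limitin_mspace by blast

lemma d_Gk_tendsto: "(\<lambda>k. d (Gk k w) (G w)) \<longlonglongrightarrow> 0"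
proof (rule LIMSEQ_I)
  fix e :: real assume "0 < e"
  then obtain j where "\<And>k. j \<le> k \<Longrightarrow> d (Gk k w) (G w) < e"
    using Gk_limit[of w] unfolding limit_metric_sequentially by meson
  then show "\<exists>j. \<forall>k\<ge>j. norm (d (Gk k w) (G w) - 0) < e" by auto
qed

lemma Gk_preimage:
  assumes "openin mtopology U"
  shows "{w \<in> space N. Gk k w \<in> U} \<in> sets N"
proof -
  have "{w \<in> space N. Gk k w \<in> U} = ({w \<in> space N. good w} \<inter> {w \<in> space N. \<Phi> k (W w) \<in> U}) \<union>
      (if \<Phi> 0 (\<lambda>_. 0) \<in> U then space N - {w \<in> space N. good w} else {})"
    by (auto simp: Gk_def)
  also have "... \<in> sets N" using good_measurable \<Phi>W_preimage[OF assms] by auto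
  finally show ?thesis .
qed

text \<open>\<open>G w\<close> lies in the open set \<open>U\<close> iff, for some \<open>n\<close>,
  the points \<open>Gk k w\<close> eventually avoid the open \<open>1 / Suc n\<close>-neighbourhood
  of the complement. This is a countable combination of preimages of open sets under the
  \<open>Gk\<close>.\<close>

lemma G_preimage:
  assumes U: "openin mtopology U"
  shows "{w \<in> space N. G w \<in> U} \<in> sets N"
proof -
  define V where "V n = (\<Union>y\<in>mspace m - U. mball y (1 / real (Suc n)))" for n
  have V: "openin mtopology (V n)" for n unfolding V_def by (intro openin_Union) auto
  have "G w \<in> U \<longleftrightarrow> (\<exists>n j. \<forall>k\<ge>j. Gk k w \<notin> V n)" for w
  proof
    assume "G w \<in> U"
    then obtain e where e: "0 < e" "mball (G w) e \<subseteq> U" using U by (auto simp: openin_mtopology)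
    obtain n where n: "1 / real (Suc n) < e / 2"
      using e reals_Archimedean[of "e / 2"] by (auto simp: inverse_eq_divide)
    obtain j where j: "\<And>k. j \<le> k \<Longrightarrow> d (Gk k w) (G w) < e / 2"
      using Gk_limit[of w] e unfolding limit_metric_sequentially by (meson half_gt_zero)
    have "Gk k w \<notin> V n" if "j \<le> k" for k
    proof
      assume "Gk k w \<in> V n"
      then obtain y where y: "y \<in> mspace m" "y \<notin> U" "d y (Gk k w) < 1 / real (Suc n)" by (auto simp: V_def)
      have "d (G w) y \<le> d (G w) (Gk k w) + d (Gk k w) y" using y G_space Gk_space by (intro triangle) auto
      also have "... < e" using j[OF that] y(3) n commute by (smt (verit) field_sum_of_halves)
      finally have "y \<in> mball (G w) e" using y G_space by simp
      then show False using e y by blast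
    qed
    then show "\<exists>n j. \<forall>k\<ge>j. Gk k w \<notin> V n" by blast
  next
    assume "\<exists>n j. \<forall>k\<ge>j. Gk k w \<notin> V n"
    then obtain n j where nj: "\<And>k. j \<le> k \<Longrightarrow> Gk k w \<notin> V n" by blast
    show "G w \<in> U"
    proof (rule ccontr)
      assume nU: "G w \<notin> U"
      obtain j' where j': "\<And>k. j' \<le> k \<Longrightarrow> d (Gk k w) (G w) < 1 / real (Suc n)"
        using Gk_limit[of w] unfolding limit_metric_sequentially by (metis zero_less_divide_1_iff of_nat_0_less_iff zero_less_Suc)
      have "Gk (max j j') w \<in> V n"
        unfolding V_def using nU G_space Gk_space j'[of "max j j'"] commute by (auto intro!: bexI[of _ "G w"])
      then show False using nj by simp
    qed
  qed
  then have "{w \<in> space N. G w \<in> U} = {w \<in> space N. \<exists>n j. \<forall>k. j \<le> k \<longrightarrow> \<not> Gk k w \<in> V n}"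
    by simp
  also have "... \<in> sets N"
    by (intro sets.sets_Collect_countable_Ex sets.sets_Collect_countable_All sets.sets_Collect_imp
        sets.sets_Collect_neg sets.sets_Collect_const Gk_preimage V)
  finally show ?thesis .
qed

lemma borel_of_metric_space [simp]: "space (borel_of_metric m) = mspace m"
  and borel_of_metric_sets: "sets (borel_of_metric m) = sigma_sets (mspace m) {U. openin mtopology U}"
proof -
  have "{U. openin mtopology U} \<subseteq> Pow (mspace m)" using openin_subset by fastforce
  then show "space (borel_of_metric m) = mspace m" "sets (borel_of_metric m) = sigma_sets (mspace m) {U. openin mtopology U}"
    by (auto simp: borel_of_metric_def topology_eq)
qed

lemma G_measurable: "G \<in> N \<rightarrow>\<^sub>M borel_of_metric m"
  unfolding borel_of_metric_def topology_eq
proof (rule measurable_measure_of)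
  show "{U. openin mtopology U} \<subseteq> Pow (mspace m)" using openin_subset by fastforce
  show "G \<in> space N \<rightarrow> mspace m" using G_space by auto
  fix U assume "U \<in> {U. openin mtopology U}"
  then show "G -` U \<inter> space N \<in> sets N" using G_preimage[of U] by (simp add: vimage_def Int_def conj_commute)
qed

lemma continuous_measurable:
  assumes "continuous_map mtopology euclideanreal h"
  shows "h \<in> borel_measurable (borel_of_metric m)"
proof (rule borel_measurableI)
  fix S :: "real set" assume "open S"
  then have "openin mtopology {x \<in> mspace m. h x \<in> S}"
    using openin_continuous_map_preimage[OF assms, of S] by simp
  then show "h -` S \<inter> space (borel_of_metric m) \<in> sets (borel_of_metric m)"
    unfolding borel_of_metric_sets by (auto simp: vimage_def Int_def conj_commute intro: sigma_sets.Basic)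
qed

lemma Gk_AE: "AE w in N. \<forall>k. Gk k w = \<Phi> k (W w)"
  using good_AE by eventually_elim (simp add: Gk_def)

text \<open>In a non-separable space the distance of two random elements may fail to be measurable.
  Here it is a limit of gaps, which are Lipschitz functions of finitely many coordinates of
  \<open>W\<close>.\<close>

lemma d_Gk_G_measurable: "(\<lambda>w. min 1 (d (Gk k w) (G w))) \<in> borel_measurable N"
proof (rule borel_measurable_LIMSEQ_real)
  fix w assume "w \<in> space N"
  have "(\<lambda>n. d (Gk k w) (Gk n w)) \<longlonglongrightarrow> d (Gk k w) (G w)"
  proof (rule LIM_zero_cancel, rule Lim_null_comparison[OF always_eventually d_Gk_tendsto[of w]], rule allI)
    show "norm (d (Gk k w) (Gk n w) - d (Gk k w) (G w)) \<le> d (Gk n w) (G w)" for n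
      using d_quadrilateral[of "Gk k w" "Gk n w" "Gk k w" "G w"] Gk_space G_space by simp
  qed
  then show "(\<lambda>n. min 1 (d (Gk k w) (Gk n w))) \<longlonglongrightarrow> min 1 (d (Gk k w) (G w))"
    by (intro tendsto_min tendsto_const)
next
  fix n
  have "(\<lambda>w. min 1 (d (Gk k w) (Gk n w))) = (\<lambda>w. if good w then gap k n (W w) else 0)"
    by (auto simp: Gk_def gap_def \<Phi>_space)
  also have "... \<in> borel_measurable N"
    using gap_measurable good_measurable by (intro measurable_If) (auto simp: )
  finally show "(\<lambda>w. min 1 (d (Gk k w) (Gk n w))) \<in> borel_measurable N" .
qed

lemma d_Gk_G_expectation: "(\<lambda>k. \<integral>w. min 1 (d (Gk k w) (G w)) \<partial>N) \<longlonglongrightarrow> 0"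
proof -
  have "(\<lambda>k. \<integral>w. min 1 (d (Gk k w) (G w)) \<partial>N) \<longlonglongrightarrow> (\<integral>w. 0 \<partial>N)"
  proof (rule integral_dominated_convergence[where w = "\<lambda>_. 1"])
    show "AE w in N. (\<lambda>k. min 1 (d (Gk k w) (G w))) \<longlonglongrightarrow> 0"
      using tendsto_min[OF tendsto_const[of "1::real"] d_Gk_tendsto] by (intro AE_I2) simp
  qed (use d_Gk_G_measurable in \<open>auto intro!: AE_I2\<close>)
  then show ?thesis by simp
qed


text \<open>Coordinates outside \<open>J\<close> are frozen at 0, so the box is a product of compact
  sets and its continuous image is compact.\<close>

lemma box_compact:
  fixes h :: real
  shows "compactin mtopology (\<Phi> k ` {y. \<forall>i. y i \<in> (if i \<in> J then {-h..h} else {0})})"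
proof (rule image_compactin[OF _ \<Phi>_continuous])
  have "{y. \<forall>i. y i \<in> (if i \<in> J then {-h..h} else {0})} = PiE UNIV (\<lambda>i. if i \<in> J then {-h..h} else {0})"
    by (auto simp: PiE_UNIV_domain Pi_iff split: if_splits)
  then show "compactin euclidean {y. \<forall>i. y i \<in> (if i \<in> J then {-h..h} else {0})}"
    unfolding euclidean_product_topology[symmetric] by (simp add: compactin_PiE)
qed

text \<open>By the Lipschitz bound \<Phi> ignores coordinates outside \<open>I k\<close>, so these
  may be set to 0.\<close>

lemma \<Phi>_in_box:
  assumes "\<And>i. i \<in> I k \<Longrightarrow> \<bar>y i\<bar> \<le> h"
  shows "\<Phi> k y \<in> \<Phi> k ` {y. \<forall>i. y i \<in> (if i \<in> I k then {-h..h} else {0})}"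
proof -
  define y' where "y' i = (if i \<in> I k then y i else 0)" for i
  have "d (\<Phi> k y) (\<Phi> k y') \<le> (\<Sum>i\<in>I k. \<bar>y i - y' i\<bar>)" by (rule \<Phi>_lipschitz)
  also have "... = 0" by (intro sum.neutral) (auto simp: y'_def)
  finally have "d (\<Phi> k y) (\<Phi> k y') = 0" using nonneg[of "\<Phi> k y" "\<Phi> k y'"] by linarith
  then have "\<Phi> k y = \<Phi> k y'" using \<Phi>_space by simp
  moreover have "y' \<in> {y. \<forall>i. y i \<in> (if i \<in> I k then {-h..h} else {0})}"
    using assms by (auto simp: y'_def abs_le_iff minus_le_iff)
  ultimately show ?thesis by blast
qed

lemma W_tight:
  assumes "0 < e"
  shows "\<exists>h. measure N {w \<in> space N. \<not> (\<forall>i\<in>I k. \<bar>W w i\<bar> \<le> h)} \<le> e"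
proof -
  let ?A = "\<lambda>n::nat. {w \<in> space N. \<not> (\<forall>i\<in>I k. \<bar>W w i\<bar> \<le> real n)}"
  have A: "?A n \<in> sets N" for n
    using W_measurable I_finite by measurable
  have "(\<lambda>n. measure N (?A n)) \<longlonglongrightarrow> measure N (\<Inter>n. ?A n)"
    using A by (intro N.finite_Lim_measure_decseq) (auto simp: decseq_def intro: order_trans[OF _ of_nat_mono])
  moreover have "(\<Inter>n. ?A n) = {}"
  proof -
    have "\<exists>n. w \<notin> ?A n" for w
    proof -
      obtain n :: nat where "(\<Sum>i\<in>I k. \<bar>W w i\<bar>) \<le> real n" using real_arch_simple by blast
      then have "\<bar>W w i\<bar> \<le> real n" if "i \<in> I k" for i
        using member_le_sum[OF that, of "\<lambda>i. \<bar>W w i\<bar>"] I_finite[of k] by force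
      then show ?thesis by blast
    qed
    then show ?thesis by blast
  qed
  ultimately have "(\<lambda>n. measure N (?A n)) \<longlonglongrightarrow> 0" by simp
  from order_tendstoD(2)[OF this assms] obtain n where "measure N (?A n) < e" by (auto simp: eventually_sequentially)
  then show ?thesis by (intro exI[of _ "real n"]) simp
qed

lemma Gk_close:
  assumes "0 < e" "0 < a" "a < 1"
  shows "\<exists>k. measure N {w \<in> space N. a \<le> min 1 (d (Gk k w) (G w))} \<le> e"
proof -
  have "0 < e * a" using assms by simp
  from order_tendstoD(2)[OF d_Gk_G_expectation this] obtain k
    where k: "(\<integral>w. min 1 (d (Gk k w) (G w)) \<partial>N) < e * a" by (auto simp: eventually_sequentially)
  have "measure N {w \<in> space N. a \<le> min 1 (d (Gk k w) (G w))} \<le> (\<integral>w. min 1 (d (Gk k w) (G w)) \<partial>N) / a"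
    using assms d_Gk_G_measurable
    by (intro integral_Markov_inequality_measure[where A = "{}"] N.bounded_integrable[where B = 1]) auto
  also have "... \<le> e" using k assms by (simp add: divide_le_eq less_imp_le)
  finally show ?thesis by blast
qed

text \<open>For each \<open>n\<close> choose a level whose approximation is within
  \<open>a n\<close> of \<open>G\<close>, and a compact \<open>C n\<close> catching that
  approximation, each with small exceptional probability. The points within \<open>a n\<close> of
  every \<open>C n\<close> form a totally bounded set, and its closure is compact by completeness.
  The exceptions \<open>p n + p n = e * (1 / 2) ^ Suc n\<close> sum to \<open>e\<close>.\<close>

lemma G_tight:
  assumes e: "0 < e"
  shows "\<exists>K. compactin mtopology K \<and> measure N (G -` K \<inter> space N) \<ge> 1 - e"
proof -
  \<comment> \<open>The shift by 2 keeps \<open>a n\<close> below 1, so the cut-off of the distance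
    at 1 cannot hide a violation.\<close>
  define a where "a n = 1 / real (n + 2)" for n :: nat
  define p where "p n = e / 2 * (1 / 2) ^ Suc n" for n :: nat
  have a: "0 < a n" "a n < 1" for n by (auto simp: a_def)
  have p: "0 < p n" for n using e by (simp add: p_def)
  from choice[OF allI[OF Gk_close[OF p a]]]
  obtain \<kappa> where \<kappa>: "\<forall>n. measure N {w \<in> space N. a n \<le> min 1 (d (Gk (\<kappa> n) w) (G w))} \<le> p n" ..
  have "\<forall>n. \<exists>h. measure N {w \<in> space N. \<not> (\<forall>i\<in>I (\<kappa> n). \<bar>W w i\<bar> \<le> h)} \<le> p n"
    by (intro allI W_tight p)
  from choice[OF this]
  obtain h where h: "\<forall>n. measure N {w \<in> space N. \<not> (\<forall>i\<in>I (\<kappa> n). \<bar>W w i\<bar> \<le> h n)} \<le> p n" ..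
  define C where "C n = \<Phi> (\<kappa> n) ` {y. \<forall>i. y i \<in> (if i \<in> I (\<kappa> n) then {-h n..h n} else {0})}" for n
  define S where "S = {x \<in> mspace m. \<forall>n. \<exists>y\<in>C n. d x y < a n}"
  have S: "S \<subseteq> mspace m" by (auto simp: S_def)
  have C: "mtotally_bounded (C n)" "C n \<subseteq> mspace m" for n
    unfolding C_def using box_compact compactin_imp_mtotally_bounded \<Phi>_space by auto
  have "mtotally_bounded S"
    unfolding mtotally_bounded_def
  proof (intro allI impI)
    fix x :: real assume "0 < x"
    then have x4: "0 < x / 4" by simp
    obtain n where n: "a n < x / 4"
    proof -
      obtain n where "inverse (real (Suc n)) < x / 4" using reals_Archimedean[OF x4] by auto
      moreover have "a n \<le> inverse (real (Suc n))" by (simp add: a_def inverse_eq_divide field_simps)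
      ultimately show ?thesis using that[of n] by linarith
    qed
    obtain L where L: "finite L" "L \<subseteq> C n" "C n \<subseteq> (\<Union>y\<in>L. mball y (x / 4))"
      using C(1)[of n] x4 unfolding mtotally_bounded_def by meson
    \<comment> \<open>Centres of the net for \<open>C n\<close> need not belong to \<open>S\<close>;
      each useful one is exchanged for a point of \<open>S\<close>. The radii \<open>x / 4\<close>,
      \<open>x / 4\<close> and \<open>x / 2\<close> add up to \<open>x\<close>.\<close>
    define q where "q v = (SOME z. z \<in> S \<and> d v z < x / 2)" for v
    have q: "q v \<in> S \<and> d v (q v) < x / 2" if "\<exists>z. z \<in> S \<and> d v z < x / 2" for v
      unfolding q_def using someI_ex[OF that] .
    show "\<exists>K. finite K \<and> K \<subseteq> S \<and> S \<subseteq> (\<Union>y\<in>K. mball y x)"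
    proof (intro exI[of _ "q ` {v \<in> L. \<exists>z. z \<in> S \<and> d v z < x / 2}"] conjI subsetI)
      show "z \<in> S" if "z \<in> q ` {v \<in> L. \<exists>z. z \<in> S \<and> d v z < x / 2}" for z using that q by auto
      fix z assume z: "z \<in> S"
      then obtain y where y: "y \<in> C n" "d z y < a n" by (auto simp: S_def)
      then obtain v where v: "v \<in> L" "d v y < x / 4" using L(3) by auto
      have sp: "v \<in> mspace m" "y \<in> mspace m" "z \<in> mspace m" using v y z L C(2) S by blast+
      then have dvz: "d v z < x / 2" using triangle[of v y z] commute[of y z] y v n by linarith
      with z have ex: "\<exists>z. z \<in> S \<and> d v z < x / 2" by blast
      have "q v \<in> mspace m" using q[OF ex] S by blast
      then have "d (q v) z < x" using triangle[of "q v" v z] sp q[OF ex] dvz commute[of v "q v"] by linarith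
      then show "z \<in> (\<Union>y\<in>q ` {v \<in> L. \<exists>z. z \<in> S \<and> d v z < x / 2}. mball y x)"
        using v ex \<open>q v \<in> mspace m\<close> sp by auto
    qed (use L in auto)
  qed
  moreover have mcomplete using complete by (simp add: mcomplete_of_def)
  ultimately have K: "compactin mtopology (mtopology closure_of S)"
    using mtotally_bounded_eq_compact_closure_of by blast
  let ?K = "mtopology closure_of S"
  let ?B = "\<lambda>n. {w \<in> space N. a n \<le> min 1 (d (Gk (\<kappa> n) w) (G w))} \<union> {w \<in> space N. \<not> (\<forall>i\<in>I (\<kappa> n). \<bar>W w i\<bar> \<le> h n)}"
  let ?bad = "{w \<in> space N. \<not> good w}"
  have Bm: "?B n \<in> sets N" "{w \<in> space N. a n \<le> min 1 (d (Gk (\<kappa> n) w) (G w))} \<in> sets N"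
      "{w \<in> space N. \<not> (\<forall>i\<in>I (\<kappa> n). \<bar>W w i\<bar> \<le> h n)} \<in> sets N" for n
    using d_Gk_G_measurable W_measurable I_finite by measurable
  have rng: "range ?B \<subseteq> sets N" using Bm(1) by (rule image_subsetI)
  have UBm: "(\<Union>n. ?B n) \<in> sets N" using sets.countable_UN[OF rng] .
  have badm: "?bad \<in> sets N"
    using sets.sets_Collect_neg[OF good_measurable] .
  have bad0: "measure N ?bad = 0"
    using good_AE badm by (simp add: AE_iff_measurable[OF badm] measure_def)
  have Bp: "measure N (?B n) \<le> e * (1 / 2) ^ Suc n" for n
  proof -
    have "measure N (?B n) \<le> p n + p n"
      using measure_Un_le[OF Bm(2,3), of n n] \<kappa>[THEN spec, of n] h[THEN spec, of n] by linarith
    then show ?thesis by (simp add: p_def)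
  qed
  have sm: "summable (\<lambda>n. e * (1 / 2) ^ Suc n)" by (intro summable_mult) (simp add: summable_geometric)
  have smB: "summable (\<lambda>n. measure N (?B n))"
    by (rule summable_comparison_test'[OF sm, of 0]) (use Bp in simp)
  have "measure N (\<Union>n. ?B n) \<le> (\<Sum>n. measure N (?B n))"
    by (rule N.finite_measure_subadditive_countably[OF rng smB])
  also have "... \<le> (\<Sum>n. e * (1 / 2) ^ Suc n)" using Bp smB sm by (intro suminf_le)
  also have "... = e" using sums_unique[OF sums_mult[OF power_half_series, of e]] by simp
  finally have Be: "measure N (\<Union>n. ?B n) \<le> e" .
  have Km: "G -` ?K \<inter> space N \<in> sets N"
  proof -
    have "{w \<in> space N. \<not> G w \<in> mspace m - ?K} \<in> sets N"
      by (intro sets.sets_Collect_neg G_preimage) (metis closedin_closure_of closedin_def topspace_mtopology)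
    also have "{w \<in> space N. \<not> G w \<in> mspace m - ?K} = G -` ?K \<inter> space N" using G_space by auto
    finally show ?thesis .
  qed
  have "space N - (G -` ?K \<inter> space N) \<subseteq> ?bad \<union> (\<Union>n. ?B n)"
  proof
    fix w assume w: "w \<in> space N - (G -` ?K \<inter> space N)"
    then have "G w \<notin> S" using closure_of_subset[of S mtopology] S by auto
    then obtain n where n: "\<And>y. y \<in> C n \<Longrightarrow> a n \<le> d (G w) y" using G_space by (force simp: S_def)
    show "w \<in> ?bad \<union> (\<Union>n. ?B n)"
    proof (cases "good w \<and> (\<forall>i\<in>I (\<kappa> n). \<bar>W w i\<bar> \<le> h n)")
      case True
      then have "Gk (\<kappa> n) w \<in> C n" using \<Phi>_in_box[of "\<kappa> n" "W w" "h n"] by (simp add: Gk_def C_def)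
      then have "a n \<le> min 1 (d (Gk (\<kappa> n) w) (G w))" using n[of "Gk (\<kappa> n) w"] commute a(2)[of n] by simp
      then show ?thesis using w by blast
    qed (use w in blast)
  qed
  then have "measure N (space N - (G -` ?K \<inter> space N)) \<le> measure N (?bad \<union> (\<Union>n. ?B n))"
    by (rule N.finite_measure_mono) (rule sets.Un[OF badm UBm])
  also have "... \<le> measure N ?bad + measure N (\<Union>n. ?B n)"
    by (rule measure_Un_le[OF badm UBm])
  also have "... \<le> e" using bad0 Be by simp
  finally have "1 - measure N (G -` ?K \<inter> space N) \<le> e" using N.prob_compl[OF Km] by simp
  then show ?thesis using K by (intro exI[of _ ?K]) simp
qed

section \<open>Lipschitz minorants and weak convergence\<close>

text \<open>The Pasch-Hausdorff envelope, the largest \<open>n\<close>-Lipschitz minorant of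
  \<open>h\<close>. It passes from continuous to Lipschitz test functions.\<close>

definition lower_lipschitz :: "('b \<Rightarrow> real) \<Rightarrow> nat \<Rightarrow> 'b \<Rightarrow> real" where
  "lower_lipschitz h n x = (INF y\<in>mspace m. h y + real n * d x y)"

context
  fixes h :: "'b \<Rightarrow> real" and B :: real
  assumes hB: "\<And>x. x \<in> mspace m \<Longrightarrow> \<bar>h x\<bar> \<le> B"
begin

lemma lower_lipschitz_bdd: "bdd_below ((\<lambda>y. h y + real n * d x y) ` mspace m)"
proof (rule bdd_belowI2[where m = "- B"])
  fix y assume "y \<in> mspace m"
  then show "- B \<le> h y + real n * d x y" using hB[of y] nonneg[of x y] by (smt (verit) mult_nonneg_nonneg of_nat_0_le_iff)
qed

lemma lower_lipschitz_le: "x \<in> mspace m \<Longrightarrow> lower_lipschitz h n x \<le> h x"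
  unfolding lower_lipschitz_def using cINF_lower[OF lower_lipschitz_bdd, of x n x] by simp

lemma lower_lipschitz_ge: "- B \<le> lower_lipschitz h n x"
  unfolding lower_lipschitz_def
proof (rule cINF_greatest)
  show "mspace m \<noteq> {}" using \<Phi>_space by blast
  fix y assume "y \<in> mspace m"
  then show "- B \<le> h y + real n * d x y" using hB[of y] nonneg[of x y] by (smt (verit) mult_nonneg_nonneg of_nat_0_le_iff)
qed

lemma lower_lipschitz_abs: "x \<in> mspace m \<Longrightarrow> \<bar>lower_lipschitz h n x\<bar> \<le> B"
  using lower_lipschitz_le[of x n] lower_lipschitz_ge[of n x] hB[of x] by (simp add: abs_le_iff)

lemma lower_lipschitz_step:
  assumes "x \<in> mspace m" "x' \<in> mspace m"
  shows "lower_lipschitz h n x \<le> lower_lipschitz h n x' + real n * d x x'"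
proof -
  have "lower_lipschitz h n x - real n * d x x' \<le> lower_lipschitz h n x'"
    unfolding lower_lipschitz_def[of h n x']
  proof (rule cINF_greatest)
    show "mspace m \<noteq> {}" using assms by blast
    fix y assume y: "y \<in> mspace m"
    have "lower_lipschitz h n x \<le> h y + real n * d x y"
      unfolding lower_lipschitz_def by (rule cINF_lower[OF lower_lipschitz_bdd y])
    also have "real n * d x y \<le> real n * (d x x' + d x' y)" using assms y by (intro mult_left_mono triangle) auto
    finally show "lower_lipschitz h n x - real n * d x x' \<le> h y + real n * d x' y" by (simp add: algebra_simps)
  qed
  then show ?thesis by simp
qed

lemma lower_lipschitz_lipschitz:
  assumes "x \<in> mspace m" "x' \<in> mspace m"
  shows "\<bar>lower_lipschitz h n x - lower_lipschitz h n x'\<bar> \<le> real n * d x x'"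
  using lower_lipschitz_step[OF assms, of n] lower_lipschitz_step[OF assms(2,1), of n] commute[of x x'] by (simp add: abs_le_iff)

lemma lower_lipschitz_fin: "fin_lipschitz (I k) (real n) (\<lambda>y. lower_lipschitz h n (\<Phi> k y))"
  unfolding fin_lipschitz_def
proof (intro conjI allI I_finite)
  fix y y'
  have "\<bar>lower_lipschitz h n (\<Phi> k y) - lower_lipschitz h n (\<Phi> k y')\<bar> \<le> real n * d (\<Phi> k y) (\<Phi> k y')"
    by (intro lower_lipschitz_lipschitz \<Phi>_space)
  also have "... \<le> real n * (\<Sum>i\<in>I k. \<bar>y i - y' i\<bar>)" by (intro mult_left_mono \<Phi>_lipschitz) simp
  finally show "\<bar>lower_lipschitz h n (\<Phi> k y) - lower_lipschitz h n (\<Phi> k y')\<bar> \<le> real n * (\<Sum>i\<in>I k. \<bar>y i - y' i\<bar>)" .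
qed simp

lemma lower_lipschitz_tendsto:
  assumes h: "continuous_map mtopology euclideanreal h" and x: "x \<in> mspace m"
  shows "(\<lambda>n. lower_lipschitz h n x) \<longlonglongrightarrow> h x"
proof (rule LIMSEQ_I)
  fix e :: real assume e: "0 < e"
  have B0: "0 \<le> B" using hB[OF x] by linarith
  have "openin mtopology {y \<in> mspace m. h y \<in> {h x - e / 2 <..}}"
    using openin_continuous_map_preimage[OF h, of "{h x - e / 2 <..}"] by simp
  then obtain z where z: "0 < z" "mball x z \<subseteq> {y \<in> mspace m. h y \<in> {h x - e / 2 <..}}"
    using x e unfolding openin_mtopology by (auto dest!: spec[of _ x])
  \<comment> \<open>Outside the ball of radius \<open>z\<close> the penalty then exceeds
    \<open>2 * B\<close>, the largest possible oscillation of \<open>h\<close>; inside it continuity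
    decides.\<close>
  obtain n0 :: nat where n0: "2 * B / z \<le> real n0" using real_arch_simple by blast
  have "norm (lower_lipschitz h n x - h x) < e" if "n0 \<le> n" for n
  proof -
    have "h x - e / 2 \<le> lower_lipschitz h n x"
      unfolding lower_lipschitz_def
    proof (rule cINF_greatest)
      show "mspace m \<noteq> {}" using x by blast
      fix y assume y: "y \<in> mspace m"
      show "h x - e / 2 \<le> h y + real n * d x y"
      proof (cases "d x y < z")
        case True
        then have "h x - e / 2 < h y" using z(2) x y by auto
        then show ?thesis using nonneg[of x y] by (smt (verit) mult_nonneg_nonneg of_nat_0_le_iff)
      next
        case False
        have "2 * B / z * z \<le> real n * d x y"
          using n0 that False z(1) B0 by (intro mult_mono) auto
        then have "2 * B \<le> real n * d x y" using z(1) by simp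
        then show ?thesis using hB[OF x] hB[OF y] e by linarith
      qed
    qed
    then show ?thesis using lower_lipschitz_le[OF x, of n] e by simp
  qed
  then show "\<exists>n0. \<forall>n\<ge>n0. norm (lower_lipschitz h n x - h x) < e" by blast
qed

lemma lower_lipschitz_continuous: "continuous_map mtopology euclideanreal (lower_lipschitz h n)"
proof -
  have "continuous_map mtopology Met_TC.mtopology (lower_lipschitz h n)"
    unfolding Met_TC.continuous_map_to_metric
  proof (intro ballI allI impI)
    fix x and e :: real assume x: "x \<in> topspace mtopology" and e: "0 < e"
    have "dist (lower_lipschitz h n x) (lower_lipschitz h n y) < e" if "y \<in> mball x (e / (real n + 1))" for y
    proof -
      have "dist (lower_lipschitz h n x) (lower_lipschitz h n y) \<le> real n * d x y"
        using lower_lipschitz_lipschitz[of x y n] that by (simp add: dist_real_def)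
      also have "... \<le> (real n + 1) * d x y" by (intro mult_right_mono) auto
      also have "... < e" using that by (simp add: field_simps)
      finally show ?thesis .
    qed
    then show "\<exists>U. openin mtopology U \<and> x \<in> U \<and> (\<forall>y\<in>U. lower_lipschitz h n y \<in> Met_TC.mball (lower_lipschitz h n x) e)"
      using x e by (intro exI[of _ "mball x (e / (real n + 1))"]) auto
  qed
  then show ?thesis by simp
qed

text \<open>The function \<open>h\<close> is lowered to a Lipschitz minorant, \<open>G\<close> is
  replaced by an approximation from \<open>W\<close>, this by the same approximation from
  \<open>V\<close>, and that by \<open>Y\<close> at a cost of \<open>n * R\<close>. The outcome is
  an integrable minorant \<open>Z\<close>, because \<open>h (Y t w)\<close> need not be measurable
  in \<open>w\<close>.\<close>

lemma expectation_minorant: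
  assumes h: "continuous_map mtopology euclideanreal h" and e: "0 < e"
  shows "\<forall>\<^sub>F t in at_top. \<exists>Z. integrable M Z \<and> (AE w in M. Z w \<le> h (Y t w)) \<and> (\<integral>w. h (G w) \<partial>N) - e \<le> (\<integral>w. Z w \<partial>M)"
proof -
  have meas: "(\<lambda>w. g (G w)) \<in> borel_measurable N" if "continuous_map mtopology euclideanreal g" for g
    using measurable_compose[OF G_measurable continuous_measurable[OF that]] .
  have "(\<lambda>n. \<integral>w. lower_lipschitz h n (G w) \<partial>N) \<longlonglongrightarrow> (\<integral>w. h (G w) \<partial>N)"
    using meas[OF h] meas[OF lower_lipschitz_continuous] lower_lipschitz_abs lower_lipschitz_tendsto[OF h] G_space
    by (intro integral_dominated_convergence[where w = "\<lambda>_. B"]) auto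
  from order_tendstoD(1)[OF this, of "(\<integral>w. h (G w) \<partial>N) - e / 4"] e obtain n
    where n: "(\<integral>w. h (G w) \<partial>N) - e / 4 < (\<integral>w. lower_lipschitz h n (G w) \<partial>N)"
    by (auto simp: eventually_sequentially)
  have \<Phi>m: "(\<lambda>w. lower_lipschitz h n (\<Phi> k (W w))) \<in> borel_measurable N" for k
    by (rule fin_lipschitz_measurable[OF lower_lipschitz_fin W_measurable])
  have "(\<lambda>k. \<integral>w. lower_lipschitz h n (\<Phi> k (W w)) \<partial>N) \<longlonglongrightarrow> (\<integral>w. lower_lipschitz h n (G w) \<partial>N)"
  proof (rule integral_dominated_convergence[where w = "\<lambda>_. B"])
    show "AE w in N. (\<lambda>k. lower_lipschitz h n (\<Phi> k (W w))) \<longlonglongrightarrow> lower_lipschitz h n (G w)"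
      using Gk_AE
    proof eventually_elim
      case (elim w)
      have "(\<lambda>k. real n * d (Gk k w) (G w)) \<longlonglongrightarrow> 0" using tendsto_mult[OF tendsto_const d_Gk_tendsto, of "real n" w] by simp
      then have "(\<lambda>k. lower_lipschitz h n (Gk k w) - lower_lipschitz h n (G w)) \<longlonglongrightarrow> 0"
      proof (rule Lim_null_comparison[OF always_eventually, OF allI, rotated])
        show "norm (lower_lipschitz h n (Gk k w) - lower_lipschitz h n (G w)) \<le> real n * d (Gk k w) (G w)" for k
          using lower_lipschitz_lipschitz[OF Gk_space[of k w] G_space[of w], of n] by simp
      qed
      then show ?case using elim by (simp add: LIM_zero_iff)
    qed
  qed (use \<Phi>m meas[OF lower_lipschitz_continuous] lower_lipschitz_abs \<Phi>_space in auto)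
  from order_tendstoD(1)[OF this, of "(\<integral>w. h (G w) \<partial>N) - e / 4"] n
  have ev1: "\<forall>\<^sub>F k in sequentially. (\<integral>w. h (G w) \<partial>N) - e / 4 < (\<integral>w. lower_lipschitz h n (\<Phi> k (W w)) \<partial>N)" by simp
  have "(\<lambda>k. real n * (1 / 2) ^ k) \<longlonglongrightarrow> real n * 0" by (intro tendsto_mult tendsto_const LIMSEQ_power_zero) simp
  from order_tendstoD(2)[OF this, of "e / 4"] e have ev2: "\<forall>\<^sub>F k in sequentially. real n * (1 / 2) ^ k < e / 4" by simp
  obtain k where k: "(\<integral>w. h (G w) \<partial>N) - e / 4 < (\<integral>w. lower_lipschitz h n (\<Phi> k (W w)) \<partial>N)" "real n * (1 / 2) ^ k < e / 4"
    using eventually_conj[OF ev1 ev2] by (auto simp: eventually_sequentially)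
  have "((\<lambda>t. \<integral>w. lower_lipschitz h n (\<Phi> k (V t w)) \<partial>M) \<longlongrightarrow> (\<integral>w. lower_lipschitz h n (\<Phi> k (W w)) \<partial>N)) at_top"
    using lower_lipschitz_abs \<Phi>_space by (intro fidi[OF lower_lipschitz_fin, where B = B]) auto
  from order_tendstoD(1)[OF this, of "(\<integral>w. h (G w) \<partial>N) - e / 4"] k(1)
  have "\<forall>\<^sub>F t in at_top. (\<integral>w. h (G w) \<partial>N) - e / 4 < (\<integral>w. lower_lipschitz h n (\<Phi> k (V t w)) \<partial>M)" by simp
  then show ?thesis using approx[of k]
  proof eventually_elim
    case (elim t)
    obtain R where R: "integrable M R" "(\<integral>w. R w \<partial>M) \<le> r k" "AE w in M. Y t w \<in> mspace m \<and> d (Y t w) (\<Phi> k (V t w)) \<le> R w"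
      using elim(2) by blast
    define Z where "Z w = lower_lipschitz h n (\<Phi> k (V t w)) - real n * R w" for w
    have i: "integrable M (\<lambda>w. lower_lipschitz h n (\<Phi> k (V t w)))"
      using lower_lipschitz_abs \<Phi>_space
      by (intro M.bounded_integrable[where B = B] fin_lipschitz_measurable[OF lower_lipschitz_fin V_measurable]) auto
    have "integrable M Z" unfolding Z_def using i R by simp
    moreover have "AE w in M. Z w \<le> h (Y t w)"
      using R(3)
    proof eventually_elim
      case (elim w)
      have "lower_lipschitz h n (\<Phi> k (V t w)) - lower_lipschitz h n (Y t w) \<le> real n * d (\<Phi> k (V t w)) (Y t w)"
        using lower_lipschitz_lipschitz[of "\<Phi> k (V t w)" "Y t w" n] \<Phi>_space elim by auto
      also have "... \<le> real n * R w" using elim commute by (intro mult_left_mono) auto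
      finally show ?case using lower_lipschitz_le[of "Y t w" n] elim by (simp add: Z_def)
    qed
    moreover have "(\<integral>w. h (G w) \<partial>N) - e \<le> (\<integral>w. Z w \<partial>M)"
    proof -
      have "(\<integral>w. Z w \<partial>M) = (\<integral>w. lower_lipschitz h n (\<Phi> k (V t w)) \<partial>M) - real n * (\<integral>w. R w \<partial>M)"
        unfolding Z_def using i R by simp
      moreover have "real n * (\<integral>w. R w \<partial>M) \<le> real n * (1 / 2) ^ k"
        using R(2) r_le[of k] by (intro mult_left_mono) auto
      ultimately show ?thesis using elim(1) k(2) e by linarith
    qed
    ultimately show ?case by blast
  qed
qed

end

text \<open>The minorants for \<open>h\<close> and for \<open>- h\<close> enclose the outer
  expectation: the former lies below every admissible majorant, the negative of the latter is an
  admissible majorant.\<close>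

lemma G_converges: "HJ_converges M Y N G m"
  unfolding HJ_converges_def topology_eq
proof (intro allI impI)
  fix h assume h: "continuous_map mtopology euclideanreal h" and "bounded (h ` mspace m)"
  then obtain B where B: "\<And>x. x \<in> mspace m \<Longrightarrow> \<bar>h x\<bar> \<le> B" by (auto simp: bounded_iff)
  have h': "continuous_map mtopology euclideanreal (\<lambda>x. - h x)" using h by (intro continuous_map_minus)
  show "((\<lambda>t. outer_expectation M (\<lambda>w. h (Y t w))) \<longlongrightarrow> (\<integral>w. h (G w) \<partial>N)) at_top"
  proof (rule tendstoI)
    fix e :: real assume "0 < e"
    then have e: "0 < e / 2" by simp
    have lo: "\<forall>\<^sub>F t in at_top. \<exists>Z. integrable M Z \<and> (AE w in M. Z w \<le> h (Y t w)) \<and> (\<integral>w. h (G w) \<partial>N) - e / 2 \<le> (\<integral>w. Z w \<partial>M)"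
      by (rule expectation_minorant[OF B h e])
    have hi: "\<forall>\<^sub>F t in at_top. \<exists>Z. integrable M Z \<and> (AE w in M. Z w \<le> - h (Y t w)) \<and> (\<integral>w. - h (G w) \<partial>N) - e / 2 \<le> (\<integral>w. Z w \<partial>M)"
      using B by (intro expectation_minorant[OF _ h' e, of B]) auto
    show "\<forall>\<^sub>F t in at_top. dist (outer_expectation M (\<lambda>w. h (Y t w))) (\<integral>w. h (G w) \<partial>N) < e"
      using lo hi
    proof eventually_elim
      case (elim t)
      obtain Z where Z: "integrable M Z" "AE w in M. Z w \<le> h (Y t w)" "(\<integral>w. h (G w) \<partial>N) - e / 2 \<le> (\<integral>w. Z w \<partial>M)" using elim(1) by blast
      obtain Z' where Z': "integrable M Z'" "AE w in M. Z' w \<le> - h (Y t w)" "(\<integral>w. - h (G w) \<partial>N) - e / 2 \<le> (\<integral>w. Z' w \<partial>M)" using elim(2) by blast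
      let ?S = "{(\<integral>w. U w \<partial>M) | U. integrable M U \<and> (AE w in M. h (Y t w) \<le> U w)}"
      have mem: "(\<integral>w. - Z' w \<partial>M) \<in> ?S"
        using Z' by (auto intro!: exI[of _ "\<lambda>w. - Z' w"] elim!: eventually_mono)
      have low: "(\<integral>w. Z w \<partial>M) \<le> s" if "s \<in> ?S" for s
      proof -
        from that obtain U where U: "s = (\<integral>w. U w \<partial>M)" "integrable M U" "AE w in M. h (Y t w) \<le> U w" by blast
        have "AE w in M. Z w \<le> U w" using Z(2) U(3) by eventually_elim simp
        then show ?thesis unfolding U(1) using Z(1) U(2) by (intro integral_mono_AE)
      qed
      have "(\<integral>w. Z w \<partial>M) \<le> Inf ?S" using mem low by (intro cInf_greatest) auto
      moreover have "Inf ?S \<le> (\<integral>w. - Z' w \<partial>M)" using mem low by (intro cInf_lower bdd_belowI[of ?S "\<integral>w. Z w \<partial>M"]) auto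
      moreover have "0 < e" using e by simp
      ultimately show ?case using Z(3) Z'(3) by (simp add: outer_expectation_def dist_real_def abs_less_iff)
    qed
  qed
qed

text \<open>The limit is moved to its own law, with the identity as random element, so that the
  probability space has the type of the metric space as \<open>donsker\<close> demands.\<close>

theorem weak_limit_exists:
  "\<exists>(N' :: 'b measure) G'. tight_random_element N' G' m \<and> HJ_converges M Y N' G' m"
proof (intro exI conjI)
  let ?N = "distr N (borel_of_metric m) G"
  show "tight_random_element ?N (\<lambda>x. x) m"
    unfolding tight_random_element_def topology_eq
  proof (intro conjI allI impI)
    show "prob_space ?N" by (rule N.prob_space_distr[OF G_measurable])
    show "(\<lambda>x. x) \<in> ?N \<rightarrow>\<^sub>M borel_of_metric m" by simp
    fix e :: real assume "0 < e"
    then obtain K where K: "compactin mtopology K" "measure N (G -` K \<inter> space N) \<ge> 1 - e" using G_tight by blast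
    have "closedin mtopology K" using K(1) by (intro compactin_imp_closedin Hausdorff_space_mtopology)
    then have "openin mtopology (mspace m - K)" "K \<subseteq> mspace m" by (auto simp: closedin_def)
    then have "mspace m - (mspace m - K) \<in> sets (borel_of_metric m)"
      unfolding borel_of_metric_sets by (intro sigma_sets.Compl sigma_sets.Basic) auto
    then have "K \<in> sets (borel_of_metric m)" using \<open>K \<subseteq> mspace m\<close> by (simp add: double_diff)
    then have "measure ?N K = measure N (G -` K \<inter> space N)" by (intro measure_distr G_measurable)
    then show "\<exists>K. compactin mtopology K \<and> 1 - e \<le> measure ?N ((\<lambda>x. x) -` K \<inter> space ?N)"
      using K \<open>K \<subseteq> mspace m\<close> by (intro exI[of _ K]) (simp add: Int_absorb2)
  qed
  show "HJ_converges M Y ?N (\<lambda>x. x) m"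
    using G_converges unfolding HJ_converges_def topology_eq
    by (simp add: integral_distr[OF G_measurable continuous_measurable])
qed

end

section \<open>Gaussian sequences\<close>

definition psd_kernel :: "(nat \<Rightarrow> nat \<Rightarrow> real) \<Rightarrow> bool" where
  "psd_kernel K \<longleftrightarrow> (\<forall>i j. K i j = K j i) \<and> (\<forall>n c. 0 \<le> (\<Sum>i<n. \<Sum>j<n. c i * c j * K i j))"

lemma psd_kernel_pair:
  assumes "psd_kernel K"
  shows "0 \<le> s\<^sup>2 * K i i + 2 * s * t * K i j + t\<^sup>2 * K j j"
proof -
  \<comment> \<open>Adding two cases, rather than nesting them, also covers
    \<open>i = j\<close>.\<close>
  define c where "c k = (if k = i then s else 0) + (if k = j then t else 0)" for k
  have *: "(\<Sum>k<Suc (max i j). c k * g k) = s * g i + t * g j" for g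
    by (simp add: c_def distrib_right sum.distrib if_distrib[of "\<lambda>x. x * _"] sum.delta less_Suc_eq_le cong: if_cong)
  have "0 \<le> (\<Sum>k<Suc (max i j). \<Sum>l<Suc (max i j). c k * c l * K k l)" using assms unfolding psd_kernel_def by blast
  also have "... = (\<Sum>k<Suc (max i j). c k * (\<Sum>l<Suc (max i j). c l * K k l))"
    by (simp add: sum_distrib_left mult.assoc del: sum.lessThan_Suc)
  also have "... = s * (s * K i i + t * K i j) + t * (s * K j i + t * K j j)" unfolding * by simp
  also have "K j i = K i j" using assms unfolding psd_kernel_def by blast
  finally show ?thesis by (simp add: power2_eq_square algebra_simps)
qed

lemma psd_kernel_diag: "psd_kernel K \<Longrightarrow> 0 \<le> K i i"
  using psd_kernel_pair[of K 1 i 0 i] by simp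

text \<open>With a vanishing diagonal entry the two-by-two form is affine in \<open>s\<close>, and
  nonnegative for all \<open>s\<close> only if its slope vanishes.\<close>

lemma psd_kernel_zero_row:
  assumes "psd_kernel K" "K i i = 0"
  shows "K i j = 0"
proof (rule ccontr)
  assume "K i j \<noteq> 0"
  moreover have "0 \<le> 2 * s * K i j + K j j" for s
    using psd_kernel_pair[OF assms(1), of s i 1 j] assms(2) by simp
  from this[of "- (K j j + 1) / (2 * K i j)"] have "0 \<le> 2 * (- (K j j + 1) / (2 * K i j)) * K i j + K j j" .
  moreover have "2 * (- (K j j + 1) / (2 * K i j)) * K i j = - (K j j + 1)" using \<open>K i j \<noteq> 0\<close> by simp
  ultimately show False by linarith
qed

text \<open>The Schur complement at pivot \<open>n\<close>: the covariance left after regressing out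
  coordinate \<open>n\<close>. For a zero pivot the quotient is 0 and the kernel is
  unchanged.\<close>

definition schur :: "nat \<Rightarrow> (nat \<Rightarrow> nat \<Rightarrow> real) \<Rightarrow> nat \<Rightarrow> nat \<Rightarrow> real" where
  "schur n K i j = K i j - K i n * K n j / K n n"

text \<open>The form of the Schur complement is the minimum of the original form over the
  coefficient of coordinate \<open>n\<close>, attained at \<open>t = - b / a\<close>.\<close>

lemma psd_kernel_schur:
  assumes K: "psd_kernel K"
  shows "psd_kernel (schur n K)"
  unfolding psd_kernel_def
proof (intro conjI allI)
  have sym: "K i j = K j i" for i j using K unfolding psd_kernel_def by blast
  show "schur n K i j = schur n K j i" for i j
    unfolding schur_def using sym[of i j] sym[of i n] sym[of j n] by simp
  fix N c
  define a where "a = K n n"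
  define b where "b = (\<Sum>i<N. c i * K i n)"
  define Q where "Q = (\<Sum>i<N. \<Sum>j<N. c i * c j * K i j)"
  have *: "(\<Sum>i<N. \<Sum>j<N. c i * c j * schur n K i j) = Q - b\<^sup>2 / a"
  proof -
    have "b\<^sup>2 = (\<Sum>i<N. \<Sum>j<N. (c i * K i n) * (c j * K n j))"
      unfolding b_def power2_eq_square sum_product by (simp add: sym[of n])
    then show ?thesis
      by (simp add: schur_def Q_def a_def right_diff_distrib sum_subtractf sum_divide_distrib ac_simps)
  qed
  \<comment> \<open>Adds \<open>t\<close> to the coefficient of index \<open>n\<close>, whether or
    not \<open>n\<close> is already among the first \<open>N\<close> indices.\<close>
  have ext: "0 \<le> Q + 2 * t * b + t\<^sup>2 * a" for t
  proof -
    define N' where "N' = max N (Suc n)"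
    define c' where "c' i = (if i < N then c i else 0) + (if i = n then t else 0)" for i
    have S: "(\<Sum>i<N'. c' i * g i) = (\<Sum>i<N. c i * g i) + t * g n" for g
    proof -
      have "(\<Sum>i<N'. c' i * g i) = (\<Sum>i<N'. if i < N then c i * g i else 0) + (\<Sum>i<N'. if i = n then t * g i else 0)"
        unfolding sum.distrib[symmetric] by (intro sum.cong refl) (auto simp: c'_def distrib_right)
      also have "(\<Sum>i<N'. if i < N then c i * g i else 0) = (\<Sum>i<N. c i * g i)"
        unfolding sum.inter_filter[symmetric, OF finite_lessThan]
        by (intro sum.cong) (auto simp: N'_def)
      also have "(\<Sum>i<N'. if i = n then t * g i else 0) = t * g n" by (simp add: N'_def)
      finally show ?thesis .
    qed
    have "0 \<le> (\<Sum>i<N'. \<Sum>j<N'. c' i * c' j * K i j)" using K unfolding psd_kernel_def by blast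
    also have "... = (\<Sum>i<N'. c' i * (\<Sum>j<N'. c' j * K i j))" by (simp add: sum_distrib_left mult.assoc)
    also have "... = (\<Sum>i<N. c i * ((\<Sum>j<N. c j * K i j) + t * K i n)) + t * ((\<Sum>j<N. c j * K n j) + t * K n n)"
      unfolding S ..
    also have "(\<Sum>j<N. c j * K n j) = b" by (simp add: b_def sym[of n])
    also have "(\<Sum>i<N. c i * ((\<Sum>j<N. c j * K i j) + t * K i n)) = Q + t * b"
      by (simp add: Q_def b_def distrib_left sum.distrib sum_distrib_left ac_simps)
    finally show ?thesis by (simp add: a_def power2_eq_square algebra_simps)
  qed
  have "0 \<le> Q - b\<^sup>2 / a"
  proof (cases "a = 0")
    case True
    then show ?thesis using ext[of 0] by simp
  next
    case False
    then show ?thesis using ext[of "- b / a"] by (simp add: power2_eq_square field_simps)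
  qed
  then show "0 \<le> (\<Sum>i<N. \<Sum>j<N. c i * c j * schur n K i j)" using * by simp
qed

text \<open>Cholesky factorisation; division by zero is harmless since a vanishing pivot has a vanishing row.\<close>

lemma psd_kernel_factorization:
  assumes K: "psd_kernel K"
  obtains L :: "nat \<Rightarrow> nat \<Rightarrow> real" where "\<And>i j n. i < n \<Longrightarrow> K i j = (\<Sum>k<n. L i k * L j k)"
    "\<And>i k. i < k \<Longrightarrow> L i k = 0"
proof -
  define S where "S = rec_nat K schur"
  have S0: "S 0 = K" and S_Suc: "S (Suc n) = schur n (S n)" for n by (auto simp: S_def)
  have psd: "psd_kernel (S n)" for n by (induction n) (auto simp: S0 S_Suc K psd_kernel_schur)
  have sym: "S n i j = S n j i" for n i j using psd[of n] unfolding psd_kernel_def by blast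
  \<comment> \<open>\<open>S n\<close> is the residual kernel after eliminating the coordinates
    below \<open>n\<close>; their vanishing rows make the factorisation finite.\<close>
  have zero: "i < n \<Longrightarrow> S n i j = 0" for n i j
  proof (induction n arbitrary: i j)
    case (Suc n)
    show ?case
    proof (cases "i < n")
      case True then show ?thesis using Suc.IH by (simp add: S_Suc schur_def)
    next
      case False
      then have "i = n" using Suc.prems by simp
      then show ?thesis using psd_kernel_zero_row[OF psd[of n], of n j] by (cases "S n n n = 0") (simp_all add: S_Suc schur_def)
    qed
  qed simp
  define L where "L i k = S k i k / sqrt (S k k k)" for i k
  have step: "S k i j = S (Suc k) i j + L i k * L j k" for i j k
  proof -
    have "L i k * L j k = S k i k * S k j k / (sqrt (S k k k) * sqrt (S k k k))" by (simp add: L_def)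
    also have "sqrt (S k k k) * sqrt (S k k k) = S k k k" using psd_kernel_diag[OF psd] by simp
    finally show ?thesis using sym[of k j k] by (simp add: S_Suc schur_def)
  qed
  have tel: "K i j = S n i j + (\<Sum>k<n. L i k * L j k)" for i j n
  proof (induction n)
    case 0 then show ?case by (simp add: S0)
  next
    case (Suc n) then show ?case using step[of n i j] by simp
  qed
  show ?thesis
  proof (rule that)
    show "K i j = (\<Sum>k<n. L i k * L j k)" if "i < n" for i j n using tel[of i j n] zero[OF that] by simp
    show "L i k = 0" if "i < k" for i k using zero[OF that] by (simp add: L_def)
  qed
qed

abbreviation gauss_space :: "(nat \<Rightarrow> real) measure" where
  "gauss_space \<equiv> PiM UNIV (\<lambda>_. std_normal_distribution)"

lemma prob_space_gauss: "prob_space gauss_space"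
  by (intro prob_space_PiM) (simp add: real_distribution.axioms(1)[OF real_dist_normal_dist])

lemma gauss_coordinates_indep: "prob_space.indep_vars gauss_space (\<lambda>_. borel) (\<lambda>i w. w i) UNIV"
proof -
  interpret prob_space gauss_space by (rule prob_space_gauss)
  have d: "distr gauss_space borel (\<lambda>w. w i) = std_normal_distribution" for i
  proof -
    have "distr gauss_space borel (\<lambda>w. w i) = distr gauss_space std_normal_distribution (\<lambda>w. w i)"
      by (intro distr_cong) auto
    then show ?thesis
      using distr_PiM_component[of UNIV "\<lambda>_. std_normal_distribution" i]
      by (simp add: real_distribution.axioms(1)[OF real_dist_normal_dist])
  qed
  have m: "random_variable borel (\<lambda>w. w i)" for i
    using measurable_component_singleton[of i UNIV "\<lambda>_. std_normal_distribution"] by simp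
  have "distr gauss_space (PiM UNIV (\<lambda>_. borel)) (\<lambda>x. x) = gauss_space"
    by (rule distr_id2, rule sets_PiM_cong) auto
  then show ?thesis
    by (subst indep_vars_iff_distr_eq_PiM) (use m in \<open>auto simp: d restrict_UNIV\<close>)
qed

lemma gauss_linear_char:
  "(\<integral>w. cis (\<Sum>k<n. b k * w k) \<partial>gauss_space) = complex_of_real (exp (- (\<Sum>k<n. (b k)^2) / 2))"
proof -
  interpret prob_space gauss_space by (rule prob_space_gauss)
  have m[measurable]: "random_variable borel (\<lambda>w. w i)" for i
    using measurable_component_singleton[of i UNIV "\<lambda>_. std_normal_distribution"] by simp
  have d: "distr gauss_space borel (\<lambda>w. w i) = std_normal_distribution" for i
  proof -
    have "distr gauss_space borel (\<lambda>w. w i) = distr gauss_space std_normal_distribution (\<lambda>w. w i)"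
      by (intro distr_cong) auto
    then show ?thesis
      using distr_PiM_component[of UNIV "\<lambda>_. std_normal_distribution" i]
      by (simp add: real_distribution.axioms(1)[OF real_dist_normal_dist])
  qed
  have ind: "indep_vars (\<lambda>_. borel) (\<lambda>i w. b i * w i) {..<n}"
    using indep_vars_compose2[OF indep_vars_subset[OF gauss_coordinates_indep, of "{..<n}"], of "\<lambda>i x. b i * x" "\<lambda>_. borel"] by simp
  have one: "char (distr gauss_space borel (\<lambda>w. b i * w i)) 1 = complex_of_real (exp (- (b i)\<^sup>2 / 2))" for i
  proof -
    have "char (distr gauss_space borel (\<lambda>w. b i * w i)) 1 = (\<integral>w. iexp (b i * w i) \<partial>gauss_space)"
      unfolding char_def by (subst integral_distr) auto
    also have "... = char (distr gauss_space borel (\<lambda>w. w i)) (b i)"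
      unfolding char_def by (subst integral_distr) auto
    also have "... = complex_of_real (exp (- (b i)\<^sup>2 / 2))" unfolding d char_std_normal_distribution ..
    finally show ?thesis .
  qed
  have "(\<integral>w. cis (\<Sum>k<n. b k * w k) \<partial>gauss_space) = char (distr gauss_space borel (\<lambda>w. \<Sum>k<n. b k * w k)) 1"
    unfolding char_def by (subst integral_distr) (auto simp: cis_conv_exp)
  also have "... = (\<Prod>k<n. complex_of_real (exp (- (b k)\<^sup>2 / 2)))"
    unfolding char_distr_sum[OF ind] one ..
  also have "... = complex_of_real (exp (\<Sum>k<n. - (b k)\<^sup>2 / 2))" by (simp add: exp_sum)
  also have "(\<Sum>k<n. - (b k)\<^sup>2 / 2) = - (\<Sum>k<n. (b k)^2) / 2" by (simp add: sum_divide_distrib sum_negf)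
  finally show ?thesis .
qed

text \<open>The \<open>i\<close>-th coordinate of the Gaussian sequence is \<open>\<Sum>k. L i k * w k\<close> with the Cholesky factor \<open>L\<close> of \<open>K\<close>.\<close>

lemma gaussian_sequence_exists:
  assumes "psd_kernel K"
  obtains W :: "(nat \<Rightarrow> real) \<Rightarrow> nat \<Rightarrow> real" where "\<And>i. (\<lambda>w. W w i) \<in> borel_measurable gauss_space"
    "\<And>n c. (\<integral>w. cis (\<Sum>i<n. c i * W w i) \<partial>gauss_space) = complex_of_real (exp (- (\<Sum>i<n. \<Sum>j<n. c i * c j * K i j) / 2))"
proof -
  obtain L where L: "\<And>i j n. i < n \<Longrightarrow> K i j = (\<Sum>k<n. L i k * L j k)" "\<And>i k. i < k \<Longrightarrow> L i k = 0"
    using psd_kernel_factorization[OF assms] by blast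
  define W where "W w i = (\<Sum>k<Suc i. L i k * w k)" for w :: "nat \<Rightarrow> real" and i
  have m[measurable]: "(\<lambda>w. w i) \<in> borel_measurable gauss_space" for i
    using measurable_component_singleton[of i UNIV "\<lambda>_. std_normal_distribution"] by simp
  have W: "W w i = (\<Sum>k<n. L i k * w k)" if "i < n" for w i n
    unfolding W_def using that L(2) by (intro sum.mono_neutral_left) auto
  show ?thesis
  proof (rule that)
    show "(\<lambda>w. W w i) \<in> borel_measurable gauss_space" for i unfolding W_def by measurable
    fix n c
    have "(\<Sum>i<n. c i * W w i) = (\<Sum>k<n. (\<Sum>i<n. c i * L i k) * w k)" for w
    proof -
      have "(\<Sum>i<n. c i * W w i) = (\<Sum>i<n. \<Sum>k<n. c i * L i k * w k)"
        by (intro sum.cong refl) (simp add: W[of _ n] sum_distrib_left mult.assoc)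
      also have "... = (\<Sum>k<n. \<Sum>i<n. c i * L i k * w k)" by (rule sum.swap)
      finally show ?thesis by (simp add: sum_distrib_right)
    qed
    then have "(\<integral>w. cis (\<Sum>i<n. c i * W w i) \<partial>gauss_space) = complex_of_real (exp (- (\<Sum>k<n. (\<Sum>i<n. c i * L i k)^2) / 2))"
      by (simp add: gauss_linear_char)
    also have "(\<Sum>k<n. (\<Sum>i<n. c i * L i k)^2) = (\<Sum>k<n. \<Sum>i<n. \<Sum>j<n. c i * c j * (L i k * L j k))"
      by (simp add: power2_eq_square sum_product ac_simps)
    also have "... = (\<Sum>i<n. \<Sum>k<n. \<Sum>j<n. c i * c j * (L i k * L j k))" by (rule sum.swap)
    also have "... = (\<Sum>i<n. \<Sum>j<n. \<Sum>k<n. c i * c j * (L i k * L j k))" by (intro sum.cong refl sum.swap)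
    also have "... = (\<Sum>i<n. \<Sum>j<n. c i * c j * K i j)"
      by (intro sum.cong refl) (simp add: L(1)[of _ n] sum_distrib_left)
    finally show "(\<integral>w. cis (\<Sum>i<n. c i * W w i) \<partial>gauss_space) = complex_of_real (exp (- (\<Sum>i<n. \<Sum>j<n. c i * c j * K i j) / 2))" .
  qed
qed

section \<open>Trigonometric polynomials in finitely many coordinates\<close>

text \<open>Arbitrary frequencies and a free phase, which includes sines. Expectations of these
  functions are linear combinations of values of characteristic functions.\<close>

inductive_set trig :: "((nat \<Rightarrow> real) \<Rightarrow> real) set" where
  cos: "(\<lambda>y. cos ((\<Sum>i<n. c i * y i) + a)) \<in> trig"
| add: "p \<in> trig \<Longrightarrow> q \<in> trig \<Longrightarrow> (\<lambda>y. p y + q y) \<in> trig"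
| scale: "p \<in> trig \<Longrightarrow> (\<lambda>y. s * p y) \<in> trig"

lemma trig_const: "(\<lambda>_. s) \<in> trig"
  using trig.scale[OF trig.cos[where n = 0 and a = 0], of s] by simp

text \<open>The product-to-sum formula, after padding both frequency vectors with zeros to a common
  length.\<close>

lemma trig_cos_cos: "(\<lambda>y. cos ((\<Sum>i<n. c i * y i) + a) * cos ((\<Sum>i<k. e i * y i) + b)) \<in> trig"
proof -
  define N where "N = max n k"
  define c' where "c' i = (if i < n then c i else 0)" for i
  define e' where "e' i = (if i < k then e i else 0)" for i
  have 1: "(\<Sum>i<n. c i * y i) = (\<Sum>i<N. c' i * y i)" "(\<Sum>i<k. e i * y i) = (\<Sum>i<N. e' i * y i)" for y :: "nat \<Rightarrow> real"
    by (rule sum.mono_neutral_cong_left; auto simp: c'_def e'_def N_def split: if_splits)+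
  have eq: "(\<lambda>y. cos ((\<Sum>i<n. c i * y i) + a) * cos ((\<Sum>i<k. e i * y i) + b)) =
      (\<lambda>y. 1 / 2 * cos ((\<Sum>i<N. (c' i - e' i) * y i) + (a - b)) + 1 / 2 * cos ((\<Sum>i<N. (c' i + e' i) * y i) + (a + b)))"
    unfolding 1
    by (intro ext) (simp add: cos_times_cos left_diff_distrib distrib_right sum_subtractf sum.distrib algebra_simps)
  show ?thesis unfolding eq by (intro trig.add trig.scale trig.cos)
qed

lemma trig_mult: "p \<in> trig \<Longrightarrow> q \<in> trig \<Longrightarrow> (\<lambda>y. p y * q y) \<in> trig"
proof (induction rule: trig.induct)
  case (cos c n a)
  from cos show ?case
  proof (induction rule: trig.induct)
    case (cos e k b) then show ?case by (rule trig_cos_cos)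
  next
    case (add p q) then show ?case using trig.add by (simp add: distrib_left)
  next
    case (scale p s) then show ?case using trig.scale by (simp add: mult.left_commute)
  qed
next
  case (add p q) then show ?case using trig.add by (simp add: distrib_right)
next
  case (scale p s) then show ?case using trig.scale by (simp add: mult.assoc)
qed

lemma trig_sin: "(\<lambda>y. sin (y i / L)) \<in> trig"
proof -
  have eq: "(\<lambda>y. sin (y i / L)) = (\<lambda>y. cos ((\<Sum>j<Suc i. (if j = i then 1 / L else 0) * y j) + (- (pi / 2))))"
    by (intro ext) (simp add: cos_diff if_distrib[of "\<lambda>x. x * _"] cong: if_cong)
  show ?thesis unfolding eq by (rule trig.cos)
qed

lemma trig_bounded: "q \<in> trig \<Longrightarrow> \<exists>B. \<forall>y. \<bar>q y\<bar> \<le> B"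
proof (induction rule: trig.induct)
  case (cos c n a) then show ?case by (intro exI[of _ 1]) simp
next
  case (add p q)
  then obtain A B where "\<And>y. \<bar>p y\<bar> \<le> A" "\<And>y. \<bar>q y\<bar> \<le> B" by blast
  then have "\<bar>p y + q y\<bar> \<le> A + B" for y by (meson abs_triangle_ineq add_mono order_trans)
  then show ?case by blast
next
  case (scale p s)
  then obtain A where "\<And>y. \<bar>p y\<bar> \<le> A" by blast
  then have "\<bar>s * p y\<bar> \<le> \<bar>s\<bar> * A" for y by (simp add: abs_mult mult_left_mono)
  then show ?case by blast
qed

lemma trig_continuous: "q \<in> trig \<Longrightarrow> continuous_on UNIV q"
  by (induction rule: trig.induct) (intro continuous_intros continuous_on_product_coordinates; assumption)+

text \<open>Allows an unbounded coordinate to be replaced by a bounded periodic one, at an error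
  controlled by its second moment.\<close>

lemma sin_linear_error:
  fixes x L :: real
  assumes "0 < L"
  shows "\<bar>x - L * sin (x / L)\<bar> \<le> x\<^sup>2 / (2 * L)"
proof -
  have "\<bar>sin (x / L) - x / L\<bar> \<le> (x / L)^2 / 2"
    using Maclaurin_sin_bound[of "x / L" 2] by (simp add: numeral_2_eq_2 sin_coeff_def)
  then have "L * \<bar>sin (x / L) - x / L\<bar> \<le> L * ((x / L)^2 / 2)" using assms by (intro mult_left_mono) auto
  also have "L * \<bar>sin (x / L) - x / L\<bar> = \<bar>L * (sin (x / L) - x / L)\<bar>" using assms by (simp add: abs_mult)
  also have "... = \<bar>x - L * sin (x / L)\<bar>" using assms by (simp add: right_diff_distrib abs_minus_commute)
  also have "L * ((x / L)^2 / 2) = x\<^sup>2 / (2 * L)" using assms by (simp add: power2_eq_square)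
  finally show ?thesis .
qed

text \<open>The function \<open>h (\<lambda>i. L * sin (y i / L))\<close> is close to \<open>h\<close> for large \<open>L\<close> and, being a continuous
  function of the coordinates \<open>sin (y i / L)\<close> in a compact cube, a uniform limit of trigonometric polynomials.\<close>

lemma trig_dense:
  assumes h: "fin_lipschitz J L h" and \<epsilon>: "0 < \<epsilon>"
  shows "\<exists>q\<in>trig. \<forall>y. \<bar>h (\<lambda>i. H * sin (y i / H)) - q y\<bar> \<le> \<epsilon>"
proof -
  define S where "S = {s :: nat \<Rightarrow> real. \<forall>i. s i \<in> {-1..1}}"
  define R where "R = {g. continuous_on UNIV g \<and> (\<lambda>y. g (\<lambda>i. sin (y i / H))) \<in> trig}"
  have S: "compact S"
  proof -
    have "S = PiE UNIV (\<lambda>_. {-1..1})" by (auto simp: S_def PiE_UNIV_domain Pi_iff)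
    then have "compactin euclidean S" unfolding euclidean_product_topology[symmetric] by (simp add: compactin_PiE)
    then show ?thesis by simp
  qed
  interpret function_ring_on R S
  proof
    show "compact S" by (rule S)
    show "continuous_on S f" if "f \<in> R" for f using that continuous_on_subset by (auto simp: R_def)
    show "(\<lambda>x. f x + g x) \<in> R" "(\<lambda>x. f x * g x) \<in> R" if "f \<in> R" "g \<in> R" for f g
      using that by (auto simp: R_def intro: continuous_intros trig.add trig_mult)
    show "(\<lambda>_. c) \<in> R" for c by (auto simp: R_def trig_const)
    fix x y :: "nat \<Rightarrow> real" assume "x \<noteq> y"
    then obtain i where "x i \<noteq> y i" by auto
    moreover have "(\<lambda>s. s i) \<in> R" by (auto simp: R_def trig_sin)
    ultimately show "\<exists>f\<in>R. f x \<noteq> f y" by (intro bexI[of _ "\<lambda>s. s i"])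
  qed
  have "continuous_on UNIV (\<lambda>s. h (\<lambda>i. H * s i))"
  proof -
    have "fin_lipschitz J (L * \<bar>H\<bar>) (\<lambda>s. h (\<lambda>i. H * s i))"
      unfolding fin_lipschitz_def
    proof (intro conjI allI)
      show "finite J" "0 \<le> L * \<bar>H\<bar>" using h by (auto simp: fin_lipschitz_def)
      fix y y' :: "nat \<Rightarrow> real"
      have "\<bar>h (\<lambda>i. H * y i) - h (\<lambda>i. H * y' i)\<bar> \<le> L * (\<Sum>i\<in>J. \<bar>H * y i - H * y' i\<bar>)"
        using h by (auto simp: fin_lipschitz_def)
      also have "... = L * \<bar>H\<bar> * (\<Sum>i\<in>J. \<bar>y i - y' i\<bar>)"
        by (simp add: right_diff_distrib[symmetric] abs_mult sum_distrib_left mult.assoc)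
      finally show "\<bar>h (\<lambda>i. H * y i) - h (\<lambda>i. H * y' i)\<bar> \<le> L * \<bar>H\<bar> * (\<Sum>i\<in>J. \<bar>y i - y' i\<bar>)" .
    qed
    then show ?thesis by (rule fin_lipschitz_continuous)
  qed
  then have "continuous_on S (\<lambda>s. h (\<lambda>i. H * s i))" by (rule continuous_on_subset) simp
  from Stone_Weierstrass_basic[OF this \<epsilon>] obtain g where g: "g \<in> R" "\<And>s. s \<in> S \<Longrightarrow> \<bar>h (\<lambda>i. H * s i) - g s\<bar> < \<epsilon>" by blast
  show ?thesis
  proof (intro bexI[of _ "\<lambda>y. g (\<lambda>i. sin (y i / H))"] allI)
    show "(\<lambda>y. g (\<lambda>i. sin (y i / H))) \<in> trig" using g(1) by (simp add: R_def)
    show "\<bar>h (\<lambda>i. H * sin (y i / H)) - g (\<lambda>i. sin (y i / H))\<bar> \<le> \<epsilon>" for y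
      using g(2)[of "\<lambda>i. sin (y i / H)"] by (simp add: S_def less_imp_le)
  qed
qed

section \<open>Convergence of characteristic functions\<close>

text \<open>The second moments of \<open>V\<close>, bounded for large \<open>t\<close>, play the
  role of tightness: they bound the error of \<open>sin_linear_error\<close> independently of
  \<open>t\<close>.\<close>

locale char_convergence = M: prob_space M + N: prob_space N
  for M :: "'w measure" and N :: "'n measure" +
  fixes V :: "real \<Rightarrow> 'w \<Rightarrow> nat \<Rightarrow> real" and W :: "'n \<Rightarrow> nat \<Rightarrow> real"
  assumes V_measurable: "(\<lambda>w. V t w i) \<in> borel_measurable M"
    and W_measurable: "(\<lambda>w. W w i) \<in> borel_measurable N"
    and V_moment: "\<exists>C. \<forall>\<^sub>F t in at_top. integrable M (\<lambda>w. (V t w i)^2) \<and> (\<integral>w. (V t w i)^2 \<partial>M) \<le> C"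
    and char_tendsto: "((\<lambda>t. \<integral>w. cis (\<Sum>i<n. c i * V t w i) \<partial>M) \<longlongrightarrow> (\<integral>w. cis (\<Sum>i<n. c i * W w i) \<partial>N)) at_top"
begin

lemma VW_borel: "V t \<in> borel_measurable M" "W \<in> borel_measurable N"
  using V_measurable W_measurable by (auto intro: measurable_coordinatewise_then_product)

lemma trig_expectation_tendsto:
  "q \<in> trig \<Longrightarrow> ((\<lambda>t. \<integral>w. q (V t w) \<partial>M) \<longlongrightarrow> (\<integral>w. q (W w) \<partial>N)) at_top"
proof (induction rule: trig.induct)
  case (cos c n a)
  have red: "(\<integral>w. cos ((\<Sum>i<n. c i * Y w i) + a) \<partial>Q) = Re (cis a * (\<integral>w. cis (\<Sum>i<n. c i * Y w i) \<partial>Q))"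
    if "prob_space Q" "\<And>i. (\<lambda>w. Y w i) \<in> borel_measurable Q" for Q :: "'q measure" and Y :: "'q \<Rightarrow> nat \<Rightarrow> real"
  proof -
    interpret Q: prob_space Q by fact
    have i: "integrable Q (\<lambda>w. cis (\<Sum>i<n. c i * Y w i))"
    proof (rule Q.integrable_const_bound[where B = 1])
      have "(\<lambda>w. \<Sum>i<n. c i * Y w i) \<in> borel_measurable Q" using that(2) by measurable
      from measurable_compose[OF this borel_measurable_continuous_onI[OF continuous_on_cis[OF continuous_on_id]]]
      show "(\<lambda>w. cis (\<Sum>i<n. c i * Y w i)) \<in> borel_measurable Q" .
    qed simp
    have "Re (cis a * (\<integral>w. cis (\<Sum>i<n. c i * Y w i) \<partial>Q)) = Re (\<integral>w. cis a * cis (\<Sum>i<n. c i * Y w i) \<partial>Q)" by simp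
    also have "... = (\<integral>w. Re (cis a * cis (\<Sum>i<n. c i * Y w i)) \<partial>Q)" using i by (intro integral_Re[symmetric]) simp
    finally show ?thesis by (simp add: cis_mult add.commute)
  qed
  show ?case
    unfolding red[OF M.prob_space_axioms V_measurable] red[OF N.prob_space_axioms W_measurable]
    by (intro tendsto_intros char_tendsto)
next
  case (add p q)
  have int: "integrable M (\<lambda>w. r (V t w)) \<and> integrable N (\<lambda>w. r (W w))" if r: "r \<in> trig" for r t
  proof -
    obtain B where B: "\<And>y. \<bar>r y\<bar> \<le> B" using trig_bounded[OF r] by blast
    have rm: "r \<in> borel_measurable borel" using trig_continuous[OF r] by (rule borel_measurable_continuous_onI)
    then show ?thesis using B VW_borel
      by (auto intro!: M.bounded_integrable[where B = B] N.bounded_integrable[where B = B] measurable_compose[OF _ rm])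
  qed
  show ?case using tendsto_add[OF add.IH] int[OF add.hyps(1)] int[OF add.hyps(2)] by simp
next
  case (scale p s)
  then show ?case by (auto intro: tendsto_intros)
qed

text \<open>Five errors of size \<open>e / 5\<close>: periodic replacement under \<open>V\<close>,
  trigonometric approximation under \<open>V\<close>, convergence in \<open>t\<close>, and the two
  approximations again under \<open>W\<close>. For \<open>W\<close> the replacement error is removed
  by dominated convergence, for \<open>V\<close> by the second moments.\<close>

theorem fin_lipschitz_expectation_tendsto:
  assumes h: "fin_lipschitz J L h" and hB: "\<And>y. \<bar>h y\<bar> \<le> B"
  shows "((\<lambda>t. \<integral>w. h (V t w) \<partial>M) \<longlongrightarrow> (\<integral>w. h (W w) \<partial>N)) at_top"
proof (rule tendstoI)
  fix e :: real assume "0 < e"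
  then have e: "0 < e / 5" by simp
  have J: "finite J" "0 \<le> L" "\<And>y y'. \<bar>h y - h y'\<bar> \<le> L * (\<Sum>i\<in>J. \<bar>y i - y' i\<bar>)" using h by (auto simp: fin_lipschitz_def)
  define hs where "hs H y = h (\<lambda>i. H * sin (y i / H))" for H y
  have hc: "continuous_on UNIV h" by (rule fin_lipschitz_continuous[OF h])
  have hm: "h \<in> borel_measurable borel" using hc by (rule borel_measurable_continuous_onI)
  have hsm: "(\<lambda>w. hs H (Y w)) \<in> borel_measurable Q" if "\<And>i. (\<lambda>w. Y w i) \<in> borel_measurable Q" for H Y and Q :: "'q measure"
    unfolding hs_def using that by (intro fin_lipschitz_measurable[OF h]) simp
  from V_moment have "\<forall>i. \<exists>C. \<forall>\<^sub>F t in at_top. integrable M (\<lambda>w. (V t w i)^2) \<and> (\<integral>w. (V t w i)^2 \<partial>M) \<le> C" by blast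
  from choice[OF this] obtain C where C: "\<And>i. \<forall>\<^sub>F t in at_top. integrable M (\<lambda>w. (V t w i)^2) \<and> (\<integral>w. (V t w i)^2 \<partial>M) \<le> C i" by blast
  have "(\<lambda>n. \<integral>w. hs (real (Suc n)) (W w) \<partial>N) \<longlonglongrightarrow> (\<integral>w. h (W w) \<partial>N)"
  proof (rule integral_dominated_convergence[where w = "\<lambda>_. B"])
    show "(\<lambda>w. h (W w)) \<in> borel_measurable N" by (rule fin_lipschitz_measurable[OF h W_measurable])
    show "(\<lambda>w. hs (real (Suc n)) (W w)) \<in> borel_measurable N" for n by (rule hsm[OF W_measurable])
    show "AE w in N. (\<lambda>n. hs (real (Suc n)) (W w)) \<longlonglongrightarrow> h (W w)"
    proof (rule AE_I2, rule LIM_zero_cancel, rule Lim_null_comparison[OF always_eventually, OF allI])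
      fix w n
      have "norm (hs (real (Suc n)) (W w) - h (W w)) \<le> L * (\<Sum>i\<in>J. \<bar>real (Suc n) * sin (W w i / real (Suc n)) - W w i\<bar>)"
        unfolding hs_def using J(3) by simp
      also have "... \<le> L * (\<Sum>i\<in>J. (W w i)^2 / (2 * real (Suc n)))"
        using J(2) sin_linear_error[of "real (Suc n)"] by (intro mult_left_mono sum_mono) (auto simp: abs_minus_commute)
      also have "(\<Sum>i\<in>J. (W w i)^2 / (2 * real (Suc n))) = (\<Sum>i\<in>J. (W w i)^2 / 2) * inverse (real (Suc n))"
        unfolding sum_distrib_right by (intro sum.cong refl) (simp add: field_simps)
      also have "L * ((\<Sum>i\<in>J. (W w i)^2 / 2) * inverse (real (Suc n))) = L * (\<Sum>i\<in>J. (W w i)^2 / 2) * inverse (real (Suc n))"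
        by (rule mult.assoc[symmetric])
      finally show "norm (hs (real (Suc n)) (W w) - h (W w)) \<le> L * (\<Sum>i\<in>J. (W w i)^2 / 2) * inverse (real (Suc n))" .
    next
      fix w
      show "(\<lambda>n. L * (\<Sum>i\<in>J. (W w i)^2 / 2) * inverse (real (Suc n))) \<longlonglongrightarrow> 0"
        using tendsto_mult[OF tendsto_const LIMSEQ_inverse_real_of_nat] by fastforce
    qed
  qed (use hB in \<open>auto simp: hs_def\<close>)
  then have ev1: "\<forall>\<^sub>F n in sequentially. dist (\<integral>w. hs (real (Suc n)) (W w) \<partial>N) (\<integral>w. h (W w) \<partial>N) < e / 5"
    using e by (rule tendstoD)
  define D where "D = L * (\<Sum>i\<in>J. C i / 2)"
  have "(\<lambda>n. D * inverse (real (Suc n))) \<longlonglongrightarrow> D * 0" by (intro tendsto_mult tendsto_const LIMSEQ_inverse_real_of_nat)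
  from order_tendstoD(2)[OF this, of "e / 5"] e have ev2: "\<forall>\<^sub>F n in sequentially. D * inverse (real (Suc n)) < e / 5" by simp
  obtain n where n: "dist (\<integral>w. hs (real (Suc n)) (W w) \<partial>N) (\<integral>w. h (W w) \<partial>N) < e / 5" "D * inverse (real (Suc n)) < e / 5"
    using eventually_conj[OF ev1 ev2] by (auto simp: eventually_sequentially)
  define H where "H = real (Suc n)"
  have H: "0 < H" by (simp add: H_def)
  obtain q where q: "q \<in> trig" "\<And>y. \<bar>hs H y - q y\<bar> \<le> e / 5"
    using trig_dense[OF h e, of H] unfolding hs_def by blast
  obtain Bq where Bq: "\<And>y. \<bar>q y\<bar> \<le> Bq" using trig_bounded[OF q(1)] by blast
  have qm: "q \<in> borel_measurable borel" using trig_continuous[OF q(1)] by (rule borel_measurable_continuous_onI)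
  have close: "\<bar>(\<integral>w. hs H (Y w) \<partial>Q) - (\<integral>w. q (Y w) \<partial>Q)\<bar> \<le> e / 5"
    if "prob_space Q" "\<And>i. (\<lambda>w. Y w i) \<in> borel_measurable Q" for Q :: "'q measure" and Y
  proof -
    interpret Q: prob_space Q by fact
    have Y: "Y \<in> borel_measurable Q" using that(2) by (rule measurable_coordinatewise_then_product)
    have i: "integrable Q (\<lambda>w. hs H (Y w))" "integrable Q (\<lambda>w. q (Y w))"
    proof -
      show "integrable Q (\<lambda>w. hs H (Y w))"
        by (rule Q.bounded_integrable[where B = B], rule hsm[OF that(2)]) (simp add: hs_def hB)
      show "integrable Q (\<lambda>w. q (Y w))"
        by (rule Q.bounded_integrable[where B = Bq], rule measurable_compose[OF Y qm]) (rule Bq)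
    qed
    have "\<bar>\<integral>w. hs H (Y w) - q (Y w) \<partial>Q\<bar> \<le> (\<integral>w. \<bar>hs H (Y w) - q (Y w)\<bar> \<partial>Q)" by (rule integral_abs_bound)
    also have "... \<le> (\<integral>w. e / 5 \<partial>Q)" using q(2) i by (intro integral_mono) auto
    finally show ?thesis using i by (simp add: Q.prob_space)
  qed
  have "\<forall>\<^sub>F t in at_top. dist (\<integral>w. q (V t w) \<partial>M) (\<integral>w. q (W w) \<partial>N) < e / 5"
    using trig_expectation_tendsto[OF q(1)] e by (rule tendstoD)
  moreover have "\<forall>\<^sub>F t in at_top. \<forall>i\<in>J. integrable M (\<lambda>w. (V t w i)^2) \<and> (\<integral>w. (V t w i)^2 \<partial>M) \<le> C i"
    using C by (intro eventually_ball_finite J) auto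
  ultimately show "\<forall>\<^sub>F t in at_top. dist (\<integral>w. h (V t w) \<partial>M) (\<integral>w. h (W w) \<partial>N) < e"
  proof eventually_elim
    case (elim t)
    have ih: "integrable M (\<lambda>w. h (V t w))"
      using hB by (intro M.bounded_integrable[where B = B] fin_lipschitz_measurable[OF h V_measurable])
    have ihs: "integrable M (\<lambda>w. hs H (V t w))"
      using hB by (intro M.bounded_integrable[where B = B] hsm[OF V_measurable]) (auto simp: hs_def)
    have i2: "integrable M (\<lambda>w. L * (\<Sum>i\<in>J. (V t w i)^2 / (2 * H)))"
      using elim(2) by (intro integrable_mult_right Bochner_Integration.integrable_sum integrable_divide) auto
    have "\<bar>\<integral>w. h (V t w) - hs H (V t w) \<partial>M\<bar> \<le> (\<integral>w. \<bar>h (V t w) - hs H (V t w)\<bar> \<partial>M)" by (rule integral_abs_bound)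
    also have "... \<le> (\<integral>w. L * (\<Sum>i\<in>J. (V t w i)^2 / (2 * H)) \<partial>M)"
    proof (rule integral_mono[OF _ i2])
      fix w
      have "\<bar>h (V t w) - hs H (V t w)\<bar> \<le> L * (\<Sum>i\<in>J. \<bar>V t w i - H * sin (V t w i / H)\<bar>)" unfolding hs_def by (rule J(3))
      also have "... \<le> L * (\<Sum>i\<in>J. (V t w i)^2 / (2 * H))"
        using J(2) H by (intro mult_left_mono sum_mono sin_linear_error)
      finally show "\<bar>h (V t w) - hs H (V t w)\<bar> \<le> L * (\<Sum>i\<in>J. (V t w i)^2 / (2 * H))" .
    qed (use ih ihs in auto)
    also have "... = L * (\<Sum>i\<in>J. (\<integral>w. (V t w i)^2 \<partial>M) / (2 * H))"
      using elim(2) by simp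
    also have "... \<le> L * (\<Sum>i\<in>J. C i / (2 * H))"
      using elim(2) J(2) H by (intro mult_left_mono sum_mono divide_right_mono) auto
    also have "(\<Sum>i\<in>J. C i / (2 * H)) = (\<Sum>i\<in>J. C i / 2) * inverse (real (Suc n))"
      unfolding sum_distrib_right H_def by (intro sum.cong refl) (simp add: field_simps)
    also have "L * ((\<Sum>i\<in>J. C i / 2) * inverse (real (Suc n))) = D * inverse (real (Suc n))"
      unfolding D_def by (rule mult.assoc[symmetric])
    finally have 1: "\<bar>(\<integral>w. h (V t w) \<partial>M) - (\<integral>w. hs H (V t w) \<partial>M)\<bar> < e / 5"
      using n(2) ih ihs by simp
    show ?case
      using 1 n(1) close[of M "V t", OF M.prob_space_axioms V_measurable] close[of N W, OF N.prob_space_axioms W_measurable] elim(1)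
      unfolding dist_real_def H_def[symmetric] by linarith
  qed
qed

end

section \<open>Asymptotic variance\<close>

text \<open>Closeness to convergent functions gives the Cauchy property at infinity; the limit is
  then found along the integers.\<close>

lemma tendsto_at_top_of_approximations:
  fixes F :: "real \<Rightarrow> 'b::banach"
  assumes "\<And>e. 0 < e \<Longrightarrow> \<exists>g l. (g \<longlongrightarrow> l) at_top \<and> (\<forall>\<^sub>F t in at_top. dist (F t) (g t) \<le> e)"
  shows "\<exists>l. (F \<longlongrightarrow> l) at_top"
proof -
  have close: "\<exists>T. \<forall>s\<ge>T. \<forall>t\<ge>T. dist (F s) (F t) < e" if e: "0 < e" for e
  proof -
    obtain g l where g: "(g \<longlongrightarrow> l) at_top" "\<forall>\<^sub>F t in at_top. dist (F t) (g t) \<le> e / 5"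
      using assms[of "e / 5"] e by auto
    have "\<forall>\<^sub>F t in at_top. dist (F t) l < 2 * e / 5"
      using g(2) tendstoD[OF g(1) divide_pos_pos[OF e zero_less_numeral[of "num.Bit1 (num.Bit0 num.One)"]]]
    proof eventually_elim
      case (elim t)
      then show ?case using dist_triangle[of "F t" l "g t"] by simp
    qed
    then obtain T where T: "\<And>t. t \<ge> T \<Longrightarrow> dist (F t) l < 2 * e / 5" by (auto simp: eventually_at_top_linorder)
    have "dist (F s) (F t) < e" if "s \<ge> T" "t \<ge> T" for s t
      using T[OF that(1)] T[OF that(2)] dist_triangle2[of "F s" "F t" l] e by simp
    then show ?thesis by blast
  qed
  have "Cauchy (\<lambda>n. F (real n))"
  proof (rule metric_CauchyI)
    fix e :: real assume "0 < e"
    then obtain T where T: "\<And>s t. s \<ge> T \<Longrightarrow> t \<ge> T \<Longrightarrow> dist (F s) (F t) < e" using close by blast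
    obtain N where "T \<le> real N" using real_arch_simple by blast
    then show "\<exists>N. \<forall>m\<ge>N. \<forall>n\<ge>N. dist (F (real m)) (F (real n)) < e"
      by (intro exI[of _ N] allI impI T) auto
  qed
  then obtain l where l: "(\<lambda>n. F (real n)) \<longlonglongrightarrow> l" using Cauchy_convergent convergent_def by blast
  have "(F \<longlongrightarrow> l) at_top"
  proof (rule tendstoI)
    fix e :: real assume e: "0 < e"
    then obtain T where T: "\<And>s t. s \<ge> T \<Longrightarrow> t \<ge> T \<Longrightarrow> dist (F s) (F t) < e / 2" using close[of "e / 2"] by auto
    obtain N where N: "\<And>n. n \<ge> N \<Longrightarrow> dist (F (real n)) l < e / 2"
      using tendstoD[OF l, of "e / 2"] e by (auto simp: eventually_sequentially)
    obtain N' where "T \<le> real N'" using real_arch_simple by blast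
    then have "T \<le> real (max N N')" by simp
    then have "dist (F t) l < e" if "t \<ge> T" for t
      using T[OF that, of "real (max N N')"] N[of "max N N'"] dist_triangle[of "F t" l "F (real (max N N'))"] by simp
    then show "\<forall>\<^sub>F t in at_top. dist (F t) l < e" by (auto simp: eventually_at_top_linorder)
  qed
  then show ?thesis by blast
qed

lemma exp_has_integral:
  fixes \<gamma> s :: real
  assumes "0 < \<gamma>" "0 \<le> s"
  shows "((\<lambda>r. exp (- \<gamma> * (s - r))) has_integral (1 - exp (- \<gamma> * s)) / \<gamma>) {0..s}"
proof -
  have "((\<lambda>r. exp (- \<gamma> * (s - r))) has_integral (exp (- \<gamma> * (s - s)) / \<gamma> - exp (- \<gamma> * (s - 0)) / \<gamma>)) {0..s}"
    using assms by (intro fundamental_theorem_of_calculus)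
      (auto intro!: derivative_eq_intros simp: has_real_derivative_iff_has_vector_derivative[symmetric])
  then show ?thesis by (simp add: diff_divide_distrib)
qed

lemma exp_kernel_integral_bound:
  fixes H :: "real \<Rightarrow> 'b::euclidean_space"
  assumes "0 < \<gamma>" "0 \<le> s" "0 \<le> B" "H integrable_on {0..s}" "\<And>r. r \<in> {0..s} \<Longrightarrow> norm (H r) \<le> B * exp (- \<gamma> * (s - r))"
  shows "norm (integral {0..s} H) \<le> B / \<gamma>"
proof -
  have hi: "((\<lambda>r. B * exp (- \<gamma> * (s - r))) has_integral B * ((1 - exp (- \<gamma> * s)) / \<gamma>)) {0..s}"
    using assms by (intro has_integral_mult_right exp_has_integral)
  have "norm (integral {0..s} H) \<le> integral {0..s} (\<lambda>r. B * exp (- \<gamma> * (s - r)))"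
    using assms hi by (intro integral_norm_bound_integral) (auto simp: has_integral_integrable)
  also have "... = B * ((1 - exp (- \<gamma> * s)) / \<gamma>)" using hi by (rule integral_unique)
  also have "... \<le> B * (1 / \<gamma>)" using assms by (intro mult_left_mono divide_right_mono) auto
  finally show ?thesis by simp
qed

lemma exp_integral_bound:
  fixes H :: "real \<Rightarrow> 'b::euclidean_space"
  assumes "0 < \<gamma>" "0 \<le> s" "0 \<le> B" "H integrable_on {0..s}" "\<And>r. r \<in> {0..s} \<Longrightarrow> norm (H r) \<le> B * exp (- \<gamma> * r)"
  shows "norm (integral {0..s} H) \<le> B / \<gamma>"
proof -
  have "((\<lambda>r. exp (- \<gamma> * r)) has_integral (- exp (- \<gamma> * s) / \<gamma> - (- exp (- \<gamma> * 0) / \<gamma>))) {0..s}"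
    using assms by (intro fundamental_theorem_of_calculus)
      (auto intro!: derivative_eq_intros simp: has_real_derivative_iff_has_vector_derivative[symmetric])
  then have hi: "((\<lambda>r. B * exp (- \<gamma> * r)) has_integral B * ((1 - exp (- \<gamma> * s)) / \<gamma>)) {0..s}"
    by (intro has_integral_mult_right) (simp add: diff_divide_distrib)
  have "norm (integral {0..s} H) \<le> integral {0..s} (\<lambda>r. B * exp (- \<gamma> * r))"
    using assms hi by (intro integral_norm_bound_integral) (auto simp: has_integral_integrable)
  also have "... = B * ((1 - exp (- \<gamma> * s)) / \<gamma>)" using hi by (rule integral_unique)
  also have "... \<le> B * (1 / \<gamma>)" using assms by (intro mult_left_mono divide_right_mono) auto
  finally show ?thesis by simp
qed

context spectral_gap_process
begin

definition corr :: "('a \<Rightarrow> real) \<Rightarrow> real \<Rightarrow> real" where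
  "corr f v = mean (\<lambda>x. f x * P v f x)"

lemma corr_continuous: "f \<in> Bd \<Longrightarrow> continuous_on {0..} (corr f)"
  unfolding corr_def by (rule inner_P_continuous)

lemma corr_integrable: "f \<in> Bd \<Longrightarrow> 0 \<le> a \<Longrightarrow> corr f integrable_on {a..b}"
  by (intro integrable_continuous_interval continuous_on_subset[OF corr_continuous]) auto

lemma corr_bound:
  assumes "f \<in> Bd" "mean f = 0" "0 \<le> v"
  shows "\<bar>corr f v\<bar> \<le> exp (- \<gamma> * v) * (nrm f)^2"
proof -
  have "\<bar>corr f v\<bar> \<le> nrm f * nrm (P v f)"
    unfolding corr_def using assms by (intro L2_Cauchy_Schwarz Bd_L2 P_Bd)
  also have "... \<le> nrm f * (exp (- \<gamma> * v) * nrm f)" using assms by (intro mult_left_mono decay) auto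
  finally show ?thesis by (simp add: power2_eq_square ac_simps)
qed

lemma two_point:
  assumes "f \<in> Bd" "0 \<le> u" "0 \<le> v"
  shows "(\<integral>w. f (X u w) * f (X v w) \<partial>M) = corr f \<bar>u - v\<bar>"
proof (cases "u \<le> v")
  case True
  then show ?thesis using correlation[of u "v - u" f f] assms by (simp add: corr_def)
next
  case False
  then show ?thesis using correlation[of v "u - v" f f] assms by (simp add: corr_def mult.commute)
qed

definition cumcorr :: "('a \<Rightarrow> real) \<Rightarrow> real \<Rightarrow> real" where
  "cumcorr f s = integral {0..s} (corr f)"

lemma cumcorr_increment:
  assumes f: "f \<in> Bd" "mean f = 0" and s: "0 \<le> s" "s \<le> s'"
  shows "\<bar>cumcorr f s' - cumcorr f s\<bar> \<le> exp (- \<gamma> * s) * (nrm f)^2 / \<gamma>"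
proof -
  have "cumcorr f s' - cumcorr f s = integral {s..s'} (corr f)"
    using Henstock_Kurzweil_Integration.integral_combine[of 0 s s' "corr f"] corr_integrable[OF f(1), of 0 s'] s by (simp add: cumcorr_def)
  also have "... = integral {0 + s..(s' - s) + s} (corr f)" by simp
  also have "... = integral {0..s' - s} (corr f \<circ> (\<lambda>x. x + s))"
    using s by (intro integral_shift[symmetric] continuous_on_subset[OF corr_continuous[OF f(1)]]) auto
  also have "norm ... \<le> (exp (- \<gamma> * s) * (nrm f)^2) / \<gamma>"
  proof (rule exp_integral_bound[OF gap_pos])
    show "corr f \<circ> (\<lambda>x. x + s) integrable_on {0..s' - s}"
      using s by (intro integrable_continuous_interval continuous_on_compose2[OF corr_continuous[OF f(1)], of _ "\<lambda>x. x + s", folded o_def])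
        (auto simp: o_def intro!: continuous_intros continuous_on_compose2[OF corr_continuous[OF f(1)]])
    fix r assume "r \<in> {0..s' - s}"
    then have "\<bar>corr f (r + s)\<bar> \<le> exp (- \<gamma> * (r + s)) * (nrm f)^2" using s by (intro corr_bound[OF f]) auto
    then show "norm ((corr f \<circ> (\<lambda>x. x + s)) r) \<le> exp (- \<gamma> * s) * (nrm f)^2 * exp (- \<gamma> * r)"
      by (simp add: distrib_left exp_add[symmetric] mult.assoc) (simp add: exp_add ac_simps exp_diff exp_minus divide_inverse)
  qed (use s in auto)
  finally show ?thesis by simp
qed

lemma cumcorr_limit:
  assumes f: "f \<in> Bd" "mean f = 0"
  shows "\<exists>l. \<forall>s\<ge>0. \<bar>cumcorr f s - l\<bar> \<le> exp (- \<gamma> * s) * (nrm f)^2 / \<gamma>"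
proof -
  have e0: "((\<lambda>s. exp (- \<gamma> * s) * (nrm f)^2 / \<gamma>) \<longlongrightarrow> 0) at_top"
  proof -
    have "((\<lambda>s. exp (- \<gamma> * s)) \<longlongrightarrow> 0) at_top"
      by (rule filterlim_compose[OF exp_at_bot filterlim_tendsto_neg_mult_at_bot[OF tendsto_const _ filterlim_ident]]) (use gap_pos in simp)
    from tendsto_divide_zero[OF tendsto_mult_left_zero[OF this]] show ?thesis .
  qed
  have "\<exists>l. (cumcorr f \<longlongrightarrow> l) at_top"
  proof (rule tendsto_at_top_of_approximations)
    fix e :: real assume e: "0 < e"
    obtain s where s: "0 \<le> s" "exp (- \<gamma> * s) * (nrm f)^2 / \<gamma> < e"
      using eventually_conj[OF order_tendstoD(2)[OF e0 e] eventually_ge_at_top[of 0]]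
      by (auto simp: eventually_at_top_linorder)
    have "\<forall>\<^sub>F t in at_top. dist (cumcorr f t) (cumcorr f s) \<le> e"
      using eventually_ge_at_top[of s]
      by eventually_elim (use cumcorr_increment[OF f s(1)] s(2) in \<open>force simp: dist_real_def\<close>)
    then show "\<exists>g l. (g \<longlongrightarrow> l) at_top \<and> (\<forall>\<^sub>F t in at_top. dist (cumcorr f t) (g t) \<le> e)"
      by (intro exI[of _ "\<lambda>_. cumcorr f s"] exI[of _ "cumcorr f s"]) auto
  qed
  then obtain l where l: "(cumcorr f \<longlongrightarrow> l) at_top" by blast
  have "\<bar>cumcorr f s - l\<bar> \<le> exp (- \<gamma> * s) * (nrm f)^2 / \<gamma>" if s: "0 \<le> s" for s
  proof (rule tendsto_upperbound)
    show "((\<lambda>t. \<bar>cumcorr f s - cumcorr f t\<bar>) \<longlongrightarrow> \<bar>cumcorr f s - l\<bar>) at_top" by (intro tendsto_intros l)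
    show "\<forall>\<^sub>F t in at_top. \<bar>cumcorr f s - cumcorr f t\<bar> \<le> exp (- \<gamma> * s) * (nrm f)^2 / \<gamma>"
      using eventually_ge_at_top[of s]
      by eventually_elim (use cumcorr_increment[OF f s] in \<open>simp add: abs_minus_commute\<close>)
  qed simp
  then show ?thesis by blast
qed

text \<open>The integral of the autocovariance over the half-line, half the asymptotic variance of
  \<open>f\<close>; it is selected by its exponential rate of approach.\<close>

definition corrlim :: "('a \<Rightarrow> real) \<Rightarrow> real" where
  "corrlim f = (SOME l. \<forall>s\<ge>0. \<bar>cumcorr f s - l\<bar> \<le> exp (- \<gamma> * s) * (nrm f)^2 / \<gamma>)"

lemma corrlim:
  assumes "f \<in> Bd" "mean f = 0" "0 \<le> s"
  shows "\<bar>cumcorr f s - corrlim f\<bar> \<le> exp (- \<gamma> * s) * (nrm f)^2 / \<gamma>"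
  using someI_ex[OF cumcorr_limit[OF assms(1,2)]] assms(3) unfolding corrlim_def by blast

lemma cumcorr_bound:
  assumes f: "f \<in> Bd" "mean f = 0" and s: "0 \<le> s"
  shows "\<bar>cumcorr f s\<bar> \<le> (nrm f)^2 / \<gamma>"
  using cumcorr_increment[OF f order_refl s] by (simp add: cumcorr_def)

text \<open>The integral is split at \<open>v = u\<close>; reflection and translation turn both
  halves into one-sided integrals.\<close>

lemma two_sided_corr:
  assumes f: "f \<in> Bd" and u: "0 \<le> u" "u \<le> T"
  shows "(LBINT v:{0..T}. corr f \<bar>u - v\<bar>) = cumcorr f u + cumcorr f (T - u)"
proof -
  have c: "continuous_on {0..T} (\<lambda>v. corr f \<bar>u - v\<bar>)"
    by (intro continuous_on_compose2[OF corr_continuous[OF f]] continuous_intros) auto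
  have "(LBINT v:{0..T}. corr f \<bar>u - v\<bar>) = integral {0..T} (\<lambda>v. corr f \<bar>u - v\<bar>)"
    by (intro set_borel_integral_eq_integral borel_integrable_atLeastAtMost' c)
  also have "... = integral {0..u} (\<lambda>v. corr f \<bar>u - v\<bar>) + integral {u..T} (\<lambda>v. corr f \<bar>u - v\<bar>)"
    using u by (intro Henstock_Kurzweil_Integration.integral_combine[symmetric] integrable_continuous_interval c)
  also have "integral {0..u} (\<lambda>v. corr f \<bar>u - v\<bar>) = integral {-0..-(-u)} (\<lambda>v. (corr f \<circ> (\<lambda>x. x + u)) (- v))"
    unfolding minus_minus minus_zero by (intro integral_cong) auto
  also have "... = integral {-u..0} (corr f \<circ> (\<lambda>x. x + u))" using Henstock_Kurzweil_Integration.integral_reflect_real[of 0 "- u" "corr f \<circ> (\<lambda>x. x + u)"] by (simp only:)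
  also have "... = integral {-u + u..0 + u} (corr f)"
    by (intro integral_shift continuous_on_subset[OF corr_continuous[OF f]]) auto
  also have "integral {u..T} (\<lambda>v. corr f \<bar>u - v\<bar>) = integral {u..T} (corr f \<circ> (\<lambda>x. x + (- u)))"
    by (intro integral_cong) auto
  also have "... = integral {u + (- u)..T + (- u)} (corr f)"
    by (intro integral_shift continuous_on_subset[OF corr_continuous[OF f]]) auto
  finally show ?thesis by (simp add: cumcorr_def)
qed

text \<open>Fubini in each of the two factors of the square, then stationarity for the two-point
  function.\<close>

lemma path_integral_second_moment:
  assumes f: "f \<in> Bd" and T: "0 \<le> T"
  shows "(\<integral>w. (path_integral T f w)^2 \<partial>M) = (LBINT u:{0..T}. cumcorr f u + cumcorr f (T - u))"
proof -
  obtain b where b: "\<And>x. x \<in> E \<Longrightarrow> \<bar>f x\<bar> \<le> b" using BdE[OF f] by metis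
  have fm: "f \<in> borel_measurable \<mu>" using f by (rule Bd_measurable)
  have m: "path_integral T f \<in> borel_measurable M" by (rule path_integral_measurable[OF fm])
  have Sb: "\<bar>path_integral T f w\<bar> \<le> b * T" if "w \<in> space M" for w by (rule path_integral_bound[OF T that fm b])
  have Xm: "(\<lambda>w. f (X u w)) \<in> borel_measurable M" if "0 \<le> u" for u using measurable_compose[OF X_measurable[OF that] fm] .
  have Xb: "\<bar>f (X u w)\<bar> \<le> b" if "0 \<le> u" "w \<in> space M" for u w using b X_in_E that by blast
  have "(\<integral>w. (path_integral T f w)^2 \<partial>M) = (\<integral>w. path_integral T f w * path_integral T f w \<partial>M)"
    by (simp add: power2_eq_square)
  also have "... = (LBINT u:{0..T}. \<integral>w. path_integral T f w * f (X u w) \<partial>M)"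
    by (rule expectation_path_integral[OF T m Sb f])
  also have "... = (LBINT u:{0..T}. cumcorr f u + cumcorr f (T - u))"
  proof (rule set_lebesgue_integral_cong)
    show "\<forall>u. u \<in> {0..T} \<longrightarrow> (\<integral>w. path_integral T f w * f (X u w) \<partial>M) = cumcorr f u + cumcorr f (T - u)"
    proof (intro allI impI)
      fix u assume u: "u \<in> {0..T}"
      have "(\<integral>w. path_integral T f w * f (X u w) \<partial>M) = (\<integral>w. f (X u w) * path_integral T f w \<partial>M)" by (simp add: mult.commute)
      also have "... = (LBINT v:{0..T}. \<integral>w. f (X u w) * f (X v w) \<partial>M)"
        using u by (intro expectation_path_integral[OF T Xm _ f, where c = b] Xb) auto
      also have "... = (LBINT v:{0..T}. corr f \<bar>u - v\<bar>)"
        using u by (intro set_lebesgue_integral_cong) (auto simp: two_point[OF f])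
      also have "... = cumcorr f u + cumcorr f (T - u)" using u by (intro two_sided_corr[OF f]) auto
      finally show "(\<integral>w. path_integral T f w * f (X u w) \<partial>M) = cumcorr f u + cumcorr f (T - u)" .
    qed
  qed simp
  finally show ?thesis .
qed

lemma cumcorr_continuous: "f \<in> Bd \<Longrightarrow> continuous_on {0..T} (cumcorr f)"
  unfolding cumcorr_def by (intro indefinite_integral_continuous_1 corr_integrable) auto

lemma second_moment_integrable:
  assumes f: "f \<in> Bd"
  shows "continuous_on {0..T} (\<lambda>u. cumcorr f u + cumcorr f (T - u))"
  by (intro continuous_intros cumcorr_continuous[OF f] continuous_on_compose2[OF cumcorr_continuous[OF f, of T]]) auto

lemma second_moment_HK:
  assumes f: "f \<in> Bd" and T: "0 \<le> T"
  shows "(\<integral>w. (path_integral T f w)^2 \<partial>M) = integral {0..T} (\<lambda>u. cumcorr f u + cumcorr f (T - u))"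
  unfolding path_integral_second_moment[OF assms]
  by (intro set_borel_integral_eq_integral borel_integrable_atLeastAtMost' second_moment_integrable[OF f])

lemma variance_bound_Bd:
  assumes f: "f \<in> Bd" "mean f = 0" and T: "0 \<le> T"
  shows "(\<integral>w. (path_integral T f w)^2 \<partial>M) \<le> 2 * T * (nrm f)^2 / \<gamma>"
proof -
  have "integral {0..T} (\<lambda>u. cumcorr f u + cumcorr f (T - u)) \<le> integral {0..T} (\<lambda>_. 2 * (nrm f)^2 / \<gamma>)"
  proof (rule integral_le)
    show "(\<lambda>u. cumcorr f u + cumcorr f (T - u)) integrable_on {0..T}"
      by (intro integrable_continuous_interval second_moment_integrable[OF f(1)])
    show "cumcorr f u + cumcorr f (T - u) \<le> 2 * (nrm f)^2 / \<gamma>" if "u \<in> {0..T}" for u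
      using cumcorr_bound[OF f, of u] cumcorr_bound[OF f, of "T - u"] that by simp
  qed auto
  then show ?thesis unfolding second_moment_HK[OF f(1) T] using T by (simp add: mult.assoc mult.left_commute)
qed

text \<open>The inner integral differs from \<open>2 * corrlim f\<close> by terms that decay
  exponentially away from the two ends of the time interval, so the total error is bounded in
  \<open>T\<close>, and of order \<open>1 / T\<close> after division.\<close>

lemma variance_limit_Bd:
  assumes f: "f \<in> Bd" "mean f = 0" and T: "0 < T"
  shows "\<bar>(\<integral>w. (path_integral T f w)^2 \<partial>M) / T - 2 * corrlim f\<bar> \<le> 2 * ((nrm f)^2 / \<gamma>) / \<gamma> / T"
proof -
  let ?K = "(nrm f)^2 / \<gamma>"
  have ci: "(\<lambda>u. cumcorr f u - corrlim f) integrable_on {0..T}" "(\<lambda>u. cumcorr f (T - u) - corrlim f) integrable_on {0..T}"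
    by (intro integrable_continuous_interval continuous_intros cumcorr_continuous[OF f(1)]
        continuous_on_compose2[OF cumcorr_continuous[OF f(1), of T]]; auto)+
  have K: "0 \<le> ?K" using gap_pos by simp
  have 1: "norm (integral {0..T} (\<lambda>u. cumcorr f u - corrlim f)) \<le> ?K / \<gamma>"
    using corrlim[OF f] T K by (intro exp_integral_bound[OF gap_pos _ _ ci(1)]) (auto simp: field_simps)
  have 2: "norm (integral {0..T} (\<lambda>u. cumcorr f (T - u) - corrlim f)) \<le> ?K / \<gamma>"
  proof (rule exp_kernel_integral_bound[OF gap_pos _ K ci(2)])
    fix u assume "u \<in> {0..T}"
    then show "norm (cumcorr f (T - u) - corrlim f) \<le> ?K * exp (- \<gamma> * (T - u))"
      using corrlim[OF f, of "T - u"] by (simp add: mult.commute)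
  qed (use T in simp)
  have "(\<integral>w. (path_integral T f w)^2 \<partial>M) = integral {0..T} (\<lambda>u. (cumcorr f u - corrlim f) + (cumcorr f (T - u) - corrlim f) + 2 * corrlim f)"
    unfolding second_moment_HK[OF f(1) less_imp_le[OF T]] by (simp add: algebra_simps)
  also have "... = integral {0..T} (\<lambda>u. cumcorr f u - corrlim f) + integral {0..T} (\<lambda>u. cumcorr f (T - u) - corrlim f) + 2 * corrlim f * T"
    unfolding integral_add[OF integrable_add[OF ci] integrable_const_ivl]
      integral_add[OF ci] using T by simp
  finally have "\<bar>(\<integral>w. (path_integral T f w)^2 \<partial>M) - 2 * corrlim f * T\<bar> \<le> 2 * ?K / \<gamma>"
    using 1 2 by (simp add: add_divide_distrib)
  then have "\<bar>(\<integral>w. (path_integral T f w)^2 \<partial>M) - 2 * corrlim f * T\<bar> / T \<le> 2 * ?K / \<gamma> / T"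
    using T by (intro divide_right_mono) auto
  moreover have "\<bar>(\<integral>w. (path_integral T f w)^2 \<partial>M) - 2 * corrlim f * T\<bar> / T = \<bar>(\<integral>w. (path_integral T f w)^2 \<partial>M) / T - 2 * corrlim f\<bar>"
  proof -
    have "x / T - y = (x - y * T) / T" for x y using T by (simp add: field_simps)
    then show ?thesis using T by simp
  qed
  ultimately show ?thesis by simp
qed

text \<open>\<open>2 * corrlim f\<close> is the limit of nonnegative scaled second moments.\<close>

lemma corrlim_nonneg:
  assumes f: "f \<in> Bd" "mean f = 0"
  shows "0 \<le> corrlim f"
proof -
  have "((\<lambda>T. 2 * ((nrm f)^2 / \<gamma>) / \<gamma> / T) \<longlongrightarrow> 0) at_top"
    by (intro tendsto_divide_0[OF tendsto_const] filterlim_at_top_imp_at_infinity filterlim_ident)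
  moreover have "\<forall>\<^sub>F T in at_top. - 2 * corrlim f \<le> 2 * ((nrm f)^2 / \<gamma>) / \<gamma> / T"
    using eventually_gt_at_top[of 0]
  proof eventually_elim
    case (elim T)
    have "0 \<le> (\<integral>w. (path_integral T f w)^2 \<partial>M) / T" using elim by simp
    then show ?case using variance_limit_Bd[OF f elim] by linarith
  qed
  ultimately have "- 2 * corrlim f \<le> 0" by (intro tendsto_lowerbound[where F = at_top]) auto
  then show ?thesis by simp
qed

end

section \<open>Exchanging expectations and time integrals\<close>

context prob_space
begin

lemma expectation_continuous:
  fixes Y :: "real \<Rightarrow> 'a \<Rightarrow> real"
  assumes Y: "\<And>u. 0 \<le> u \<Longrightarrow> Y u \<in> borel_measurable M"
    and cont: "\<And>w. w \<in> space M \<Longrightarrow> continuous_on {0..T} (\<lambda>u. Y u w)"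
    and bound: "\<And>u w. u \<in> {0..T} \<Longrightarrow> w \<in> space M \<Longrightarrow> \<bar>Y u w\<bar> \<le> c"
  shows "continuous_on {0..T} (\<lambda>u. \<integral>w. Y u w \<partial>M)"
  unfolding continuous_on_sequentially
proof (intro ballI allI impI, unfold o_def)
  fix u s assume u: "u \<in> {0..T}" and s: "(\<forall>n::nat. s n \<in> {0..T}) \<and> s \<longlonglongrightarrow> u"
  show "(\<lambda>n. \<integral>w. Y (s n) w \<partial>M) \<longlonglongrightarrow> (\<integral>w. Y u w \<partial>M)"
  proof (rule integral_dominated_convergence[where w = "\<lambda>_. c"])
    show "AE w in M. (\<lambda>n. Y (s n) w) \<longlonglongrightarrow> Y u w"
      using cont s u unfolding continuous_on_sequentially o_def by (intro AE_I2) blast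
    show "AE w in M. norm (Y (s n) w) \<le> c" for n using bound s by (intro AE_I2) auto
  qed (use Y u s in auto)
qed

lemma expectation_integral_swap:
  fixes Y :: "real \<Rightarrow> 'a \<Rightarrow> real"
  assumes T: "0 \<le> T" and Y: "\<And>u. 0 \<le> u \<Longrightarrow> Y u \<in> borel_measurable M"
    and cont: "\<And>w. w \<in> space M \<Longrightarrow> continuous_on {0..T} (\<lambda>u. Y u w)"
    and bound: "\<And>u w. u \<in> {0..T} \<Longrightarrow> w \<in> space M \<Longrightarrow> \<bar>Y u w\<bar> \<le> c"
  shows "(\<integral>w. integral {0..T} (\<lambda>u. Y u w) \<partial>M) = integral {0..T} (\<lambda>u. \<integral>w. Y u w \<partial>M)"
proof -
  interpret pair_sigma_finite lborel M by unfold_locales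
  let ?Y = "\<lambda>u. Y (min T (max 0 u))"
  have "(\<lambda>p. ?Y (fst p) (snd p)) \<in> borel_measurable (borel \<Otimes>\<^sub>M M)"
    using Y T by (intro jointly_measurable_continuous[of ?Y] continuous_on_compose2[OF cont]) (auto intro!: continuous_intros)
  then have Ym[measurable]: "(\<lambda>p. ?Y (fst p) (snd p)) \<in> borel_measurable (lborel \<Otimes>\<^sub>M M)" by simp
  let ?k = "\<lambda>u w. indicator {0..T} u * ?Y u w"
  have int: "integrable (lborel \<Otimes>\<^sub>M M) (case_prod ?k)"
  proof (rule integrableI_bounded_set[where A = "{0..T} \<times> space M" and B = c])
    show "{0..T} \<times> space M \<in> sets (lborel \<Otimes>\<^sub>M M)" by auto
    show "emeasure (lborel \<Otimes>\<^sub>M M) ({0..T} \<times> space M) < \<infinity>"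
      using T by (subst sigma_finite_measure.emeasure_pair_measure_Times[OF prob_space_imp_sigma_finite[OF prob_space_axioms]]) (auto simp: emeasure_space_1)
    show "case_prod ?k \<in> borel_measurable (lborel \<Otimes>\<^sub>M M)"
      unfolding split_beta' by measurable
    show "AE p in lborel \<Otimes>\<^sub>M M. p \<in> {0..T} \<times> space M \<longrightarrow> norm (case_prod ?k p) \<le> c"
      using bound T by (intro AE_I2) (auto simp: abs_mult)
    show "AE p in lborel \<Otimes>\<^sub>M M. p \<notin> {0..T} \<times> space M \<longrightarrow> case_prod ?k p = 0"
      by (intro AE_I2) (auto simp: space_pair_measure indicator_def)
  qed
  have "(\<integral>w. integral {0..T} (\<lambda>u. Y u w) \<partial>M) = (\<integral>w. (\<integral>u. ?k u w \<partial>lborel) \<partial>M)"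
  proof (intro lint_cong refl)
    fix w assume w: "w \<in> space M"
    have "integral {0..T} (\<lambda>u. Y u w) = (LBINT u:{0..T}. Y u w)"
      by (intro set_borel_integral_eq_integral(2)[symmetric] borel_integrable_atLeastAtMost' cont w)
    also have "... = (\<integral>u. ?k u w \<partial>lborel)"
      unfolding set_lebesgue_integral_def by (intro lint_cong refl) (auto simp: indicator_def)
    finally show "integral {0..T} (\<lambda>u. Y u w) = (\<integral>u. ?k u w \<partial>lborel)" .
  qed
  also have "... = (\<integral>u. (\<integral>w. ?k u w \<partial>M) \<partial>lborel)"
    using Fubini_integral[OF int] .
  also have "... = (LBINT u:{0..T}. \<integral>w. Y u w \<partial>M)"
    unfolding set_lebesgue_integral_def by (intro lint_cong refl) (auto simp: indicator_def)
  also have "... = integral {0..T} (\<lambda>u. \<integral>w. Y u w \<partial>M)"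
    by (intro set_borel_integral_eq_integral borel_integrable_atLeastAtMost' expectation_continuous[OF Y cont bound])
  finally show ?thesis .
qed

end

text \<open>Half of the decay rate absorbs a linear factor.\<close>

lemma mult_exp_le_exp_half:
  fixes c v :: real
  assumes "0 < c" "0 \<le> v"
  shows "v * exp (- c * v) \<le> 2 / c * exp (- (c / 2) * v)"
proof -
  have "c / 2 * v \<le> exp (c / 2 * v)" using exp_ge_add_one_self[of "c / 2 * v"] by linarith
  then have "c / 2 * v * exp (- c * v) \<le> exp (c / 2 * v) * exp (- c * v)" by (rule mult_right_mono) simp
  also have "... = exp (- (c / 2) * v)" by (simp add: exp_add[symmetric] field_simps)
  finally show ?thesis using assms(1) by (simp add: field_simps)
qed

section \<open>Central limit theorem\<close>

text \<open>The parameter \<epsilon> is the scaling \<open>1 / sqrt T\<close>, held fixed while time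
  runs up to \<open>T\<close>. Continuity of \<open>f\<close> makes the path integral differentiable
  in time along every path.\<close>

locale clt_function = spectral_gap_process M \<mu> X E \<kappa> \<gamma>
  for M :: "'w measure" and \<mu> :: "'a::euclidean_space measure" and X E \<kappa> \<gamma> +
  fixes f :: "'a \<Rightarrow> real" and b \<epsilon> :: real
  assumes f_continuous: "continuous_on UNIV f" and f_le: "\<And>x. \<bar>f x\<bar> \<le> b" and f_mean: "mean f = 0"
    and eps_nonneg: "0 \<le> \<epsilon>"
begin

lemma b_nonneg: "0 \<le> b" using f_le[of undefined] by linarith

lemma f_measurable: "f \<in> borel_measurable \<mu>"
proof -
  have "f \<in> borel_measurable borel" using f_continuous by (rule borel_measurable_continuous_onI)
  then show ?thesis using sets_mu' by (simp add: measurable_restrict_space1 cong: measurable_cong_sets)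
qed

lemma f_Bd: "f \<in> Bd" using f_measurable f_le by (rule BdI)

lemma f_path_continuous: "w \<in> space M \<Longrightarrow> continuous_on {0..} (\<lambda>u. f (X u w))"
  by (rule continuous_on_compose2[OF f_continuous X_continuous]) auto

text \<open>Working with real cosines of all phases instead of one complex exponential keeps the
  Markov property and the bounds real; differentiation shifts the phase by \<open>pi / 2\<close>.\<close>

definition osc :: "real \<Rightarrow> real \<Rightarrow> 'w \<Rightarrow> real" where
  "osc \<theta> s w = cos (\<theta> + \<epsilon> * path_integral s f w)"

lemma osc_le: "\<bar>osc z s w\<bar> \<le> 1" by (simp add: osc_def)

lemma osc_Filt: "0 \<le> s \<Longrightarrow> osc z s \<in> borel_measurable (Filt s)"
  unfolding osc_def using path_integral_Filt[OF _ f_measurable, of s] by measurable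

lemma osc_measurable [measurable]: "0 \<le> s \<Longrightarrow> osc z s \<in> borel_measurable M"
  using osc_Filt by (rule Filt_measurable)

lemma osc_pi: "osc (z + pi / 2 + pi / 2) s w = - osc z s w"
  by (simp add: osc_def add.assoc cos_add cos_diff)

lemma path_integral_HK: "0 \<le> s \<Longrightarrow> w \<in> space M \<Longrightarrow> path_integral s f w = integral {0..s} (\<lambda>u. f (X u w))"
  unfolding path_integral_def
  by (intro set_borel_integral_eq_integral borel_integrable_atLeastAtMost' continuous_on_subset[OF f_path_continuous]) auto

lemma osc_derivative:
  assumes "w \<in> space M" "r \<in> {0..s}"
  shows "((\<lambda>t. osc z t w) has_real_derivative \<epsilon> * (f (X r w) * osc (z + pi / 2) r w)) (at r within {0..s})"
proof -
  have "((\<lambda>t. integral {0..t} (\<lambda>u. f (X u w))) has_real_derivative f (X r w)) (at r within {0..s})"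
    using assms by (intro integral_has_real_derivative continuous_on_subset[OF f_path_continuous]) auto
  then have "((\<lambda>t. cos (z + \<epsilon> * integral {0..t} (\<lambda>u. f (X u w)))) has_real_derivative
     - sin (z + \<epsilon> * integral {0..r} (\<lambda>u. f (X u w))) * (\<epsilon> * f (X r w))) (at r within {0..s})"
    by (auto intro!: derivative_eq_intros)
  also have "- sin (z + \<epsilon> * integral {0..r} (\<lambda>u. f (X u w))) = osc (z + pi / 2) r w"
    using assms path_integral_HK[of r w] by (simp add: osc_def cos_add sin_add)
  finally have "((\<lambda>t. cos (z + \<epsilon> * integral {0..t} (\<lambda>u. f (X u w)))) has_real_derivative
     \<epsilon> * (f (X r w) * osc (z + pi / 2) r w)) (at r within {0..s})" by (simp add: ac_simps)
  then show ?thesis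
    by (rule has_field_derivative_transform_within[where d = 1]) (use assms in \<open>auto simp: osc_def path_integral_HK\<close>)
qed

lemma osc_continuous:
  assumes "w \<in> space M"
  shows "continuous_on {0..s} (\<lambda>r. osc z r w)"
  using osc_derivative[OF assms] by (intro DERIV_continuous_on) blast

lemma osc_FTC:
  assumes "w \<in> space M" "0 \<le> s"
  shows "osc z s w = cos z + \<epsilon> * integral {0..s} (\<lambda>r. f (X r w) * osc (z + pi / 2) r w)"
proof -
  have "((\<lambda>r. \<epsilon> * (f (X r w) * osc (z + pi / 2) r w)) has_integral (osc z s w - osc z 0 w)) {0..s}"
    using osc_derivative[OF assms(1)] assms(2)
    by (intro fundamental_theorem_of_calculus) (auto simp: has_real_derivative_iff_has_vector_derivative)
  then have "integral {0..s} (\<lambda>r. \<epsilon> * (f (X r w) * osc (z + pi / 2) r w)) = osc z s w - osc z 0 w" by (rule integral_unique)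
  moreover have "osc z 0 w = cos z" using path_integral_HK[OF order_refl assms(1)] by (simp add: osc_def)
  ultimately show ?thesis by simp
qed

lemma osc_lipschitz:
  assumes "w \<in> space M" "0 \<le> r" "r \<le> s"
  shows "\<bar>osc z s w - osc z r w\<bar> \<le> \<epsilon> * b * (s - r)"
proof -
  have "((\<lambda>r. \<epsilon> * (f (X r w) * osc (z + pi / 2) r w)) has_integral (osc z s w - osc z r w)) {r..s}"
  proof (intro fundamental_theorem_of_calculus)
    fix t assume "t \<in> {r..s}"
    then have "((\<lambda>t. osc z t w) has_real_derivative \<epsilon> * (f (X t w) * osc (z + pi / 2) t w)) (at t within {r..s})"
      using assms by (intro DERIV_subset[OF osc_derivative[of w t s]]) auto
    then show "((\<lambda>t. osc z t w) has_vector_derivative \<epsilon> * (f (X t w) * osc (z + pi / 2) t w)) (at t within {r..s})"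
      by (simp add: has_real_derivative_iff_has_vector_derivative)
  qed (use assms in auto)
  then have "((\<lambda>r. \<epsilon> * (f (X r w) * osc (z + pi / 2) r w)) has_integral (osc z s w - osc z r w)) (cbox r s)" by simp
  then have "norm (osc z s w - osc z r w) \<le> \<epsilon> * b * measure lborel (cbox r s)"
  proof (rule has_integral_bound[rotated])
    show "norm (\<epsilon> * (f (X t w) * osc (z + pi / 2) t w)) \<le> \<epsilon> * b" if "t \<in> cbox r s" for t
      using mult_mono[OF f_le[of "X t w"] osc_le[of "z + pi / 2" t w] b_nonneg] eps_nonneg
      by (auto simp: abs_mult intro!: mult_left_mono)
  qed (use eps_nonneg b_nonneg in auto)
  then show ?thesis using assms by simp
qed

text \<open>The mixed moments of the phase and the present state are the unknowns of the argument;
  the Markov property closes the recursion among them.\<close>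

definition mk :: "real \<Rightarrow> ('a \<Rightarrow> real) \<Rightarrow> real \<Rightarrow> real" where
  "mk \<theta> g s = (\<integral>w. osc \<theta> s w * g (X s w) \<partial>M)"

lemma f_osc_continuous:
  "w \<in> space M \<Longrightarrow> continuous_on {0..s} (\<lambda>r. f (X r w) * osc z r w)"
  by (intro continuous_intros osc_continuous continuous_on_subset[OF f_path_continuous]) auto

lemma f_osc_bound: "\<bar>f (X r w) * osc z r w\<bar> \<le> b"
  using mult_mono[OF f_le[of "X r w"] osc_le[of z r w] b_nonneg abs_ge_zero] by (simp add: abs_mult)

lemma fX_measurable [measurable]: "0 \<le> r \<Longrightarrow> (\<lambda>w. f (X r w)) \<in> borel_measurable M"
  using measurable_compose[OF X_measurable f_measurable] .

lemma U_f_osc: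
  assumes U: "U \<in> borel_measurable M" "\<And>w. w \<in> space M \<Longrightarrow> \<bar>U w\<bar> \<le> c"
  shows "0 \<le> r \<Longrightarrow> (\<lambda>w. U w * (f (X r w) * osc z r w)) \<in> borel_measurable M"
    and "w \<in> space M \<Longrightarrow> continuous_on {0..s} (\<lambda>r. U w * (f (X r w) * osc z r w))"
    and "w \<in> space M \<Longrightarrow> \<bar>U w * (f (X r w) * osc z r w)\<bar> \<le> c * b"
proof -
  note [measurable] = U(1)
  show "0 \<le> r \<Longrightarrow> (\<lambda>w. U w * (f (X r w) * osc z r w)) \<in> borel_measurable M" by measurable
  show "w \<in> space M \<Longrightarrow> continuous_on {0..s} (\<lambda>r. U w * (f (X r w) * osc z r w))"
    by (intro continuous_on_mult continuous_on_const f_osc_continuous)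
  assume "w \<in> space M"
  then show "\<bar>U w * (f (X r w) * osc z r w)\<bar> \<le> c * b"
    using mult_mono[OF U(2) f_osc_bound] U(2)[of w] by (simp add: abs_mult)
qed

lemma osc_expectation:
  assumes U: "U \<in> borel_measurable M" "\<And>w. w \<in> space M \<Longrightarrow> \<bar>U w\<bar> \<le> c" and s: "0 \<le> s"
  shows "(\<integral>w. U w * osc z s w \<partial>M) = cos z * (\<integral>w. U w \<partial>M)
     + \<epsilon> * integral {0..s} (\<lambda>r. \<integral>w. U w * (f (X r w) * osc (z + pi / 2) r w) \<partial>M)"
proof -
  note Y = U_f_osc[OF U]
  have Ui: "integrable M U" using U by (intro integrable_const_bound[of _ c]) auto
  let ?J = "\<lambda>w. integral {0..s} (\<lambda>r. U w * (f (X r w) * osc (z + pi / 2) r w))"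
  have eq: "U w * osc z s w = cos z * U w + \<epsilon> * ?J w" if "w \<in> space M" for w
    unfolding osc_FTC[OF that s, of z] by (simp add: algebra_simps)
  have Uo: "integrable M (\<lambda>w. U w * osc z s w)"
  proof (rule integrable_const_bound[of _ c])
    show "AE w in M. norm (U w * osc z s w) \<le> c"
    proof (rule AE_I2)
      fix w assume "w \<in> space M"
      then show "norm (U w * osc z s w) \<le> c"
        using mult_mono[OF U(2)[of w] osc_le[of z s w]] U(2)[of w] by (simp add: abs_mult)
    qed
  qed (use U s in simp)
  have "integrable M (\<lambda>w. U w * osc z s w - cos z * U w)" using Uo Ui by simp
  then have J: "integrable M (\<lambda>w. \<epsilon> * ?J w)"
    by (rule Bochner_Integration.integrable_cong[THEN iffD1, rotated -1]) (auto simp: eq)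
  have "(\<integral>w. U w * osc z s w \<partial>M) = (\<integral>w. cos z * U w + \<epsilon> * ?J w \<partial>M)"
    by (intro lint_cong eq refl)
  also have "... = cos z * (\<integral>w. U w \<partial>M) + \<epsilon> * (\<integral>w. ?J w \<partial>M)"
    using Ui J by (subst Bochner_Integration.integral_add) auto
  also have "(\<integral>w. ?J w \<partial>M) = integral {0..s} (\<lambda>r. \<integral>w. U w * (f (X r w) * osc (z + pi / 2) r w) \<partial>M)"
    by (rule expectation_integral_swap[OF s Y(1,2)]) (use Y(3) in auto)
  finally show ?thesis .
qed

lemma mk_integrable:
  assumes "0 \<le> s" "g \<in> Bd"
  shows "integrable M (\<lambda>w. osc z s w * g (X s w))"
  using osc_le assms by (intro integrable_bounded_mult_Bd[where c = 1]) auto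

lemma mk_bound:
  assumes s: "0 \<le> s" and g: "g \<in> Bd"
  shows "\<bar>mk z g s\<bar> \<le> nrm g"
proof -
  have i: "integrable M (\<lambda>w. \<bar>g (X s w)\<bar>)" using integrable_X[OF s Bd_integrable[OF g]] by simp
  have "\<bar>mk z g s\<bar> \<le> (\<integral>w. \<bar>osc z s w * g (X s w)\<bar> \<partial>M)" unfolding mk_def by (rule integral_abs_bound)
  also have "... \<le> (\<integral>w. \<bar>g (X s w)\<bar> \<partial>M)"
    using osc_le[of z s] by (intro integral_mono integrable_abs mk_integrable s g i) (simp add: abs_mult mult_left_le_one_le)
  also have "... = mean (\<lambda>x. \<bar>g x\<bar>)" using g s by (intro integral_X[of s "\<lambda>x. \<bar>g x\<bar>"]) (auto dest: Bd_measurable)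
  also have "... \<le> nrm g" by (intro mu.L2_norm_ge_L1 Bd_L2 g)
  finally show ?thesis .
qed

lemma mk_diff: "0 \<le> s \<Longrightarrow> g \<in> Bd \<Longrightarrow> h \<in> Bd \<Longrightarrow> mk z (\<lambda>x. g x - h x) s = mk z g s - mk z h s"
  unfolding mk_def by (subst Bochner_Integration.integral_diff[symmetric]) (auto simp: right_diff_distrib intro!: mk_integrable)

lemma mk_const: "mk z (\<lambda>_. c) s = c * mk z (\<lambda>_. 1) s"
  by (simp add: mk_def mult.commute)

lemma mk_markov:
  assumes r: "0 \<le> r" "r \<le> s" and g: "g \<in> Bd"
  shows "(\<integral>w. g (X s w) * (f (X r w) * osc z r w) \<partial>M) = mk z (\<lambda>x. f x * P (s - r) g x) r"
proof -
  have Z: "(\<lambda>w. f (X r w) * osc z r w) \<in> borel_measurable (Filt r)"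
    using osc_Filt[OF r(1)] measurable_compose[OF X_Filt[OF r(1) order_refl] f_measurable] by simp
  show ?thesis
    using markov_property[OF r(1) _ Z f_osc_bound g, of "s - r"] r by (simp add: mk_def ac_simps)
qed

lemma Bd_f_P: "0 \<le> v \<Longrightarrow> g \<in> Bd \<Longrightarrow> (\<lambda>x. f x * P v g x) \<in> Bd"
  using f_Bd by blast

lemma nrm_f_P:
  assumes "g \<in> Bd" "mean g = 0" "0 \<le> v"
  shows "nrm (\<lambda>x. f x * P v g x) \<le> b * nrm g * exp (- \<gamma> * v)"
proof -
  have "nrm (\<lambda>x. f x * P v g x) \<le> nrm (\<lambda>x. b * P v g x)"
    using assms f_le b_nonneg by (intro L2_norm_mono L2_cmult Bd_L2 P_Bd Bd_measurable Bd_f_P) (auto simp: abs_mult intro!: mult_right_mono)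
  also have "... = b * nrm (P v g)" using b_nonneg by (simp add: L2_norm_cmult)
  also have "... \<le> b * (exp (- \<gamma> * v) * nrm g)" using assms b_nonneg by (intro mult_left_mono decay)
  finally show ?thesis by (simp add: ac_simps)
qed

text \<open>The fundamental theorem of calculus writes the phase at \<open>s\<close> through its
  derivative at earlier times \<open>r\<close>, each with a factor
  \<open>\<epsilon> * f (X r)\<close>; conditioning on the past of \<open>r\<close> turns
  \<open>g (X s)\<close> into \<open>P (s - r) g\<close>.\<close>

lemma mk_recursion:
  assumes g: "g \<in> Bd" and s: "0 \<le> s"
  shows "mk z g s = cos z * mean g + \<epsilon> * integral {0..s} (\<lambda>r. mk (z + pi / 2) (\<lambda>x. f x * P (s - r) g x) r)"
    and "continuous_on {0..s} (\<lambda>r. mk z (\<lambda>x. f x * P (s - r) g x) r)"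
proof -
  obtain c where c: "\<And>w. w \<in> space M \<Longrightarrow> \<bar>g (X s w)\<bar> \<le> c" using Bd_X_bounded[OF s g] by metis
  have gm: "(\<lambda>w. g (X s w)) \<in> borel_measurable M" using measurable_compose[OF X_measurable[OF s] Bd_measurable[OF g]] .
  have "mk z g s = (\<integral>w. g (X s w) * osc z s w \<partial>M)" by (simp add: mk_def mult.commute)
  also have "... = cos z * (\<integral>w. g (X s w) \<partial>M)
     + \<epsilon> * integral {0..s} (\<lambda>r. \<integral>w. g (X s w) * (f (X r w) * osc (z + pi / 2) r w) \<partial>M)"
    by (rule osc_expectation[OF gm c s])
  also have "(\<integral>w. g (X s w) \<partial>M) = mean g" by (rule integral_X[OF s Bd_measurable[OF g]])
  also have "integral {0..s} (\<lambda>r. \<integral>w. g (X s w) * (f (X r w) * osc (z + pi / 2) r w) \<partial>M)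
    = integral {0..s} (\<lambda>r. mk (z + pi / 2) (\<lambda>x. f x * P (s - r) g x) r)"
    by (intro integral_cong mk_markov g) auto
  finally show "mk z g s = cos z * mean g + \<epsilon> * integral {0..s} (\<lambda>r. mk (z + pi / 2) (\<lambda>x. f x * P (s - r) g x) r)" .
  have "continuous_on {0..s} (\<lambda>r. \<integral>w. g (X s w) * (f (X r w) * osc z r w) \<partial>M)"
    by (rule expectation_continuous[OF U_f_osc(1,2)[OF gm c]]) (use U_f_osc(3)[OF gm c] in auto)
  then show "continuous_on {0..s} (\<lambda>r. mk z (\<lambda>x. f x * P (s - r) g x) r)"
    by (rule continuous_on_eq) (auto simp: mk_markov g)
qed

text \<open>For centred \<open>g\<close> the recursion has no leading term and
  \<open>P (s - r) g\<close> decays, so the estimate gains one factor \<epsilon> over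
  \<open>mk_bound\<close>, uniformly in \<open>s\<close>.\<close>

lemma mk_bound_centered:
  assumes g: "g \<in> Bd" "mean g = 0" and s: "0 \<le> s"
  shows "\<bar>mk z g s\<bar> \<le> \<epsilon> * (b * nrm g / \<gamma>)"
proof -
  have "norm (integral {0..s} (\<lambda>r. mk (z + pi / 2) (\<lambda>x. f x * P (s - r) g x) r)) \<le> b * nrm g / \<gamma>"
  proof (rule exp_kernel_integral_bound[OF gap_pos s])
    show "(\<lambda>r. mk (z + pi / 2) (\<lambda>x. f x * P (s - r) g x) r) integrable_on {0..s}"
      by (intro integrable_continuous_interval mk_recursion(2) g s)
    fix r assume r: "r \<in> {0..s}"
    then have "\<bar>mk (z + pi / 2) (\<lambda>x. f x * P (s - r) g x) r\<bar> \<le> nrm (\<lambda>x. f x * P (s - r) g x)"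
      by (intro mk_bound Bd_f_P g) auto
    also have "... \<le> b * nrm g * exp (- \<gamma> * (s - r))" using r by (intro nrm_f_P g) auto
    finally show "norm (mk (z + pi / 2) (\<lambda>x. f x * P (s - r) g x) r) \<le> b * nrm g * exp (- \<gamma> * (s - r))" by simp
  qed (use b_nonneg in \<open>simp add: L2_norm_nonneg\<close>)
  from mult_left_mono[OF this eps_nonneg] show ?thesis
    unfolding mk_recursion(1)[OF g(1) s, of z] g(2) using eps_nonneg by (simp add: abs_mult)
qed

abbreviation m1 :: "real \<Rightarrow> real \<Rightarrow> real" where "m1 \<theta> \<equiv> mk \<theta> (\<lambda>_. 1)"

lemma m1_eq: "m1 z s = (\<integral>w. osc z s w \<partial>M)" by (simp add: mk_def)

lemma osc_integrable: "0 \<le> s \<Longrightarrow> integrable M (osc z s)"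
  using osc_le by (intro integrable_const_bound[of _ 1]) auto

lemma m1_lipschitz:
  assumes "0 \<le> r" "r \<le> s"
  shows "\<bar>m1 z s - m1 z r\<bar> \<le> \<epsilon> * b * (s - r)"
proof -
  have "\<bar>m1 z s - m1 z r\<bar> = \<bar>\<integral>w. osc z s w - osc z r w \<partial>M\<bar>"
    unfolding m1_eq using assms osc_integrable by (subst Bochner_Integration.integral_diff) auto
  also have "... \<le> (\<integral>w. \<bar>osc z s w - osc z r w\<bar> \<partial>M)" by (rule integral_abs_bound)
  also have "... \<le> (\<integral>w. \<epsilon> * b * (s - r) \<partial>M)"
    using assms osc_integrable osc_lipschitz by (intro integral_mono integrable_abs Bochner_Integration.integrable_diff) auto
  also have "... = \<epsilon> * b * (s - r)" by (simp add: prob_space)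
  finally show ?thesis .
qed

text \<open>The constants of \<open>mk_f\<close>: the summands of \<open>K2\<close> belong to
  centring the product and to moving the phase in time, \<open>K3\<close> to cutting the correlation
  integral at \<open>s\<close>.\<close>

definition K2 :: real where "K2 = b * (b * nrm f) / \<gamma> / \<gamma> + (nrm f)^2 * b * (2 / \<gamma>) / (\<gamma> / 2)"
definition K3 :: real where "K3 = (nrm f)^2 / \<gamma>"

text \<open>The past decorrelates: conditionally on the path up to \<open>r\<close>, \<open>f (X r) * f (X s)\<close> is
  replaced by its expectation, and \<open>osc r\<close> by \<open>osc s\<close>, at the price of errors of order
  \<open>\<epsilon>\<close>.\<close>

lemma mk_f:
  assumes s: "0 \<le> s"
  shows "\<bar>mk \<theta> f s - \<epsilon> * (corrlim f * m1 (\<theta> + pi / 2) s)\<bar> \<le> \<epsilon> * (\<epsilon> * K2 + K3 * exp (- \<gamma> * s))"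
proof -
  define h where "h = \<theta> + pi / 2"
  define G where "G v = (\<lambda>x. f x * P v f x)" for v
  have G: "G v \<in> Bd" if "0 \<le> v" for v unfolding G_def by (intro Bd_f_P that f_Bd)
  have Gm: "mean (G v) = corr f v" for v unfolding G_def corr_def ..
  let ?A = "\<lambda>r. mk h (\<lambda>x. G (s - r) x - corr f (s - r)) r"
  let ?B = "\<lambda>r. corr f (s - r) * (m1 h r - m1 h s)"
  let ?C = "\<lambda>r. corr f (s - r) * m1 h s"
  have split: "mk h (G (s - r)) r = ?A r + ?B r + ?C r" if "r \<in> {0..s}" for r
    using that by (subst mk_diff) (auto simp: G mk_const[of h "corr f (s - r)"] algebra_simps)
  have cG: "continuous_on {0..s} (\<lambda>r. mk h (G (s - r)) r)" unfolding G_def by (rule mk_recursion(2)[OF f_Bd s])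
  have cc: "continuous_on {0..s} (\<lambda>r. corr f (s - r))"
    by (intro continuous_on_compose2[OF corr_continuous[OF f_Bd]] continuous_intros) auto
  have cm: "continuous_on {0..s} (\<lambda>r. m1 h r)"
    unfolding m1_eq using osc_le by (intro expectation_continuous[where c = 1] osc_continuous) auto
  have cB: "continuous_on {0..s} ?B" and cC: "continuous_on {0..s} ?C"
    by (intro continuous_intros cc cm)+
  have "continuous_on {0..s} (\<lambda>r. mk h (G (s - r)) r - ?B r - ?C r)"
    by (intro continuous_on_diff cG cB cC)
  then have cA: "continuous_on {0..s} ?A" by (rule continuous_on_eq) (simp add: split)
  note int = integrable_continuous_interval[OF cA] integrable_continuous_interval[OF cB] integrable_continuous_interval[OF cC]
  have A: "norm (integral {0..s} ?A) \<le> \<epsilon> * (b * (b * nrm f) / \<gamma>) / \<gamma>"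
  proof (rule exp_kernel_integral_bound[OF gap_pos s _ int(1)])
    fix r assume r: "r \<in> {0..s}"
    then have v: "0 \<le> s - r" by simp
    let ?g = "\<lambda>x. G (s - r) x - corr f (s - r)"
    have "mean ?g = mean (G (s - r)) - mean (\<lambda>x. corr f (s - r))"
      by (rule Bochner_Integration.integral_diff[OF Bd_integrable[OF G[OF v]] Bd_integrable[OF Bd_const]])
    also have "... = 0" unfolding Gm by (simp add: mu.prob_space)
    finally have "\<bar>?A r\<bar> \<le> \<epsilon> * (b * nrm ?g / \<gamma>)" using r by (intro mk_bound_centered Bd_diff[OF G[OF v] Bd_const]) auto
    also have "\<epsilon> * (b * nrm ?g / \<gamma>) \<le> \<epsilon> * (b * (b * nrm f * exp (- \<gamma> * (s - r))) / \<gamma>)"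
    proof (intro mult_left_mono divide_right_mono)
      have "(nrm ?g)^2 = (nrm (G (s - r)))^2 - (corr f (s - r))\<^sup>2"
        using mu.L2_norm_centered[OF Bd_L2[OF G[OF v]]] unfolding Gm .
      then have "(nrm ?g)^2 \<le> (nrm (G (s - r)))^2" using zero_le_power2[of "corr f (s - r)"] by linarith
      then have "nrm ?g \<le> nrm (G (s - r))" by (rule power2_le_imp_le) (rule L2_norm_nonneg)
      also have "... \<le> b * nrm f * exp (- \<gamma> * (s - r))" unfolding G_def by (rule nrm_f_P[OF f_Bd f_mean v])
      finally show "nrm ?g \<le> b * nrm f * exp (- \<gamma> * (s - r))" .
    qed (use eps_nonneg b_nonneg gap_pos in auto)
    also have "... = \<epsilon> * (b * (b * nrm f) / \<gamma>) * exp (- \<gamma> * (s - r))" by simp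
    finally show "norm (?A r) \<le> \<epsilon> * (b * (b * nrm f) / \<gamma>) * exp (- \<gamma> * (s - r))"
      by simp
  qed (use eps_nonneg b_nonneg gap_pos in \<open>simp add: L2_norm_nonneg\<close>)
  \<comment> \<open>The Lipschitz bound for the phase brings a factor \<open>s - r\<close>, which is
    absorbed at half the rate; hence \<open>\<gamma> / 2\<close>.\<close>
  have B: "norm (integral {0..s} ?B) \<le> \<epsilon> * ((nrm f)^2 * b * (2 / \<gamma>)) / (\<gamma> / 2)"
  proof (rule exp_kernel_integral_bound[OF _ s _ int(2)])
    fix r assume r: "r \<in> {0..s}"
    then have v: "0 \<le> s - r" by simp
    have "norm (?B r) \<le> (exp (- \<gamma> * (s - r)) * (nrm f)^2) * (\<epsilon> * b * (s - r))"
      unfolding real_norm_def abs_mult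
      using r v m1_lipschitz[of r s h] by (intro mult_mono corr_bound f_Bd f_mean) (auto simp: abs_minus_commute)
    also have "... = \<epsilon> * ((nrm f)^2 * b) * ((s - r) * exp (- \<gamma> * (s - r)))" by (simp add: ac_simps)
    also have "... \<le> \<epsilon> * ((nrm f)^2 * b) * (2 / \<gamma> * exp (- (\<gamma> / 2) * (s - r)))"
      using eps_nonneg b_nonneg by (intro mult_left_mono mult_exp_le_exp_half gap_pos v) auto
    finally show "norm (?B r) \<le> \<epsilon> * ((nrm f)^2 * b * (2 / \<gamma>)) * exp (- (\<gamma> / 2) * (s - r))" by (simp only: ac_simps)
  qed (use eps_nonneg b_nonneg gap_pos in simp_all)
  have "integral {0..s} (\<lambda>r. corr f (s - r)) = cumcorr f s"
  proof -
    have "integral {0..s} (\<lambda>r. corr f (s - r)) = (LBINT v:{0..s}. corr f \<bar>s - v\<bar>)"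
      by (subst set_borel_integral_eq_integral(2))
        (auto intro!: integral_cong borel_integrable_atLeastAtMost' continuous_on_eq[OF cc])
    also have "... = cumcorr f s" using two_sided_corr[OF f_Bd s order_refl] by (simp add: cumcorr_def)
    finally show ?thesis .
  qed
  then have C: "integral {0..s} ?C = cumcorr f s * m1 h s" by simp
  have "\<bar>m1 h s\<bar> \<le> 1" using mk_bound[OF s Bd_const[of 1], of h] by (simp add: mu.L2_norm_const)
  then have D: "\<bar>cumcorr f s * m1 h s - corrlim f * m1 h s\<bar> \<le> exp (- \<gamma> * s) * (nrm f)^2 / \<gamma> * 1"
    unfolding left_diff_distrib[symmetric] abs_mult
    by (intro mult_mono corrlim f_Bd f_mean s) (use gap_pos in auto)
  have "integral {0..s} (\<lambda>r. mk h (G (s - r)) r) = integral {0..s} (\<lambda>r. ?A r + ?B r + ?C r)"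
    by (intro integral_cong split)
  also have "... = integral {0..s} ?A + integral {0..s} ?B + integral {0..s} ?C"
    unfolding integral_add[OF integrable_add[OF int(1,2)] int(3)]
      integral_add[OF int(1,2)] ..
  finally have sp: "integral {0..s} (\<lambda>r. mk h (G (s - r)) r) = integral {0..s} ?A + integral {0..s} ?B + integral {0..s} ?C" .
  have "\<bar>integral {0..s} (\<lambda>r. mk h (G (s - r)) r) - corrlim f * m1 h s\<bar> \<le> \<epsilon> * K2 + K3 * exp (- \<gamma> * s)"
  proof -
    have a: "\<bar>x\<bar> \<le> A \<Longrightarrow> \<bar>y\<bar> \<le> B \<Longrightarrow> \<bar>z - w\<bar> \<le> D \<Longrightarrow> \<bar>x + y + z - w\<bar> \<le> (A + B) + D" for x y z w A B D :: real by linarith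
    have K: "\<epsilon> * K2 = \<epsilon> * (b * (b * nrm f) / \<gamma>) / \<gamma> + \<epsilon> * ((nrm f)^2 * b * (2 / \<gamma>)) / (\<gamma> / 2)"
      by (simp add: K2_def distrib_left)
    have K': "K3 * exp (- \<gamma> * s) = exp (- \<gamma> * s) * (nrm f)^2 / \<gamma> * 1" by (simp add: K3_def)
    show ?thesis unfolding sp C K K' by (rule a[OF A[unfolded real_norm_def] B[unfolded real_norm_def] D])
  qed
  moreover have "mk \<theta> f s = \<epsilon> * integral {0..s} (\<lambda>r. mk h (G (s - r)) r)"
    using mk_recursion(1)[OF f_Bd s, of \<theta>] f_mean by (simp add: G_def h_def)
  ultimately show ?thesis
    using eps_nonneg unfolding h_def[symmetric]
    by (simp add: abs_mult right_diff_distrib[symmetric] mult_left_mono)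
qed

lemma m1_recursion:
  assumes s: "0 \<le> s"
  shows "m1 z s = cos z + \<epsilon> * integral {0..s} (\<lambda>r. mk (z + pi / 2) f r)"
  using osc_expectation[of "\<lambda>_. 1" 1 s z] s by (simp add: m1_eq mk_def mult.commute prob_space)

lemma mk_f_continuous: "continuous_on {0..s} (mk z f)"
proof -
  have "continuous_on {0..s} (\<lambda>r. \<integral>w. f (X r w) * osc z r w \<partial>M)"
    by (rule expectation_continuous[where c = b]) (use f_osc_continuous f_osc_bound in auto)
  then show ?thesis unfolding mk_def by (simp add: mult.commute)
qed

text \<open>Two phase shifts by \<open>pi / 2\<close> produce a minus sign, so \<open>mk_f\<close>
  turns the derivative of \<open>m1 z\<close> into \<open>- q * m1 z\<close> up to a small error;
  the integrating factor \<open>exp (q * r)\<close> solves this linear equation. With \<epsilon>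
  equal to \<open>1 / sqrt T\<close> the error is of order \<open>1 / sqrt T\<close>.\<close>

theorem m1_limit:
  assumes T: "0 \<le> T"
  shows "\<bar>m1 z T - exp (- (\<epsilon>\<^sup>2 * corrlim f * T)) * cos z\<bar> \<le> \<epsilon>\<^sup>2 * (\<epsilon> * K2 * T + K3 / \<gamma>)"
proof -
  define q where "q = \<epsilon>\<^sup>2 * corrlim f"
  have q: "0 \<le> q" using corrlim_nonneg[OF f_Bd f_mean] by (simp add: q_def)
  let ?D = "\<lambda>r. \<epsilon> * mk (z + pi / 2) f r + q * m1 z r"
  have D: "\<bar>?D r\<bar> \<le> \<epsilon> * (\<epsilon> * (\<epsilon> * K2 + K3 * exp (- \<gamma> * r)))" if "0 \<le> r" for r
  proof -
    have "m1 (z + pi / 2 + pi / 2) r = - m1 z r" unfolding m1_eq osc_pi by simp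
    then have "?D r = \<epsilon> * (mk (z + pi / 2) f r - \<epsilon> * (corrlim f * m1 (z + pi / 2 + pi / 2) r))"
      by (simp add: q_def power2_eq_square algebra_simps)
    then show ?thesis using mult_left_mono[OF mk_f[OF that, of "z + pi / 2"] eps_nonneg] eps_nonneg by (simp add: abs_mult)
  qed
  have m1': "(m1 z has_real_derivative \<epsilon> * mk (z + pi / 2) f r) (at r within {0..T})" if "r \<in> {0..T}" for r
  proof -
    have "((\<lambda>s. integral {0..s} (mk (z + pi / 2) f)) has_real_derivative mk (z + pi / 2) f r) (at r within {0..T})"
      by (rule integral_has_real_derivative[OF mk_f_continuous that])
    then have "((\<lambda>s. cos z + \<epsilon> * integral {0..s} (mk (z + pi / 2) f)) has_real_derivative \<epsilon> * mk (z + pi / 2) f r) (at r within {0..T})"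
      by (auto intro!: derivative_eq_intros)
    then show ?thesis
      by (rule has_field_derivative_transform_within[where d = 1]) (use that in \<open>auto simp: m1_recursion\<close>)
  qed
  have "((\<lambda>r. exp (q * r) * ?D r) has_integral (exp (q * T) * m1 z T - exp (q * 0) * m1 z 0)) {0..T}"
    by (rule fundamental_theorem_of_calculus[OF T])
      (auto intro!: derivative_eq_intros m1' simp: has_real_derivative_iff_has_vector_derivative[symmetric] distrib_left)
  moreover have "m1 z 0 = cos z" using m1_recursion[of 0 z] by simp
  ultimately have "((\<lambda>r. exp (q * r) * ?D r) has_integral (exp (q * T) * m1 z T - cos z)) {0..T}" by simp
  from has_integral_mult_right[OF this, of "exp (- (q * T))"]
  have "((\<lambda>r. exp (- (q * T)) * (exp (q * r) * ?D r)) has_integral exp (- (q * T)) * (exp (q * T) * m1 z T - cos z)) {0..T}" .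
  also have "exp (- (q * T)) * (exp (q * T) * m1 z T - cos z) = m1 z T - exp (- (q * T)) * cos z"
    by (simp add: right_diff_distrib mult.assoc[symmetric] exp_add[symmetric])
  finally have I: "((\<lambda>r. exp (- (q * T)) * (exp (q * r) * ?D r)) has_integral m1 z T - exp (- (q * T)) * cos z) {0..T}" .
  have le: "norm (exp (- (q * T)) * (exp (q * r) * ?D r)) \<le> \<epsilon>\<^sup>2 * (\<epsilon> * K2) + \<epsilon>\<^sup>2 * K3 * exp (- \<gamma> * r)" if "r \<in> {0..T}" for r
  proof -
    have "exp (- (q * T)) * (exp (q * r) * ?D r) = exp (- (q * (T - r))) * ?D r"
      unfolding mult.assoc[symmetric] exp_add[symmetric] by (simp add: right_diff_distrib)
    then have "norm (exp (- (q * T)) * (exp (q * r) * ?D r)) = exp (- (q * (T - r))) * \<bar>?D r\<bar>"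
      by (simp only: real_norm_def abs_mult abs_exp_cancel)
    \<comment> \<open>Nonnegativity of \<open>q\<close>, that is of the asymptotic variance, keeps
      the error from being amplified.\<close>
    also have "... \<le> 1 * \<bar>?D r\<bar>" using that q by (intro mult_right_mono) auto
    also have "... \<le> \<epsilon> * (\<epsilon> * (\<epsilon> * K2 + K3 * exp (- \<gamma> * r)))" using D[of r] that by simp
    finally show ?thesis by (simp add: power2_eq_square algebra_simps)
  qed
  have E: "((\<lambda>r. exp (- \<gamma> * r)) has_integral (- exp (- \<gamma> * T) / \<gamma> - (- exp (- \<gamma> * 0) / \<gamma>))) {0..T}"
    using T gap_pos by (intro fundamental_theorem_of_calculus)
      (auto intro!: derivative_eq_intros simp: has_real_derivative_iff_has_vector_derivative[symmetric])
  have "((\<lambda>r. \<epsilon>\<^sup>2 * (\<epsilon> * K2) + \<epsilon>\<^sup>2 * K3 * exp (- \<gamma> * r)) has_integral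
      (\<epsilon>\<^sup>2 * (\<epsilon> * K2)) * T + \<epsilon>\<^sup>2 * K3 * (- exp (- \<gamma> * T) / \<gamma> - (- exp (- \<gamma> * 0) / \<gamma>))) {0..T}"
    using has_integral_add[OF has_integral_const_real[of "\<epsilon>\<^sup>2 * (\<epsilon> * K2)" 0 T] has_integral_mult_right[OF E, of "\<epsilon>\<^sup>2 * K3"]] T
    by (simp add: mult.commute)
  from has_integral_norm_bound_integral_component[OF I this, of 1]
  have "\<bar>m1 z T - exp (- (q * T)) * cos z\<bar> \<le> (\<epsilon>\<^sup>2 * (\<epsilon> * K2)) * T + \<epsilon>\<^sup>2 * K3 * (- exp (- \<gamma> * T) / \<gamma> - (- exp (- \<gamma> * 0) / \<gamma>))"
    using le by simp
  also have "... \<le> (\<epsilon>\<^sup>2 * (\<epsilon> * K2)) * T + \<epsilon>\<^sup>2 * K3 * (1 / \<gamma>)"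
    using gap_pos by (intro add_left_mono mult_left_mono) (auto simp: K3_def)
  finally show ?thesis by (simp add: q_def algebra_simps)
qed

end

section \<open>Deviations and the limit theorem in \<open>L2_0\<close>\<close>

context spectral_gap_process
begin

lemma L2_0_D: "f \<in> L2_0 \<mu> \<Longrightarrow> f \<in> L2 \<mu>" "f \<in> L2_0 \<mu> \<Longrightarrow> mean f = 0"
  by (auto simp: L2_0_def)

lemma L2_path_integrable_AE:
  assumes "f \<in> L2 \<mu>" "0 \<le> T"
  shows "AE w in M. path_integrable T w f"
  using assms by (intro path_integrable_AE mu.L2_integrable)

lemma dev_cmult: "dev T (\<lambda>x. c * f x) w = c * dev T f w"
  by (simp add: dev_def path_integral_cmult right_diff_distrib)

lemma dev_linear_AE:
  assumes "finite I" "\<And>i. i \<in> I \<Longrightarrow> r i \<in> L2 \<mu>" "0 \<le> T"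
  shows "AE w in M. dev T (\<lambda>x. \<Sum>i\<in>I. c i * r i x) w = (\<Sum>i\<in>I. c i * dev T (r i) w)"
proof -
  have "AE w in M. \<forall>i\<in>I. path_integrable T w (r i)"
    using assms by (intro AE_finite_allI L2_path_integrable_AE) auto
  then show ?thesis
  proof eventually_elim
    case (elim w)
    have "dev T (\<lambda>x. \<Sum>i\<in>I. c i * r i x) w = (\<Sum>i\<in>I. dev T (\<lambda>x. c i * r i x) w)"
      using elim assms(1,2) by (intro dev_sum) (auto intro!: mu.L2_integrable)
    then show ?case by (simp add: dev_cmult)
  qed
qed

lemma dev_add_AE:
  assumes "f \<in> L2 \<mu>" "g \<in> L2 \<mu>" "0 \<le> T"
  shows "AE w in M. dev T (\<lambda>x. f x + g x) w = dev T f w + dev T g w"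
  using L2_path_integrable_AE[OF assms(1,3)] L2_path_integrable_AE[OF assms(2,3)]
  by eventually_elim (intro dev_add mu.L2_integrable assms(1,2))

lemma dev_diff_AE:
  assumes "f \<in> L2 \<mu>" "g \<in> L2 \<mu>" "0 \<le> T"
  shows "AE w in M. dev T (\<lambda>x. f x - g x) w = dev T f w - dev T g w"
  using dev_add_AE[OF assms(1) L2_cmult[OF assms(2), of "-1"] assms(3)]
  by (simp add: dev_cmult[of T "-1" g, simplified])

lemma dev_integrable:
  assumes "f \<in> L2 \<mu>" "0 \<le> T"
  shows "integrable M (dev T f)"
  unfolding dev_def using path_integral_integrable(1)[OF assms(2) mu.L2_integrable[OF assms(1)]] by simp

text \<open>A crude bound that grows with \<open>T\<close>; it serves at fixed \<open>T\<close>, to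
  identify the limit of deviations of approximants.\<close>

lemma dev_L1:
  assumes f: "f \<in> L2_0 \<mu>" and T: "0 < T"
  shows "(\<integral>w. \<bar>dev T f w\<bar> \<partial>M) \<le> sqrt T * nrm f"
proof -
  note f' = L2_0_D[OF f]
  have i: "integrable \<mu> (\<lambda>x. \<bar>f x\<bar>)" using mu.L2_integrable[OF f'(1)] by simp
  have ae: "AE w in M. \<bar>dev T f w\<bar> \<le> path_integral T (\<lambda>x. \<bar>f x\<bar>) w / sqrt T"
    using path_integrable_AE[OF less_imp_le[OF T] i] AE_space
  proof eventually_elim
    case (elim w)
    have "\<bar>path_integral T f w\<bar> \<le> path_integral T (\<lambda>x. \<bar>f x\<bar>) w"
      using elim L2_measurable[OF f'(1)] by (intro path_integral_abs_le) auto
    then show ?case using T by (simp add: dev_def f'(2) divide_right_mono)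
  qed
  have "(\<integral>w. \<bar>dev T f w\<bar> \<partial>M) \<le> (\<integral>w. path_integral T (\<lambda>x. \<bar>f x\<bar>) w / sqrt T \<partial>M)"
    using dev_integrable[OF f'(1)] path_integral_integrable(1)[OF less_imp_le[OF T] i] ae T
    by (intro integral_mono_AE) auto
  also have "... = T * mean (\<lambda>x. \<bar>f x\<bar>) / sqrt T"
    using path_integral_integrable(2)[OF less_imp_le[OF T] i] by simp
  also have "... = sqrt T * mean (\<lambda>x. \<bar>f x\<bar>)" using T by (simp add: real_div_sqrt mult.commute[of T] flip: times_divide_eq_right)
  also have "... \<le> sqrt T * nrm f" using T f' by (intro mult_left_mono mu.L2_norm_ge_L1) auto
  finally show ?thesis .
qed

lemma continuous_Bd:
  fixes g :: "'a \<Rightarrow> real"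
  assumes "continuous_on UNIV g" "\<And>x. \<bar>g x\<bar> \<le> b"
  shows "g \<in> Bd"
proof (rule BdI[OF _ assms(2)])
  have "g \<in> borel_measurable borel" using assms(1) by (rule borel_measurable_continuous_onI)
  then show "g \<in> borel_measurable \<mu>" using sets_mu' by (simp add: measurable_restrict_space1 cong: measurable_cong_sets)
qed

text \<open>Subtracting the mean from a continuous approximant does not increase its distance to a
  mean-zero function.\<close>

lemma L2_0_approx_continuous:
  assumes f: "f \<in> L2_0 \<mu>" and e: "0 < e"
  obtains g b where "continuous_on UNIV g" "\<And>x. \<bar>g x\<bar> \<le> b" "g \<in> L2_0 \<mu>" "nrm (\<lambda>x. f x - g x) < e"
proof -
  obtain h where h: "continuous_on UNIV h" "bounded (range h)" "h \<in> L2 \<mu>" "nrm (\<lambda>x. f x - h x) < e"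
    using L2_approx_continuous[OF mu.prob_space_axioms sets_mu' E_borel L2_0_D(1)[OF f] e] by blast
  obtain b where b: "\<And>x. \<bar>h x\<bar> \<le> b" using h(2) unfolding bounded_iff by auto
  define c where "c = mean h"
  define g where "g x = h x - c" for x
  have i: "integrable \<mu> f" "integrable \<mu> h" using f h(3) by (auto intro!: mu.L2_integrable L2_0_D)
  have "nrm (\<lambda>x. f x - g x) = nrm (\<lambda>x. (f x - h x) - mean (\<lambda>x. f x - h x))"
    using i L2_0_D(2)[OF f] by (simp add: g_def c_def algebra_simps)
  also have "... \<le> nrm (\<lambda>x. f x - h x)"
  proof (rule power2_le_imp_le[OF _ L2_norm_nonneg])
    have "(\<lambda>x. f x - h x) \<in> L2 \<mu>" by (intro L2_diff L2_0_D f h)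
    from mu.L2_norm_centered[OF this] show "(nrm (\<lambda>x. (f x - h x) - mean (\<lambda>x. f x - h x)))^2 \<le> (nrm (\<lambda>x. f x - h x))^2"
      using zero_le_power2[of "\<integral>x. f x - h x \<partial>\<mu>"] by linarith
  qed
  finally have "nrm (\<lambda>x. f x - g x) < e" using h(4) by simp
  moreover have "g \<in> L2_0 \<mu>" unfolding g_def[abs_def] using h(3) i(2) by (auto simp: L2_0_def c_def mu.prob_space)
  moreover have "continuous_on UNIV g" unfolding g_def by (intro continuous_intros h)
  moreover have "\<bar>g x\<bar> \<le> b + \<bar>c\<bar>" for x using b[of x] by (simp add: g_def)
  ultimately show ?thesis using that by blast
qed

lemma dev_norm_Bd:
  assumes "f \<in> Bd" "mean f = 0" "0 < T"
  shows "(\<integral>w. (dev T f w)^2 \<partial>M) = (\<integral>w. (path_integral T f w)^2 \<partial>M) / T"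
    and "(dev T f) \<in> L2 M" "L2_norm M (dev T f) \<le> sqrt (2 / \<gamma>) * nrm f"
proof -
  show eq: "(\<integral>w. (dev T f w)^2 \<partial>M) = (\<integral>w. (path_integral T f w)^2 \<partial>M) / T"
    using assms by (simp add: dev_def power_divide)
  obtain b where b: "\<And>x. x \<in> E \<Longrightarrow> \<bar>f x\<bar> \<le> b" using BdE[OF assms(1)] by metis
  show "(dev T f) \<in> L2 M"
  proof (rule L2_bounded[where c = "b * T / sqrt T"])
    show "\<bar>dev T f w\<bar> \<le> b * T / sqrt T" if "w \<in> space M" for w
      using path_integral_bound[OF less_imp_le[OF assms(3)] that Bd_measurable[OF assms(1)] b] assms
      by (simp add: dev_def divide_right_mono)
  qed (use assms(1) Bd_measurable in measurable)
  have "(\<integral>w. (path_integral T f w)^2 \<partial>M) / T \<le> 2 * T * (nrm f)^2 / \<gamma> / T"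
    using assms by (intro divide_right_mono variance_bound_Bd) auto
  also have "... = (sqrt (2 / \<gamma>) * nrm f)^2" using assms gap_pos by (simp add: power_mult_distrib)
  finally have "(L2_norm M (dev T f))^2 \<le> (sqrt (2 / \<gamma>) * nrm f)^2" unfolding L2_norm_sq eq .
  then show "L2_norm M (dev T f) \<le> sqrt (2 / \<gamma>) * nrm f" using gap_pos by (rule_tac power2_le_imp_le) auto
qed

text \<open>At fixed \<open>T\<close>, deviations of bounded approximants converge to that of
  \<open>f\<close> in mean by \<open>dev_L1\<close>, hence almost surely along a subsequence.
  Fatou's lemma carries over the variance bound, which is uniform in \<open>T\<close>.\<close>

lemma dev_norm:
  assumes f: "f \<in> L2_0 \<mu>" and T: "0 < T"
  shows "dev T f \<in> L2 M" "L2_norm M (dev T f) \<le> sqrt (2 / \<gamma>) * nrm f"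
proof -
  let ?D = "dev T" and ?C = "sqrt (2 / \<gamma>)"
  have "\<exists>h. h \<in> Bd \<and> h \<in> L2_0 \<mu> \<and> nrm (\<lambda>x. f x - h x) < 1 / real (Suc n)" for n
  proof -
    obtain h b where "continuous_on UNIV h" "\<And>x. \<bar>h x\<bar> \<le> b" "h \<in> L2_0 \<mu>" "nrm (\<lambda>x. f x - h x) < 1 / real (Suc n)"
      using L2_0_approx_continuous[OF f, of "1 / real (Suc n)"] by auto
    then show ?thesis using continuous_Bd by blast
  qed
  then obtain h where h: "\<And>n. h n \<in> Bd" "\<And>n. h n \<in> L2_0 \<mu>" "\<And>n. nrm (\<lambda>x. f x - h n x) < 1 / real (Suc n)" by metis
  have fd: "(\<lambda>x. f x - h n x) \<in> L2_0 \<mu>" for n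
    using f h(2)[of n] by (auto simp: L2_0_def mu.L2_integrable)
  have lim1: "(\<lambda>n. 1 / real (Suc n)) \<longlonglongrightarrow> 0" by (rule LIMSEQ_inverse_real_of_nat[unfolded inverse_eq_divide])
  have L1: "(\<lambda>n. \<integral>w. norm (?D f w - ?D (h n) w) \<partial>M) \<longlonglongrightarrow> 0"
  proof (rule tendsto_sandwich[OF _ _ tendsto_const])
    show "\<forall>\<^sub>F n in sequentially. 0 \<le> (\<integral>w. norm (?D f w - ?D (h n) w) \<partial>M)" by simp
    show "(\<lambda>n. sqrt T * (1 / real (Suc n))) \<longlonglongrightarrow> 0" using tendsto_mult_right_zero[OF lim1] .
    show "\<forall>\<^sub>F n in sequentially. (\<integral>w. norm (?D f w - ?D (h n) w) \<partial>M) \<le> sqrt T * (1 / real (Suc n))"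
    proof (intro always_eventually allI)
      fix n
      have "(\<integral>w. norm (?D f w - ?D (h n) w) \<partial>M) = (\<integral>w. \<bar>?D (\<lambda>x. f x - h n x) w\<bar> \<partial>M)"
      proof (rule integral_cong_AE)
        show "AE w in M. norm (?D f w - ?D (h n) w) = \<bar>?D (\<lambda>x. f x - h n x) w\<bar>"
          using dev_diff_AE[OF L2_0_D(1)[OF f] L2_0_D(1)[OF h(2)[of n]] less_imp_le[OF T]] by eventually_elim simp
      qed (use L2_measurable[OF L2_0_D(1)[OF f]] L2_measurable[OF L2_0_D(1)[OF h(2)[of n]]] in \<open>measurable\<close>)
      also have "... \<le> sqrt T * nrm (\<lambda>x. f x - h n x)" by (rule dev_L1[OF fd T])
      also have "... \<le> sqrt T * (1 / real (Suc n))" using h(3)[of n] T by (intro mult_left_mono) auto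
      finally show "(\<integral>w. norm (?D f w - ?D (h n) w) \<partial>M) \<le> sqrt T * (1 / real (Suc n))" .
    qed
  qed
  have int: "integrable M (\<lambda>w. ?D f w - ?D (h n) w)" for n
    using f h(2)[of n] T by (intro Bochner_Integration.integrable_diff dev_integrable L2_0_D) auto
  obtain r where r: "strict_mono r" "AE w in M. (\<lambda>n. ?D f w - ?D (h (r n)) w) \<longlonglongrightarrow> 0"
    using tendsto_L1_AE_subseq[OF int L1] by blast
  have Dm[measurable]: "?D f \<in> borel_measurable M" "?D (h n) \<in> borel_measurable M" for n
    using L2_measurable[OF L2_0_D(1)[OF f]] L2_measurable[OF L2_0_D(1)[OF h(2)[of n]]] by auto
  have "(\<integral>\<^sup>+w. ennreal ((?D f w)^2) \<partial>M) = (\<integral>\<^sup>+w. liminf (\<lambda>n. ennreal ((?D (h (r n)) w)^2)) \<partial>M)"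
  proof (rule nn_integral_cong_AE, use r(2) in eventually_elim)
    case (elim w)
    have "(\<lambda>n. ?D f w - (?D f w - ?D (h (r n)) w)) \<longlonglongrightarrow> ?D f w - 0" by (intro tendsto_diff tendsto_const elim)
    then have "(\<lambda>n. ennreal ((?D (h (r n)) w)^2)) \<longlonglongrightarrow> ennreal ((?D f w)^2)" by (intro tendsto_ennrealI tendsto_power) simp
    then show ?case by (intro lim_imp_Liminf[symmetric]) auto
  qed
  also have "... \<le> liminf (\<lambda>n. \<integral>\<^sup>+w. ennreal ((?D (h (r n)) w)^2) \<partial>M)"
    by (rule nn_integral_liminf) measurable
  also have "... \<le> liminf (\<lambda>n. ennreal ((?C * (nrm f + 1 / real (Suc (r n))))^2))"
  proof (intro Liminf_mono always_eventually allI)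
    fix n
    let ?g = "h (r n)"
    have "(\<integral>\<^sup>+w. ennreal ((?D ?g w)^2) \<partial>M) = ennreal (\<integral>w. (?D ?g w)^2 \<partial>M)"
      by (intro nn_integral_eq_integral L2_integrable_square dev_norm_Bd(2) h L2_0_D(2) T) auto
    also have "(\<integral>w. (?D ?g w)^2 \<partial>M) = (L2_norm M (?D ?g))^2" by (simp add: L2_norm_sq)
    also have "ennreal ... \<le> ennreal ((?C * (nrm f + 1 / real (Suc (r n))))^2)"
    proof (intro ennreal_leI power_mono)
      have "L2_norm M (?D ?g) \<le> ?C * nrm ?g" by (intro dev_norm_Bd(3) h L2_0_D(2) T)
      also have "nrm ?g \<le> nrm (\<lambda>x. ?g x - f x) + nrm f" by (intro L2_norm_triangle_diff L2_0_D f h)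
      also have "nrm (\<lambda>x. ?g x - f x) = nrm (\<lambda>x. f x - ?g x)" by (rule L2_norm_minus_commute)
      also have "... + nrm f \<le> nrm f + 1 / real (Suc (r n))" using h(3)[of "r n"] by simp
      finally show "L2_norm M (?D ?g) \<le> ?C * (nrm f + 1 / real (Suc (r n)))" using gap_pos by (simp add: mult_left_mono)
    qed simp
    finally show "(\<integral>\<^sup>+w. ennreal ((?D ?g w)^2) \<partial>M) \<le> ennreal ((?C * (nrm f + 1 / real (Suc (r n))))^2)" .
  qed
  also have "... = ennreal ((?C * (nrm f + 0))^2)"
    using LIMSEQ_subseq_LIMSEQ[OF lim1 r(1)] unfolding o_def
    by (intro lim_imp_Liminf tendsto_ennrealI tendsto_intros) auto
  finally have nn: "(\<integral>\<^sup>+w. ennreal ((?D f w)^2) \<partial>M) \<le> ennreal ((?C * nrm f)^2)" by simp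
  have i2: "integrable M (\<lambda>w. (?D f w)^2)"
    using nn by (intro integrableI_nonneg) (auto intro: le_less_trans)
  then show "?D f \<in> L2 M" by (intro L2I Dm)
  have "ennreal (\<integral>w. (?D f w)^2 \<partial>M) \<le> ennreal ((?C * nrm f)^2)"
    using nn i2 by (subst nn_integral_eq_integral[symmetric]) auto
  then have "(L2_norm M (?D f))^2 \<le> (?C * nrm f)^2" unfolding L2_norm_sq by (simp add: ennreal_le_iff)
  then show "L2_norm M (?D f) \<le> ?C * nrm f" using gap_pos by (rule_tac power2_le_imp_le) auto
qed

text \<open>The modulus, uniform in \<open>T\<close>, that transfers limits from bounded continuous
  functions to all of \<open>L2_0\<close>.\<close>

lemma dev_norm_diff:
  assumes f: "f \<in> L2_0 \<mu>" "g \<in> L2_0 \<mu>" and T: "0 < T"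
  shows "L2_norm M (\<lambda>w. dev T f w - dev T g w) \<le> sqrt (2 / \<gamma>) * nrm (\<lambda>x. f x - g x)"
proof -
  have fd: "(\<lambda>x. f x - g x) \<in> L2_0 \<mu>" using f by (auto simp: L2_0_def mu.L2_integrable)
  have "(\<integral>w. (dev T f w - dev T g w)^2 \<partial>M) = (\<integral>w. (dev T (\<lambda>x. f x - g x) w)^2 \<partial>M)"
  proof (rule integral_cong_AE)
    show "AE w in M. (dev T f w - dev T g w)^2 = (dev T (\<lambda>x. f x - g x) w)^2"
      using dev_diff_AE[OF L2_0_D(1)[OF f(1)] L2_0_D(1)[OF f(2)] less_imp_le[OF T]] by eventually_elim simp
  qed (use L2_measurable[OF L2_0_D(1)[OF f(1)]] L2_measurable[OF L2_0_D(1)[OF f(2)]] in measurable)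
  then have "L2_norm M (\<lambda>w. dev T f w - dev T g w) = L2_norm M (dev T (\<lambda>x. f x - g x))"
    by (simp add: L2_norm_def)
  then show ?thesis using dev_norm(2)[OF fd T] by simp
qed

text \<open>The phases 0 and \<open>- pi / 2\<close> in \<open>m1_limit\<close> yield the real and
  imaginary parts of the characteristic function.\<close>

lemma clt_continuous:
  assumes g: "continuous_on UNIV g" "\<And>x. \<bar>g x\<bar> \<le> b" "mean g = 0"
  shows "((\<lambda>T. L2_norm M (dev T g)) \<longlongrightarrow> sqrt (2 * corrlim g)) at_top"
    and "((\<lambda>T. \<integral>w. cis (dev T g w) \<partial>M) \<longlongrightarrow> complex_of_real (exp (- corrlim g))) at_top"
proof -
  have Bd: "g \<in> Bd" by (rule continuous_Bd[OF g(1,2)])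
  have inv: "((\<lambda>T. c / T) \<longlongrightarrow> 0) at_top" for c :: real
    by (intro tendsto_divide_0[OF tendsto_const] filterlim_at_top_imp_at_infinity filterlim_ident)
  have "((\<lambda>T. \<integral>w. (dev T g w)^2 \<partial>M) \<longlongrightarrow> 2 * corrlim g) at_top"
  proof (rule Lim_transform_bound[THEN LIM_zero_cancel])
    show "((\<lambda>T. 2 * ((nrm g)^2 / \<gamma>) / \<gamma> / T) \<longlongrightarrow> 0) at_top" by (rule inv)
    show "\<forall>\<^sub>F T in at_top. norm ((\<integral>w. (dev T g w)^2 \<partial>M) - 2 * corrlim g) \<le> norm (2 * ((nrm g)^2 / \<gamma>) / \<gamma> / T)"
      using eventually_gt_at_top[of 0]
    proof eventually_elim
      case (elim T)
      then show ?case using variance_limit_Bd[OF Bd g(3) elim] dev_norm_Bd(1)[OF Bd g(3) elim] gap_pos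
        by simp
    qed
  qed
  then show "((\<lambda>T. L2_norm M (dev T g)) \<longlongrightarrow> sqrt (2 * corrlim g)) at_top"
    unfolding L2_norm_def by (rule tendsto_real_sqrt)
  define A where "A = b * (b * nrm g) / \<gamma> / \<gamma> + (nrm g)^2 * b * (2 / \<gamma>) / (\<gamma> / 2)"
  define B where "B = (nrm g)^2 / \<gamma>"
  have phase: "((\<lambda>T. \<integral>w. cos (z + dev T g w) \<partial>M) \<longlongrightarrow> exp (- corrlim g) * cos z) at_top" for z
  proof (rule Lim_transform_bound[THEN LIM_zero_cancel])
    have "((\<lambda>T. A / sqrt T + (B / \<gamma>) / T) \<longlongrightarrow> 0 + 0) at_top"
      by (intro tendsto_add filterlim_compose[OF inv sqrt_at_top] inv)
    then show "((\<lambda>T. A / sqrt T + (B / \<gamma>) / T) \<longlongrightarrow> 0) at_top" by simp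
    show "\<forall>\<^sub>F T in at_top. norm ((\<integral>w. cos (z + dev T g w) \<partial>M) - exp (- corrlim g) * cos z) \<le> norm (A / sqrt T + (B / \<gamma>) / T)"
      using eventually_gt_at_top[of 0]
    proof eventually_elim
      case (elim T)
      \<comment> \<open>A separate instance for each \<open>T\<close>, evaluated at time
        \<open>T\<close>; the constants \<open>A\<close> and \<open>B\<close> do not depend on
        it.\<close>
      interpret clt_function M \<mu> X E \<kappa> \<gamma> g b "1 / sqrt T"
        by unfold_locales (use g elim in auto)
      have a: "m1 z T = (\<integral>w. cos (z + dev T g w) \<partial>M)"
        unfolding m1_eq osc_def dev_def by (simp add: g(3))
      have b': "(1 / sqrt T)^2 * corrlim g * T = corrlim g" using elim by (simp add: power_divide)
      have c: "(1 / sqrt T)^2 * (1 / sqrt T * K2 * T + K3 / \<gamma>) = A / sqrt T + (B / \<gamma>) / T"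
        using elim by (simp add: power_divide A_def[folded K2_def] B_def[folded K3_def] distrib_left)
      show ?case using m1_limit[of T z, unfolded a b' c] elim by simp
    qed
  qed
  have Dm[measurable]: "dev T g \<in> borel_measurable M" for T using Bd_measurable[OF Bd] by simp
  have ci: "integrable M (\<lambda>w. cis (dev T g w))" for T
    by (intro integrable_const_bound[of _ 1]) (auto simp: cis_conv_exp)
  have cre: "Re (\<integral>w. cis (dev T g w) \<partial>M) = (\<integral>w. cos (0 + dev T g w) \<partial>M)" for T
    using integral_Re[OF ci[of T]] by simp
  have cim: "Im (\<integral>w. cis (dev T g w) \<partial>M) = (\<integral>w. cos (- pi / 2 + dev T g w) \<partial>M)" for T
  proof -
    have "cos (- pi / 2 + x) = sin x" for x :: real using cos_add[of "- (pi / 2)" x] by simp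
    then show ?thesis using integral_Im[OF ci[of T]] by (simp only: cis.simps)
  qed
  show "((\<lambda>T. \<integral>w. cis (dev T g w) \<partial>M) \<longlongrightarrow> complex_of_real (exp (- corrlim g))) at_top"
    unfolding tendsto_complex_iff cre cim using phase[of 0] phase[of "- pi / 2"] by simp
qed

lemma norm_cis_diff_le: "norm (cis a - cis b) \<le> \<bar>a - b\<bar>"
proof -
  have "cis a - cis b = cis b * (exp (\<i> * of_real (a - b)) - 1)"
    by (simp add: cis_conv_exp algebra_simps exp_add[symmetric])
  then show ?thesis using iexp_approx1[of "a - b" 0] by (simp add: norm_mult)
qed

text \<open>Norms and characteristic functions of deviations are Lipschitz in \<open>f\<close>
  uniformly in \<open>T\<close>, so both limits exist by approximation. Norms are used instead of
  variances because they are Lipschitz globally.\<close>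

lemma clt:
  assumes f: "f \<in> L2_0 \<mu>"
  shows "\<exists>v. ((\<lambda>T. L2_norm M (dev T f)) \<longlongrightarrow> v) at_top \<and>
    ((\<lambda>T. \<integral>w. cis (dev T f w) \<partial>M) \<longlongrightarrow> complex_of_real (exp (- v\<^sup>2 / 2))) at_top"
proof -
  let ?N = "\<lambda>f T. L2_norm M (dev T f)" and ?c = "\<lambda>f T. \<integral>w. cis (dev T f w) \<partial>M"
  let ?C = "sqrt (2 / \<gamma>)"
  have C: "0 < ?C" using gap_pos by simp
  have approx: "\<exists>h. 0 \<le> corrlim h \<and> (?N h \<longlongrightarrow> sqrt (2 * corrlim h)) at_top \<and> (?c h \<longlongrightarrow> complex_of_real (exp (- corrlim h))) at_top \<and>
      (\<forall>\<^sub>F T in at_top. dist (?N f T) (?N h T) \<le> e \<and> dist (?c f T) (?c h T) \<le> e)" if e: "0 < e" for e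
  proof -
    obtain h b where h: "continuous_on UNIV h" "\<And>x. \<bar>h x\<bar> \<le> b" "h \<in> L2_0 \<mu>" "nrm (\<lambda>x. f x - h x) < e / ?C"
      using L2_0_approx_continuous[OF f divide_pos_pos[OF e C]] by metis
    note Bd = continuous_Bd[OF h(1,2)]
    have "\<forall>\<^sub>F T in at_top. dist (?N f T) (?N h T) \<le> e \<and> dist (?c f T) (?c h T) \<le> e"
      using eventually_gt_at_top[of 0]
    proof eventually_elim
      case (elim T)
      let ?d = "\<lambda>w. dev T f w - dev T h w"
      note L = dev_norm(1)[OF f elim] dev_norm(1)[OF h(3) elim]
      have "?C * nrm (\<lambda>x. f x - h x) \<le> e" using h(4) C by (simp add: field_simps)
      then have d: "L2_norm M ?d \<le> e" using dev_norm_diff[OF f h(3) elim] by linarith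
      have "?N f T \<le> L2_norm M ?d + ?N h T" "?N h T \<le> L2_norm M (\<lambda>w. dev T h w - dev T f w) + ?N f T"
        by (intro L2_norm_triangle_diff L)+
      then have 1: "dist (?N f T) (?N h T) \<le> e"
        using d L2_norm_minus_commute[of M "dev T f" "dev T h"] by (simp add: dist_real_def)
      have ci: "integrable M (\<lambda>w. cis (dev T g w))" if "dev T g \<in> L2 M" for g
        using L2_measurable[OF that] by (intro integrable_const_bound[of _ 1]) (auto simp: cis_conv_exp)
      have "dist (?c f T) (?c h T) = norm (\<integral>w. cis (dev T f w) - cis (dev T h w) \<partial>M)"
        unfolding dist_norm using ci L by simp
      also have "... \<le> (\<integral>w. \<bar>?d w\<bar> \<partial>M)"
      proof (rule integral_norm_bound[THEN order_trans], rule integral_mono)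
        show "integrable M (\<lambda>w. \<bar>?d w\<bar>)" using L2_integrable[OF L2_diff[OF L]] by simp
        show "integrable M (\<lambda>w. norm (cis (dev T f w) - cis (dev T h w)))"
          using ci L by (intro integrable_norm Bochner_Integration.integrable_diff)
      qed (rule norm_cis_diff_le)
      also have "... \<le> e" using L2_norm_ge_L1[OF L2_diff[OF L]] d by linarith
      finally show ?case using 1 by simp
    qed
    moreover have "0 \<le> corrlim h" by (intro corrlim_nonneg Bd L2_0_D(2) h)
    ultimately show ?thesis using clt_continuous[OF h(1,2) L2_0_D(2)[OF h(3)]] by blast
  qed
  have "\<exists>v. (?N f \<longlongrightarrow> v) at_top"
  proof (rule tendsto_at_top_of_approximations)
    fix e :: real assume "0 < e"
    from approx[OF this] obtain h where "(?N h \<longlongrightarrow> sqrt (2 * corrlim h)) at_top"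
      "\<forall>\<^sub>F T in at_top. dist (?N f T) (?N h T) \<le> e \<and> dist (?c f T) (?c h T) \<le> e" by blast
    then show "\<exists>g l. (g \<longlongrightarrow> l) at_top \<and> (\<forall>\<^sub>F T in at_top. dist (?N f T) (g T) \<le> e)"
      by (intro exI[of _ "?N h"] exI[of _ "sqrt (2 * corrlim h)"]) (auto elim: eventually_mono)
  qed
  then obtain v where v: "(?N f \<longlongrightarrow> v) at_top" by blast
  have "\<exists>l. (?c f \<longlongrightarrow> l) at_top"
  proof (rule tendsto_at_top_of_approximations)
    fix e :: real assume "0 < e"
    from approx[OF this] obtain h where "(?c h \<longlongrightarrow> complex_of_real (exp (- corrlim h))) at_top"
      "\<forall>\<^sub>F T in at_top. dist (?N f T) (?N h T) \<le> e \<and> dist (?c f T) (?c h T) \<le> e" by blast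
    then show "\<exists>g l. (g \<longlongrightarrow> l) at_top \<and> (\<forall>\<^sub>F T in at_top. dist (?c f T) (g T) \<le> e)"
      by (intro exI[of _ "?c h"] exI[of _ "complex_of_real (exp (- corrlim h))"]) (auto elim: eventually_mono)
  qed
  then obtain l where l: "(?c f \<longlongrightarrow> l) at_top" by blast
  \<comment> \<open>The pair of limits is a limit of pairs on the closed graph of
    \<open>exp (- s\<^sup>2 / 2)\<close>, hence lies on it.\<close>
  have lim_le: "\<exists>s. dist v s \<le> e \<and> dist l (complex_of_real (exp (- s\<^sup>2 / 2))) \<le> e" if e: "0 < e" for e
  proof -
    from approx[OF e] obtain h where h: "0 \<le> corrlim h" "(?N h \<longlongrightarrow> sqrt (2 * corrlim h)) at_top"
      "(?c h \<longlongrightarrow> complex_of_real (exp (- corrlim h))) at_top"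
      "\<forall>\<^sub>F T in at_top. dist (?N f T) (?N h T) \<le> e \<and> dist (?c f T) (?c h T) \<le> e" by blast
    have "dist v (sqrt (2 * corrlim h)) \<le> e"
      by (rule tendsto_upperbound[OF tendsto_dist[OF v h(2)]]) (use h(4) in \<open>auto elim: eventually_mono\<close>)
    moreover have "dist l (complex_of_real (exp (- corrlim h))) \<le> e"
      by (rule tendsto_upperbound[OF tendsto_dist[OF l h(3)]]) (use h(4) in \<open>auto elim: eventually_mono\<close>)
    ultimately show ?thesis using h(1) by (intro exI[of _ "sqrt (2 * corrlim h)"]) simp
  qed
  have "\<exists>s. dist v s \<le> 1 / real (Suc n) \<and> dist l (complex_of_real (exp (- s\<^sup>2 / 2))) \<le> 1 / real (Suc n)" for n
    by (rule lim_le) simp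
  then obtain s where s: "\<And>n. dist v (s n) \<le> 1 / real (Suc n)" "\<And>n. dist l (complex_of_real (exp (- (s n)\<^sup>2 / 2))) \<le> 1 / real (Suc n)" by metis
  have lim1: "(\<lambda>n. 1 / real (Suc n)) \<longlonglongrightarrow> 0" by (rule LIMSEQ_inverse_real_of_nat[unfolded inverse_eq_divide])
  have "s \<longlonglongrightarrow> v"
    by (rule tendsto_dist_iff[THEN iffD2], rule tendsto_sandwich[OF _ _ tendsto_const lim1]) (use s(1) in \<open>auto simp: dist_commute\<close>)
  then have "(\<lambda>n. complex_of_real (exp (- (s n)\<^sup>2 / 2))) \<longlonglongrightarrow> complex_of_real (exp (- v\<^sup>2 / 2))" by (intro tendsto_intros) auto
  moreover have "(\<lambda>n. complex_of_real (exp (- (s n)\<^sup>2 / 2))) \<longlonglongrightarrow> l"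
    by (rule tendsto_dist_iff[THEN iffD2], rule tendsto_sandwich[OF _ _ tendsto_const lim1]) (use s(2) in \<open>auto simp: dist_commute\<close>)
  ultimately have "l = complex_of_real (exp (- v\<^sup>2 / 2))" by (rule LIMSEQ_unique[symmetric])
  then show ?thesis using v l by blast
qed

definition asymptotic_variance :: "('a \<Rightarrow> real) \<Rightarrow> real" where
  "asymptotic_variance f = Lim at_top (\<lambda>T. \<integral>w. (dev T f w)^2 \<partial>M)"

lemma asymptotic_variance:
  assumes f: "f \<in> L2_0 \<mu>"
  shows "((\<lambda>T. \<integral>w. (dev T f w)^2 \<partial>M) \<longlongrightarrow> asymptotic_variance f) at_top"
    and "((\<lambda>T. \<integral>w. cis (dev T f w) \<partial>M) \<longlongrightarrow> complex_of_real (exp (- asymptotic_variance f / 2))) at_top"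
    and "0 \<le> asymptotic_variance f"
proof -
  obtain s where s: "((\<lambda>T. L2_norm M (dev T f)) \<longlongrightarrow> s) at_top"
    "((\<lambda>T. \<integral>w. cis (dev T f w) \<partial>M) \<longlongrightarrow> complex_of_real (exp (- s\<^sup>2 / 2))) at_top" using clt[OF f] by blast
  have lim: "((\<lambda>T. \<integral>w. (dev T f w)^2 \<partial>M) \<longlongrightarrow> s\<^sup>2) at_top"
    using tendsto_power[OF s(1), of 2] by (simp add: L2_norm_sq)
  have "asymptotic_variance f = s\<^sup>2" unfolding asymptotic_variance_def by (rule tendsto_Lim[OF _ lim]) simp
  then show "((\<lambda>T. \<integral>w. (dev T f w)^2 \<partial>M) \<longlongrightarrow> asymptotic_variance f) at_top"
    "((\<lambda>T. \<integral>w. cis (dev T f w) \<partial>M) \<longlongrightarrow> complex_of_real (exp (- asymptotic_variance f / 2))) at_top"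
    "0 \<le> asymptotic_variance f" using lim s(2) by auto
qed

text \<open>Polarisation of the asymptotic variance.\<close>

definition asymptotic_covariance :: "('a \<Rightarrow> real) \<Rightarrow> ('a \<Rightarrow> real) \<Rightarrow> real" where
  "asymptotic_covariance f g = (asymptotic_variance (\<lambda>x. f x + g x) - asymptotic_variance (\<lambda>x. f x - g x)) / 4"

lemma asymptotic_covariance:
  assumes f: "f \<in> L2_0 \<mu>" "g \<in> L2_0 \<mu>"
  shows "((\<lambda>T. \<integral>w. dev T f w * dev T g w \<partial>M) \<longlongrightarrow> asymptotic_covariance f g) at_top"
proof -
  have fd: "(\<lambda>x. f x - g x) \<in> L2_0 \<mu>" "(\<lambda>x. f x + g x) \<in> L2_0 \<mu>" using f by (auto simp: L2_0_def mu.L2_integrable)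
  have "((\<lambda>T. ((\<integral>w. (dev T (\<lambda>x. f x + g x) w)^2 \<partial>M) - (\<integral>w. (dev T (\<lambda>x. f x - g x) w)^2 \<partial>M)) / 4) \<longlongrightarrow> asymptotic_covariance f g) at_top"
    unfolding asymptotic_covariance_def by (intro tendsto_intros asymptotic_variance fd) simp
  then show ?thesis
  proof (rule Lim_transform_eventually)
    show "\<forall>\<^sub>F T in at_top. ((\<integral>w. (dev T (\<lambda>x. f x + g x) w)^2 \<partial>M) - (\<integral>w. (dev T (\<lambda>x. f x - g x) w)^2 \<partial>M)) / 4
        = (\<integral>w. dev T f w * dev T g w \<partial>M)"
      using eventually_gt_at_top[of 0]
    proof eventually_elim
      case (elim T)
      note L = dev_norm(1)[OF fd(2) elim] dev_norm(1)[OF fd(1) elim] dev_norm(1)[OF f(1) elim] dev_norm(1)[OF f(2) elim]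
      note [measurable] = L[THEN L2_measurable]
      have "(\<integral>w. (dev T (\<lambda>x. f x + g x) w)^2 \<partial>M) - (\<integral>w. (dev T (\<lambda>x. f x - g x) w)^2 \<partial>M)
        = (\<integral>w. (dev T (\<lambda>x. f x + g x) w)^2 - (dev T (\<lambda>x. f x - g x) w)\<^sup>2 \<partial>M)"
        using L by (simp add: L2_integrable_square)
      also have "... = (\<integral>w. 4 * (dev T f w * dev T g w) \<partial>M)"
      proof (rule integral_cong_AE)
        show "AE w in M. (dev T (\<lambda>x. f x + g x) w)^2 - (dev T (\<lambda>x. f x - g x) w)\<^sup>2 = 4 * (dev T f w * dev T g w)"
          using dev_diff_AE[OF L2_0_D(1)[OF f(1)] L2_0_D(1)[OF f(2)] less_imp_le[OF elim]]
            dev_add_AE[OF L2_0_D(1)[OF f(1)] L2_0_D(1)[OF f(2)] less_imp_le[OF elim]]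
        proof eventually_elim
          case (elim w)
          show ?case unfolding elim by (simp add: power2_eq_square algebra_simps)
        qed
      qed measurable
      finally show ?case by simp
    qed
  qed
qed

lemma L2_0_linear:
  assumes "\<And>i. r i \<in> L2_0 \<mu>"
  shows "(\<lambda>x. \<Sum>i<n::nat. c i * r i x) \<in> L2_0 \<mu>"
proof -
  have "(\<lambda>x. \<Sum>i<n. c i * r i x) \<in> L2 \<mu>" using assms by (intro L2_sum L2_cmult L2_0_D)
  moreover have "mean (\<lambda>x. (\<Sum>i<n. c i * r i x)) = 0"
    using assms by (subst Bochner_Integration.integral_sum) (auto intro!: mu.L2_integrable L2_0_D simp: L2_0_D)
  ultimately show ?thesis by (simp add: L2_0_def)
qed

text \<open>Bilinearity is inherited from the identity for second moments at finite \<open>T\<close>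
  by passing to the limit.\<close>

lemma asymptotic_variance_linear:
  fixes r :: "nat \<Rightarrow> 'a \<Rightarrow> real"
  assumes r: "\<And>i. r i \<in> L2_0 \<mu>"
  shows "asymptotic_variance (\<lambda>x. \<Sum>i<n. c i * r i x) = (\<Sum>i<n. \<Sum>j<n. c i * c j * asymptotic_covariance (r i) (r j))"
proof (rule tendsto_unique[OF _ asymptotic_variance(1)[OF L2_0_linear[OF r]]])
  have "((\<lambda>T. \<Sum>i<n. \<Sum>j<n. c i * c j * (\<integral>w. dev T (r i) w * dev T (r j) w \<partial>M)) \<longlongrightarrow>
      (\<Sum>i<n. \<Sum>j<n. c i * c j * asymptotic_covariance (r i) (r j))) at_top"
    by (intro tendsto_intros asymptotic_covariance r)
  then show "((\<lambda>T. \<integral>w. (dev T (\<lambda>x. \<Sum>i<n. c i * r i x) w)^2 \<partial>M) \<longlongrightarrow>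
      (\<Sum>i<n. \<Sum>j<n. c i * c j * asymptotic_covariance (r i) (r j))) at_top"
  proof (rule Lim_transform_eventually)
    show "\<forall>\<^sub>F T in at_top. (\<Sum>i<n. \<Sum>j<n. c i * c j * (\<integral>w. dev T (r i) w * dev T (r j) w \<partial>M))
        = (\<integral>w. (dev T (\<lambda>x. \<Sum>i<n. c i * r i x) w)^2 \<partial>M)"
      using eventually_gt_at_top[of 0]
    proof eventually_elim
      case (elim T)
      note L = dev_norm(1)[OF r elim]
      note [measurable] = L[THEN L2_measurable] dev_norm(1)[OF L2_0_linear[OF r] elim, THEN L2_measurable]
      have "(\<integral>w. (dev T (\<lambda>x. \<Sum>i<n. c i * r i x) w)^2 \<partial>M)
        = (\<integral>w. (\<Sum>i<n. \<Sum>j<n. c i * c j * (dev T (r i) w * dev T (r j) w)) \<partial>M)"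
      proof (rule integral_cong_AE)
        have "AE w in M. dev T (\<lambda>x. \<Sum>i<n. c i * r i x) w = (\<Sum>i<n. c i * dev T (r i) w)"
          using elim r by (intro dev_linear_AE L2_0_D) auto
        then show "AE w in M. (dev T (\<lambda>x. \<Sum>i<n. c i * r i x) w)^2 = (\<Sum>i<n. \<Sum>j<n. c i * c j * (dev T (r i) w * dev T (r j) w))"
          by eventually_elim (simp add: power2_eq_square sum_product ac_simps)
      qed measurable
      also have "... = (\<Sum>i<n. \<Sum>j<n. c i * c j * (\<integral>w. dev T (r i) w * dev T (r j) w \<partial>M))"
        using L2_integrable_mult[OF L L] by simp
      finally show ?case by simp
    qed
  qed
qed simp

text \<open>The Cramer-Wold device: every finite linear combination of the \<open>r i\<close> is
  again in \<open>L2_0\<close>, so \<open>clt\<close> applies to it. Nonnegativity of its asymptotic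
  variance is exactly what makes the covariance kernel positive semidefinite.\<close>

theorem deviations_converge_to_gaussian:
  fixes r :: "nat \<Rightarrow> 'a \<Rightarrow> real"
  assumes r: "\<And>i. r i \<in> L2_0 \<mu>"
  obtains W where "char_convergence M gauss_space (\<lambda>T w i. dev T (r i) w) W"
proof -
  let ?K = "\<lambda>i j. asymptotic_covariance (r i) (r j)"
  have "psd_kernel ?K"
    unfolding psd_kernel_def
  proof (intro conjI allI)
    show "?K i j = ?K j i" for i j
      using tendsto_unique[OF _ asymptotic_covariance[OF r[of i] r[of j]]] asymptotic_covariance[OF r[of j] r[of i]]
      by (simp add: mult.commute)
    show "0 \<le> (\<Sum>i<n. \<Sum>j<n. c i * c j * ?K i j)" for n c
      unfolding asymptotic_variance_linear[OF r, symmetric] by (intro asymptotic_variance(3) L2_0_linear r)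
  qed
  then obtain W :: "(nat \<Rightarrow> real) \<Rightarrow> nat \<Rightarrow> real" where W: "\<And>i. (\<lambda>w. W w i) \<in> borel_measurable gauss_space"
    "\<And>n c. (\<integral>w. cis (\<Sum>i<n. c i * W w i) \<partial>gauss_space) = complex_of_real (exp (- (\<Sum>i<n. \<Sum>j<n. c i * c j * ?K i j) / 2))"
    by (rule gaussian_sequence_exists) (rule that, assumption+)
  interpret G: prob_space gauss_space by (rule prob_space_gauss)
  show ?thesis
  proof (rule that, unfold_locales)
    show "(\<lambda>w. dev t (r i) w) \<in> borel_measurable M" for t i
      using L2_measurable[OF L2_0_D(1)[OF r[of i]]] by simp
    show "\<exists>C. \<forall>\<^sub>F t in at_top. integrable M (\<lambda>w. (dev t (r i) w)^2) \<and> (\<integral>w. (dev t (r i) w)^2 \<partial>M) \<le> C" for i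
    proof (intro exI[of _ "(sqrt (2 / \<gamma>) * nrm (r i))^2"], use eventually_gt_at_top[of 0] in eventually_elim)
      case (elim t)
      show ?case
        using dev_norm[OF r elim, of i] power_mono[OF dev_norm(2)[OF r elim, of i], of 2]
        by (simp add: L2_integrable_square L2_norm_sq)
    qed
    show "((\<lambda>t. \<integral>w. cis (\<Sum>i<n. c i * dev t (r i) w) \<partial>M) \<longlongrightarrow> (\<integral>w. cis (\<Sum>i<n. c i * W w i) \<partial>gauss_space)) at_top" for n c
      unfolding W(2) asymptotic_variance_linear[OF r, symmetric]
    proof (rule Lim_transform_eventually[OF asymptotic_variance(2)[OF L2_0_linear[OF r]]])
      show "\<forall>\<^sub>F T in at_top. (\<integral>w. cis (dev T (\<lambda>x. \<Sum>i<n. c i * r i x) w) \<partial>M) = (\<integral>w. cis (\<Sum>i<n. c i * dev T (r i) w) \<partial>M)"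
        using eventually_gt_at_top[of 0]
      proof eventually_elim
        case (elim T)
        note [measurable] = dev_norm(1)[OF r elim, THEN L2_measurable] dev_norm(1)[OF L2_0_linear[OF r] elim, THEN L2_measurable]
        show ?case
        proof (rule integral_cong_AE)
          have "AE w in M. dev T (\<lambda>x. \<Sum>i<n. c i * r i x) w = (\<Sum>i<n. c i * dev T (r i) w)"
            using elim r by (intro dev_linear_AE L2_0_D) auto
          then show "AE w in M. cis (dev T (\<lambda>x. \<Sum>i<n. c i * r i x) w) = cis (\<Sum>i<n. c i * dev T (r i) w)"
            by eventually_elim simp
        qed (simp_all add: cis_conv_exp)
      qed
    qed
  qed (rule W(1))
qed

end

section \<open>Bracketing entropy\<close>

lemma bracketing_number_antimono: "\<epsilon> \<le> \<epsilon>' \<Longrightarrow> bracketing_number \<epsilon>' F \<mu> \<le> bracketing_number \<epsilon> F \<mu>"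
  unfolding bracketing_number_def by (rule Inf_superset_mono) force

lemma sqrt_entropy_antimono:
  assumes "\<epsilon> \<le> \<epsilon>'"
  shows "sqrt_entropy \<epsilon>' F \<mu> \<le> sqrt_entropy \<epsilon> F \<mu>"
proof (cases "bracketing_number \<epsilon> F \<mu>")
  case (enat n)
  then obtain n' where n': "bracketing_number \<epsilon>' F \<mu> = enat n'" "n' \<le> n"
    using bracketing_number_antimono[OF assms, of F \<mu>] by (cases "bracketing_number \<epsilon>' F \<mu>") auto
  have "ln (real n') \<le> ln (real n)"
  \<comment> \<open>\<open>ln 0\<close> is 0 by convention, so bracketing number 0, which occurs for
    empty \<open>F\<close>, does no harm.\<close>
  proof (cases "n' = 0")
    case True then show ?thesis by (cases "n = 0") auto
  next
    case False then show ?thesis using n'(2) by simp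
  qed
  then show ?thesis using enat n' by (simp add: sqrt_entropy_def ennreal_leI)
qed (simp add: sqrt_entropy_def)

text \<open>An infinite number at \<epsilon> would make the integrand infinite on all of
  \<open>{0<..\<epsilon>}\<close>.\<close>

lemma bracketing_number_finite:
  assumes "(\<integral>\<^sup>+\<epsilon>\<in>{0<..}. sqrt_entropy \<epsilon> F \<mu> \<partial>lborel) < \<infinity>" "0 < \<epsilon>"
  shows "bracketing_number \<epsilon> F \<mu> \<noteq> \<infinity>"
proof
  assume "bracketing_number \<epsilon> F \<mu> = \<infinity>"
  then have "sqrt_entropy d F \<mu> = \<infinity>" if "d \<le> \<epsilon>" for d
    using sqrt_entropy_antimono[OF that, of F \<mu>] by (simp add: sqrt_entropy_def top_unique)
  then have "(\<integral>\<^sup>+d. \<infinity> * indicator {0<..\<epsilon>} d \<partial>lborel) \<le> (\<integral>\<^sup>+d\<in>{0<..}. sqrt_entropy d F \<mu> \<partial>lborel)"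
    by (intro nn_integral_mono) (auto simp: indicator_def)
  moreover have "(\<integral>\<^sup>+d. \<infinity> * indicator {0<..\<epsilon>} d \<partial>lborel) = \<infinity>"
    using assms(2) by (subst nn_integral_cmult_indicator) (auto simp: ennreal_top_mult)
  ultimately show False using assms(1) by (simp add: top_unique)
qed

definition bracket_cover :: "real \<Rightarrow> ('a \<Rightarrow> real) set \<Rightarrow> 'a measure \<Rightarrow> (('a \<Rightarrow> real) \<times> ('a \<Rightarrow> real)) set \<Rightarrow> bool" where
  "bracket_cover \<epsilon> F \<mu> B \<longleftrightarrow> finite B \<and>
     (\<forall>(l, u)\<in>B. l \<in> L2 \<mu> \<and> u \<in> L2 \<mu> \<and> L2_norm \<mu> (\<lambda>x. u x - l x) < \<epsilon>) \<and>
     (\<forall>f\<in>F. \<exists>(l, u)\<in>B. \<forall>x\<in>space \<mu>. l x \<le> f x \<and> f x \<le> u x)"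

lemma bracketing_number_attained:
  assumes "bracketing_number \<epsilon> F \<mu> \<noteq> \<infinity>"
  shows "\<exists>B. bracket_cover \<epsilon> F \<mu> B \<and> bracketing_number \<epsilon> F \<mu> = enat (card B)"
proof -
  let ?A = "{enat (card B) | B. bracket_cover \<epsilon> F \<mu> B}"
  have eq: "bracketing_number \<epsilon> F \<mu> = Inf ?A" unfolding bracketing_number_def bracket_cover_def ..
  have "?A \<noteq> {}"
  proof
    assume "?A = {}"
    then show False using assms unfolding eq by (simp only: Inf_empty top_enat_def)
  qed
  then obtain k where "k \<in> ?A" by blast
  then have "Inf ?A \<in> ?A" by (rule wellorder_InfI)
  then show ?thesis unfolding eq by blast
qed

text \<open>By monotonicity the integrand on the dyadic interval below \<open>(1 / 2) ^ q\<close> is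
  at least its value at that endpoint. The interval has half that length, so the series is at most
  twice the entropy integral.\<close>

lemma bracketing_sequence:
  assumes fin: "(\<integral>\<^sup>+\<epsilon>\<in>{0<..}. sqrt_entropy \<epsilon> F \<mu> \<partial>lborel) < \<infinity>"
  obtains B where "\<And>q. bracket_cover ((1 / 2) ^ q) F \<mu> (B q)" "summable (\<lambda>q. (1 / 2) ^ q * sqrt (ln (real (card (B q)))))"
proof -
  have "\<exists>B. bracket_cover ((1 / 2) ^ q) F \<mu> B \<and> bracketing_number ((1 / 2) ^ q) F \<mu> = enat (card B)" for q :: nat
    by (intro bracketing_number_attained bracketing_number_finite[OF fin]) simp
  then obtain B where B: "\<And>q::nat. bracket_cover ((1 / 2) ^ q) F \<mu> (B q)" "\<And>q::nat. bracketing_number ((1 / 2) ^ q) F \<mu> = enat (card (B q))" by metis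
  define h where "h q = sqrt (ln (real (card (B q))))" for q
  have h0: "0 \<le> h q" for q by (cases "card (B q) = 0") (auto simp: h_def)
  have sq: "sqrt_entropy ((1 / 2) ^ q) F \<mu> = ennreal (h q)" for q by (simp add: sqrt_entropy_def B(2) h_def)
  define J where "J q = {(1 / 2) ^ Suc q <.. (1 / 2 :: real) ^ q}" for q :: nat
  \<comment> \<open>The indicator on the right vanishes on the next interval \<open>J Q\<close>,
    which is what lets the induction add its term.\<close>
  have pointwise: "(\<Sum>q<Q. ennreal (h q) * indicator (J q) \<epsilon>) \<le> sqrt_entropy \<epsilon> F \<mu> * indicator {(1 / 2) ^ Q <..} \<epsilon>" for \<epsilon> :: real and Q :: nat
  proof (induction Q)
    case (Suc Q)
    have le: "(1 / 2) ^ Suc Q \<le> (1 / 2 :: real) ^ Q" by simp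
    show ?case
    proof (cases "\<epsilon> \<in> J Q")
      case True
      then have "\<epsilon> \<le> (1 / 2) ^ Q" "(1 / 2) ^ Suc Q < \<epsilon>" by (auto simp: J_def)
      then show ?thesis
        using Suc.IH True sqrt_entropy_antimono[of \<epsilon> "(1 / 2) ^ Q" F \<mu>] by (simp add: sq)
    next
      case False
      have "indicator {(1 / 2) ^ Q <..} \<epsilon> \<le> (indicator {(1 / 2) ^ Suc Q <..} \<epsilon> :: ennreal)"
        by (auto simp: indicator_def simp del: power_Suc intro: le_less_trans[OF le])
      then have "sqrt_entropy \<epsilon> F \<mu> * indicator {(1 / 2) ^ Q <..} \<epsilon> \<le> sqrt_entropy \<epsilon> F \<mu> * indicator {(1 / 2) ^ Suc Q <..} \<epsilon>"
        by (rule mult_left_mono) simp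
      then show ?thesis using order_trans[OF Suc.IH] False by simp
    qed
  qed simp
  define C where "C = enn2real (\<integral>\<^sup>+\<epsilon>\<in>{0<..}. sqrt_entropy \<epsilon> F \<mu> \<partial>lborel)"
  have "(\<Sum>q<Q. (1 / 2) ^ q * h q) \<le> 2 * C" for Q
  proof -
    have "ennreal (\<Sum>q<Q. h q * (1 / 2) ^ Suc q) = (\<Sum>q<Q. ennreal (h q) * ennreal ((1 / 2) ^ Suc q))"
      using h0 by (simp add: ennreal_mult[symmetric] sum_ennreal del: power_Suc)
    also have "... = (\<Sum>q<Q. \<integral>\<^sup>+\<epsilon>. ennreal (h q) * indicator (J q) \<epsilon> \<partial>lborel)"
      by (intro sum.cong refl) (simp add: nn_integral_cmult_indicator J_def)
    also have "... = (\<integral>\<^sup>+\<epsilon>. (\<Sum>q<Q. ennreal (h q) * indicator (J q) \<epsilon>) \<partial>lborel)"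
      by (intro nn_integral_sum[symmetric]) (simp add: J_def)
    also have "... \<le> (\<integral>\<^sup>+\<epsilon>\<in>{0<..}. sqrt_entropy \<epsilon> F \<mu> \<partial>lborel)"
    proof (intro nn_integral_mono order_trans[OF pointwise] mult_left_mono)
      fix \<epsilon> :: real
      show "indicator {(1 / 2) ^ Q <..} \<epsilon> \<le> (indicator {0<..} \<epsilon> :: ennreal)"
        using less_trans[of 0 "(1 / 2) ^ Q" \<epsilon>] by (auto simp: indicator_def)
    qed simp
    also have "... = ennreal C" using fin by (simp add: C_def)
    finally have "(\<Sum>q<Q. h q * (1 / 2) ^ Suc q) \<le> C" by (simp add: ennreal_le_iff C_def)
    moreover have "(\<Sum>q<Q. (1 / 2) ^ q * h q) = 2 * (\<Sum>q<Q. h q * (1 / 2) ^ Suc q)"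
      by (simp add: sum_distrib_left mult.commute)
    ultimately show ?thesis by linarith
  qed
  then have "summable (\<lambda>q. (1 / 2) ^ q * h q)"
    using h0 by (intro bounded_imp_summable[where B = "2 * C"]) (auto simp: lessThan_Suc_atMost[symmetric] simp del: sum.lessThan_Suc)
  then show ?thesis unfolding h_def by (rule that[OF B(1)])
qed

section \<open>From summable entropy to the Donsker property\<close>

context bracket_chain
begin

text \<open>A label is a tuple of brackets, so there are at most as many labels as the product of
  the cover sizes; the root of a sum of logarithms is at most the sum of roots. The 2 bounds
  \<open>sqrt (ln 4)\<close>, where 4 comes from \<open>2 * (m + 1) \<le> 4 * n\<close>.\<close>

lemma Len_le:
  assumes B: "\<And>q. finite (B q)" "\<And>q. br q ` F \<subseteq> B q"
  shows "Len q \<le> 2 + (\<Sum>r\<le>q. sqrt (ln (real (card (B r)))))"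
proof -
  have h: "0 \<le> ln (real (card (B r)))" for r by (cases "card (B r) = 0") auto
  have sub: "sqrt (ln 4 + (\<Sum>r\<le>q. ln (real (card (B r))))) \<le> 2 + (\<Sum>r\<le>q. sqrt (ln (real (card (B r)))))" for q
  proof (induction q)
    case 0
    have "sqrt (ln 4) \<le> sqrt 4" using ln_add_one_self_le_self[of 3] by (intro real_sqrt_le_mono) simp
    then show ?case using sqrt_add_le_add_sqrt[of "ln 4" "ln (real (card (B 0)))"] h[of 0] by simp
  next
    case (Suc q)
    then show ?case
      using sqrt_add_le_add_sqrt[of "ln 4 + (\<Sum>r\<le>q. ln (real (card (B r))))" "ln (real (card (B (Suc q))))"] h
      by (simp add: sum_nonneg add.assoc)
  qed
  have card: "card (lab q ` F) \<le> (\<Prod>r\<le>q. card (B r))" for q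
  proof (induction q)
    case 0
    have "lab 0 ` F = (\<lambda>b. [b]) ` (br 0 ` F)" by (auto simp: lab_def)
    then have "card (lab 0 ` F) \<le> card (br 0 ` F)" using br_finite[of 0] by (simp add: card_image_le)
    also have "... \<le> card (B 0)" by (intro card_mono B)
    finally show ?case by simp
  next
    case (Suc q)
    have "lab (Suc q) ` F \<subseteq> (\<lambda>(a, b). a @ [b]) ` (lab q ` F \<times> B (Suc q))"
    proof (rule image_subsetI)
      fix f assume "f \<in> F"
      then show "lab (Suc q) f \<in> (\<lambda>(a, b). a @ [b]) ` (lab q ` F \<times> B (Suc q))"
        using B(2)[of "Suc q"] by (intro image_eqI[of _ _ "(lab q f, br (Suc q) f)"]) (auto simp: lab_Suc)
    qed
    then have "card (lab (Suc q) ` F) \<le> card ((\<lambda>(a, b). a @ [b]) ` (lab q ` F \<times> B (Suc q)))"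
      using B(1) lab_finite by (intro card_mono) auto
    also have "... \<le> card (lab q ` F \<times> B (Suc q))" using B(1) lab_finite by (intro card_image_le) auto
    also have "... \<le> (\<Prod>r\<le>Suc q. card (B r))" using Suc by (simp add: card_cartesian_product)
    finally show ?case .
  qed
  have "ln (2 * (real (card (lab q ` F)) + 1)) \<le> ln 4 + (\<Sum>r\<le>q. ln (real (card (B r))))"
  proof (cases "F = {}")
    case True
    have "ln 2 \<le> ln (4::real)" by simp
    moreover have "0 \<le> (\<Sum>r\<le>q. ln (real (card (B r))))" by (intro sum_nonneg h)
    ultimately have "ln 2 \<le> ln 4 + (\<Sum>r\<le>q. ln (real (card (B r))))" by linarith
    then show ?thesis using True by simp
  next
    case False
    have pos: "card (B r) \<noteq> 0" for r using False B[of r] by auto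
    then have "1 \<le> (\<Prod>r\<le>q. card (B r))" by (simp add: Suc_le_eq prod_pos)
    moreover have "2 * (m + 1) \<le> 4 * n" if "1 \<le> n" "m \<le> n" for m n :: nat using add_mono[OF add_mono[OF that(2) that(2)] add_mono[OF that(1) that(1)]] by simp
    ultimately have "2 * (card (lab q ` F) + 1) \<le> 4 * (\<Prod>r\<le>q. card (B r))" using card[of q] by blast
    then have "real (2 * (card (lab q ` F) + 1)) \<le> real (4 * (\<Prod>r\<le>q. card (B r)))" by (rule of_nat_mono)
    then have "2 * (real (card (lab q ` F)) + 1) \<le> 4 * (\<Prod>r\<le>q. real (card (B r)))" by simp
    then have "ln (2 * (real (card (lab q ` F)) + 1)) \<le> ln (4 * (\<Prod>r\<le>q. real (card (B r))))"
      using pos by (subst ln_le_cancel_iff) (auto intro!: mult_pos_pos prod_pos add_nonneg_pos simp: neq0_conv)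
    also have "... = ln 4 + ln (\<Prod>r\<le>q. real (card (B r)))" using pos by (intro ln_mult_pos) (auto intro!: prod_pos simp: neq0_conv)
    also have "ln (\<Prod>r\<le>q. real (card (B r))) = (\<Sum>r\<le>q. ln (real (card (B r))))" using pos by (intro ln_prod) auto
    finally show ?thesis .
  qed
  then have "Len q \<le> sqrt (ln 4 + (\<Sum>r\<le>q. ln (real (card (B r)))))" unfolding Len_def by (rule real_sqrt_le_mono)
  then show ?thesis using sub[of q] by linarith
qed

text \<open>After \<open>Len_le\<close> the weighted partial sums of the entropy terms form the
  Cauchy product of the given series with a geometric one, so passing from brackets to nested labels
  preserves summability.\<close>

lemma cst_summable:
  assumes B: "\<And>q. finite (B q)" "\<And>q. br q ` F \<subseteq> B q"
    and sm: "summable (\<lambda>q. (1 / 2) ^ q * sqrt (ln (real (card (B q)))))"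
  shows "summable cst"
proof -
  define b where "b q = (1 / 2) ^ q * sqrt (ln (real (card (B q))))" for q
  have b0: "0 \<le> b q" for q by (cases "card (B q) = 0") (auto simp: b_def)
  have "summable (\<lambda>k. \<Sum>i\<le>k. b i * (1 / 2 :: real) ^ (k - i))"
    using sm b0 by (intro summable_Cauchy_product) (simp_all add: b_def[symmetric] summable_geometric)
  then have "summable (\<lambda>k. 2 * (1 / 2 :: real) ^ k + 2 * (\<Sum>i\<le>Suc k. b i * (1 / 2) ^ (Suc k - i)))"
    by (intro summable_add summable_mult summable_geometric, simp, subst summable_Suc_iff[of "\<lambda>k. \<Sum>i\<le>k. b i * (1 / 2) ^ (k - i)"])
  then show ?thesis
  proof (rule summable_comparison_test'[where N = 0])
    fix k :: nat
    have e: "b i * (1 / 2) ^ (Suc k - i) = (1 / 2) ^ Suc k * sqrt (ln (real (card (B i))))" if "i \<le> Suc k" for i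
    proof -
      have "(1 / 2 :: real) ^ Suc k = (1 / 2) ^ i * (1 / 2) ^ (Suc k - i)" using that by (simp only: power_add[symmetric] le_add_diff_inverse)
      then show ?thesis by (simp only: b_def ac_simps)
    qed
    have "norm (cst k) = (1 / 2) ^ k * Len (Suc k)" using cst_nonneg[of k] by (simp add: cst_def)
    also have "... \<le> (1 / 2) ^ k * (2 + (\<Sum>r\<le>Suc k. sqrt (ln (real (card (B r))))))"
      using Len_le[OF B, of "Suc k"] by (intro mult_left_mono) (simp_all del: sum.atMost_Suc)
    also have "... = 2 * (1 / 2) ^ k + 2 * ((1 / 2) ^ Suc k * (\<Sum>r\<le>Suc k. sqrt (ln (real (card (B r))))))"
      by (simp add: distrib_left)
    also have "(1 / 2) ^ Suc k * (\<Sum>r\<le>Suc k. sqrt (ln (real (card (B r))))) = (\<Sum>i\<le>Suc k. b i * (1 / 2) ^ (Suc k - i))"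
      unfolding sum_distrib_left by (intro sum.cong refl e[symmetric]) simp
    finally show "norm (cst k) \<le> 2 * (1 / 2) ^ k + 2 * (\<Sum>i\<le>Suc k. b i * (1 / 2) ^ (Suc k - i))" .
  qed
qed

lemma ell_infinityI:
  assumes "\<And>f. f \<in> F \<Longrightarrow> \<bar>y f\<bar> \<le> c"
  shows "restrict y F \<in> mspace (ell_infinity F)"
proof -
  have "Metric_space.mbounded (UNIV :: real set) dist (restrict y F ` F)"
    using assms unfolding Met_TC.mbounded by (intro disjI2 conjI ballI exI[of _ 0] exI[of _ c]) (auto simp: dist_real_def)
  then show ?thesis by (simp add: Met_TC.fspace_def)
qed

lemma ell_infinity_distance:
  assumes "x \<in> mspace (ell_infinity F)" "y \<in> mspace (ell_infinity F)" "\<And>f. f \<in> F \<Longrightarrow> \<bar>x f - y f\<bar> \<le> c" "0 \<le> c"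
  shows "mdist (ell_infinity F) x y \<le> c"
proof (cases "F = {}")
  case True
  then show ?thesis using assms(4) by (simp add: Met_TC.fdist_empty)
next
  case False
  then show ?thesis using assms(3) by (subst funspace_mdist_le[OF assms(1,2)]) (auto simp: dist_real_def)
qed

text \<open>On \<open>F\<close> the centring in \<open>dev\<close> subtracts 0.\<close>

lemma empirical_process_eq:
  assumes "0 < t"
  shows "empirical_process X F t w = (\<lambda>f\<in>F. dev t f w)"
proof (rule ext)
  fix f
  have "t powr (- 1 / 2) = 1 / sqrt t"
  proof -
    have "t powr - (1 / 2) = inverse (sqrt t)" unfolding powr_minus using assms by (simp add: powr_half_sqrt)
    moreover have "(- 1 / 2 :: real) = - (1 / 2)" by simp
    ultimately show ?thesis by (simp only: inverse_eq_divide)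
  qed
  then show "empirical_process X F t w f = (\<lambda>f\<in>F. dev t f w) f"
    using F_L2_0 L2_0_D(2)[of f] by (auto simp: empirical_process_def dev_def path_integral_def restrict_def)
qed

lemma chaining_bound_increment:
  assumes T: "0 < T" and pQ: "p < Q" and sm: "summable cst"
  shows "\<exists>R. integrable M R \<and>
    (\<integral>w. R w \<partial>M) \<le> chain_total T p Q \<and>
    (AE w in M. (\<forall>f\<in>F. path_integrable T w f) \<and> (\<forall>f\<in>F. \<bar>dev T f w - dev T (rep p f) w\<bar> \<le> R w))"
proof -
  obtain R where R: "integrable M R"
    "(\<integral>w. R w \<partial>M) \<le> chain_total T p Q"
    "AE w in M. \<forall>f\<in>F. \<bar>dev T (\<lambda>x. f x - rep p f x) w\<bar> \<le> R w" using chaining_bound[OF assms] by blast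
  have "AE w in M. (\<forall>f\<in>F. path_integrable T w f) \<and> (\<forall>f\<in>F. \<bar>dev T f w - dev T (rep p f) w\<bar> \<le> R w)"
    using R(3) F_path_integrable_AE[OF T, of p]
  proof eventually_elim
    case (elim w)
    have "dev T (\<lambda>x. f x - rep p f x) w = dev T f w - dev T (rep p f) w" if "f \<in> F" for f
    proof -
      have "rep p f \<in> F" by (rule rep_in[OF that])
      then have i: "path_integrable T w f" "path_integrable T w (rep p f)" "integrable \<mu> f" "integrable \<mu> (rep p f)"
        using elim that F_L2_0 by (auto intro!: mu.L2_integrable L2_0_D)
      then show ?thesis
        by (simp add: dev_def path_integral_diff right_diff_distrib diff_divide_distrib)
    qed
    then show ?case using elim by auto
  qed
  then show ?thesis using R(1,2) by blast
qed

text \<open>Chaining from level 0 places all deviations within one finite \<open>R w\<close> of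
  those of finitely many representatives.\<close>

lemma empirical_process_in_ell_infinity:
  assumes t: "0 < t" and sm: "summable cst"
  shows "AE w in M. (\<forall>f\<in>F. path_integrable t w f) \<and> empirical_process X F t w \<in> mspace (ell_infinity F)"
proof -
  obtain R where "AE w in M. (\<forall>f\<in>F. path_integrable t w f) \<and> (\<forall>f\<in>F. \<bar>dev t f w - dev t (rep 0 f) w\<bar> \<le> R w)"
    using chaining_bound_increment[OF t zero_less_one sm] by blast
  then show ?thesis
  proof eventually_elim
    case (elim w)
    have bound: "\<bar>dev t f w\<bar> \<le> R w + (\<Sum>g\<in>rep 0 ` F. \<bar>dev t g w\<bar>)" if "f \<in> F" for f
    proof -
      have "\<bar>dev t (rep 0 f) w\<bar> \<le> (\<Sum>g\<in>rep 0 ` F. \<bar>dev t g w\<bar>)"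
        using that by (intro member_le_sum reps_finite) auto
      moreover have "\<bar>dev t f w - dev t (rep 0 f) w\<bar> \<le> R w" using elim that by blast
      ultimately show ?thesis by linarith
    qed
    have "(\<lambda>f\<in>F. dev t f w) \<in> mspace (ell_infinity F)" by (rule ell_infinityI[OF bound])
    then show ?case using elim unfolding empirical_process_eq[OF t] by blast
  qed
qed

text \<open>An instance of \<open>weak_approximation\<close>: the coordinates enumerate the
  countably many representatives of all chosen levels, and \<Phi> assigns to each \<open>f\<close>
  the coordinate of its representative.\<close>

theorem donsker_of_summable:
  assumes sm: "summable cst"
  shows "donsker M X F"
  unfolding donsker_def
proof (intro conjI allI impI empirical_process_in_ell_infinity sm)
  let ?m = "ell_infinity F"
  have tail0: "(\<lambda>p. (3 + 14 / \<gamma>) * tail p) \<longlonglongrightarrow> 0" using tendsto_mult_right_zero[OF tail_tendsto[OF sm]] .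
  \<comment> \<open>Half of the budget \<open>(1 / 2) ^ k\<close> goes to the tail; the start of the
    chain and its last width receive a quarter each.\<close>
  have "\<exists>p. (3 + 14 / \<gamma>) * tail p < (1 / 2) ^ k / 2" for k :: nat
    using order_tendstoD(2)[OF tail0, of "(1 / 2) ^ k / 2"] by (auto simp: eventually_sequentially)
  then obtain p where p: "\<And>k. (3 + 14 / \<gamma>) * tail (p k) < (1 / 2) ^ k / 2" by metis
  \<comment> \<open>The zero function keeps the set nonempty for empty \<open>F\<close>, so that it
    can be enumerated.\<close>
  define S where "S = insert (\<lambda>_. 0) (\<Union>k. rep (p k) ` F)"
  have "countable (\<Union>k. rep (p k) ` F)" by (rule countable_UN) (auto intro: countable_finite[OF reps_finite])
  then have S: "countable S" "S \<noteq> {}" by (auto simp: S_def)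
  have S_L2: "S \<subseteq> L2_0 \<mu>" using F_L2_0 rep_in by (auto simp: S_def L2_0_def)
  define r where "r = from_nat_into S"
  define c where "c k f = to_nat_on S (rep (p k) f)" for k f
  have r_L2: "r i \<in> L2_0 \<mu>" for i using from_nat_into[OF S(2)] S_L2 by (auto simp: r_def)
  have rc: "r (c k f) = rep (p k) f" if "f \<in> F" for k f
    unfolding r_def c_def using that by (intro from_nat_into_to_nat_on S) (auto simp: S_def)
  have c_fin: "finite (c k ` F)" for k
  proof -
    have "c k ` F = to_nat_on S ` (rep (p k) ` F)" by (auto simp: c_def)
    then show ?thesis using reps_finite by simp
  qed
  obtain W where W: "char_convergence M gauss_space (\<lambda>T w i. dev T (r i) w) W"
    by (rule deviations_converge_to_gaussian[OF r_L2])
  interpret W: char_convergence M gauss_space "\<lambda>T w i. dev T (r i) w" W by (rule W)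
  define \<Phi> where "\<Phi> k y = (\<lambda>f\<in>F. y (c k f) :: real)" for k y
  have le_sum: "\<bar>y (c k f)\<bar> \<le> (\<Sum>i\<in>c k ` F. \<bar>y i\<bar>)" if "f \<in> F" for k f and y :: "nat \<Rightarrow> real"
    using that c_fin by (intro member_le_sum[of "c k f" _ "\<lambda>i. \<bar>y i\<bar>"]) auto
  have \<Phi>: "\<Phi> k y \<in> mspace ?m" for k y unfolding \<Phi>_def using le_sum by (rule ell_infinityI)
  interpret weak_approximation M gauss_space ?m "empirical_process X F" "\<lambda>T w i. dev T (r i) w" W \<Phi> "\<lambda>k. c k ` F" "\<lambda>k. (1 / 2) ^ k"
  proof unfold_locales
    have "mcomplete_of (ell_infinity F)"
      using Met_TC.mcomplete_funspace[of F] complete_UNIV unfolding Met_TC.Self_def euclidean_metric_def by simp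
    then show "mcomplete_of ?m" .
    show "\<Phi> k y \<in> mspace ?m" for k y by (rule \<Phi>)
    show "finite (c k ` F)" for k by (rule c_fin)
    show "mdist ?m (\<Phi> k y) (\<Phi> k y') \<le> (\<Sum>i\<in>c k ` F. \<bar>y i - y' i\<bar>)" for k y y'
    proof (rule ell_infinity_distance[OF \<Phi> \<Phi>])
      show "\<bar>\<Phi> k y f - \<Phi> k y' f\<bar> \<le> (\<Sum>i\<in>c k ` F. \<bar>y i - y' i\<bar>)" if "f \<in> F" for f
        using le_sum[OF that, of "\<lambda>i. y i - y' i" k] that by (simp add: \<Phi>_def)
    qed (simp add: sum_nonneg)
    show "((\<lambda>t. \<integral>w. h (\<lambda>i. dev t (r i) w) \<partial>M) \<longlongrightarrow> (\<integral>w. h (W w) \<partial>gauss_space)) at_top"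
      if "fin_lipschitz J L h" "\<And>y. \<bar>h y\<bar> \<le> B" for J L h B using W.fin_lipschitz_expectation_tendsto[OF that] .
    show "\<forall>\<^sub>F t in at_top. \<exists>R. integrable M R \<and> (\<integral>w. R w \<partial>M) \<le> (1 / 2) ^ k \<and>
      (AE w in M. empirical_process X F t w \<in> mspace ?m \<and> mdist ?m (empirical_process X F t w) (\<Phi> k (\<lambda>i. dev t (r i) w)) \<le> R w)" for k
    \<comment> \<open>Nonnegativity of the majorant is read off from a member of \<open>F\<close>,
      so the empty class is treated apart.\<close>
    proof (cases "F = {}")
      case True
      have "AE w in M. empirical_process X F t w \<in> mspace ?m \<and> mdist ?m (empirical_process X F t w) (\<Phi> k (\<lambda>i. dev t (r i) w)) \<le> 0" if "0 < t" for t
        using empirical_process_in_ell_infinity[OF that sm] by eventually_elim (use True \<Phi> in \<open>auto intro!: ell_infinity_distance\<close>)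
      then show ?thesis
        by (intro eventually_mono[OF eventually_gt_at_top[of 0]] exI[of _ "\<lambda>_. 0"]) auto
    next
      case False
      have "((\<lambda>T. \<Sum>g\<in>rep (p k) ` F. 2 * (sqrt T * mean (excess T (p k) g))) \<longlongrightarrow> (\<Sum>g\<in>rep (p k) ` F. 2 * 0)) at_top"
        using rep_in by (intro tendsto_sum tendsto_mult tendsto_const excess_integral_tendsto) auto
      then have "\<forall>\<^sub>F T in at_top. chain_start T (p k) < (1 / 2) ^ k / 4"
        by (rule order_tendstoD(2)) simp
      then show ?thesis using eventually_gt_at_top[of 0]
      proof eventually_elim
        case (elim T)
        \<comment> \<open>The final level \<open>Q\<close> may depend on \<open>T\<close>: in
          \<open>chain_total\<close> it enters only through this term.\<close>
        have "(\<lambda>Q. 2 * sqrt T * (1 / 2) ^ Q) \<longlonglongrightarrow> 0" by (intro tendsto_mult_right_zero LIMSEQ_power_zero) simp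
        then have "\<forall>\<^sub>F Q in sequentially. 2 * sqrt T * (1 / 2) ^ Q < (1 / 2) ^ k / 4" by (rule order_tendstoD(2)) simp
        from eventually_conj[OF this eventually_gt_at_top[of "p k"]]
        obtain Q where Q: "2 * sqrt T * (1 / 2) ^ Q < (1 / 2) ^ k / 4" "p k < Q" by (auto simp: eventually_sequentially)
        obtain R where R: "integrable M R"
          "(\<integral>w. R w \<partial>M) \<le> chain_total T (p k) Q"
          "AE w in M. (\<forall>f\<in>F. path_integrable T w f) \<and> (\<forall>f\<in>F. \<bar>dev T f w - dev T (rep (p k) f) w\<bar> \<le> R w)"
          using chaining_bound_increment[OF elim(2) Q(2) sm] by blast
        have "(\<integral>w. R w \<partial>M) \<le> (1 / 2) ^ k" using R(2) Q(1) elim(1) p[of k] by linarith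
        moreover have "AE w in M. empirical_process X F T w \<in> mspace ?m \<and> mdist ?m (empirical_process X F T w) (\<Phi> k (\<lambda>i. dev T (r i) w)) \<le> R w"
          using R(3) empirical_process_in_ell_infinity[OF elim(2) sm]
        proof eventually_elim
          case (elim w)
          from False obtain f where "f \<in> F" by blast
          then have "0 \<le> R w" using elim by fastforce
          moreover have "\<bar>empirical_process X F T w f - \<Phi> k (\<lambda>i. dev T (r i) w) f\<bar> \<le> R w" if "f \<in> F" for f
            using elim that unfolding empirical_process_eq[OF \<open>0 < T\<close>] by (auto simp: \<Phi>_def rc)
          ultimately show ?case using elim \<Phi> by (blast intro: ell_infinity_distance)
        qed
        ultimately show ?case using R(1) by blast
      qed
    qed
  qed (auto intro: W.V_measurable W.W_measurable)
  show "\<exists>(N :: (('a \<Rightarrow> real) \<Rightarrow> real) measure) G. tight_random_element N G ?m \<and> HJ_converges M (empirical_process X F) N G ?m"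
    by (rule weak_limit_exists)
qed auto

end

theorem theorem3p2:
  fixes E K :: "(real ^ 'n::finite) set"
    and M :: "'w measure"
    and X :: "real \<Rightarrow> 'w \<Rightarrow> real ^ 'n"
    and \<kappa> :: "real \<Rightarrow> real ^ 'n \<Rightarrow> (real ^ 'n) measure"
    and p :: "real \<Rightarrow> real ^ 'n \<Rightarrow> real ^ 'n \<Rightarrow> real"
    and \<mu> :: "(real ^ 'n) measure"
    and a :: "real ^ 'n \<Rightarrow> real ^ 'n ^ 'n"
    and b :: "real ^ 'n \<Rightarrow> real ^ 'n"
    and F :: "(real ^ 'n \<Rightarrow> real) set"
  assumes "stationary_ergodic_feller_diffusion M X E \<kappa> p \<mu>"
    and "generator_coefficients E \<mu> \<kappa> a b"
    and I: "poincare \<mu> \<kappa>"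
    and II: "heat_kernel_bound p"
    and III: "uniformly_elliptic E a"
    and IV: "symmetric_semigroup \<mu> \<kappa>"
    and V: "locally_bounded_density E \<mu>"
    and "F \<subseteq> L2_0 \<mu>"
    and "compact K" and "K \<subseteq> interior E"
    and "\<And>f x. f \<in> F \<Longrightarrow> x \<in> E - K \<Longrightarrow> f x = 0"
    and "(\<integral>\<^sup>+\<epsilon>\<in>{0<..}. sqrt_entropy \<epsilon> F \<mu> \<partial>lborel) < \<infinity>"
  shows "donsker M X F"
proof -
  interpret stationary_reversible_process M \<mu> X E \<kappa>
  proof -
    have "prob_space M" using assms(1) unfolding stationary_ergodic_feller_diffusion_def continuous_markov_process_def by blast
    then show "stationary_reversible_process M \<mu> X E \<kappa>"
      using assms(1) IV unfolding stationary_ergodic_feller_diffusion_def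
      by (intro stationary_reversible_process.intro stationary_reversible_process_axioms.intro) blast+
  qed
  obtain \<gamma> where \<gamma>: "0 < \<gamma>" "\<And>f t. f \<in> Bd \<Longrightarrow> (\<integral>x. f x \<partial>\<mu>) = 0 \<Longrightarrow> 0 \<le> t \<Longrightarrow> nrm (P t f) \<le> exp (- \<gamma> * t) * nrm f"
    using exponential_decay[OF I] by blast
  interpret spectral_gap_process M \<mu> X E \<kappa> \<gamma> by unfold_locales (use \<gamma> in auto)
  obtain B where cover: "\<And>q. bracket_cover ((1 / 2) ^ q) F \<mu> (B q)"
    and summable: "summable (\<lambda>q. (1 / 2) ^ q * sqrt (ln (real (card (B q)))))"
    using bracketing_sequence[OF assms(12)] by blast
  have B: "finite (B q)" "b \<in> B q \<Longrightarrow> fst b \<in> L2 \<mu> \<and> snd b \<in> L2 \<mu> \<and> nrm (\<lambda>x. snd b x - fst b x) < (1 / 2) ^ q"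
    "f \<in> F \<Longrightarrow> \<exists>b. b \<in> B q \<and> (\<forall>x\<in>space \<mu>. fst b x \<le> f x \<and> f x \<le> snd b x)" for q b f
    using cover[of q] unfolding bracket_cover_def case_prod_beta by blast+
  \<comment> \<open>One bracket per function and level is fixed; the choice is meaningful for
    members of \<open>F\<close>, to which the conditions of \<open>bracket_chain\<close> are
    confined.\<close>
  define br where "br q f = (SOME b. b \<in> B q \<and> (\<forall>x\<in>space \<mu>. fst b x \<le> f x \<and> f x \<le> snd b x))" for q f
  have br: "br q f \<in> B q" "\<forall>x\<in>E. fst (br q f) x \<le> f x \<and> f x \<le> snd (br q f) x" if "f \<in> F" for q f
    using someI_ex[OF B(3)[OF that, of q]] unfolding br_def space_mu by blast+
  interpret bracket_chain M \<mu> X E \<kappa> \<gamma> F br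
  proof unfold_locales
    show "F \<subseteq> L2_0 \<mu>" by fact
    show "finite (br q ` F)" for q using B(1) by (rule finite_subset[rotated]) (use br in blast)
  qed (use br B(2)[OF br(1)] in \<open>auto intro: less_imp_le\<close>)
  show ?thesis
    by (intro donsker_of_summable cst_summable[OF B(1) _ summable]) (use br(1) in blast)
qed

end
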